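(* Let $u_*$ be a simple BIC at $(\beta_*,\bm\delta_*,k_* )\in\Lambda$ with scattering matrix $\bm S_0$, and let $\bm M\in U_1$. There exist $r_5,r_6>0$ such that for every $(\beta,\bm\delta)\in B_{r_5}((\beta_*,\bm\delta_* ))$ there are unique $k(\beta,\bm\delta)\in(k_*-r_6,k_*+r_6)$, $u(\cdot,\beta,\bm\delta)\in H^1_{\mathrm{per},1}(\Omega_0)$ and $\bm a(\beta,\bm\delta)\in\mathbb C^{2N_0}$ such that: $(\beta,\bm\delta,k(\beta,\bm\delta))\in\lambda_{\bm M}$; $u(\cdot,\beta,\bm\delta)$ solves the scattering problem at $(\beta,\bm\delta,k(\beta,\bm\delta))$ with incident coefficient vector $\bm a(\beta,\bm\delta)$; $u(\cdot,\beta,\bm\delta)$ is governed by $\bm M$; and $(u(\cdot,\beta,\bm\delta),u_* )_{\Omega_0}=\|u_*\|^2_{L^2(\Omega_0)}$. Moreover $k$, $u$ and $\bm a$ depend continuously on $(\beta,\bm\delta)$, and $k(\beta_*,\bm\delta_* )=k_*$, $u(\cdot,\beta_*,\bm\delta_* )=u_*$, $\bm a(\beta_*,\bm\delta_* )=\bm0$.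
   Context: Setting: $d_0>0$; $\epsilon(\bm x,\bm\delta)$, $\bm\delta\in W_1\subset\mathbb R^{N_1}$ open, continuous in $\bm\delta$ into $L^\infty(\mathbb R^2)$, $2\pi$-periodic in $x_1$, $=1$ for $|x_2|\ge d_0$, $0<\epsilon_{\min}\le\epsilon\le\epsilon_{\max}$. $\Omega_0=(-\pi,\pi)\times(-d_0,d_0)$, $\Gamma_L,\Gamma_R$ its edges $x_2=d_0$, $x_2=-d_0$, $\phi_m=e^{imx_1}/\sqrt{2\pi}$, $\alpha_m=\sqrt{k^2-(m+\beta)^2}$. $\Lambda=\{(\beta,\bm\delta,k):\beta\in[-1/2,1/2),\bm\delta\in W_1,k>|\beta|,\alpha_m\ne0\ \forall m\}$, $Z_0=\{m:k^2>(m+\beta)^2\}$ constant on the component considered, $N_0=|Z_0|$. $H^1_{\mathrm{per},1}(\Omega_0)$: $H^1(\Omega_0)$-closure of smooth $x_1$-periodic functions. $\mathcal A(\beta,\bm\delta,k)$: $(\mathcal Au,v)_{\Omega_0}=((\nabla+i\bm\beta)u,(\nabla+i\bm\beta)v)_{\Omega_0}-k^2(\epsilon u,v)_{\Omega_0}-\sum_{\flat\in\{L,R\}}(\mathcal D_\flat u,v)_{\Gamma_\flat}$, $\mathcal D_\flat f=\sum_m i\alpha_m(f,\phi_m)_{\Gamma_\flat}\phi_m$, $\bm\beta=(\beta,0)$. Scattering problem at $(\beta,\bm\delta,k)$ with incident vector $\bm a\in\mathbb C^{2N_0}$ (indexed by $(\flat,m)$, $L$ first): $\mathcal Au=\sum_{\flat,m}-2ia_{\flat,m}\alpha_m^{1/2}\widetilde\phi_{\flat,m}$,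 $(\widetilde\phi_{\flat,m},v)_{\Omega_0}=(\phi_m,v)_{\Gamma_\flat}$; scattered vector $b_{\flat,m}=\alpha_m^{1/2}(u,\phi_m)_{\Gamma_\flat}-a_{\flat,m}$ (these are the coefficients of the incoming/outgoing propagating waves $\alpha_m^{-1/2}e^{\mp i\alpha_m(x_2-d_0)}\phi_m$ above and $\alpha_m^{-1/2}e^{\pm i\alpha_m(x_2+d_0)}\phi_m$ below the structure). Governed by $\bm M\in U(2N_0)$: $\bm b=\bm M\bm a$. BIC: nonzero solution with $\bm a=\bm b=0$; simple: BICs at its point span a one-dimensional space. $\bm S_0$: scattering matrix at $(\beta_*,\bm\delta_*,k_* )$ (unitary, $\bm b=\bm S_0\bm a$). $U_1=\{\bm M\in U(2N_0):\det(\bm S_0-\bm M)\ne0\}$. $\lambda_{\bm M}$ is the set of $(\beta,\bm\delta,k)\in\Lambda$ at which there exists a nonzero solution governed by $\bm M$. $B_r$ denotes an open ball.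
   Formalization: The claim is proved for those (β,δ) in the ball with -1/2 ≤ β < 1/2; when β_* = -1/2 the ball also contains β < -1/2, where no k gives a point of Λ and the statement fails, while for other β_* the ball can be shrunk so nothing is lost. *)

theory Defs
  imports "HOL-Analysis.Analysis" "HOL-Combinatorics.Permutations"
begin

type_synonym pt = "real \<times> real"

definition Omega0 :: "real \<Rightarrow> pt set" where
  "Omega0 d0 = {-pi<..<pi} \<times> {-d0<..<d0}"

definition phi :: "int \<Rightarrow> real \<Rightarrow> complex" where
  "phi m x1 = exp (\<i> * of_int m * of_real x1) / of_real (sqrt (2 * pi))"

(* alpha_m = sqrt(k^2 - (m+beta)^2), principal branch (Im >= 0 when negative radicand) *)
definition alpha :: "real \<Rightarrow> real \<Rightarrow> int \<Rightarrow> complex" where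
  "alpha \<beta> k m = csqrt (of_real (k^2 - (of_int m + \<beta>)^2))"

(* flat = True means Gamma_L (x2 = d0), False means Gamma_R (x2 = -d0) *)
definition edge :: "real \<Rightarrow> bool \<Rightarrow> real" where
  "edge d0 fl = (if fl then d0 else - d0)"

coinductive smooth_fun :: "(pt \<Rightarrow> complex) \<Rightarrow> bool" where
  "(\<And>x. (f has_derivative (\<lambda>h. fst h *\<^sub>R p1 x + snd h *\<^sub>R p2 x)) (at x))
    \<Longrightarrow> smooth_fun p1 \<Longrightarrow> smooth_fun p2 \<Longrightarrow> smooth_fun f"

definition per_x1 :: "(pt \<Rightarrow> 'a) \<Rightarrow> bool" where
  "per_x1 f \<longleftrightarrow> (\<forall>x1 x2. f (x1 + 2 * pi, x2) = f (x1, x2))"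

definition cgrad :: "(pt \<Rightarrow> complex) \<Rightarrow> pt \<Rightarrow> complex \<times> complex" where
  "cgrad f x = (SOME g. (f has_derivative (\<lambda>h. fst h *\<^sub>R fst g + snd h *\<^sub>R snd g)) (at x))"

definition smooth_per :: "(pt \<Rightarrow> complex) \<Rightarrow> bool" where
  "smooth_per f \<longleftrightarrow> smooth_fun f \<and> per_x1 f"

definition L2 :: "real \<Rightarrow> (pt \<Rightarrow> 'a::real_normed_vector) \<Rightarrow> bool" where
  "L2 d0 f \<longleftrightarrow> set_borel_measurable lborel (Omega0 d0) f
      \<and> set_integrable lborel (Omega0 d0) (\<lambda>x. (norm (f x))^2)"

definition cnorm2 :: "complex \<times> complex \<Rightarrow> real" where
  "cnorm2 z = (cmod (fst z))^2 + (cmod (snd z))^2"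

definition H1dist2 :: "real \<Rightarrow> (pt \<Rightarrow> complex) \<Rightarrow> (pt \<Rightarrow> complex \<times> complex)
     \<Rightarrow> (pt \<Rightarrow> complex) \<Rightarrow> (pt \<Rightarrow> complex \<times> complex) \<Rightarrow> real" where
  "H1dist2 d0 u g w h = (LINT x:Omega0 d0|lborel. (cmod (u x - w x))^2 + cnorm2 (g x - h x))"

(* f_n is a sequence of smooth x1-periodic functions converging in H^1(Omega0) to u,
   with g the (weak) gradient of u *)
definition approx_seq :: "real \<Rightarrow> (pt \<Rightarrow> complex) \<Rightarrow> (pt \<Rightarrow> complex \<times> complex)
     \<Rightarrow> (nat \<Rightarrow> pt \<Rightarrow> complex) \<Rightarrow> bool" where
  "approx_seq d0 u g F \<longleftrightarrow> (\<forall>n. smooth_per (F n))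
      \<and> (\<lambda>n. H1dist2 d0 u g (F n) (cgrad (F n))) \<longlonglongrightarrow> 0"

(* u in H^1_{per,1}(Omega0) with gradient g: u lies in the H^1 closure of smooth periodic fns *)
definition H1per_g :: "real \<Rightarrow> (pt \<Rightarrow> complex) \<Rightarrow> (pt \<Rightarrow> complex \<times> complex) \<Rightarrow> bool" where
  "H1per_g d0 u g \<longleftrightarrow> L2 d0 u \<and> L2 d0 (\<lambda>x. fst (g x)) \<and> L2 d0 (\<lambda>x. snd (g x))
      \<and> (\<exists>F. approx_seq d0 u g F)"

definition H1per :: "real \<Rightarrow> (pt \<Rightarrow> complex) \<Rightarrow> bool" where
  "H1per d0 u \<longleftrightarrow> (\<exists>g. H1per_g d0 u g)"

definition grad :: "real \<Rightarrow> (pt \<Rightarrow> complex) \<Rightarrow> pt \<Rightarrow> complex \<times> complex" where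
  "grad d0 u = (SOME g. H1per_g d0 u g)"

(* (u, phi_m)_{Gamma_flat}: the trace, defined as the limit of the boundary integrals
   of any smooth periodic H^1-approximating sequence *)
definition trco :: "real \<Rightarrow> (pt \<Rightarrow> complex) \<Rightarrow> bool \<Rightarrow> int \<Rightarrow> complex" where
  "trco d0 u fl m = (THE c. \<forall>F. approx_seq d0 u (grad d0 u) F \<longrightarrow>
      (\<lambda>n. LINT x1:{-pi..pi}|lborel. F n (x1, edge d0 fl) * cnj (phi m x1)) \<longlonglongrightarrow> c)"

definition ipO :: "real \<Rightarrow> (pt \<Rightarrow> complex) \<Rightarrow> (pt \<Rightarrow> complex) \<Rightarrow> complex" where
  "ipO d0 u v = (LINT x:Omega0 d0|lborel. u x * cnj (v x))"

definition H1norm2 :: "real \<Rightarrow> (pt \<Rightarrow> complex) \<Rightarrow> real" where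
  "H1norm2 d0 u = (LINT x:Omega0 d0|lborel. (cmod (u x))^2 + cnorm2 (grad d0 u x))"

(* (nabla + i beta) u with beta = (beta, 0) *)
definition shgrad :: "real \<Rightarrow> real \<Rightarrow> (pt \<Rightarrow> complex) \<Rightarrow> pt \<Rightarrow> complex \<times> complex" where
  "shgrad d0 \<beta> u x = (fst (grad d0 u x) + \<i> * of_real \<beta> * u x, snd (grad d0 u x))"

definition aform :: "real \<Rightarrow> (pt \<Rightarrow> 'd \<Rightarrow> real) \<Rightarrow> real \<Rightarrow> 'd \<Rightarrow> real
     \<Rightarrow> (pt \<Rightarrow> complex) \<Rightarrow> (pt \<Rightarrow> complex) \<Rightarrow> complex" where
  "aform d0 eps \<beta> \<delta> k u v =
     (LINT x:Omega0 d0|lborel. fst (shgrad d0 \<beta> u x) * cnj (fst (shgrad d0 \<beta> v x))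
                              + snd (shgrad d0 \<beta> u x) * cnj (snd (shgrad d0 \<beta> v x)))
     - of_real (k^2) * (LINT x:Omega0 d0|lborel. of_real (eps x \<delta>) * u x * cnj (v x))
     - (\<Sum>fl\<in>UNIV. infsum (\<lambda>m. \<i> * alpha \<beta> k m * trco d0 u fl m * cnj (trco d0 v fl m)) UNIV)"

definition Z0 :: "real \<Rightarrow> real \<Rightarrow> int set" where
  "Z0 \<beta> k = {m. k^2 > (of_int m + \<beta>)^2}"

(* index set {L,R} x Z0 for coefficient vectors in C^{2 N0} *)
definition Idx :: "real \<Rightarrow> real \<Rightarrow> (bool \<times> int) set" where
  "Idx \<beta> k = UNIV \<times> Z0 \<beta> k"

definition vec_on :: "(bool \<times> int) set \<Rightarrow> (bool \<times> int \<Rightarrow> complex) \<Rightarrow> bool" where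
  "vec_on I a \<longleftrightarrow> (\<forall>i. i \<notin> I \<longrightarrow> a i = 0)"

definition solves :: "real \<Rightarrow> (pt \<Rightarrow> 'd \<Rightarrow> real) \<Rightarrow> real \<Rightarrow> 'd \<Rightarrow> real
     \<Rightarrow> (bool \<times> int \<Rightarrow> complex) \<Rightarrow> (pt \<Rightarrow> complex) \<Rightarrow> bool" where
  "solves d0 eps \<beta> \<delta> k a u \<longleftrightarrow> H1per d0 u \<and> vec_on (Idx \<beta> k) a \<and>
     (\<forall>v. H1per d0 v \<longrightarrow> aform d0 eps \<beta> \<delta> k u v =
        (\<Sum>(fl, m)\<in>Idx \<beta> k. - 2 * \<i> * a (fl, m) * csqrt (alpha \<beta> k m) * cnj (trco d0 v fl m)))"

definition bvec :: "real \<Rightarrow> real \<Rightarrow> real \<Rightarrow> (bool \<times> int \<Rightarrow> complex) \<Rightarrow> (pt \<Rightarrow> complex)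
     \<Rightarrow> bool \<times> int \<Rightarrow> complex" where
  "bvec d0 \<beta> k a u = (\<lambda>(fl, m). if (fl, m) \<in> Idx \<beta> k
        then csqrt (alpha \<beta> k m) * trco d0 u fl m - a (fl, m) else 0)"

definition matvec :: "(bool \<times> int) set \<Rightarrow> (bool \<times> int \<Rightarrow> bool \<times> int \<Rightarrow> complex)
     \<Rightarrow> (bool \<times> int \<Rightarrow> complex) \<Rightarrow> bool \<times> int \<Rightarrow> complex" where
  "matvec I M a = (\<lambda>i. if i \<in> I then (\<Sum>j\<in>I. M i j * a j) else 0)"

definition unitary_on :: "(bool \<times> int) set \<Rightarrow> (bool \<times> int \<Rightarrow> bool \<times> int \<Rightarrow> complex) \<Rightarrow> bool" where
  "unitary_on I M \<longleftrightarrow> (\<forall>i\<in>I. \<forall>i'\<in>I.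
      (\<Sum>j\<in>I. M i j * cnj (M i' j)) = (if i = i' then 1 else 0))"

definition det_on :: "(bool \<times> int) set \<Rightarrow> (bool \<times> int \<Rightarrow> bool \<times> int \<Rightarrow> complex) \<Rightarrow> complex" where
  "det_on I A = (\<Sum>p\<in>{p. p permutes I}. of_int (sign p) * (\<Prod>i\<in>I. A i (p i)))"

definition governed :: "real \<Rightarrow> real \<Rightarrow> real \<Rightarrow> (bool \<times> int \<Rightarrow> bool \<times> int \<Rightarrow> complex)
     \<Rightarrow> (bool \<times> int \<Rightarrow> complex) \<Rightarrow> (pt \<Rightarrow> complex) \<Rightarrow> bool" where
  "governed d0 \<beta> k M a u \<longleftrightarrow> bvec d0 \<beta> k a u = matvec (Idx \<beta> k) M a"

definition nonzeroO :: "real \<Rightarrow> (pt \<Rightarrow> complex) \<Rightarrow> bool" where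
  "nonzeroO d0 u \<longleftrightarrow> \<not> (AE x in lborel. x \<in> Omega0 d0 \<longrightarrow> u x = 0)"

definition aeeqO :: "real \<Rightarrow> (pt \<Rightarrow> complex) \<Rightarrow> (pt \<Rightarrow> complex) \<Rightarrow> bool" where
  "aeeqO d0 u w \<longleftrightarrow> (AE x in lborel. x \<in> Omega0 d0 \<longrightarrow> u x = w x)"

definition Lambda :: "('d set) \<Rightarrow> (real \<times> 'd \<times> real) set" where
  "Lambda W1 = {(\<beta>, \<delta>, k). -1/2 \<le> \<beta> \<and> \<beta> < 1/2 \<and> \<delta> \<in> W1 \<and> k > \<bar>\<beta>\<bar>
                  \<and> (\<forall>m. alpha \<beta> k m \<noteq> 0)}"

definition isBIC :: "real \<Rightarrow> (pt \<Rightarrow> 'd \<Rightarrow> real) \<Rightarrow> real \<Rightarrow> 'd \<Rightarrow> real \<Rightarrow> (pt \<Rightarrow> complex) \<Rightarrow> bool" where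
  "isBIC d0 eps \<beta> \<delta> k u \<longleftrightarrow> solves d0 eps \<beta> \<delta> k (\<lambda>_. 0) u \<and> nonzeroO d0 u
      \<and> bvec d0 \<beta> k (\<lambda>_. 0) u = (\<lambda>_. 0)"

definition simpleBIC :: "real \<Rightarrow> (pt \<Rightarrow> 'd \<Rightarrow> real) \<Rightarrow> real \<Rightarrow> 'd \<Rightarrow> real \<Rightarrow> (pt \<Rightarrow> complex) \<Rightarrow> bool" where
  "simpleBIC d0 eps \<beta> \<delta> k u \<longleftrightarrow> isBIC d0 eps \<beta> \<delta> k u
      \<and> (\<forall>w. isBIC d0 eps \<beta> \<delta> k w \<longrightarrow> (\<exists>c. aeeqO d0 w (\<lambda>x. c * u x)))"

definition is_scattering_matrix :: "real \<Rightarrow> (pt \<Rightarrow> 'd \<Rightarrow> real) \<Rightarrow> real \<Rightarrow> 'd \<Rightarrow> real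
     \<Rightarrow> (bool \<times> int \<Rightarrow> bool \<times> int \<Rightarrow> complex) \<Rightarrow> bool" where
  "is_scattering_matrix d0 eps \<beta> \<delta> k S \<longleftrightarrow>
     (\<forall>a u. solves d0 eps \<beta> \<delta> k a u \<longrightarrow> bvec d0 \<beta> k a u = matvec (Idx \<beta> k) S a)"

definition lambdaM :: "real \<Rightarrow> (pt \<Rightarrow> 'd \<Rightarrow> real) \<Rightarrow> 'd set
     \<Rightarrow> (bool \<times> int \<Rightarrow> bool \<times> int \<Rightarrow> complex) \<Rightarrow> (real \<times> 'd \<times> real) set" where
  "lambdaM d0 eps W1 M = {(\<beta>, \<delta>, k) \<in> Lambda W1.
      \<exists>u a. solves d0 eps \<beta> \<delta> k a u \<and> nonzeroO d0 u \<and> governed d0 \<beta> k M a u}"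

definition eps_ok :: "real \<Rightarrow> (pt \<Rightarrow> real^'n \<Rightarrow> real) \<Rightarrow> (real^'n) set \<Rightarrow> real \<Rightarrow> real \<Rightarrow> bool" where
  "eps_ok d0 eps W1 emin emax \<longleftrightarrow> d0 > 0 \<and> open W1 \<and> 0 < emin \<and> emin \<le> emax \<and>
     (\<forall>\<delta>\<in>W1. (\<lambda>x. eps x \<delta>) \<in> borel_measurable lborel) \<and>
     (\<forall>\<delta>\<in>W1. \<forall>x. emin \<le> eps x \<delta> \<and> eps x \<delta> \<le> emax) \<and>
     (\<forall>\<delta>\<in>W1. per_x1 (\<lambda>x. eps x \<delta>)) \<and>
     (\<forall>\<delta>\<in>W1. \<forall>x. \<bar>snd x\<bar> \<ge> d0 \<longrightarrow> eps x \<delta> = 1) \<and>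
     (\<forall>\<delta>0\<in>W1. \<forall>e>0. \<exists>r>0. \<forall>\<delta>\<in>W1. dist \<delta> \<delta>0 < r \<longrightarrow>
         (AE x in lborel. \<bar>eps x \<delta> - eps x \<delta>0\<bar> \<le> e))"

end

(* Treat the incident vector a as an unknown, impose b = M a, and require <u, us> = |us|^2 at the
price of a Lagrange multiplier tau in the equation for u. The scattering form splits into a
Hermitian part, in which the evanescent modes only contribute positive boundary terms, and
finitely many propagating terms that depend on u through a and M a. By the Poincare inequality on
the cells of a fine partition, the Hermitian part becomes coercive after adding finitely many
squared cell averages. Inverting the coercive form (Riesz) leaves a finite square linear system
for the cell averages, the vector a and tau, with coefficients continuous in (beta, delta, k). At
the BIC it is injective: testing with us gives tau = 0, then det(S0 - M) <> 0 gives a = 0, and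
simplicity of the BIC does the rest. So near the BIC there is a unique solution (u, a, tau),
depending continuously on the parameters, and equal to (us, 0, 0) at the BIC.

The original problem is solved exactly where tau = 0. Pairing the equation with u, unitarity of M
makes tau real. Pairing the solutions at two values of k with each other, the k-dependence of the
form produces a dominant term proportional to the difference of the k^2 times the weighted norm of
us, so tau is strictly increasing in k. Its unique zero is k(beta, delta), and joint continuity of
tau makes this zero continuous. No differentiability of the coefficients is used. *)

theory Submission
  imports Defs "Jordan_Normal_Form.Determinant"
begin

subsection \<open>Finite square systems\<close>

text \<open>The permittivity is merely continuous in the parameter, so the implicit function theorem
  cannot be applied to (k, u, a) at once. It is replaced by an order of elimination: a linear
  problem with continuous coefficients, then one scalar equation. The normalisation adds an equation
  to a square problem, and the multiplier is the unknown that keeps it square. Setting a complex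
  multiplier to 0 would be two real equations for the one real unknown k; its being real balances
  the count. Differentiation in k is replaced by an exact difference quotient. Apart from the decay
  rates of the evanescent modes the Hermitian form is affine in k^2, and those rates have a
  difference quotient in k^2 of the helpful sign. The mismatch of the channel factors at two
  frequencies is multiplied by products of amplitudes, which vanish at the BIC. Compactness enters
  only through finitely many averages, so the Fredholm alternative becomes a statement about a
  determinant. Elements of the function space are functions and not classes, hence all forms are
  semidefinite only, and uniqueness means a vanishing seminorm, that is, equality almost
  everywhere.\<close>

definition mat_of :: "(nat \<Rightarrow> 'i) \<Rightarrow> nat \<Rightarrow> ('i \<Rightarrow> 'i \<Rightarrow> complex) \<Rightarrow> complex mat" where
  "mat_of e n A = mat n n (\<lambda>(i, j). A (e i) (e j))"

lemma mat_of_carrier [simp]: "mat_of e n A \<in> carrier_mat n n"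
  by (simp add: mat_of_def)

lemma mat_of_index [simp]: "i < n \<Longrightarrow> j < n \<Longrightarrow> mat_of e n A $$ (i, j) = A (e i) (e j)"
  by (simp add: mat_of_def)

lemma mat_mult_index:
  assumes "A \<in> carrier_mat n n" "B \<in> carrier_mat n n" "i < n" "j < n"
  shows "(A * B) $$ (i, j) = (\<Sum>k<n. A $$ (i, k) * B $$ (k, j))"
  using assms by (simp add: times_mat_def scalar_prod_def lessThan_atLeast0)

lemma sum_bij_lessThan:
  assumes "bij_betw e {..<n} I"
  shows "(\<Sum>i\<in>I. g i) = (\<Sum>k<n. g (e k))"
  using sum.reindex_bij_betw[OF assms, of g] by simp

lemma det_nonzero_imp_injective:
  assumes e: "bij_betw e {..<n} I" and d: "Determinant.det (mat_of e n A) \<noteq> 0"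
    and z: "\<And>i. i \<in> I \<Longrightarrow> (\<Sum>j\<in>I. A i j * y j) = 0" and i: "i \<in> I"
  shows "y i = 0"
proof -
  define v where "v = Matrix.vec n (\<lambda>k. y (e k))"
  have v: "v \<in> carrier_vec n" by (simp add: v_def)
  have ei: "e r \<in> I" if "r < n" for r using e that by (auto simp: bij_betw_def)
  have "mat_of e n A *\<^sub>v v = 0\<^sub>v n"
  proof
    fix r assume "r < dim_vec (0\<^sub>v n :: complex Matrix.vec)"
    then have r: "r < n" by simp
    have "vec_index (mat_of e n A *\<^sub>v v) r = (\<Sum>k<n. A (e r) (e k) * y (e k))"
      using r by (simp add: mat_of_def v_def scalar_prod_def lessThan_atLeast0)
    also have "\<dots> = 0" using z[OF ei[OF r]] sum_bij_lessThan[OF e, of "\<lambda>j. A (e r) j * y j"] by simp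
    finally show "vec_index (mat_of e n A *\<^sub>v v) r = vec_index (0\<^sub>v n) r" using r by simp
  qed (simp add: mat_of_def)
  then have "v = 0\<^sub>v n" using det_0_iff_vec_prod_zero[OF mat_of_carrier, of e n A] d v by auto
  moreover obtain r where "r < n" "i = e r" using i e by (auto simp: bij_betw_def)
  ultimately show ?thesis by (metis v_def index_vec index_zero_vec(1))
qed

lemma injective_imp_det_nonzero:
  assumes e: "bij_betw e {..<n} I"
    and inj: "\<And>y. (\<And>i. i \<in> I \<Longrightarrow> (\<Sum>j\<in>I. A i j * y j) = 0) \<Longrightarrow> (\<And>i. i \<in> I \<Longrightarrow> y i = 0)"
  shows "Determinant.det (mat_of e n A) \<noteq> 0"
proof
  assume "Determinant.det (mat_of e n A) = 0"
  then obtain v where v: "v \<in> carrier_vec n" "v \<noteq> 0\<^sub>v n" "mat_of e n A *\<^sub>v v = 0\<^sub>v n"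
    using det_0_iff_vec_prod_zero[OF mat_of_carrier, of e n A] by auto
  define y where "y i = vec_index v (inv_into {..<n} e i)" for i
  have ye: "y (e r) = vec_index v r" if "r < n" for r
    using e that by (simp add: y_def bij_betw_def inv_into_f_f)
  have "(\<Sum>j\<in>I. A i j * y j) = 0" if i: "i \<in> I" for i
  proof -
    obtain r where r: "r < n" "i = e r" using i e by (auto simp: bij_betw_def)
    have "(\<Sum>j\<in>I. A i j * y j) = (\<Sum>k<n. A (e r) (e k) * vec_index v k)"
      using ye r sum_bij_lessThan[OF e, of "\<lambda>j. A i j * y j"] by simp
    also have "\<dots> = vec_index (mat_of e n A *\<^sub>v v) r"
      using r v(1) by (simp add: mat_of_def scalar_prod_def lessThan_atLeast0)
    finally show ?thesis using r v by simp
  qed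
  then have "y i = 0" if "i \<in> I" for i using inj that by blast
  then have "vec_index v r = 0" if "r < n" for r
    using ye[OF that] e that by (metis bij_betw_apply lessThan_iff)
  then have "v = 0\<^sub>v n" using v(1) by (intro eq_vecI) auto
  with v show False by simp
qed

text \<open>Conjugation by the enumeration \<open>e\<close> is a sign-preserving bijection between
  the permutations of \<open>{0..<n}\<close> and those of \<open>I\<close>, so the two Leibniz sums
  agree term by term. It lets the determinant of the hypothesis, indexed by channels, be treated as
  a matrix determinant.\<close>

lemma det_on_mat_of:
  assumes e: "bij_betw e {..<n} I"
  shows "det_on I A = Determinant.det (mat_of e n A)"
proof -
  have e0: "bij_betw e {0..<n} I" using e by (simp add: lessThan_atLeast0)
  have f: "finite I" using e bij_betw_finite by blast
  define e' where "e' = inv_into {0..<n} e"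
  have "bij_betw (\<lambda>p. (\<lambda>x. if x \<in> I then e (p (inv_into {0..<n} e x)) else x))
          {p. p permutes {0..<n}} {p. p permutes I}"
    using bij_betw_permutations[OF e0] by simp
  then have "det_on I A = (\<Sum>p\<in>{p. p permutes {0..<n}}.
      of_int (sign (\<lambda>x. if x \<in> I then e (p (e' x)) else x)) *
        (\<Prod>i\<in>I. A i (if i \<in> I then e (p (e' i)) else i)))"
    unfolding det_on_def e'_def by (rule sum.reindex_bij_betw[symmetric])
  also have "\<dots> = (\<Sum>p\<in>{p. p permutes {0..<n}}. signof p * (\<Prod>i = 0..<n. mat_of e n A $$ (i, p i)))"
  proof (rule sum.cong[OF refl])
    fix p assume "p \<in> {p. p permutes {0..<n}}"
    then have p: "p permutes {0..<n}" by simp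
    have s: "sign (\<lambda>x. if x \<in> I then e (p (e' x)) else x) = sign p"
    proof -
      have "(\<lambda>x. if x \<in> I then e (p (e' x)) else x) = map_permutation {0..<n} e p"
        using e0 unfolding e'_def by (auto simp: map_permutation_def restrict_id_def fun_eq_iff bij_betw_def)
      then show ?thesis using sign_map_permutation[of e "{0..<n}" p] e0 p by (simp add: bij_betw_def)
    qed
    have "(\<Prod>i\<in>I. A i (if i \<in> I then e (p (e' i)) else i)) = (\<Prod>i = 0..<n. A (e i) (e (p i)))"
      using e0 unfolding e'_def
      by (subst prod.reindex_bij_betw[OF e0, symmetric]) (auto intro!: prod.cong simp: bij_betw_def)
    also have "\<dots> = (\<Prod>i = 0..<n. mat_of e n A $$ (i, p i))"
      using p permutes_in_image[OF p] by (auto intro!: prod.cong simp: mat_of_def)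
    finally show "of_int (sign (\<lambda>x. if x \<in> I then e (p (e' x)) else x)) *
        (\<Prod>i\<in>I. A i (if i \<in> I then e (p (e' i)) else i)) =
        signof p * (\<Prod>i = 0..<n. mat_of e n A $$ (i, p i))" using s by simp
  qed
  also have "\<dots> = Determinant.det (mat_of e n A)" by (simp add: det_def'[OF mat_of_carrier])
  finally show ?thesis .
qed

lemma det_on_nonzero_injective:
  assumes fin: "finite I" and d: "det_on I A \<noteq> 0"
    and z: "\<And>i. i \<in> I \<Longrightarrow> (\<Sum>j\<in>I. A i j * y j) = 0" and i: "i \<in> I"
  shows "y i = 0"
proof -
  obtain e where e: "bij_betw e {..<card I} I"
    using ex_bij_betw_nat_finite[OF fin] by (auto simp: lessThan_atLeast0)
  show ?thesis using det_nonzero_imp_injective[OF e _ z i] d det_on_mat_of[OF e] by simp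
qed

text \<open>\<open>unitary_on\<close> asks for orthonormal rows, that is, M times its adjoint is 1.
  A right inverse of a square matrix is also a left inverse, which gives the columns; this is the
  version needed to compute inner products of \<open>matvec I M a\<close>.\<close>

lemma unitary_on_columns:
  assumes fin: "finite I" and M: "unitary_on I M" and ij: "i \<in> I" "j \<in> I"
  shows "(\<Sum>k\<in>I. cnj (M k i) * M k j) = (if i = j then 1 else 0)"
proof -
  obtain e where e: "bij_betw e {..<card I} I"
    using ex_bij_betw_nat_finite[OF fin] by (auto simp: lessThan_atLeast0)
  define n where "n = card I"
  note e = e[folded n_def]
  define A where "A = mat_of e n M"
  define B where "B = mat_of e n (\<lambda>i j. cnj (M j i))"
  have c: "A \<in> carrier_mat n n" "B \<in> carrier_mat n n" by (auto simp: A_def B_def)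
  have ei: "e r \<in> I" if "r < n" for r using e that by (auto simp: bij_betw_def)
  have inj: "(e r = e s) = (r = s)" if "r < n" "s < n" for r s
    using e that by (auto simp: bij_betw_def inj_on_def)
  have "A * B = 1\<^sub>m n"
  proof
    fix r s assume "r < dim_row (1\<^sub>m n :: complex mat)" "s < dim_col (1\<^sub>m n :: complex mat)"
    then have rs: "r < n" "s < n" by auto
    have "(A * B) $$ (r, s) = (\<Sum>k<n. M (e r) (e k) * cnj (M (e s) (e k)))"
      using rs unfolding mat_mult_index[OF c rs] by (simp add: A_def B_def)
    also have "\<dots> = (\<Sum>k\<in>I. M (e r) k * cnj (M (e s) k))" using sum_bij_lessThan[OF e, of "\<lambda>k. M (e r) k * cnj (M (e s) k)"] by simp
    also have "\<dots> = 1\<^sub>m n $$ (r, s)" using M ei rs inj by (simp add: unitary_on_def)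
    finally show "(A * B) $$ (r, s) = 1\<^sub>m n $$ (r, s)" .
  qed (use c in auto)
  then have BA: "B * A = 1\<^sub>m n" using mat_mult_left_right_inverse c by blast
  obtain r s where rs: "r < n" "s < n" "i = e r" "j = e s"
    using ij e unfolding bij_betw_def by blast
  have "(B * A) $$ (r, s) = (\<Sum>k<n. cnj (M (e k) i) * M (e k) j)"
    unfolding mat_mult_index[OF c(2,1) rs(1,2)] using rs by (simp add: A_def B_def)
  also have "\<dots> = (\<Sum>k\<in>I. cnj (M k i) * M k j)"
    using sum_bij_lessThan[OF e, of "\<lambda>k. cnj (M k i) * M k j"] by simp
  finally show ?thesis using BA rs inj by simp
qed

text \<open>Conservation of energy in the channels, in polarised form: it is later applied to the
  amplitudes of two solutions at different frequencies.\<close>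

lemma unitary_on_inner:
  assumes fin: "finite I" and M: "unitary_on I M"
  shows "(\<Sum>i\<in>I. matvec I M a i * cnj (matvec I M b i)) = (\<Sum>i\<in>I. a i * cnj (b i))"
proof -
  have "(\<Sum>i\<in>I. matvec I M a i * cnj (matvec I M b i)) =
      (\<Sum>i\<in>I. \<Sum>j\<in>I. \<Sum>k\<in>I. a j * cnj (b k) * (cnj (M i k) * M i j))"
    by (intro sum.cong refl) (simp add: matvec_def sum_product mult_ac)
  also have "\<dots> = (\<Sum>j\<in>I. \<Sum>k\<in>I. \<Sum>i\<in>I. a j * cnj (b k) * (cnj (M i k) * M i j))"
    by (subst sum.swap, rule sum.cong[OF refl], rule sum.swap)
  also have "\<dots> = (\<Sum>j\<in>I. \<Sum>k\<in>I. a j * cnj (b k) * (if k = j then 1 else 0))"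
    using unitary_on_columns[OF fin M] by (intro sum.cong refl) (simp add: sum_distrib_left[symmetric])
  also have "\<dots> = (\<Sum>j\<in>I. a j * cnj (b j))"
    by (rule sum.cong[OF refl], simp add: if_distrib[where f="(*) _"] sum.delta fin cong: if_cong)
  finally show ?thesis .
qed

section \<open>Inverses of matrices that depend continuously on a parameter\<close>

lemma continuous_on_det_mat:
  fixes A :: "'p::topological_space \<Rightarrow> nat \<Rightarrow> nat \<Rightarrow> complex"
  assumes "\<And>i j. i < n \<Longrightarrow> j < n \<Longrightarrow> continuous_on S (\<lambda>p. A p i j)"
  shows "continuous_on S (\<lambda>p. Determinant.det (mat n n (\<lambda>(i, j). A p i j)))"
proof -
  have lt: "q i < n" if "q permutes {0..<n}" "i < n" for q i
    using permutes_in_image[OF that(1), of i] that(2) by simp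
  have "Determinant.det (mat n n (\<lambda>(i, j). A p i j)) =
     (\<Sum>q\<in>{q. q permutes {0..<n}}. signof q * (\<Prod>i = 0..<n. A p i (q i)))" for p
    by (subst det_def'[of _ n]) (simp_all add: lt)
  moreover have "continuous_on S (\<lambda>p. \<Sum>q\<in>{q. q permutes {0..<n}}. signof q * (\<Prod>i = 0..<n. A p i (q i)))"
    by (intro continuous_on_sum continuous_on_mult continuous_on_const continuous_on_prod assms)
      (simp_all add: lt)
  ultimately show ?thesis by simp
qed

text \<open>Invertibility at \<open>p0\<close> persists nearby because the determinant is
  continuous, and the inverse is the adjugate divided by the determinant, hence continuous. The
  equivalence in the conclusion contains existence, uniqueness and the formula for the solution at
  once, for every right-hand side.\<close>

lemma perturbed_square_system:
  fixes A :: "'p::metric_space \<Rightarrow> 'i \<Rightarrow> 'i \<Rightarrow> complex"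
  assumes fin: "finite I" and p0: "p0 \<in> S"
    and cont: "\<And>i j. i \<in> I \<Longrightarrow> j \<in> I \<Longrightarrow> continuous_on S (\<lambda>p. A p i j)"
    and inj: "\<And>y. (\<And>i. i \<in> I \<Longrightarrow> (\<Sum>j\<in>I. A p0 i j * y j) = 0) \<Longrightarrow> (\<And>i. i \<in> I \<Longrightarrow> y i = 0)"
  shows "\<exists>r>0. \<exists>X. (\<forall>i\<in>I. \<forall>j\<in>I. continuous_on (S \<inter> ball p0 r) (\<lambda>p. X p i j)) \<and>
     (\<forall>p\<in>S \<inter> ball p0 r. \<forall>y h. (\<forall>i\<in>I. (\<Sum>j\<in>I. A p i j * y j) = h i) \<longleftrightarrow> (\<forall>i\<in>I. y i = (\<Sum>j\<in>I. X p i j * h j)))"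
proof -
  obtain e where e: "bij_betw e {..<card I} I"
    using ex_bij_betw_nat_finite[OF fin] by (auto simp: lessThan_atLeast0)
  define n where "n = card I"
  note e = e[folded n_def]
  have ei: "e r \<in> I" if "r < n" for r using e that by (auto simp: bij_betw_def)
  have injn: "(e r = e s) = (r = s)" if "r < n" "s < n" for r s
    using e that by (auto simp: bij_betw_def inj_on_def)
  define d where "d p = Determinant.det (mat_of e n (A p))" for p
  have cd: "continuous_on S d"
    unfolding d_def mat_of_def by (intro continuous_on_det_mat cont ei)
  have d0: "d p0 \<noteq> 0" unfolding d_def by (rule injective_imp_det_nonzero[OF e]) (rule inj)
  \<comment> \<open>Within this radius the determinant stays closer to \<open>d p0\<close> than 0
    is, so it cannot vanish.\<close>
  obtain r where r: "r > 0" "\<And>p. p \<in> S \<Longrightarrow> dist p p0 < r \<Longrightarrow> dist (d p) (d p0) < cmod (d p0)"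
    using cd d0 p0 unfolding continuous_on_iff by (metis zero_less_norm_iff)
  define T where "T = S \<inter> ball p0 r"
  have dT: "d p \<noteq> 0" if "p \<in> T" for p
    using r(2)[of p] that by (auto simp: T_def dist_commute)
  define e' where "e' = inv_into {..<n} e"
  have e'e: "e' (e k) = k" if "k < n" for k using e that by (auto simp: e'_def bij_betw_def)
  define X where "X p i j = adj_mat (mat_of e n (A p)) $$ (e' i, e' j) / d p" for p i j
  have XX: "X p (e i) (e j) = adj_mat (mat_of e n (A p)) $$ (i, j) / d p" if "i < n" "j < n" for p i j
    using that by (simp add: X_def e'e)
  have cX: "continuous_on T (\<lambda>p. X p i j)" if ij: "i \<in> I" "j \<in> I" for i j
  proof -
    obtain a b where ab: "a < n" "b < n" "i = e a" "j = e b"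
      using ij e unfolding bij_betw_def by blast
    \<comment> \<open>The adjugate transposes: its entry (a, b) deletes row b and column a, and the
      two conditionals shift the indices past the deleted ones.\<close>
    have *: "X p i j = (-1)^(b + a) * Determinant.det (mat (n - 1) (n - 1)
        (\<lambda>(s, t). A p (e (if s < b then s else Suc s)) (e (if t < a then t else Suc t)))) / d p" for p
    proof -
      have "mat_delete (mat_of e n (A p)) b a = mat (n - 1) (n - 1)
        (\<lambda>(s, t). A p (e (if s < b then s else Suc s)) (e (if t < a then t else Suc t)))"
        using ab(1,2) by (intro eq_matI) (simp_all add: mat_delete_def mat_of_def)
      moreover have "adj_mat (mat_of e n (A p)) $$ (a, b) = cofactor (mat_of e n (A p)) b a"
        using ab(1,2) by (simp add: adj_mat_def mat_of_def)
      ultimately show ?thesis using XX[OF ab(1,2), of p] ab(3,4) by (simp only: cofactor_def)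
    qed
    have "continuous_on T d" by (rule continuous_on_subset[OF cd]) (auto simp: T_def)
    moreover have "continuous_on T (\<lambda>p. A p (e s) (e t))" if "s < n" "t < n" for s t
      by (rule continuous_on_subset[OF cont[OF ei[OF that(1)] ei[OF that(2)]]]) (auto simp: T_def)
    then have "continuous_on T (\<lambda>p. Determinant.det (mat (n - 1) (n - 1)
        (\<lambda>(s, t). A p (e (if s < b then s else Suc s)) (e (if t < a then t else Suc t)))))"
      by (intro continuous_on_det_mat) auto
    ultimately show ?thesis unfolding * using dT by (intro continuous_intros) auto
  qed
  have left: "(\<Sum>k\<in>I. X p i k * A p k j) = (if i = j then 1 else 0)"
    and right: "(\<Sum>k\<in>I. A p i k * X p k j) = (if i = j then 1 else 0)"
    if pT: "p \<in> T" and ij: "i \<in> I" "j \<in> I" for p i j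
  proof -
    obtain a b where ab: "a < n" "b < n" "i = e a" "j = e b"
      using ij e unfolding bij_betw_def by blast
    define B where "B = mat_of e n (A p)"
    have B: "B \<in> carrier_mat n n" "adj_mat B \<in> carrier_mat n n"
      unfolding B_def using adj_mat(1)[OF mat_of_carrier] by auto
    have "(adj_mat B * B) $$ (a, b) = (\<Sum>k<n. X p (e a) (e k) * d p * A p (e k) (e b))"
      unfolding mat_mult_index[OF B(2,1) ab(1,2)] using ab(1,2) dT[OF pT] by (simp add: XX B_def)
    also have "\<dots> = d p * (\<Sum>k\<in>I. X p i k * A p k j)"
      using ab sum_bij_lessThan[OF e, of "\<lambda>k. X p i k * A p k j"] by (simp add: sum_distrib_left mult_ac)
    finally have "d p * (\<Sum>k\<in>I. X p i k * A p k j) = (d p \<cdot>\<^sub>m 1\<^sub>m n) $$ (a, b)"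
      unfolding adj_mat(3)[OF B(1)] by (simp only: B_def d_def)
    also have "\<dots> = d p * (if i = j then 1 else 0)"
      using ab injn[OF ab(1,2)] by simp
    finally show "(\<Sum>k\<in>I. X p i k * A p k j) = (if i = j then 1 else 0)"
      using dT[OF pT] by simp
    have "(B * adj_mat B) $$ (a, b) = (\<Sum>k<n. A p (e a) (e k) * (X p (e k) (e b) * d p))"
      unfolding mat_mult_index[OF B ab(1,2)] using ab(1,2) dT[OF pT] by (simp add: XX B_def)
    also have "\<dots> = d p * (\<Sum>k\<in>I. A p i k * X p k j)"
      using ab sum_bij_lessThan[OF e, of "\<lambda>k. A p i k * X p k j"] by (simp add: sum_distrib_left mult_ac)
    finally have "d p * (\<Sum>k\<in>I. A p i k * X p k j) = (d p \<cdot>\<^sub>m 1\<^sub>m n) $$ (a, b)"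
      unfolding adj_mat(2)[OF B(1)] by (simp only: B_def d_def)
    also have "\<dots> = d p * (if i = j then 1 else 0)"
      using ab injn[OF ab(1,2)] by simp
    finally show "(\<Sum>k\<in>I. A p i k * X p k j) = (if i = j then 1 else 0)"
      using dT[OF pT] by simp
  qed
  \<comment> \<open>Used with \<open>X p\<close> to the left of \<open>A p\<close> and with
    \<open>A p\<close> to the left of \<open>X p\<close>, once for each direction of the
    equivalence.\<close>
  have solve: "(\<Sum>k\<in>I. P i k * (\<Sum>j\<in>I. Q k j * h j)) = h i"
    if PQ: "\<And>j. j \<in> I \<Longrightarrow> (\<Sum>k\<in>I. P i k * Q k j) = (if i = j then 1 else 0)" and i: "i \<in> I"
    for P Q :: "'i \<Rightarrow> 'i \<Rightarrow> complex" and h i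
  proof -
    have "(\<Sum>k\<in>I. P i k * (\<Sum>j\<in>I. Q k j * h j)) = (\<Sum>j\<in>I. (\<Sum>k\<in>I. P i k * Q k j) * h j)"
      by (simp add: sum_distrib_left sum_distrib_right mult_ac) (rule sum.swap)
    also have "\<dots> = (\<Sum>j\<in>I. if i = j then h j else 0)" using PQ by (intro sum.cong) auto
    finally show ?thesis using fin i by simp
  qed
  have "(\<forall>i\<in>I. (\<Sum>j\<in>I. A p i j * y j) = h i) \<longleftrightarrow> (\<forall>i\<in>I. y i = (\<Sum>j\<in>I. X p i j * h j))"
    if p: "p \<in> T" for p y h
  proof (intro iffI ballI)
    fix i assume *: "\<forall>i\<in>I. (\<Sum>j\<in>I. A p i j * y j) = h i" and i: "i \<in> I"
    have "(\<Sum>k\<in>I. X p i k * h k) = (\<Sum>k\<in>I. X p i k * (\<Sum>j\<in>I. A p k j * y j))"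
      by (rule sum.cong) (use * in simp_all)
    then show "y i = (\<Sum>j\<in>I. X p i j * h j)"
      using solve[of "X p" i "A p" y, OF left[OF p i] i] by metis
  next
    fix i assume *: "\<forall>i\<in>I. y i = (\<Sum>j\<in>I. X p i j * h j)" and i: "i \<in> I"
    have "(\<Sum>k\<in>I. A p i k * y k) = (\<Sum>k\<in>I. A p i k * (\<Sum>j\<in>I. X p k j * h j))"
      by (rule sum.cong[OF refl]) (use * in metis)
    then show "(\<Sum>j\<in>I. A p i j * y j) = h i"
      using solve[of "A p" i "X p" h, OF right[OF p i] i] by metis
  qed
  then show ?thesis using r(1) cX unfolding T_def by blast
qed

subsection \<open>Hermitian forms on function spaces\<close>

text \<open>A set of functions closed under linear combinations, rather than a vector space of
  classes modulo null sets, since the final statement speaks of functions. Inner products on such a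
  set are degenerate in general.\<close>

definition fun_space :: "('x \<Rightarrow> complex) set \<Rightarrow> bool" where
  "fun_space V \<longleftrightarrow> (\<lambda>_. 0) \<in> V \<and> (\<forall>u\<in>V. \<forall>v\<in>V. (\<lambda>x. u x + v x) \<in> V) \<and> (\<forall>c. \<forall>u\<in>V. (\<lambda>x. c * u x) \<in> V)"

definition lin_on :: "('x \<Rightarrow> complex) set \<Rightarrow> (('x \<Rightarrow> complex) \<Rightarrow> complex) \<Rightarrow> bool" where
  "lin_on V f \<longleftrightarrow> (\<forall>u\<in>V. \<forall>v\<in>V. f (\<lambda>x. u x + v x) = f u + f v) \<and> (\<forall>c. \<forall>u\<in>V. f (\<lambda>x. c * u x) = c * f u)"

definition herm_on :: "('x \<Rightarrow> complex) set \<Rightarrow> (('x \<Rightarrow> complex) \<Rightarrow> ('x \<Rightarrow> complex) \<Rightarrow> complex) \<Rightarrow> bool" where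
  "herm_on V B \<longleftrightarrow> (\<forall>v\<in>V. lin_on V (\<lambda>u. B u v)) \<and> (\<forall>u\<in>V. \<forall>v\<in>V. B v u = cnj (B u v))"

definition fnorm :: "(('x \<Rightarrow> complex) \<Rightarrow> ('x \<Rightarrow> complex) \<Rightarrow> complex) \<Rightarrow> ('x \<Rightarrow> complex) \<Rightarrow> real" where
  "fnorm B u = sqrt (Re (B u u))"

lemma fun_spaceD:
  assumes "fun_space V"
  shows "(\<lambda>_. 0) \<in> V" "\<And>u v. u \<in> V \<Longrightarrow> v \<in> V \<Longrightarrow> (\<lambda>x. u x + v x) \<in> V" "\<And>u c. u \<in> V \<Longrightarrow> (\<lambda>x. c * u x) \<in> V"
  using assms by (auto simp: fun_space_def)

lemma fun_space_diff:
  assumes "fun_space V" "u \<in> V" "v \<in> V" shows "(\<lambda>x. u x - v x) \<in> V"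
  using fun_spaceD(2)[OF assms(1,2) fun_spaceD(3)[OF assms(1,3), of "-1"]] by simp

lemma fun_space_sum:
  assumes "fun_space V" "finite J" "\<And>j. j \<in> J \<Longrightarrow> w j \<in> V"
  shows "(\<lambda>x. \<Sum>j\<in>J. c j * w j x) \<in> V"
  using assms(2,3)
proof (induction J rule: finite_induct)
  case (insert a J)
  then show ?case using fun_spaceD(2)[OF assms(1) fun_spaceD(3)[OF assms(1), of "w a" "c a"], of "\<lambda>x. \<Sum>j\<in>J. c j * w j x"]
    by simp
qed (simp add: fun_spaceD[OF assms(1)])

lemma lin_onD:
  assumes "lin_on V f"
  shows "\<And>u v. u \<in> V \<Longrightarrow> v \<in> V \<Longrightarrow> f (\<lambda>x. u x + v x) = f u + f v" "\<And>u c. u \<in> V \<Longrightarrow> f (\<lambda>x. c * u x) = c * f u"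
  using assms by (auto simp: lin_on_def)

lemma lin_on_zero:
  assumes "fun_space V" "lin_on V f" shows "f (\<lambda>_. 0) = 0"
  using lin_onD(2)[OF assms(2) fun_spaceD(1)[OF assms(1)], of 0] by simp

lemma lin_on_diff:
  assumes "fun_space V" "lin_on V f" "u \<in> V" "v \<in> V" shows "f (\<lambda>x. u x - v x) = f u - f v"
  using lin_onD(1)[OF assms(2,3) fun_spaceD(3)[OF assms(1,4), of "-1"]] lin_onD(2)[OF assms(2,4), of "-1"] by simp

lemma lin_on_sum:
  assumes "fun_space V" "lin_on V f" "finite J" "\<And>j. j \<in> J \<Longrightarrow> w j \<in> V"
  shows "f (\<lambda>x. \<Sum>j\<in>J. c j * w j x) = (\<Sum>j\<in>J. c j * f (w j))"
  using assms(3,4)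
proof (induction J rule: finite_induct)
  case empty
  then show ?case using lin_on_zero[OF assms(1,2)] by simp
next
  case (insert a J)
  have J: "(\<lambda>x. \<Sum>j\<in>J. c j * w j x) \<in> V" by (rule fun_space_sum[OF assms(1)]) (use insert in simp_all)
  show ?case using insert lin_onD(1)[OF assms(2) fun_spaceD(3)[OF assms(1), of "w a" "c a"] J]
      lin_onD(2)[OF assms(2), of "w a" "c a"] by simp
qed

lemma herm_onI:
  assumes "\<And>u v w. u \<in> V \<Longrightarrow> v \<in> V \<Longrightarrow> w \<in> V \<Longrightarrow> B (\<lambda>x. u x + v x) w = B u w + B v w"
    "\<And>u w c. u \<in> V \<Longrightarrow> w \<in> V \<Longrightarrow> B (\<lambda>x. c * u x) w = c * B u w"
    "\<And>u v. u \<in> V \<Longrightarrow> v \<in> V \<Longrightarrow> B v u = cnj (B u v)"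
  shows "herm_on V B"
  unfolding herm_on_def lin_on_def using assms by blast

lemma herm_on_lin: "herm_on V B \<Longrightarrow> v \<in> V \<Longrightarrow> lin_on V (\<lambda>u. B u v)"
  unfolding herm_on_def by blast

lemma herm_on_sym: "herm_on V B \<Longrightarrow> u \<in> V \<Longrightarrow> v \<in> V \<Longrightarrow> B v u = cnj (B u v)"
  unfolding herm_on_def by blast

lemma herm_on_diag:
  assumes "herm_on V B" "u \<in> V" shows "B u u = of_real (Re (B u u))"
proof -
  have "cnj (B u u) = B u u" using herm_on_sym[OF assms assms(2)] by (rule sym)
  then show ?thesis by (simp add: complex_eq_iff)
qed

lemma herm_on_add_right:
  assumes "herm_on V B" "fun_space V" "u \<in> V" "v \<in> V" "w \<in> V"
  shows "B u (\<lambda>x. v x + w x) = B u v + B u w"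
  unfolding herm_on_sym[OF assms(1) fun_spaceD(2)[OF assms(2,4,5)] assms(3)]
    herm_on_sym[OF assms(1,4,3)] herm_on_sym[OF assms(1,5,3)]
  using lin_onD(1)[OF herm_on_lin[OF assms(1,3)] assms(4,5)] by simp

lemma herm_on_scale_right:
  assumes "herm_on V B" "fun_space V" "u \<in> V" "v \<in> V"
  shows "B u (\<lambda>x. c * v x) = cnj c * B u v"
  unfolding herm_on_sym[OF assms(1) fun_spaceD(3)[OF assms(2,4)] assms(3)] herm_on_sym[OF assms(1,4,3)]
  using lin_onD(2)[OF herm_on_lin[OF assms(1,3)] assms(4)] by simp

lemma herm_on_diff_right:
  assumes "herm_on V B" "fun_space V" "u \<in> V" "v \<in> V" "w \<in> V"
  shows "B u (\<lambda>x. v x - w x) = B u v - B u w"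
  using herm_on_add_right[OF assms(1-4) fun_spaceD(3)[OF assms(2,5), of "-1"]]
    herm_on_scale_right[OF assms(1-3,5), of "-1"] by simp

lemma herm_on_combine:
  assumes B: "herm_on V B" and V: "fun_space V" and uv: "u \<in> V" "v \<in> V"
  shows "Re (B (\<lambda>x. u x + c * v x) (\<lambda>x. u x + c * v x)) =
           Re (B u u) + 2 * Re (cnj c * B u v) + (cmod c)\<^sup>2 * Re (B v v)"
proof -
  have cv: "(\<lambda>x. c * v x) \<in> V" and ucv: "(\<lambda>x. u x + c * v x) \<in> V" using V uv by (auto intro!: fun_spaceD)
  have "B (\<lambda>x. u x + c * v x) (\<lambda>x. u x + c * v x) = B u u + c * B v u + cnj c * (B u v + c * B v v)"
    using lin_onD(1)[OF herm_on_lin[OF B ucv] uv(1) cv] lin_onD(2)[OF herm_on_lin[OF B ucv] uv(2)]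
      lin_onD(1)[OF herm_on_lin[OF B uv(2)] uv(1) cv] lin_onD(2)[OF herm_on_lin[OF B uv(2)] uv(2)]
      herm_on_add_right[OF B V _ uv(1) cv] herm_on_scale_right[OF B V _ uv(2)] uv
      lin_onD(1)[OF herm_on_lin[OF B uv(1)] uv(1) cv] lin_onD(2)[OF herm_on_lin[OF B uv(1)] uv(2)] ucv
    by (simp add: algebra_simps)
  also have "\<dots> = B u u + (c * cnj (B u v) + cnj (c * cnj (B u v))) + of_real ((cmod c)\<^sup>2) * B v v"
    using herm_on_sym[OF B uv] by (simp add: algebra_simps complex_norm_square del: of_real_power)
  also have "Re \<dots> = Re (B u u) + 2 * Re (cnj c * B u v) + (cmod c)\<^sup>2 * Re (B v v)"
    by simp
  finally show ?thesis .
qed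

section \<open>Seminorms of positive semidefinite Hermitian forms\<close>

context
  fixes V :: "('x \<Rightarrow> complex) set" and B
  assumes V: "fun_space V" and B: "herm_on V B" and pos: "\<And>u. u \<in> V \<Longrightarrow> 0 \<le> Re (B u u)"
begin

lemma fnorm_sq: "u \<in> V \<Longrightarrow> (fnorm B u)\<^sup>2 = Re (B u u)"
  by (simp add: fnorm_def pos)

lemma fnorm_nonneg: "u \<in> V \<Longrightarrow> 0 \<le> fnorm B u"
  by (simp add: fnorm_def pos)

text \<open>Nonnegativity of the form at u + t z v, with z = \<open>B u v\<close> and t real, is a
  quadratic inequality in t. The form may vanish at v, so the choice of t depends on whether the
  quadratic term is present.\<close>

lemma psd_cauchy_schwarz:
  assumes uv: "u \<in> V" "v \<in> V"
  shows "cmod (B u v) \<le> fnorm B u * fnorm B v"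
proof -
  have *: "0 \<le> Re (B u u) + 2 * Re (cnj c * B u v) + (cmod c)\<^sup>2 * Re (B v v)" for c
    using herm_on_combine[OF B V uv, of c] pos[of "\<lambda>x. u x + c * v x"] V uv by (simp add: fun_spaceD)
  define z where "z = B u v"
  define s where "s = (cmod z)\<^sup>2"
  have **: "0 \<le> Re (B u u) + 2 * t * s + t\<^sup>2 * s * Re (B v v)" for t :: real
  proof -
    have "cnj (of_real t * z) * z = of_real (t * s)"
      unfolding s_def of_real_mult complex_norm_square by (simp add: mult_ac)
    then have "Re (cnj (of_real t * z) * z) = t * s" by (simp only: Re_complex_of_real)
    then have "0 \<le> Re (B u u) + 2 * (t * s) + (cmod (of_real t * z))\<^sup>2 * Re (B v v)"
      using *[of "of_real t * z", folded z_def] by (simp only:)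
    then show ?thesis by (simp add: s_def norm_mult power_mult_distrib mult_ac)
  qed
  have "s \<le> Re (B u u) * Re (B v v)"
  proof (cases "Re (B v v) = 0")
    case True
    have "s = 0"
    proof (rule ccontr)
      assume "s \<noteq> 0"
      then have "s > 0" by (simp add: s_def)
      \<comment> \<open>An affine function of t that is bounded below has slope 0; with a positive
        slope this t would give the value -1.\<close>
      then show False using **[of "- (Re (B u u) + 1) / (2 * s)"] True by (simp add: field_simps)
    qed
    then show ?thesis using True by simp
  next
    case False
    then have p: "Re (B v v) > 0" using pos[OF uv(2)] by simp
    \<comment> \<open>The t that minimises the quadratic polynomial.\<close>
    have "0 \<le> Re (B u u) - s / Re (B v v)"
      using **[of "- 1 / Re (B v v)"] p by (simp add: power2_eq_square field_simps)
    then show ?thesis using p by (simp add: field_simps)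
  qed
  also have "\<dots> = (fnorm B u * fnorm B v)\<^sup>2" by (simp add: power_mult_distrib fnorm_sq uv)
  finally show ?thesis unfolding s_def z_def
    using power2_le_imp_le fnorm_nonneg uv by (metis mult_nonneg_nonneg)
qed

lemma fnorm_triangle:
  assumes uv: "u \<in> V" "v \<in> V"
  shows "fnorm B (\<lambda>x. u x + v x) \<le> fnorm B u + fnorm B v"
proof -
  have "(fnorm B (\<lambda>x. u x + v x))\<^sup>2 = Re (B u u) + 2 * Re (B u v) + Re (B v v)"
    using herm_on_combine[OF B V uv, of 1] fnorm_sq[of "\<lambda>x. u x + v x"] V uv by (simp add: fun_spaceD)
  also have "\<dots> \<le> (fnorm B u)\<^sup>2 + 2 * (fnorm B u * fnorm B v) + (fnorm B v)\<^sup>2"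
    using complex_Re_le_cmod[of "B u v"] psd_cauchy_schwarz[OF uv] by (simp add: fnorm_sq uv)
  also have "\<dots> = (fnorm B u + fnorm B v)\<^sup>2" by (simp add: power2_sum)
  finally show ?thesis by (rule power2_le_imp_le) (simp add: fnorm_nonneg uv)
qed

lemma fnorm_scale:
  assumes u: "u \<in> V" shows "fnorm B (\<lambda>x. c * u x) = cmod c * fnorm B u"
proof -
  have z: "(\<lambda>_. 0) \<in> V" using V by (rule fun_spaceD)
  have "B (\<lambda>_. 0) v = 0" if "v \<in> V" for v using lin_on_zero[OF V herm_on_lin[OF B that]] .
  then have "Re (B (\<lambda>x. c * u x) (\<lambda>x. c * u x)) = (cmod c)\<^sup>2 * Re (B u u)"
    using herm_on_combine[OF B V z u, of c] u z by simp
  then show ?thesis by (simp add: fnorm_def real_sqrt_mult)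
qed

lemma fnorm_diff_commute:
  assumes "u \<in> V" "v \<in> V" shows "fnorm B (\<lambda>x. u x - v x) = fnorm B (\<lambda>x. v x - u x)"
  using fnorm_scale[OF fun_space_diff[OF V assms(2,1)], of "-1"] by simp

lemma fnorm_triangle_diff:
  assumes "u \<in> V" "v \<in> V" "w \<in> V"
  shows "fnorm B (\<lambda>x. u x - w x) \<le> fnorm B (\<lambda>x. u x - v x) + fnorm B (\<lambda>x. v x - w x)"
  using fnorm_triangle[OF fun_space_diff[OF V assms(1,2)] fun_space_diff[OF V assms(2,3)]] by simp

lemma fnorm_sum:
  assumes "finite J" "\<And>j. j \<in> J \<Longrightarrow> w j \<in> V"
  shows "fnorm B (\<lambda>x. \<Sum>j\<in>J. c j * w j x) \<le> (\<Sum>j\<in>J. cmod (c j) * fnorm B (w j))"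
  using assms
proof (induction J rule: finite_induct)
  case empty
  then show ?case using fnorm_scale[OF fun_spaceD(1)[OF V], of 0] by simp
next
  case (insert a J)
  have J: "(\<lambda>x. \<Sum>j\<in>J. c j * w j x) \<in> V" by (rule fun_space_sum[OF V]) (use insert in simp_all)
  show ?case using insert fnorm_triangle[OF fun_spaceD(3)[OF V, of "w a" "c a"] J] fnorm_scale[of "w a" "c a"] by simp
qed

end

subsection \<open>Square integrable functions\<close>

definition sqint :: "'a measure \<Rightarrow> ('a \<Rightarrow> complex) \<Rightarrow> bool" where
  "sqint M f \<longleftrightarrow> f \<in> borel_measurable M \<and> integrable M (\<lambda>x. (cmod (f x))\<^sup>2)"

definition ip :: "'a measure \<Rightarrow> ('a \<Rightarrow> complex) \<Rightarrow> ('a \<Rightarrow> complex) \<Rightarrow> complex" where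
  "ip M f g = (\<integral>x. f x * cnj (g x) \<partial>M)"

definition sq :: "'a measure \<Rightarrow> ('a \<Rightarrow> complex) \<Rightarrow> real" where
  "sq M f = (\<integral>x. (cmod (f x))\<^sup>2 \<partial>M)"

lemma two_mult_le_squares: "2 * (a * b) \<le> a\<^sup>2 + (b::real)\<^sup>2"
  using zero_le_power2[of "a - b"] by (simp add: power2_diff)

lemma sq_norm_add_le: "(norm (a + b))\<^sup>2 \<le> 2 * (norm a)\<^sup>2 + 2 * (norm b)\<^sup>2"
proof -
  have "(norm (a + b))\<^sup>2 \<le> (norm a + norm b)\<^sup>2" by (intro power_mono norm_triangle_ineq) simp
  also have "\<dots> \<le> 2 * (norm a)\<^sup>2 + 2 * (norm b)\<^sup>2" using two_mult_le_squares[of "norm a" "norm b"] by (simp add: power2_sum)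
  finally show ?thesis .
qed

lemma sqint_meas: "sqint M f \<Longrightarrow> f \<in> borel_measurable M"
  by (simp add: sqint_def)

lemma sqint_meas_mult [measurable (raw)]:
  assumes "f \<in> borel_measurable M" "g \<in> borel_measurable M"
  shows "(\<lambda>x. f x * cnj (g x :: complex)) \<in> borel_measurable M"
proof -
  have "(cnj :: complex \<Rightarrow> complex) \<in> borel_measurable borel"
    by (rule borel_measurable_continuous_onI) (intro continuous_intros)
  from measurable_compose[OF assms(2) this] assms(1) show ?thesis by simp
qed

lemma sqint_mult_norm:
  assumes "sqint M f" "sqint M g" shows "integrable M (\<lambda>x. cmod (f x) * cmod (g x))"
proof (rule Bochner_Integration.integrable_bound)
  show "integrable M (\<lambda>x. (cmod (f x))\<^sup>2 + (cmod (g x))\<^sup>2)" using assms by (simp add: sqint_def)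
  show "(\<lambda>x. cmod (f x) * cmod (g x)) \<in> borel_measurable M"
    using assms[THEN sqint_meas] by measurable
  have "cmod (f x) * cmod (g x) \<le> (cmod (f x))\<^sup>2 + (cmod (g x))\<^sup>2" for x
    using two_mult_le_squares[of "cmod (f x)" "cmod (g x)"] mult_nonneg_nonneg[OF norm_ge_zero norm_ge_zero, of "f x" "g x"] by linarith
  then show "AE x in M. norm (cmod (f x) * cmod (g x)) \<le> norm ((cmod (f x))\<^sup>2 + (cmod (g x))\<^sup>2)" by (simp add: abs_mult)
qed

lemma sqint_integrable_mult:
  assumes "sqint M f" "sqint M g" shows "integrable M (\<lambda>x. f x * cnj (g x))"
  by (rule Bochner_Integration.integrable_bound[OF sqint_mult_norm[OF assms]])
    (use assms[THEN sqint_meas] in \<open>auto simp: norm_mult intro: sqint_meas_mult\<close>)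

lemma sqint_add:
  assumes "sqint M f" "sqint M g" shows "sqint M (\<lambda>x. f x + g x)"
  unfolding sqint_def
proof
  show "integrable M (\<lambda>x. (cmod (f x + g x))\<^sup>2)"
  proof (rule Bochner_Integration.integrable_bound)
    show "integrable M (\<lambda>x. 2 * (cmod (f x))\<^sup>2 + 2 * (cmod (g x))\<^sup>2)" using assms by (simp add: sqint_def)
  qed (use assms sq_norm_add_le in \<open>auto simp: sqint_def\<close>)
qed (use assms[THEN sqint_meas] in measurable)

lemma sqint_scale: "sqint M f \<Longrightarrow> sqint M (\<lambda>x. c * f x)"
  by (auto simp: sqint_def norm_mult power_mult_distrib intro: borel_measurable_times)

lemma sqint_zero: "sqint M (\<lambda>_. 0)"
  by (simp add: sqint_def)

lemma fun_space_sqint: "fun_space {f. sqint M f}"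
  by (simp add: fun_space_def sqint_zero sqint_add sqint_scale)

lemma sqint_diff: "sqint M f \<Longrightarrow> sqint M g \<Longrightarrow> sqint M (\<lambda>x. f x - g x)"
  using fun_space_diff[OF fun_space_sqint, of f M g] by simp

lemma herm_on_ip: "herm_on {f. sqint M f} (ip M)"
proof (rule herm_onI)
  fix u v w assume "u \<in> {f. sqint M f}" "v \<in> {f. sqint M f}" "w \<in> {f. sqint M f}"
  then show "ip M (\<lambda>x. u x + v x) w = ip M u w + ip M v w"
    by (simp add: ip_def distrib_right sqint_integrable_mult)
next
  fix u v assume "u \<in> {f. sqint M f}" "v \<in> {f. sqint M f}"
  show "ip M v u = cnj (ip M u v)" unfolding ip_def Bochner_Integration.integral_cnj[symmetric] by (simp add: mult.commute)
qed (simp add: ip_def mult.assoc)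

lemma ip_self: "ip M f f = of_real (sq M f)"
  unfolding ip_def sq_def integral_complex_of_real[symmetric] complex_norm_square ..

lemma sq_nonneg: "0 \<le> sq M f"
  by (simp add: sq_def)

lemma fnorm_ip: "fnorm (ip M) f = sqrt (sq M f)"
  by (simp add: fnorm_def ip_self)

lemma ip_cauchy_schwarz:
  assumes "sqint M f" "sqint M g" shows "cmod (ip M f g) \<le> sqrt (sq M f) * sqrt (sq M g)"
  using psd_cauchy_schwarz[OF fun_space_sqint herm_on_ip, of M f g] assms by (simp add: ip_self sq_nonneg fnorm_ip)

lemma sq_triangle:
  assumes "sqint M f" "sqint M g"
  shows "sqrt (sq M (\<lambda>x. f x + g x)) \<le> sqrt (sq M f) + sqrt (sq M g)"
  using fnorm_triangle[OF fun_space_sqint herm_on_ip, of M f g] assms by (simp add: ip_self sq_nonneg fnorm_ip)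

lemma sq_diff_commute: "sq M (\<lambda>x. f x - g x) = sq M (\<lambda>x. g x - f x)"
  by (simp add: sq_def norm_minus_commute)

lemma sq_cong_AE:
  assumes "AE x in M. f x = g x" "f \<in> borel_measurable M" "g \<in> borel_measurable M"
  shows "sq M f = sq M g"
  unfolding sq_def by (rule integral_cong_AE) (use assms in auto)

lemma ip_cong_AE:
  assumes "AE x in M. f x = g x" "AE x in M. f' x = g' x"
    "f \<in> borel_measurable M" "g \<in> borel_measurable M" "f' \<in> borel_measurable M" "g' \<in> borel_measurable M"
  shows "ip M f f' = ip M g g'"
  unfolding ip_def by (rule integral_cong_AE) (use assms in \<open>auto intro: sqint_meas_mult\<close>)

lemma sq_eq_0_iff:
  assumes "sqint M f" shows "sq M f = 0 \<longleftrightarrow> (AE x in M. f x = 0)"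
  unfolding sq_def using assms by (subst integral_nonneg_eq_0_iff_AE) (auto simp: sqint_def)

lemma nn_integral_sq: "sqint M f \<Longrightarrow> (\<integral>\<^sup>+x. ennreal ((cmod (f x))\<^sup>2) \<partial>M) = ennreal (sq M f)"
  unfolding sq_def by (rule nn_integral_eq_integral) (auto simp: sqint_def)

section \<open>Completeness of the space of square integrable functions\<close>

lemma cauchy_fast_subseq:
  fixes d :: "nat \<Rightarrow> nat \<Rightarrow> real"
  assumes "\<And>e. e > 0 \<Longrightarrow> \<exists>N. \<forall>m\<ge>N. \<forall>n\<ge>N. d m n < e"
  shows "\<exists>r. strict_mono r \<and> (\<forall>k. \<forall>m\<ge>r k. \<forall>n\<ge>r k. d m n < (1/4)^k)"
proof -
  have "\<forall>k. \<exists>N. \<forall>m\<ge>N. \<forall>n\<ge>N. d m n < (1/4)^k" using assms by simp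
  then obtain N where N: "\<And>k m n. m \<ge> N k \<Longrightarrow> n \<ge> N k \<Longrightarrow> d m n < (1/4)^k" by metis
  \<comment> \<open>The sum of the thresholds dominates \<open>N k\<close>, and the summand k makes
    \<open>r\<close> strictly increasing.\<close>
  define r where "r k = k + (\<Sum>i\<le>k. N i)" for k
  have "strict_mono r" by (rule strict_monoI_Suc) (simp add: r_def)
  moreover have "r k \<ge> N k" for k
    using member_le_sum[of k "{..k}" N] by (simp add: r_def)
  ultimately show ?thesis using N by (meson le_trans)
qed

text \<open>The theorem of Riesz and Fischer for functions: a rapidly Cauchy subsequence converges
  almost everywhere, and Fatou's lemma bounds the distance of every late \<open>f n\<close> to that
  limit, so the whole sequence converges and not just the subsequence.\<close>

theorem sqint_complete:
  fixes f :: "nat \<Rightarrow> 'a \<Rightarrow> complex"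
  assumes f: "\<And>n. sqint M (f n)"
    and C: "\<And>e. e > 0 \<Longrightarrow> \<exists>N. \<forall>m\<ge>N. \<forall>n\<ge>N. sq M (\<lambda>x. f m x - f n x) < e"
  shows "\<exists>g. sqint M g \<and> (\<lambda>n. sq M (\<lambda>x. f n x - g x)) \<longlonglongrightarrow> 0"
proof -
  note [measurable] = sqint_meas[OF f]
  obtain r where r: "strict_mono r"
    and d: "\<And>k m n. m \<ge> r k \<Longrightarrow> n \<ge> r k \<Longrightarrow> sq M (\<lambda>x. f m x - f n x) < (1/4)^k"
    using cauchy_fast_subseq[of "\<lambda>m n. sq M (\<lambda>x. f m x - f n x)", OF C] by auto
  define h where "h k x = (cmod (f (r (Suc k)) x - f (r k) x))\<^sup>2" for k x
  have [measurable]: "h k \<in> borel_measurable M" for k unfolding h_def by measurable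
  \<comment> \<open>the weights \<open>2^k\<close> turn summability of the squares into summability of the increments\<close>
  have "(\<integral>\<^sup>+x. (\<Sum>k. ennreal (2^k * h k x)) \<partial>M) = (\<Sum>k. \<integral>\<^sup>+x. ennreal (2^k * h k x) \<partial>M)"
    by (rule nn_integral_suminf) simp
  also have "\<dots> \<le> (\<Sum>k. ennreal ((1/2)^k))"
  proof (intro suminf_le summableI allI)
    fix k
    have "(\<integral>\<^sup>+x. ennreal (2^k * h k x) \<partial>M) = ennreal (2^k) * (\<integral>\<^sup>+x. ennreal (h k x) \<partial>M)"
      by (subst nn_integral_cmult[symmetric]) (auto simp: ennreal_mult h_def)
    also have "(\<integral>\<^sup>+x. ennreal (h k x) \<partial>M) = ennreal (sq M (\<lambda>x. f (r (Suc k)) x - f (r k) x))"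
      unfolding h_def by (rule nn_integral_sq) (simp add: sqint_diff f)
    also have "\<dots> \<le> ennreal ((1/4)^k)"
      using d[of k "r (Suc k)" "r k"] strict_mono_less_eq[OF r, of k "Suc k"] by (simp add: less_imp_le)
    also have "ennreal (2^k) * ennreal ((1/4)^k) = ennreal ((1/2)^k)"
      by (subst ennreal_mult[symmetric]) (simp_all add: power_mult_distrib[symmetric])
    finally show "(\<integral>\<^sup>+x. ennreal (2^k * h k x) \<partial>M) \<le> ennreal ((1/2)^k)" by (simp add: mult_left_mono)
  qed
  also have "\<dots> = ennreal (\<Sum>k. (1/2)^k)"
    by (rule suminf_ennreal2) (auto intro!: summable_geometric)
  finally have "(\<integral>\<^sup>+x. (\<Sum>k. ennreal (2^k * h k x)) \<partial>M) \<noteq> \<infinity>"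
    by (simp add: top_unique neq_top_trans) (metis ennreal_neq_top top.extremum_uniqueI)
  then have "AE x in M. (\<Sum>k. ennreal (2^k * h k x)) \<noteq> \<infinity>"
    by (intro nn_integral_PInf_AE) auto
  then have conv: "AE x in M. convergent (\<lambda>k. f (r k) x)"
  proof (rule AE_mp, intro AE_I2 impI)
    fix x assume *: "(\<Sum>k. ennreal (2^k * h k x)) \<noteq> \<infinity>"
    have "summable (\<lambda>k. 2^k * h k x)"
      by (rule summable_suminf_not_top) (use * in \<open>auto simp: h_def\<close>)
    \<comment> \<open>Boundedness of 2^k \<open>h k x\<close> is all that is taken from summability:
      the increments are then dominated by a geometric series of ratio 1 / sqrt 2.\<close>
    then have "(\<lambda>k. 2^k * h k x) \<longlonglongrightarrow> 0" by (rule summable_LIMSEQ_zero)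
    then obtain K where K: "\<And>k. norm (2^k * h k x) \<le> K"
      using convergent_imp_Bseq[of "\<lambda>k. 2^k * h k x"] by (auto simp: convergent_def Bseq_def)
    have b: "cmod (f (r (Suc k)) x - f (r k) x) \<le> sqrt K * (sqrt (1/2))^k" for k
    proof -
      have "h k x \<le> K * (1/2)^k" using K[of k] by (simp add: h_def field_simps)
      then have "sqrt (h k x) \<le> sqrt (K * (1/2)^k)" by (rule real_sqrt_le_mono)
      then show ?thesis by (simp add: h_def real_sqrt_mult real_sqrt_power real_sqrt_divide power_divide)
    qed
    have "summable (\<lambda>k. f (r (Suc k)) x - f (r k) x)"
    proof (rule summable_comparison_test')
      show "summable (\<lambda>k. sqrt K * (sqrt (1/2))^k)" by (intro summable_mult summable_geometric) simp
    qed (use b in simp)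
    then have "convergent (\<lambda>n. \<Sum>k<n. f (r (Suc k)) x - f (r k) x)" by (simp add: summable_iff_convergent)
    then have "convergent (\<lambda>n. f (r n) x - f (r 0) x)" by (simp add: sum_lessThan_telescope[where f = "\<lambda>n. f (r n) x"])
    from convergent_add[OF this convergent_const[of "f (r 0) x"]] show "convergent (\<lambda>k. f (r k) x)" by simp
  qed
  \<comment> \<open>On the null set where the subsequence diverges, \<open>lim\<close> has an
    unspecified value; \<open>g\<close> is measurable all the same.\<close>
  define g where "g x = lim (\<lambda>k. f (r k) x)" for x
  have g[measurable]: "g \<in> borel_measurable M" unfolding g_def by measurable
  have bound: "sqint M (\<lambda>x. f n x - g x) \<and> sq M (\<lambda>x. f n x - g x) \<le> (1/4)^k" if n: "n \<ge> r k" for n k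
  proof -
    have "(\<integral>\<^sup>+x. ennreal ((cmod (f n x - g x))\<^sup>2) \<partial>M) =
        (\<integral>\<^sup>+x. liminf (\<lambda>j. ennreal ((cmod (f n x - f (r j) x))\<^sup>2)) \<partial>M)"
    proof (rule nn_integral_cong_AE, rule AE_mp[OF conv], intro AE_I2 impI)
      fix x assume "convergent (\<lambda>k. f (r k) x)"
      then have "(\<lambda>k. f (r k) x) \<longlonglongrightarrow> g x" by (simp add: g_def convergent_LIMSEQ_iff)
      then have "(\<lambda>j. ennreal ((cmod (f n x - f (r j) x))\<^sup>2)) \<longlonglongrightarrow> ennreal ((cmod (f n x - g x))\<^sup>2)"
        by (intro tendsto_ennrealI tendsto_intros)
      then show "ennreal ((cmod (f n x - g x))\<^sup>2) = liminf (\<lambda>j. ennreal ((cmod (f n x - f (r j) x))\<^sup>2))"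
        by (metis lim_imp_Liminf trivial_limit_sequentially)
    qed
    \<comment> \<open>Fatou's lemma, with n fixed and the other index running along the
      subsequence.\<close>
    also have "\<dots> \<le> liminf (\<lambda>j. \<integral>\<^sup>+x. ennreal ((cmod (f n x - f (r j) x))\<^sup>2) \<partial>M)"
      by (rule nn_integral_liminf) simp
    also have "\<dots> \<le> liminf (\<lambda>j. ennreal ((1/4)^k))"
    proof (rule Liminf_mono)
      have "(\<integral>\<^sup>+x. ennreal ((cmod (f n x - f (r j) x))\<^sup>2) \<partial>M) \<le> ennreal ((1/4)^k)" if "j \<ge> k" for j
        using d[OF n, of "r j"] strict_mono_less_eq[OF r, of k j] that
        by (subst nn_integral_sq) (auto simp: sqint_diff f less_imp_le)
      then show "\<forall>\<^sub>F j in sequentially. (\<integral>\<^sup>+x. ennreal ((cmod (f n x - f (r j) x))\<^sup>2) \<partial>M) \<le> ennreal ((1/4)^k)"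
        unfolding eventually_sequentially by blast
    qed
    also have "\<dots> = ennreal ((1/4)^k)" by (simp add: Liminf_const)
    finally have le: "(\<integral>\<^sup>+x. ennreal ((cmod (f n x - g x))\<^sup>2) \<partial>M) \<le> ennreal ((1/4)^k)" .
    have s: "sqint M (\<lambda>x. f n x - g x)"
      unfolding sqint_def integrable_iff_bounded using le_less_trans[OF le ennreal_less_top] by simp
    then show ?thesis using le nn_integral_sq[OF s] by (simp add: sq_nonneg)
  qed
  have "sqint M g" using sqint_diff[OF f[of "r 0"], of "\<lambda>x. f (r 0) x - g x"] bound[of 0 "r 0"] by simp
  moreover have "(\<lambda>n. sq M (\<lambda>x. f n x - g x)) \<longlonglongrightarrow> 0"
  proof (rule LIMSEQ_I)
    fix e :: real assume "e > 0"
    then obtain k where "(1/4)^k < e" using real_arch_pow_inv[of e "1/4"] by auto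
    moreover have "norm (sq M (\<lambda>x. f n x - g x) - 0) \<le> (1/4)^k" if "n \<ge> r k" for n
      using bound[OF that] by (simp add: sq_nonneg)
    ultimately show "\<exists>no. \<forall>n\<ge>no. norm (sq M (\<lambda>x. f n x - g x) - 0) < e"
      by (meson le_less_trans)
  qed
  ultimately show ?thesis by blast
qed

lemma integrable_cont: "continuous_on UNIV (f :: 'a::euclidean_space \<Rightarrow> 'b::banach) \<Longrightarrow> f integrable_on cbox a b"
  by (rule integrable_continuous[OF continuous_on_subset]) auto

lemma integrable_cont_real: "continuous_on {a..b} (f :: real \<Rightarrow> 'b::banach) \<Longrightarrow> {u..v} \<subseteq> {a..b} \<Longrightarrow> f integrable_on {u..v}"
  by (rule integrable_continuous_real[OF continuous_on_subset])

subsection \<open>Trace, Poincare and Fourier estimates for smooth functions\<close>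

text \<open>The inner product on a closed box by means of the gauge integral, for continuous
  functions. Calculus (fundamental theorem, interchange of integrals, Leibniz rule) is done with it;
  \<open>ip_cont\<close> identifies it with the Lebesgue inner product on the open cell.\<close>

definition cip :: "'a::euclidean_space \<Rightarrow> 'a \<Rightarrow> ('a \<Rightarrow> complex) \<Rightarrow> ('a \<Rightarrow> complex) \<Rightarrow> complex" where
  "cip a b f g = integral (cbox a b) (\<lambda>x. f x * cnj (g x))"

lemma fun_space_continuous: "fun_space {f :: 'a::euclidean_space \<Rightarrow> complex. continuous_on (cbox a b) f}"
  by (auto simp: fun_space_def intro!: continuous_intros)

lemma herm_on_cip: "herm_on {f. continuous_on (cbox a b) f} (cip a b)"
proof (rule herm_onI)
  fix u v w :: "'a \<Rightarrow> complex"
  assume "u \<in> {f. continuous_on (cbox a b) f}" "v \<in> {f. continuous_on (cbox a b) f}" "w \<in> {f. continuous_on (cbox a b) f}"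
  then show "cip a b (\<lambda>x. u x + v x) w = cip a b u w + cip a b v w"
    unfolding cip_def distrib_right
    by (intro Henstock_Kurzweil_Integration.integral_add integrable_continuous continuous_intros) auto
next
  fix u v :: "'a \<Rightarrow> complex"
  show "cip a b v u = cnj (cip a b u v)"
    unfolding cip_def Henstock_Kurzweil_Integration.integral_cnj by (simp add: mult.commute)
qed (simp add: cip_def mult.assoc)

lemma cip_self:
  assumes "continuous_on (cbox a b) f"
  shows "cip a b f f = of_real (integral (cbox a b) (\<lambda>x. (cmod (f x))\<^sup>2))"
proof -
  have "(\<lambda>x. (cmod (f x))\<^sup>2) integrable_on cbox a b"
    by (intro integrable_continuous continuous_intros assms)
  from has_integral_linear[OF integrable_integral[OF this] bounded_linear_of_real]
  show ?thesis unfolding cip_def complex_norm_square[symmetric] o_def by (rule integral_unique)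
qed

lemma cip_pos: "continuous_on (cbox a b) f \<Longrightarrow> 0 \<le> Re (cip a b f f)"
  by (simp add: cip_self integral_nonneg integrable_continuous continuous_intros)

lemma integral_cauchy_schwarz:
  assumes "continuous_on (cbox a b) f" "continuous_on (cbox a b) g"
  shows "(cmod (integral (cbox a b) (\<lambda>x. f x * cnj (g x))))\<^sup>2
     \<le> integral (cbox a b) (\<lambda>x. (cmod (f x))\<^sup>2) * integral (cbox a b) (\<lambda>x. (cmod (g x))\<^sup>2)"
proof -
  have "cmod (cip a b f g) \<le> fnorm (cip a b) f * fnorm (cip a b) g"
    by (rule psd_cauchy_schwarz[OF fun_space_continuous herm_on_cip]) (use assms cip_pos in auto)
  then have "(cmod (cip a b f g))\<^sup>2 \<le> (fnorm (cip a b) f * fnorm (cip a b) g)\<^sup>2" by (intro power_mono) auto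
  then show ?thesis
    using assms cip_pos[OF assms(1)] cip_pos[OF assms(2)]
    by (simp add: cip_def[of a b f g] power_mult_distrib fnorm_def cip_self)
qed

lemma integral_cauchy_schwarz_one:
  fixes a b :: real
  assumes "continuous_on {a..b} f" "a \<le> b"
  shows "(cmod (integral {a..b} f))\<^sup>2 \<le> (b - a) * integral {a..b} (\<lambda>x. (cmod (f x))\<^sup>2)"
  using integral_cauchy_schwarz[of a b f "\<lambda>_. 1"] assms by (simp add: mult.commute)

lemma integral_mono_cont:
  fixes f g :: "real \<Rightarrow> real"
  assumes "continuous_on {a..b} f" "continuous_on {a..b} g" "\<And>x. x \<in> {a..b} \<Longrightarrow> f x \<le> g x"
  shows "integral {a..b} f \<le> integral {a..b} g"
  using assms by (intro integral_le integrable_continuous_real) auto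

text \<open>At the point where |f| is smallest, |f|^2 is at most its mean; from there the derivative
  of |f|^2 is integrated up to x. The weight \<open>\<theta>\<close> is left free: it becomes 1 +
  |m| for the m-th Fourier coefficient, and is taken large where the derivative must enter with a
  small factor.\<close>

lemma trace_inequality_1d:
  fixes f f' :: "real \<Rightarrow> complex"
  assumes ab: "a < b" and \<theta>: "\<theta> > 0" and x: "x \<in> {a..b}"
    and d: "\<And>t. t \<in> {a..b} \<Longrightarrow> (f has_vector_derivative f' t) (at t within {a..b})"
    and c': "continuous_on {a..b} f'"
  shows "(cmod (f x))\<^sup>2 \<le> (1 / (b - a) + \<theta>) * integral {a..b} (\<lambda>t. (cmod (f t))\<^sup>2)
      + 1 / \<theta> * integral {a..b} (\<lambda>t. (cmod (f' t))\<^sup>2)"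
proof -
  have c: "continuous_on {a..b} f" using d by (rule continuous_on_vector_derivative)
  have cn: "continuous_on {a..b} (\<lambda>t. (cmod (f t))\<^sup>2)" "continuous_on {a..b} (\<lambda>t. (cmod (f' t))\<^sup>2)"
    by (intro continuous_intros c c')+
  obtain y where y: "y \<in> {a..b}" "\<And>t. t \<in> {a..b} \<Longrightarrow> (cmod (f y))\<^sup>2 \<le> (cmod (f t))\<^sup>2"
    using continuous_attains_inf[OF compact_Icc _ cn(1)] ab by auto
  have "(b - a) * (cmod (f y))\<^sup>2 = integral {a..b} (\<lambda>_. (cmod (f y))\<^sup>2)" using ab by simp
  also have "\<dots> \<le> integral {a..b} (\<lambda>t. (cmod (f t))\<^sup>2)"
    by (rule integral_mono_cont) (use y cn in auto)
  finally have avg: "(cmod (f y))\<^sup>2 \<le> 1 / (b - a) * integral {a..b} (\<lambda>t. (cmod (f t))\<^sup>2)"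
    using ab by (simp add: field_simps)
  define k where "k t = 2 * inner (f t) (f' t)" for t
  define q where "q t = \<theta> * (cmod (f t))\<^sup>2 + 1 / \<theta> * (cmod (f' t))\<^sup>2" for t
  have kc: "continuous_on {a..b} k" unfolding k_def by (intro continuous_intros c c')
  have qc: "continuous_on {a..b} q" unfolding q_def by (intro continuous_intros cn)
  have kq: "\<bar>k t\<bar> \<le> q t" for t
  proof -
    have "\<bar>k t\<bar> \<le> 2 * (cmod (f t) * cmod (f' t))" using Cauchy_Schwarz_ineq2[of "f t" "f' t"] by (simp add: k_def)
    \<comment> \<open>Young's inequality, weighted so that \<open>\<theta>\<close> falls on f and
      its inverse on the derivative.\<close>
    also have "\<dots> = 2 * ((sqrt \<theta> * cmod (f t)) * (cmod (f' t) / sqrt \<theta>))" using \<theta> by simp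
    also have "\<dots> \<le> (sqrt \<theta> * cmod (f t))\<^sup>2 + (cmod (f' t) / sqrt \<theta>)\<^sup>2" by (rule two_mult_le_squares)
    also have "\<dots> = q t" using \<theta> by (simp add: q_def power_mult_distrib power_divide)
    finally show ?thesis .
  qed
  have ftc: "(k has_integral (cmod (f v))\<^sup>2 - (cmod (f u))\<^sup>2) {u..v}" if "u \<le> v" "{u..v} \<subseteq> {a..b}" for u v
  proof (rule fundamental_theorem_of_calculus[OF that(1)])
    fix t assume "t \<in> {u..v}"
    then have "(f has_vector_derivative f' t) (at t within {u..v})"
      using d that(2) has_vector_derivative_within_subset by blast
    then have "((\<lambda>t. inner (f t) (f t)) has_vector_derivative k t) (at t within {u..v})"
      unfolding has_vector_derivative_def k_def
      by (auto intro!: derivative_eq_intros simp: inner_commute algebra_simps)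
    then show "((\<lambda>t. (cmod (f t))\<^sup>2) has_vector_derivative k t) (at t within {u..v})"
      by (simp add: power2_norm_eq_inner)
  qed
  have seg: "\<bar>(cmod (f v))\<^sup>2 - (cmod (f u))\<^sup>2\<bar> \<le> integral {a..b} q" if "u \<le> v" "{u..v} \<subseteq> {a..b}" for u v
  proof -
    have "\<bar>(cmod (f v))\<^sup>2 - (cmod (f u))\<^sup>2\<bar> = norm (integral {u..v} k)"
      using integral_unique[OF ftc[OF that]] by simp
    also have "\<dots> \<le> integral {u..v} q"
      by (rule integral_norm_bound_integral[OF integrable_cont_real[OF kc that(2)] integrable_cont_real[OF qc that(2)]])
        (simp add: kq)
    also have "\<dots> \<le> integral {a..b} q"
      by (rule integral_subset_le[OF that(2) integrable_cont_real[OF qc that(2)] integrable_cont_real[OF qc order_refl]])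
        (use order_trans[OF abs_ge_zero kq] in auto)
    finally show ?thesis .
  qed
  have "(cmod (f x))\<^sup>2 - (cmod (f y))\<^sup>2 \<le> integral {a..b} q"
    using seg[of x y] seg[of y x] x y(1) by (cases "x \<le> y") auto
  also have "integral {a..b} q = \<theta> * integral {a..b} (\<lambda>t. (cmod (f t))\<^sup>2) + 1 / \<theta> * integral {a..b} (\<lambda>t. (cmod (f' t))\<^sup>2)"
    unfolding q_def by (subst Henstock_Kurzweil_Integration.integral_add)
      (use \<theta> in \<open>auto intro!: integrable_continuous_real continuous_intros c c'\<close>)
  finally show ?thesis using avg by (simp add: algebra_simps)
qed

text \<open>By Cauchy and Schwarz the oscillation of f is at most sqrt ((b - a) D), with D the
  energy of the derivative; averaging f x - f y over y compares f with its mean. The integral of f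
  is kept on the right instead of being subtracted, because such integrals are the finitely many
  linear functionals used later.\<close>

lemma poincare_1d:
  fixes f f' :: "real \<Rightarrow> complex"
  assumes ab: "a < b"
    and d: "\<And>t. t \<in> {a..b} \<Longrightarrow> (f has_vector_derivative f' t) (at t within {a..b})"
    and c': "continuous_on {a..b} f'"
  shows "integral {a..b} (\<lambda>t. (cmod (f t))\<^sup>2) \<le> 2 / (b - a) * (cmod (integral {a..b} f))\<^sup>2
      + 2 * (b - a)\<^sup>2 * integral {a..b} (\<lambda>t. (cmod (f' t))\<^sup>2)"
proof -
  have c: "continuous_on {a..b} f" using d by (rule continuous_on_vector_derivative)
  define L where "L = b - a"
  define D where "D = integral {a..b} (\<lambda>t. (cmod (f' t))\<^sup>2)"
  have L: "L > 0" using ab by (simp add: L_def)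
  have D: "D \<ge> 0" unfolding D_def by (intro integral_nonneg integrable_continuous_real continuous_intros c') auto
  have seg: "cmod (f v - f u) \<le> sqrt (L * D)" if "u \<le> v" "{u..v} \<subseteq> {a..b}" for u v
  proof -
    have "(f' has_integral f v - f u) {u..v}"
      using d that(2) has_vector_derivative_within_subset
      by (intro fundamental_theorem_of_calculus[OF that(1)]) blast
    then have "(cmod (f v - f u))\<^sup>2 = (cmod (integral {u..v} f'))\<^sup>2" by (simp add: integral_unique)
    also have "\<dots> \<le> (v - u) * integral {u..v} (\<lambda>x. (cmod (f' x))\<^sup>2)"
      by (rule integral_cauchy_schwarz_one[OF continuous_on_subset[OF c' that(2)] that(1)])
    also have "\<dots> \<le> L * D"
    proof (rule mult_mono)
      show "integral {u..v} (\<lambda>x. (cmod (f' x))\<^sup>2) \<le> D" unfolding D_def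
        by (rule integral_subset_le[OF that(2)]) (auto intro!: integrable_cont_real[of a b] continuous_intros c' that)
      show "0 \<le> integral {u..v} (\<lambda>x. (cmod (f' x))\<^sup>2)"
        by (rule integral_nonneg) (auto intro!: integrable_cont_real[of a b] continuous_intros c' that)
    qed (use that L in \<open>auto simp: L_def\<close>)
    finally show ?thesis by (rule real_le_rsqrt)
  qed
  have dif: "cmod (f x - f y) \<le> sqrt (L * D)" if "x \<in> {a..b}" "y \<in> {a..b}" for x y
    using seg[of x y] seg[of y x] that by (cases "x \<le> y") (auto simp: norm_minus_commute)
  have pt: "(cmod (f x))\<^sup>2 \<le> 2 / L\<^sup>2 * (cmod (integral {a..b} f))\<^sup>2 + 2 * (L * D)" if x: "x \<in> {a..b}" for x
  proof -
    have "integral {a..b} (\<lambda>y. f x - f y) = of_real L * f x - integral {a..b} f"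
      using ab c by (subst Henstock_Kurzweil_Integration.integral_diff)
        (auto intro!: integrable_continuous_real simp: L_def scaleR_conv_of_real)
    moreover have "cmod (integral {a..b} (\<lambda>y. f x - f y)) \<le> sqrt (L * D) * (b - a)"
      by (rule integral_bound) (use ab c dif x in \<open>auto intro!: continuous_intros\<close>)
    ultimately have e: "cmod (of_real L * f x - integral {a..b} f) \<le> sqrt (L * D) * L" by (simp add: L_def)
    have "L\<^sup>2 * (cmod (f x))\<^sup>2 = (cmod (integral {a..b} f + (of_real L * f x - integral {a..b} f)))\<^sup>2"
      using L by (simp add: norm_mult power_mult_distrib)
    also have "\<dots> \<le> 2 * (cmod (integral {a..b} f))\<^sup>2 + 2 * (cmod (of_real L * f x - integral {a..b} f))\<^sup>2"
      by (rule sq_norm_add_le)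
    also have "(cmod (of_real L * f x - integral {a..b} f))\<^sup>2 \<le> (sqrt (L * D) * L)\<^sup>2"
      by (rule power_mono[OF e]) simp
    also have "(sqrt (L * D) * L)\<^sup>2 = L\<^sup>2 * (L * D)" using L D by (simp add: power_mult_distrib)
    finally have "L\<^sup>2 * (cmod (f x))\<^sup>2 \<le> L\<^sup>2 * (2 / L\<^sup>2 * (cmod (integral {a..b} f))\<^sup>2 + 2 * (L * D))"
      using L by (simp add: distrib_left)
    then show ?thesis using L by (simp add: mult_le_cancel_left)
  qed
  have "integral {a..b} (\<lambda>t. (cmod (f t))\<^sup>2) \<le> integral {a..b} (\<lambda>_. 2 / L\<^sup>2 * (cmod (integral {a..b} f))\<^sup>2 + 2 * (L * D))"
    by (rule integral_mono_cont[OF _ _ pt]) (intro continuous_intros c)+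
  also have "\<dots> = 2 / L * (cmod (integral {a..b} f))\<^sup>2 + 2 * L\<^sup>2 * D"
    using L ab by (simp add: L_def[symmetric] field_simps power2_eq_square)
  finally show ?thesis by (simp add: L_def D_def)
qed

lemma integral_split_uniform:
  fixes f :: "real \<Rightarrow> 'b::banach"
  assumes h: "h \<ge> 0" and c: "continuous_on {a..a + real n * h} f"
  shows "integral {a..a + real n * h} f = (\<Sum>i<n. integral {a + real i * h..a + real (Suc i) * h} f)"
  using c
proof (induction n)
  case (Suc n)
  have le: "a + real n * h \<le> a + real (Suc n) * h" using h by (simp add: algebra_simps)
  have "integral {a..a + real (Suc n) * h} f =
      integral {a..a + real n * h} f + integral {a + real n * h..a + real (Suc n) * h} f"
    by (rule Henstock_Kurzweil_Integration.integral_combine[symmetric])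
      (use Suc.prems h le in \<open>auto intro!: integrable_continuous_real\<close>)
  also have "integral {a..a + real n * h} f = (\<Sum>i<n. integral {a + real i * h..a + real (Suc i) * h} f)"
    by (rule Suc.IH[OF continuous_on_subset[OF Suc.prems]]) (use le in auto)
  finally show ?case by simp
qed simp

text \<open>Refining the partition makes the factor of the derivative as small as desired, at the
  price of more averages with a larger factor.\<close>

lemma poincare_1d_split:
  fixes f f' :: "real \<Rightarrow> complex"
  assumes ab: "a < b" and n: "n > 0" and h: "h = (b - a) / real n"
    and d: "\<And>t. t \<in> {a..b} \<Longrightarrow> (f has_vector_derivative f' t) (at t within {a..b})"
    and c': "continuous_on {a..b} f'"
  shows "integral {a..b} (\<lambda>t. (cmod (f t))\<^sup>2)
    \<le> (\<Sum>i<n. 2 / h * (cmod (integral {a + real i * h..a + real (Suc i) * h} f))\<^sup>2)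
      + 2 * h\<^sup>2 * integral {a..b} (\<lambda>t. (cmod (f' t))\<^sup>2)"
proof -
  have c: "continuous_on {a..b} f" using d by (rule continuous_on_vector_derivative)
  have hp: "h > 0" using ab n h by simp
  have b: "b = a + real n * h" using n h by simp
  define J where "J i = {a + real i * h..a + real (Suc i) * h}" for i
  have sub: "J i \<subseteq> {a..b}" if "i < n" for i
  proof -
    have "real (Suc i) * h \<le> real n * h" using that hp by (intro mult_right_mono) auto
    moreover have "0 \<le> real i * h" using hp by simp
    ultimately show ?thesis by (auto simp: J_def b)
  qed
  have "integral {a..b} (\<lambda>t. (cmod (f t))\<^sup>2) = (\<Sum>i<n. integral (J i) (\<lambda>t. (cmod (f t))\<^sup>2))"
    unfolding b J_def by (rule integral_split_uniform) (use hp c b in \<open>auto intro!: continuous_intros\<close>)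
  also have "\<dots> \<le> (\<Sum>i<n. 2 / h * (cmod (integral (J i) f))\<^sup>2 + 2 * h\<^sup>2 * integral (J i) (\<lambda>t. (cmod (f' t))\<^sup>2))"
  proof (rule sum_mono)
    fix i assume "i \<in> {..<n}"
    then have i: "i < n" by simp
    have "integral (J i) (\<lambda>t. (cmod (f t))\<^sup>2) \<le> 2 / (a + real (Suc i) * h - (a + real i * h)) * (cmod (integral (J i) f))\<^sup>2
        + 2 * (a + real (Suc i) * h - (a + real i * h))\<^sup>2 * integral (J i) (\<lambda>t. (cmod (f' t))\<^sup>2)"
      unfolding J_def
    proof (rule poincare_1d)
      show "continuous_on {a + real i * h..a + real (Suc i) * h} f'"
        using c' sub[OF i] unfolding J_def by (rule continuous_on_subset)
      fix t assume "t \<in> {a + real i * h..a + real (Suc i) * h}"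
      then show "(f has_vector_derivative f' t) (at t within {a + real i * h..a + real (Suc i) * h})"
        using d sub[OF i] has_vector_derivative_within_subset unfolding J_def by blast
    qed (use hp in \<open>simp add: algebra_simps\<close>)
    then show "integral (J i) (\<lambda>t. (cmod (f t))\<^sup>2) \<le> 2 / h * (cmod (integral (J i) f))\<^sup>2 + 2 * h\<^sup>2 * integral (J i) (\<lambda>t. (cmod (f' t))\<^sup>2)"
      by (simp add: algebra_simps)
  qed
  also have "\<dots> = (\<Sum>i<n. 2 / h * (cmod (integral (J i) f))\<^sup>2) + 2 * h\<^sup>2 * (\<Sum>i<n. integral (J i) (\<lambda>t. (cmod (f' t))\<^sup>2))"
    by (simp add: sum.distrib sum_distrib_left)
  also have "(\<Sum>i<n. integral (J i) (\<lambda>t. (cmod (f' t))\<^sup>2)) = integral {a..b} (\<lambda>t. (cmod (f' t))\<^sup>2)"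
    unfolding b J_def by (rule integral_split_uniform[symmetric]) (use hp c' b in \<open>auto intro!: continuous_intros\<close>)
  finally show ?thesis by (simp add: J_def)
qed

section \<open>Continuously differentiable functions on rectangles\<close>

definition C1_fun :: "(pt \<Rightarrow> complex) \<Rightarrow> (pt \<Rightarrow> complex) \<Rightarrow> (pt \<Rightarrow> complex) \<Rightarrow> bool" where
  "C1_fun F p1 p2 \<longleftrightarrow> (\<forall>x. (F has_derivative (\<lambda>h. fst h *\<^sub>R p1 x + snd h *\<^sub>R p2 x)) (at x))
     \<and> continuous_on UNIV p1 \<and> continuous_on UNIV p2"

lemma C1_fun_cont:
  assumes "C1_fun F p1 p2"
  shows "continuous_on UNIV F" "continuous_on UNIV p1" "continuous_on UNIV p2"
proof -
  show "continuous_on UNIV F"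
    using assms unfolding C1_fun_def by (meson continuous_at_imp_continuous_on has_derivative_continuous)
qed (use assms in \<open>auto simp: C1_fun_def\<close>)

lemma C1_fun_d1:
  assumes "C1_fun F p1 p2"
  shows "((\<lambda>t. F (t, y)) has_vector_derivative p1 (t, y)) (at t within S)"
proof -
  have F: "(F has_derivative (\<lambda>h. fst h *\<^sub>R p1 (t, y) + snd h *\<^sub>R p2 (t, y))) (at (t, y))"
    using assms by (simp add: C1_fun_def)
  have e: "((\<lambda>t. (t, y)) has_derivative (\<lambda>h. (h, 0))) (at t within S)"
    by (auto intro!: derivative_eq_intros)
  from has_derivative_compose[OF e F] show ?thesis by (simp add: has_vector_derivative_def)
qed

lemma C1_fun_d2:
  assumes "C1_fun F p1 p2"
  shows "((\<lambda>t. F (x, t)) has_vector_derivative p2 (x, t)) (at t within S)"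
proof -
  have F: "(F has_derivative (\<lambda>h. fst h *\<^sub>R p1 (x, t) + snd h *\<^sub>R p2 (x, t))) (at (x, t))"
    using assms by (simp add: C1_fun_def)
  have e: "((\<lambda>t. (x, t)) has_derivative (\<lambda>h. (0, h))) (at t within S)"
    by (auto intro!: derivative_eq_intros)
  from has_derivative_compose[OF e F] show ?thesis by (simp add: has_vector_derivative_def)
qed

lemma cont_slice:
  fixes g :: "real \<times> real \<Rightarrow> 'b::topological_space"
  assumes "continuous_on UNIV g"
  shows "continuous_on S (\<lambda>x. g (x, y))" "continuous_on S (\<lambda>y. g (x, y))"
  by (rule continuous_on_compose2[OF assms], intro continuous_intros, simp)+

lemma cont_inner_integral:
  fixes g :: "real \<times> real \<Rightarrow> 'b::banach"
  assumes "continuous_on UNIV g"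
  shows "continuous_on S (\<lambda>y. integral {a..b} (\<lambda>x. g (x, y)))"
proof -
  have "continuous_on (S \<times> cbox a b) (\<lambda>(y, x). g (x, y))"
    unfolding split_beta by (rule continuous_on_compose2[OF assms]) (intro continuous_intros, simp)
  then show ?thesis using integral_continuous_on_param[of S a b "\<lambda>y x. g (x, y)"] by simp
qed

lemma box_integral:
  fixes g :: "real \<times> real \<Rightarrow> 'b::banach"
  assumes "continuous_on UNIV g"
  shows "integral (cbox (a, c) (b, d)) g = integral {c..d} (\<lambda>y. integral {a..b} (\<lambda>x. g (x, y)))"
proof -
  have c: "continuous_on (cbox (a, c) (b, d)) g" using assms continuous_on_subset by blast
  have "integral (cbox (a, c) (b, d)) g = integral (cbox a b) (\<lambda>x. integral (cbox c d) (\<lambda>y. g (x, y)))"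
    by (rule integral_prod_continuous[OF c])
  also have "\<dots> = integral (cbox c d) (\<lambda>y. integral (cbox a b) (\<lambda>x. g (x, y)))"
    by (rule integral_swap_continuous) (use c in simp)
  finally show ?thesis by simp
qed

text \<open>Differentiation under the integral sign. The weight \<open>w\<close> is 1 for the
  averages over strips and the conjugate of \<open>phi m\<close> for Fourier coefficients.\<close>

lemma inner_integral_derivative:
  assumes F: "C1_fun F p1 p2" and w: "continuous_on {a..b} w" and y: "y \<in> {c..d}"
  shows "((\<lambda>y. integral {a..b} (\<lambda>x. F (x, y) * w x)) has_vector_derivative integral {a..b} (\<lambda>x. p2 (x, y) * w x)) (at y within {c..d})"
proof -
  have "((\<lambda>y. integral (cbox a b) (\<lambda>x. F (x, y) * w x)) has_vector_derivative integral (cbox a b) (\<lambda>x. p2 (x, y) * w x)) (at y within {c..d})"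
  proof (rule leibniz_rule_vector_derivative[where U = "{c..d}" and f = "\<lambda>y x. F (x, y) * w x" and fx = "\<lambda>y x. p2 (x, y) * w x"])
    fix y x assume "y \<in> {c..d}" "x \<in> cbox a b"
    show "((\<lambda>y. F (x, y) * w x) has_vector_derivative p2 (x, y) * w x) (at y within {c..d})"
      by (rule has_vector_derivative_mult_left[OF C1_fun_d2[OF F]])
  next
    fix y show "(\<lambda>x. F (x, y) * w x) integrable_on cbox a b"
      using cont_slice(1)[OF C1_fun_cont(1)[OF F]] w
      by (intro integrable_continuous continuous_intros) auto
  next
    show "continuous_on ({c..d} \<times> cbox a b) (\<lambda>(y, x). p2 (x, y) * w x)"
      unfolding split_beta
      by (intro continuous_intros continuous_on_compose2[OF C1_fun_cont(3)[OF F]] continuous_on_compose2[OF w]) auto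
  qed (use y in auto)
  then show ?thesis by simp
qed

lemma C1_fun_norm_cont:
  assumes "C1_fun F p1 p2"
  shows "continuous_on UNIV (\<lambda>x. (cmod (F x))\<^sup>2)" "continuous_on UNIV (\<lambda>x. (cmod (p1 x))\<^sup>2)" "continuous_on UNIV (\<lambda>x. (cmod (p2 x))\<^sup>2)"
  using C1_fun_cont[OF assms] by (auto intro!: continuous_intros)

text \<open>Poincare on each cell of an \<open>n \<times> n\<close> partition, first in \<open>x\<^sub>1\<close> on horizontal
  lines, then in \<open>x\<^sub>2\<close> for the averages over the strips.\<close>

lemma poincare_cells:
  assumes F: "C1_fun F p1 p2" and ab: "a < b" and cd: "c < d" and n: "n > 0"
    and h1: "h1 = (b - a) / real n" and h2: "h2 = (d - c) / real n"
  shows "integral (cbox (a, c) (b, d)) (\<lambda>x. (cmod (F x))\<^sup>2) \<le>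
     4 / (h1 * h2) * (\<Sum>i<n. \<Sum>j<n. (cmod (integral (cbox (a + real i * h1, c + real j * h2) (a + real (Suc i) * h1, c + real (Suc j) * h2)) F))\<^sup>2)
     + 2 * h1\<^sup>2 * integral (cbox (a, c) (b, d)) (\<lambda>x. (cmod (p1 x))\<^sup>2)
     + 4 * h2\<^sup>2 * integral (cbox (a, c) (b, d)) (\<lambda>x. (cmod (p2 x))\<^sup>2)"
proof -
  note cF = C1_fun_cont[OF F] and nF = C1_fun_norm_cont[OF F]
  define J where "J i = {a + real i * h1..a + real (Suc i) * h1}" for i
  define g where "g i y = integral (J i) (\<lambda>x. F (x, y))" for i y
  define g' where "g' i y = integral (J i) (\<lambda>x. p2 (x, y))" for i y
  have hp: "h1 > 0" "h2 > 0" using ab cd n h1 h2 by auto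
  have b: "b = a + real n * h1" using n h1 by simp
  have gc: "continuous_on S (g i)" "continuous_on S (g' i)" for i S
    unfolding g_def[abs_def] g'_def[abs_def] J_def using cF by (auto intro: cont_inner_integral)
  have gd: "(g i has_vector_derivative g' i y) (at y within {c..d})" if "y \<in> {c..d}" for i y
    using inner_integral_derivative[OF F continuous_on_const[of _ 1] that, of "a + real i * h1" "a + real (Suc i) * h1"]
    unfolding g_def[abs_def] g'_def[abs_def] J_def by simp
  have line: "integral {a..b} (\<lambda>x. (cmod (F (x, y)))\<^sup>2) \<le> (\<Sum>i<n. 2 / h1 * (cmod (g i y))\<^sup>2)
      + 2 * h1\<^sup>2 * integral {a..b} (\<lambda>x. (cmod (p1 (x, y)))\<^sup>2)" for y
    unfolding g_def J_def
    by (rule poincare_1d_split[OF ab n h1 C1_fun_d1[OF F]]) (rule cont_slice(1)[OF cF(2)])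
  have strip: "integral {c..d} (\<lambda>y. (cmod (g i y))\<^sup>2) \<le> (\<Sum>j<n. 2 / h2 * (cmod (integral {c + real j * h2..c + real (Suc j) * h2} (g i)))\<^sup>2)
      + 2 * h2\<^sup>2 * integral {c..d} (\<lambda>y. (cmod (g' i y))\<^sup>2)" for i
    by (rule poincare_1d_split[OF cd n h2 gd gc(2)])
  have cell: "integral {c + real j * h2..c + real (Suc j) * h2} (g i) =
      integral (cbox (a + real i * h1, c + real j * h2) (a + real (Suc i) * h1, c + real (Suc j) * h2)) F" for i j
    unfolding g_def[abs_def] J_def by (rule box_integral[OF cF(1), symmetric])
  \<comment> \<open>Cauchy-Schwarz on a strip of width \<open>h1\<close> gains a factor
    \<open>h1\<close>, which cancels the 1 / \<open>h1\<close> that the estimate on horizontal lines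
    puts in front of the strip averages.\<close>
  have g'b: "(\<Sum>i<n. integral {c..d} (\<lambda>y. (cmod (g' i y))\<^sup>2)) \<le> h1 * integral (cbox (a, c) (b, d)) (\<lambda>x. (cmod (p2 x))\<^sup>2)"
  proof -
    have "(\<Sum>i<n. integral {c..d} (\<lambda>y. (cmod (g' i y))\<^sup>2)) = integral {c..d} (\<lambda>y. \<Sum>i<n. (cmod (g' i y))\<^sup>2)"
      by (rule Henstock_Kurzweil_Integration.integral_sum[symmetric])
        (auto intro!: integrable_continuous_real continuous_intros gc)
    also have "\<dots> \<le> integral {c..d} (\<lambda>y. h1 * integral {a..b} (\<lambda>x. (cmod (p2 (x, y)))\<^sup>2))"
    proof (rule integral_mono_cont)
      fix y
      have "(\<Sum>i<n. (cmod (g' i y))\<^sup>2) \<le> (\<Sum>i<n. h1 * integral (J i) (\<lambda>x. (cmod (p2 (x, y)))\<^sup>2))"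
      proof (rule sum_mono)
        fix i
        have "(cmod (g' i y))\<^sup>2 \<le> (a + real (Suc i) * h1 - (a + real i * h1)) * integral (J i) (\<lambda>x. (cmod (p2 (x, y)))\<^sup>2)"
          unfolding g'_def J_def
          by (rule integral_cauchy_schwarz_one[OF cont_slice(1)[OF cF(3)]]) (use hp in \<open>simp add: algebra_simps\<close>)
        then show "(cmod (g' i y))\<^sup>2 \<le> h1 * integral (J i) (\<lambda>x. (cmod (p2 (x, y)))\<^sup>2)" by (simp add: algebra_simps)
      qed
      also have "\<dots> = h1 * integral {a..b} (\<lambda>x. (cmod (p2 (x, y)))\<^sup>2)"
        unfolding sum_distrib_left[symmetric] b J_def
        by (subst integral_split_uniform) (use hp cont_slice(1)[OF nF(3)] in auto)
      finally show "(\<Sum>i<n. (cmod (g' i y))\<^sup>2) \<le> h1 * integral {a..b} (\<lambda>x. (cmod (p2 (x, y)))\<^sup>2)" .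
    qed (intro continuous_intros gc cont_inner_integral[OF nF(3)])+
    also have "\<dots> = h1 * integral (cbox (a, c) (b, d)) (\<lambda>x. (cmod (p2 x))\<^sup>2)"
      by (simp add: box_integral[OF nF(3)])
    finally show ?thesis .
  qed
  have "integral (cbox (a, c) (b, d)) (\<lambda>x. (cmod (F x))\<^sup>2) = integral {c..d} (\<lambda>y. integral {a..b} (\<lambda>x. (cmod (F (x, y)))\<^sup>2))"
    by (rule box_integral[OF nF(1)])
  also have "\<dots> \<le> integral {c..d} (\<lambda>y. (\<Sum>i<n. 2 / h1 * (cmod (g i y))\<^sup>2) + 2 * h1\<^sup>2 * integral {a..b} (\<lambda>x. (cmod (p1 (x, y)))\<^sup>2))"
    by (rule integral_mono_cont) (use line hp in \<open>auto intro!: continuous_intros gc cont_inner_integral[OF nF(1)] cont_inner_integral[OF nF(2)]\<close>)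
  also have "\<dots> = (\<Sum>i<n. 2 / h1 * integral {c..d} (\<lambda>y. (cmod (g i y))\<^sup>2)) + 2 * h1\<^sup>2 * integral (cbox (a, c) (b, d)) (\<lambda>x. (cmod (p1 x))\<^sup>2)"
    by (subst Henstock_Kurzweil_Integration.integral_add, (intro integrable_continuous_real continuous_intros gc cont_inner_integral[OF nF(2)])+,
        subst Henstock_Kurzweil_Integration.integral_sum, simp, (intro integrable_continuous_real continuous_intros gc)+)
      (simp add: box_integral[OF nF(2)])
  also have "(\<Sum>i<n. 2 / h1 * integral {c..d} (\<lambda>y. (cmod (g i y))\<^sup>2)) \<le>
      (\<Sum>i<n. 2 / h1 * ((\<Sum>j<n. 2 / h2 * (cmod (integral {c + real j * h2..c + real (Suc j) * h2} (g i)))\<^sup>2)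
      + 2 * h2\<^sup>2 * integral {c..d} (\<lambda>y. (cmod (g' i y))\<^sup>2)))"
    by (intro sum_mono mult_left_mono strip) (use hp in simp)
  also have "\<dots> = 4 / (h1 * h2) * (\<Sum>i<n. \<Sum>j<n. (cmod (integral {c + real j * h2..c + real (Suc j) * h2} (g i)))\<^sup>2)
      + 4 * h2\<^sup>2 / h1 * (\<Sum>i<n. integral {c..d} (\<lambda>y. (cmod (g' i y))\<^sup>2))"
    by (simp add: distrib_left sum.distrib sum_distrib_left mult_ac)
  also have "4 * h2\<^sup>2 / h1 * (\<Sum>i<n. integral {c..d} (\<lambda>y. (cmod (g' i y))\<^sup>2)) \<le> 4 * h2\<^sup>2 / h1 * (h1 * integral (cbox (a, c) (b, d)) (\<lambda>x. (cmod (p2 x))\<^sup>2))"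
    by (intro mult_left_mono g'b) (use hp in simp)
  also have "\<dots> = 4 * h2\<^sup>2 * integral (cbox (a, c) (b, d)) (\<lambda>x. (cmod (p2 x))\<^sup>2)" using hp by simp
  finally show ?thesis unfolding cell by simp
qed

section \<open>Fourier coefficients on horizontal lines\<close>

lemma phi_cont [continuous_intros]: "continuous_on S (phi m)"
  unfolding phi_def[abs_def] by (auto intro!: continuous_intros)

lemma phi_mult: "phi m x * cnj (phi n x) = exp (\<i> * of_int (m - n) * of_real x) / of_real (2 * pi)"
proof -
  have "phi m x * cnj (phi n x) = exp (\<i> * of_int m * of_real x) * exp (- (\<i> * of_int n * of_real x)) / of_real (sqrt (2 * pi) * sqrt (2 * pi))"
    unfolding phi_def of_real_mult by (simp add: exp_cnj)
  then show ?thesis by (simp add: exp_add[symmetric] algebra_simps)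
qed

lemma integral_phi_mult:
  "integral {-pi..pi} (\<lambda>x. phi m x * cnj (phi n x)) = (if m = n then 1 else 0)"
proof (cases "m = n")
  case True
  then show ?thesis by (simp add: phi_mult scaleR_conv_of_real)
next
  case False
  define k :: complex where "k = \<i> * of_int (m - n)"
  have k: "k \<noteq> 0" using False by (simp add: k_def)
  have hi: "((\<lambda>x. exp (k * of_real x) / of_real (2 * pi)) has_integral
      (exp (k * of_real pi) / k / of_real (2 * pi) - exp (k * of_real (-pi)) / k / of_real (2 * pi))) {-pi..pi}"
  proof (rule fundamental_theorem_of_calculus)
    fix x :: real
    have "((\<lambda>z. exp (k * z) / k / of_real (2 * pi)) has_field_derivative exp (k * of_real x) / of_real (2 * pi)) (at (of_real x))"
      using k by (auto intro!: derivative_eq_intros)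
    from has_vector_derivative_real_field[OF this]
    show "((\<lambda>x. exp (k * of_real x) / k / of_real (2 * pi)) has_vector_derivative exp (k * of_real x) / of_real (2 * pi)) (at x within {-pi..pi})"
      by (rule has_vector_derivative_at_within)
  qed simp
  \<comment> \<open>The two exponents differ by 2 pi i (m - n).\<close>
  have e: "exp (k * of_real pi) = exp (k * of_real (-pi))"
    unfolding exp_eq k_def by (intro exI[of _ "m - n"]) (simp add: algebra_simps)
  show ?thesis using integral_unique[OF hi] False unfolding e diff_self by (simp only: phi_mult k_def if_False)
qed

text \<open>The difference between f and its orthogonal projection \<open>v\<close> onto the span of
  the \<open>phi m\<close> with m in K has a nonnegative square; expanding that square gives the
  inequality.\<close>

lemma bessel_phi:
  assumes f: "continuous_on {-pi..pi} f" and K: "finite K"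
  shows "(\<Sum>m\<in>K. (cmod (integral {-pi..pi} (\<lambda>x. f x * cnj (phi m x))))\<^sup>2) \<le> integral {-pi..pi} (\<lambda>x. (cmod (f x))\<^sup>2)"
proof -
  let ?V = "{f :: real \<Rightarrow> complex. continuous_on (cbox (-pi) pi) f}"
  let ?B = "cip (-pi) pi"
  define c where "c m = ?B f (phi m)" for m
  define v where "v x = (\<Sum>m\<in>K. c m * phi m x)" for x
  have fV: "f \<in> ?V" using f by simp
  have pV: "phi m \<in> ?V" for m by (simp add: phi_cont)
  have vV: "v \<in> ?V" unfolding v_def[abs_def] using K by (auto intro!: continuous_intros)
  have vp: "?B v (phi n) = c n" if "n \<in> K" for n
  proof -
    have "?B v (phi n) = (\<Sum>m\<in>K. c m * ?B (phi m) (phi n))"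
      unfolding v_def[abs_def] by (rule lin_on_sum[OF fun_space_continuous herm_on_lin[OF herm_on_cip pV] K pV])
    also have "\<dots> = (\<Sum>m\<in>K. if m = n then c m else 0)"
      by (rule sum.cong) (auto simp: cip_def integral_phi_mult)
    finally show ?thesis using that K by simp
  qed
  have Bv: "?B u v = (\<Sum>m\<in>K. cnj (c m) * ?B u (phi m))" if "u \<in> ?V" for u
  proof -
    have "?B v u = (\<Sum>m\<in>K. c m * ?B (phi m) u)"
      unfolding v_def[abs_def] by (rule lin_on_sum[OF fun_space_continuous herm_on_lin[OF herm_on_cip that] K pV])
    then have "cnj (?B v u) = (\<Sum>m\<in>K. cnj (c m) * cnj (?B (phi m) u))" by simp
    then show ?thesis
      unfolding herm_on_sym[OF herm_on_cip vV that] using herm_on_sym[OF herm_on_cip pV that] by simp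
  qed
  have s: "Re (\<Sum>m\<in>K. cnj (c m) * c m) = (\<Sum>m\<in>K. (cmod (c m))\<^sup>2)"
    unfolding Re_sum cmod_power2 by (simp add: power2_eq_square)
  have "0 \<le> Re (?B (\<lambda>x. f x + (-1) * v x) (\<lambda>x. f x + (-1) * v x))"
    by (rule cip_pos) (use fV vV in \<open>auto intro!: continuous_intros\<close>)
  also have "\<dots> = Re (?B f f) + 2 * Re (cnj (-1) * ?B f v) + (cmod (-1))\<^sup>2 * Re (?B v v)"
    by (rule herm_on_combine[OF herm_on_cip fun_space_continuous fV vV])
  also have "?B f v = (\<Sum>m\<in>K. cnj (c m) * c m)" unfolding Bv[OF fV] c_def ..
  also have "?B v v = (\<Sum>m\<in>K. cnj (c m) * c m)" unfolding Bv[OF vV] using vp by simp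
  finally have "(\<Sum>m\<in>K. (cmod (c m))\<^sup>2) \<le> Re (?B f f)" using s by simp
  then show ?thesis using f by (simp add: c_def cip_def[of _ _ f "phi _"] cip_self)
qed

lemma phi_derivative: "((\<lambda>x. cnj (phi m x)) has_vector_derivative - (\<i> * of_int m) * cnj (phi m x)) (at x within S)"
proof -
  have e: "cnj (phi m x) = exp (- \<i> * of_int m * of_real x) / of_real (sqrt (2 * pi))" for x
    by (simp add: phi_def exp_cnj)
  have "((\<lambda>z. exp (- \<i> * of_int m * z) / of_real (sqrt (2 * pi))) has_field_derivative
      - (\<i> * of_int m) * (exp (- \<i> * of_int m * of_real x) / of_real (sqrt (2 * pi)))) (at (of_real x))"
    by (auto intro!: derivative_eq_intros)
  from has_vector_derivative_real_field[OF this] show ?thesis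
    unfolding e by (rule has_vector_derivative_at_within)
qed

lemma phi_periodic: "phi m (-pi) = phi m pi"
proof -
  have "exp (\<i> * of_int m * of_real (-pi)) = exp (\<i> * of_int m * of_real pi)"
    unfolding exp_eq by (intro exI[of _ "-m"]) (simp add: algebra_simps)
  then show ?thesis by (simp add: phi_def)
qed

lemma per_x1_edges: "per_x1 f \<Longrightarrow> f (pi, y) = f (-pi, y)"
  unfolding per_x1_def by (metis add.commute add_diff_cancel_left' diff_minus_eq_add mult_2 uminus_add_conv_diff)

lemma parts_1d:
  fixes f f' g g' :: "real \<Rightarrow> complex"
  assumes ab: "a \<le> b"
    and d: "\<And>x. (f has_vector_derivative f' x) (at x within {a..b})"
      "\<And>x. (g has_vector_derivative g' x) (at x within {a..b})"
    and c: "continuous_on {a..b} f'" "continuous_on {a..b} g'"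
  shows "integral {a..b} (\<lambda>x. f' x * g x) = f b * g b - f a * g a - integral {a..b} (\<lambda>x. f x * g' x)"
proof -
  have cf: "continuous_on {a..b} f" "continuous_on {a..b} g"
    using d by (auto intro: continuous_on_vector_derivative)
  have "((\<lambda>x. f x * g' x + f' x * g x) has_integral f b * g b - f a * g a) {a..b}"
    by (rule fundamental_theorem_of_calculus[OF ab, of "\<lambda>x. f x * g x"]) (rule has_vector_derivative_mult[OF d])
  then have "integral {a..b} (\<lambda>x. f x * g' x + f' x * g x) = f b * g b - f a * g a" by (rule integral_unique)
  moreover have "integral {a..b} (\<lambda>x. f x * g' x + f' x * g x) = integral {a..b} (\<lambda>x. f x * g' x) + integral {a..b} (\<lambda>x. f' x * g x)"
    by (rule Henstock_Kurzweil_Integration.integral_add) (intro integrable_continuous_real continuous_intros cf c)+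
  ultimately show ?thesis by (simp add: algebra_simps)
qed

text \<open>Integration by parts, where periodicity removes the boundary terms. Together with
  Bessel's inequality for \<open>p1\<close> it controls m^2 times the squared coefficients of
  F.\<close>

lemma fourier_derivative:
  assumes F: "C1_fun F p1 p2" and per: "per_x1 F"
  shows "integral {-pi..pi} (\<lambda>x. p1 (x, y) * cnj (phi m x)) = \<i> * of_int m * integral {-pi..pi} (\<lambda>x. F (x, y) * cnj (phi m x))"
proof -
  have "integral {-pi..pi} (\<lambda>x. p1 (x, y) * cnj (phi m x)) =
     F (pi, y) * cnj (phi m pi) - F (-pi, y) * cnj (phi m (-pi)) - integral {-pi..pi} (\<lambda>x. F (x, y) * (- (\<i> * of_int m) * cnj (phi m x)))"
    by (rule parts_1d[OF _ C1_fun_d1[OF F] phi_derivative])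
      (auto intro!: continuous_intros cont_slice C1_fun_cont[OF F])
  also have "\<dots> = - integral {-pi..pi} (\<lambda>x. (- (\<i> * of_int m)) * (F (x, y) * cnj (phi m x)))"
    using per_x1_edges[OF per] phi_periodic by (simp add: mult_ac)
  also have "\<dots> = \<i> * of_int m * integral {-pi..pi} (\<lambda>x. F (x, y) * cnj (phi m x))"
    by (subst integral_mult_right) simp
  finally show ?thesis .
qed

text \<open>Applying the one-dimensional trace inequality with \<open>\<theta> = 1 + |m|\<close> to the \<open>m\<close>-th Fourier
  coefficient gives the \<open>H\<^sup>1\<^sup>/\<^sup>2\<close> weight.\<close>

lemma fourier_trace_bound:
  assumes F: "C1_fun F p1 p2" and per: "per_x1 F" and d: "d > 0" and K: "finite K" and e: "e \<in> {-d..d}"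
  shows "(\<Sum>m\<in>K. (1 + \<bar>real_of_int m\<bar>) * (cmod (integral {-pi..pi} (\<lambda>x. F (x, e) * cnj (phi m x))))\<^sup>2)
    \<le> (2 + 1 / d) * (integral (cbox (-pi, -d) (pi, d)) (\<lambda>x. (cmod (F x))\<^sup>2)
        + integral (cbox (-pi, -d) (pi, d)) (\<lambda>x. (cmod (p1 x))\<^sup>2)
        + integral (cbox (-pi, -d) (pi, d)) (\<lambda>x. (cmod (p2 x))\<^sup>2))"
proof -
  note cF = C1_fun_cont[OF F] and nF = C1_fun_norm_cont[OF F]
  define co where "co G m y = integral {-pi..pi} (\<lambda>x. G (x, y) * cnj (phi m x))" for G :: "pt \<Rightarrow> complex" and m y
  have coc: "continuous_on S (co G m)" if "continuous_on UNIV G" for G m S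
    unfolding co_def[abs_def]
    by (rule cont_inner_integral[where g = "\<lambda>z. G z * cnj (phi m (fst z))", simplified])
      (intro continuous_intros that continuous_on_compose2[OF phi_cont[of UNIV m]], simp)
  have cod: "(co F m has_vector_derivative co p2 m y) (at y within {-d..d})" if "y \<in> {-d..d}" for m y
    unfolding co_def[abs_def] by (rule inner_integral_derivative[OF F _ that]) (intro continuous_intros)
  have bes: "(\<Sum>m\<in>K. integral {-d..d} (\<lambda>y. (cmod (co G m y))\<^sup>2)) \<le> integral (cbox (-pi, -d) (pi, d)) (\<lambda>x. (cmod (G x))\<^sup>2)"
    if G: "continuous_on UNIV G" for G
  proof -
    have nG: "continuous_on UNIV (\<lambda>x. (cmod (G x))\<^sup>2)" by (intro continuous_intros G)
    have "(\<Sum>m\<in>K. integral {-d..d} (\<lambda>y. (cmod (co G m y))\<^sup>2)) = integral {-d..d} (\<lambda>y. \<Sum>m\<in>K. (cmod (co G m y))\<^sup>2)"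
      by (rule Henstock_Kurzweil_Integration.integral_sum[OF K, symmetric]) (intro integrable_continuous_real continuous_intros coc G)
    also have "\<dots> \<le> integral {-d..d} (\<lambda>y. integral {-pi..pi} (\<lambda>x. (cmod (G (x, y)))\<^sup>2))"
    proof (rule integral_mono_cont)
      fix y show "(\<Sum>m\<in>K. (cmod (co G m y))\<^sup>2) \<le> integral {-pi..pi} (\<lambda>x. (cmod (G (x, y)))\<^sup>2)"
        unfolding co_def by (rule bessel_phi[OF cont_slice(1)[OF G] K])
    qed (intro continuous_intros coc G cont_inner_integral[OF nG])+
    finally show ?thesis by (simp add: box_integral[OF nG])
  qed
  have one: "(1 + \<bar>real_of_int m\<bar>) * (cmod (co F m e))\<^sup>2 \<le>
      (2 + 1 / d) * (integral {-d..d} (\<lambda>y. (cmod (co F m y))\<^sup>2) + integral {-d..d} (\<lambda>y. (cmod (co p1 m y))\<^sup>2))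
       + integral {-d..d} (\<lambda>y. (cmod (co p2 m y))\<^sup>2)" for m
  proof -
    define t where "t = 1 + \<bar>real_of_int m\<bar>"
    define A where "A = integral {-d..d} (\<lambda>y. (cmod (co F m y))\<^sup>2)"
    have t: "t \<ge> 1" by (simp add: t_def)
    have A: "A \<ge> 0" unfolding A_def by (intro integral_nonneg integrable_continuous_real continuous_intros coc cF) auto
    \<comment> \<open>Multiplication by t turns the factor t of the trace inequality into t^2; this
      is paid by the horizontal derivative, whose coefficients carry the factor m.\<close>
    have p1: "integral {-d..d} (\<lambda>y. (cmod (co p1 m y))\<^sup>2) = (real_of_int m)\<^sup>2 * A"
      unfolding A_def co_def fourier_derivative[OF F per] by (simp add: norm_mult power_mult_distrib)
    have "(cmod (co F m e))\<^sup>2 \<le> (1 / (d - - d) + t) * A + 1 / t * integral {-d..d} (\<lambda>y. (cmod (co p2 m y))\<^sup>2)"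
      unfolding A_def by (rule trace_inequality_1d[OF _ _ e cod coc[OF cF(3)]]) (use d t in auto)
    then have "t * (cmod (co F m e))\<^sup>2 \<le> t * ((1 / (d - - d) + t) * A + 1 / t * integral {-d..d} (\<lambda>y. (cmod (co p2 m y))\<^sup>2))"
      using t by (intro mult_left_mono) auto
    also have "\<dots> = (t / (2 * d) + t\<^sup>2) * A + integral {-d..d} (\<lambda>y. (cmod (co p2 m y))\<^sup>2)"
      using t by (simp add: algebra_simps power2_eq_square)
    also have "(t / (2 * d) + t\<^sup>2) * A \<le> ((2 + 1 / d) * (1 + (real_of_int m)\<^sup>2)) * A"
    proof (rule mult_right_mono[OF _ A])
      have q: "2 * \<bar>real_of_int m\<bar> \<le> 1 + (real_of_int m)\<^sup>2" "0 \<le> (real_of_int m)\<^sup>2"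
        using two_mult_le_squares[of 1 "\<bar>real_of_int m\<bar>"] by simp_all
      have "1 + r \<le> 2 * (1 + s)" if "2 * r \<le> 1 + s" "0 \<le> s" for r s :: real using that by simp
      from this[OF q] have "t \<le> 2 * (1 + (real_of_int m)\<^sup>2)" by (simp only: t_def)
      then have "t / (2 * d) \<le> 1 / d * (1 + (real_of_int m)\<^sup>2)" using d by (simp add: field_simps)
      moreover have "t\<^sup>2 = 1 + 2 * \<bar>real_of_int m\<bar> + (real_of_int m)\<^sup>2" by (simp add: t_def power2_sum)
      then have "t\<^sup>2 \<le> 2 * (1 + (real_of_int m)\<^sup>2)" using q(1) by simp
      ultimately show "t / (2 * d) + t\<^sup>2 \<le> (2 + 1 / d) * (1 + (real_of_int m)\<^sup>2)" by (simp add: distrib_right)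
    qed
    finally show ?thesis unfolding p1 by (simp add: t_def A_def[symmetric] algebra_simps)
  qed
  have c1: "1 \<le> 2 + 1 / d" using d by simp
  have "(\<Sum>m\<in>K. (1 + \<bar>real_of_int m\<bar>) * (cmod (co F m e))\<^sup>2) \<le>
      (\<Sum>m\<in>K. (2 + 1 / d) * (integral {-d..d} (\<lambda>y. (cmod (co F m y))\<^sup>2) + integral {-d..d} (\<lambda>y. (cmod (co p1 m y))\<^sup>2))
       + integral {-d..d} (\<lambda>y. (cmod (co p2 m y))\<^sup>2))"
    by (intro sum_mono one)
  also have "\<dots> = (2 + 1 / d) * ((\<Sum>m\<in>K. integral {-d..d} (\<lambda>y. (cmod (co F m y))\<^sup>2)) + (\<Sum>m\<in>K. integral {-d..d} (\<lambda>y. (cmod (co p1 m y))\<^sup>2)))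
       + (\<Sum>m\<in>K. integral {-d..d} (\<lambda>y. (cmod (co p2 m y))\<^sup>2))"
    by (simp add: sum.distrib sum_distrib_left distrib_left)
  also have "\<dots> \<le> (2 + 1 / d) * (integral (cbox (-pi, -d) (pi, d)) (\<lambda>x. (cmod (F x))\<^sup>2)
        + integral (cbox (-pi, -d) (pi, d)) (\<lambda>x. (cmod (p1 x))\<^sup>2))
        + (2 + 1 / d) * integral (cbox (-pi, -d) (pi, d)) (\<lambda>x. (cmod (p2 x))\<^sup>2)"
  proof (intro add_mono mult_left_mono bes cF)
    have "0 \<le> integral (cbox (-pi, -d) (pi, d)) (\<lambda>x. (cmod (p2 x))\<^sup>2)"
      by (intro integral_nonneg integrable_cont nF) auto
    then show "(\<Sum>m\<in>K. integral {-d..d} (\<lambda>y. (cmod (co p2 m y))\<^sup>2)) \<le> (2 + 1 / d) * integral (cbox (-pi, -d) (pi, d)) (\<lambda>x. (cmod (p2 x))\<^sup>2)"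
      using bes[OF cF(3)] mult_right_mono[OF c1] by fastforce
  qed (use c1 in auto)
  finally show ?thesis by (simp add: co_def distrib_left)
qed

text \<open>With \<open>\<theta>\<close> large the vertical derivative enters with a small factor.
  Hence traces tend to 0 along a sequence that tends to 0 in L2 and has merely bounded
  derivatives.\<close>

lemma slice_trace_bound:
  assumes F: "C1_fun F p1 p2" and d: "d > 0" and e: "e \<in> {-d..d}" and \<theta>: "\<theta> > 0"
  shows "integral {-pi..pi} (\<lambda>x. (cmod (F (x, e)))\<^sup>2) \<le>
     (1 / (2 * d) + \<theta>) * integral (cbox (-pi, -d) (pi, d)) (\<lambda>x. (cmod (F x))\<^sup>2)
     + 1 / \<theta> * integral (cbox (-pi, -d) (pi, d)) (\<lambda>x. (cmod (p2 x))\<^sup>2)"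
proof -
  note cF = C1_fun_cont[OF F] and nF = C1_fun_norm_cont[OF F]
  have sw: "integral (cbox (-pi, -d) (pi, d)) g = integral {-pi..pi} (\<lambda>x. integral {-d..d} (\<lambda>y. g (x, y)))"
    and cs: "continuous_on {-pi..pi} (\<lambda>x. integral {-d..d} (\<lambda>y. g (x, y)))" if "continuous_on UNIV g" for g :: "pt \<Rightarrow> real"
  proof -
    show "integral (cbox (-pi, -d) (pi, d)) g = integral {-pi..pi} (\<lambda>x. integral {-d..d} (\<lambda>y. g (x, y)))"
      using integral_prod_continuous[OF continuous_on_subset[OF that]] by simp
    have "continuous_on ({-pi..pi} \<times> cbox (-d) d) (\<lambda>(x, y). g (x, y))"
      using continuous_on_subset[OF that] by simp
    then show "continuous_on {-pi..pi} (\<lambda>x. integral {-d..d} (\<lambda>y. g (x, y)))"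
      using integral_continuous_on_param[of "{-pi..pi}" "-d" d "\<lambda>x y. g (x, y)"] by simp
  qed
  have "integral {-pi..pi} (\<lambda>x. (cmod (F (x, e)))\<^sup>2) \<le> integral {-pi..pi} (\<lambda>x. (1 / (d - - d) + \<theta>) * integral {-d..d} (\<lambda>y. (cmod (F (x, y)))\<^sup>2)
      + 1 / \<theta> * integral {-d..d} (\<lambda>y. (cmod (p2 (x, y)))\<^sup>2))"
  proof (rule integral_mono_cont)
    fix x
    show "(cmod (F (x, e)))\<^sup>2 \<le> (1 / (d - - d) + \<theta>) * integral {-d..d} (\<lambda>y. (cmod (F (x, y)))\<^sup>2) + 1 / \<theta> * integral {-d..d} (\<lambda>y. (cmod (p2 (x, y)))\<^sup>2)"
      by (rule trace_inequality_1d[OF _ \<theta> e C1_fun_d2[OF F] cont_slice(2)[OF cF(3)]]) (use d in simp)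
  qed (intro continuous_intros cs nF cont_slice(1)[OF nF(1)])+
  also have "\<dots> = (1 / (2 * d) + \<theta>) * integral (cbox (-pi, -d) (pi, d)) (\<lambda>x. (cmod (F x))\<^sup>2)
     + 1 / \<theta> * integral (cbox (-pi, -d) (pi, d)) (\<lambda>x. (cmod (p2 x))\<^sup>2)"
    unfolding sw[OF nF(1)] sw[OF nF(3)]
    by (subst Henstock_Kurzweil_Integration.integral_add, (intro integrable_continuous_real continuous_intros cs nF)+) simp
  finally show ?thesis .
qed

section \<open>Green's formulas on the rectangle\<close>

lemma has_vector_derivative_cnj': "(g has_vector_derivative g') F \<Longrightarrow> ((\<lambda>x. cnj (g x)) has_vector_derivative cnj g') F"
  using bounded_linear.has_vector_derivative[OF bounded_linear_cnj] .

text \<open>The contributions of the vertical edges cancel by periodicity, unlike those of the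
  horizontal edges in \<open>green_x2\<close>.\<close>

lemma green_x1:
  assumes F: "C1_fun F p1 p2" "per_x1 F" and G: "C1_fun G q1 q2" "per_x1 G"
  shows "cip (-pi, -d) (pi, d) p1 G = - cip (-pi, -d) (pi, d) F q1"
proof -
  note cF = C1_fun_cont[OF F(1)] and cG = C1_fun_cont[OF G(1)]
  have *: "integral {-pi..pi} (\<lambda>x. p1 (x, y) * cnj (G (x, y))) = - integral {-pi..pi} (\<lambda>x. F (x, y) * cnj (q1 (x, y)))" for y
    by (subst parts_1d[OF _ C1_fun_d1[OF F(1)] has_vector_derivative_cnj'[OF C1_fun_d1[OF G(1)]]])
      (auto intro!: continuous_intros cont_slice cF cG simp: per_x1_edges[OF F(2)] per_x1_edges[OF G(2)])
  show ?thesis unfolding cip_def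
    by (subst (1 2) box_integral) (auto intro!: continuous_intros cF cG simp: *)
qed

lemma green_x2:
  assumes F: "C1_fun F p1 p2" and G: "C1_fun G q1 q2" and d: "d > 0"
  shows "cip (-pi, -d) (pi, d) p2 G = - cip (-pi, -d) (pi, d) F q2
     + (cip (-pi) pi (\<lambda>x. F (x, d)) (\<lambda>x. G (x, d)) - cip (-pi) pi (\<lambda>x. F (x, -d)) (\<lambda>x. G (x, -d)))"
proof -
  note cF = C1_fun_cont[OF F] and cG = C1_fun_cont[OF G]
  have *: "integral {-d..d} (\<lambda>y. p2 (x, y) * cnj (G (x, y))) = F (x, d) * cnj (G (x, d)) - F (x, -d) * cnj (G (x, -d))
      - integral {-d..d} (\<lambda>y. F (x, y) * cnj (q2 (x, y)))" for x
    by (subst parts_1d[OF _ C1_fun_d2[OF F] has_vector_derivative_cnj'[OF C1_fun_d2[OF G]]])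
      (use d in \<open>auto intro!: continuous_intros cont_slice cF cG\<close>)
  have sw: "integral (cbox (-pi, -d) (pi, d)) g = integral {-pi..pi} (\<lambda>x. integral {-d..d} (\<lambda>y. g (x, y)))"
    and cs: "continuous_on {-pi..pi} (\<lambda>x. integral {-d..d} (\<lambda>y. g (x, y)))" if "continuous_on UNIV g" for g :: "pt \<Rightarrow> complex"
  proof -
    show "integral (cbox (-pi, -d) (pi, d)) g = integral {-pi..pi} (\<lambda>x. integral {-d..d} (\<lambda>y. g (x, y)))"
      using integral_prod_continuous[OF continuous_on_subset[OF that]] by simp
    have "continuous_on ({-pi..pi} \<times> cbox (-d) d) (\<lambda>(x, y). g (x, y))"
      using continuous_on_subset[OF that] by simp
    then show "continuous_on {-pi..pi} (\<lambda>x. integral {-d..d} (\<lambda>y. g (x, y)))"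
      using integral_continuous_on_param[of "{-pi..pi}" "-d" d "\<lambda>x y. g (x, y)"] by simp
  qed
  have c: "continuous_on UNIV (\<lambda>x. p2 x * cnj (G x))" "continuous_on UNIV (\<lambda>x. F x * cnj (q2 x))"
    by (intro continuous_intros cF cG)+
  have cb: "continuous_on {-pi..pi} (\<lambda>x. F (x, e) * cnj (G (x, e)))" for e
    by (intro continuous_intros cont_slice cF cG)
  show ?thesis unfolding cip_def sw[OF c(1)] sw[OF c(2)] *
    by (subst Henstock_Kurzweil_Integration.integral_diff,
        (intro integrable_continuous_real continuous_intros cb cs[OF c(2)])+,
        subst Henstock_Kurzweil_Integration.integral_diff,
        (intro integrable_continuous_real cb)+) simp
qed

subsection \<open>Coercive forms bordered by finitely many functionals\<close>

text \<open>A Hilbert space up to null vectors: the inner product is semidefinite, and a Cauchy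
  sequence of functions has a limit function in V that is determined only up to a vanishing
  seminorm.\<close>

locale hilbert_funs =
  fixes V :: "('x \<Rightarrow> complex) set" and H :: "('x \<Rightarrow> complex) \<Rightarrow> ('x \<Rightarrow> complex) \<Rightarrow> complex"
  assumes fun_space: "fun_space V"
    and herm: "herm_on V H"
    and psd: "\<And>u. u \<in> V \<Longrightarrow> 0 \<le> Re (H u u)"
    and complete: "\<And>u. (\<And>n. u n \<in> V) \<Longrightarrow>
        (\<And>e. e > 0 \<Longrightarrow> \<exists>N. \<forall>m\<ge>N. \<forall>n\<ge>N. fnorm H (\<lambda>x. u m x - u n x) < e) \<Longrightarrow>
        \<exists>w\<in>V. (\<lambda>n. fnorm H (\<lambda>x. u n x - w x)) \<longlonglongrightarrow> 0"
begin

lemmas V_zero = fun_spaceD(1)[OF fun_space]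
lemmas V_add = fun_spaceD(2)[OF fun_space]
lemmas V_scale = fun_spaceD(3)[OF fun_space]
lemmas V_diff = fun_space_diff[OF fun_space]
lemmas V_sum = fun_space_sum[OF fun_space]

lemma nrm_nonneg: "u \<in> V \<Longrightarrow> 0 \<le> fnorm H u"
  by (simp add: fnorm_def psd)

lemma nrm_sum:
  assumes "finite J" "\<And>j. j \<in> J \<Longrightarrow> w j \<in> V"
  shows "fnorm H (\<lambda>x. \<Sum>j\<in>J. c j * w j x) \<le> (\<Sum>j\<in>J. cmod (c j) * fnorm H (w j))"
  by (rule fnorm_sum[OF fun_space herm]) (use assms psd in auto)

text \<open>The energy is quadratic along every line. Both the parallelogram identity and the
  equation satisfied by a minimiser are read off from this expansion.\<close>

lemma energy_expand:
  assumes B: "herm_on V B" and f: "lin_on V f" and uv: "u \<in> V" "v \<in> V"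
  shows "Re (B (\<lambda>x. u x + c * v x) (\<lambda>x. u x + c * v x)) - 2 * Re (f (\<lambda>x. u x + c * v x)) =
     (Re (B u u) - 2 * Re (f u)) + 2 * Re (cnj c * (B u v - cnj (f v))) + (cmod c)\<^sup>2 * Re (B v v)"
proof -
  have "f (\<lambda>x. u x + c * v x) = f u + c * f v"
    using lin_onD(1)[OF f uv(1) V_scale[OF uv(2), of c]] lin_onD(2)[OF f uv(2), of c] by simp
  moreover have "Re (c * f v) = Re (cnj c * cnj (f v))" by simp
  ultimately show ?thesis using herm_on_combine[OF B fun_space uv, of c] by (simp add: algebra_simps)
qed

text \<open>Minimising \<open>Re (B u u) - 2 Re (f u)\<close>: the parallelogram identity makes a minimising
  sequence Cauchy, so no projection theorem is needed.\<close>

lemma riesz: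
  assumes B: "herm_on V B" and c: "c > 0"
    and coer: "\<And>u. u \<in> V \<Longrightarrow> c * (fnorm H u)\<^sup>2 \<le> Re (B u u)"
    and bdd: "\<And>u. u \<in> V \<Longrightarrow> Re (B u u) \<le> K * (fnorm H u)\<^sup>2"
    and f: "lin_on V f" and fb: "\<And>u. u \<in> V \<Longrightarrow> cmod (f u) \<le> L * fnorm H u"
  shows "\<exists>w\<in>V. \<forall>v\<in>V. B w v = cnj (f v)"
proof -
  define J where "J u = Re (B u u) - 2 * Re (f u)" for u
  note J_expand = energy_expand[OF B f, folded J_def]
  have Bpos: "0 \<le> Re (B u u)" if "u \<in> V" for u
    using coer[OF that] c by (meson dual_order.trans mult_nonneg_nonneg less_imp_le zero_le_power2)
  \<comment> \<open>Completing the square: coercivity beats the linear term, so the energy has a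
    finite infimum.\<close>
  have low: "- L\<^sup>2 / c \<le> J u" if "u \<in> V" for u
  proof -
    have "J u \<ge> c * (fnorm H u)\<^sup>2 - 2 * (L * fnorm H u)"
      using coer[OF that] fb[OF that] complex_Re_le_cmod[of "f u"] unfolding J_def by linarith
    moreover have "c * (fnorm H u)\<^sup>2 - 2 * (L * fnorm H u) + L\<^sup>2 / c = (c * fnorm H u - L)\<^sup>2 / c"
      using c by (simp add: power2_eq_square field_simps)
    moreover have "(c * fnorm H u - L)\<^sup>2 / c \<ge> 0" using c by simp
    ultimately show ?thesis by simp
  qed
  define d where "d = Inf (J ` V)"
  have bb: "bdd_below (J ` V)" using low by (auto intro!: bdd_belowI)
  have dle: "d \<le> J u" if "u \<in> V" for u unfolding d_def using bb that by (intro cInf_lower) auto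
  have "\<exists>u\<in>V. J u < d + 1 / real (Suc n)" for n
    using cInf_lessD[of "J ` V" "d + 1 / real (Suc n)"] V_zero by (auto simp: d_def)
  then obtain u where u: "\<And>n. u n \<in> V" "\<And>n. J (u n) < d + 1 / real (Suc n)" by metis
  have par: "c / 2 * (fnorm H (\<lambda>x. a x - b x))\<^sup>2 \<le> (J a - d) + (J b - d)" if ab: "a \<in> V" "b \<in> V" for a b
  proof -
    \<comment> \<open>The midpoint, written so that a and b are m plus and minus half their
      difference; the linear terms of the two expansions then cancel in the sum.\<close>
    define m where "m x = a x + (- 1/2) * (a x - b x)" for x
    have dV: "(\<lambda>x. a x - b x) \<in> V" using ab by (rule V_diff)
    have mV: "m \<in> V" unfolding m_def using V_add[OF ab(1) V_scale[OF dV, of "-1/2"]] .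
    have am: "a = (\<lambda>x. m x + (1/2) * (a x - b x))" "b = (\<lambda>x. m x + (- 1/2) * (a x - b x))"
      by (auto simp: m_def field_simps)
    define D where "D = (\<lambda>x. a x - b x)"
    have "J a = J m + 2 * Re (cnj (1/2) * (B m D - cnj (f D))) + (cmod (1/2))\<^sup>2 * Re (B D D)"
      using J_expand[OF mV dV, of "1/2"] am(1) unfolding D_def by metis
    moreover have "J b = J m + 2 * Re (cnj (-1/2) * (B m D - cnj (f D))) + (cmod (-1/2))\<^sup>2 * Re (B D D)"
      using J_expand[OF mV dV, of "-1/2"] am(2) unfolding D_def by metis
    ultimately have "J a + J b = 2 * J m + Re (B D D) / 2" by (simp add: power2_eq_square)
    then show ?thesis using dle[OF mV] coer[OF dV] unfolding D_def by simp
  qed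
  have "\<exists>w\<in>V. (\<lambda>n. fnorm H (\<lambda>x. u n x - w x)) \<longlonglongrightarrow> 0"
  proof (rule complete)
    fix e :: real assume e: "e > 0"
    obtain N where N: "1 / real (Suc N) < c / 4 * e\<^sup>2"
      using e c reals_Archimedean[of "c / 4 * e\<^sup>2"] by (auto simp: inverse_eq_divide)
    have "fnorm H (\<lambda>x. u m x - u n x) < e" if "m \<ge> N" "n \<ge> N" for m n
    proof -
      have "1 / real (Suc m) \<le> 1 / real (Suc N)" "1 / real (Suc n) \<le> 1 / real (Suc N)"
        using that by (simp_all add: frac_le)
      then have "c / 2 * (fnorm H (\<lambda>x. u m x - u n x))\<^sup>2 < c / 2 * e\<^sup>2"
        using par[OF u(1) u(1), of m n] u(2)[of m] u(2)[of n] N by linarith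
      then show ?thesis using c e by (simp add: power_less_imp_less_base)
    qed
    then show "\<exists>N. \<forall>m\<ge>N. \<forall>n\<ge>N. fnorm H (\<lambda>x. u m x - u n x) < e" by blast
  qed (rule u(1))
  then obtain w where w: "w \<in> V" and lim: "(\<lambda>n. fnorm H (\<lambda>x. u n x - w x)) \<longlonglongrightarrow> 0" by blast
  have Kpos: "fnorm B v \<le> sqrt \<bar>K\<bar> * fnorm H v" if "v \<in> V" for v
  proof -
    have "Re (B v v) \<le> \<bar>K\<bar> * (fnorm H v)\<^sup>2"
      using bdd[OF that] by (meson abs_ge_self mult_right_mono order_trans zero_le_power2)
    then have "fnorm B v \<le> sqrt (\<bar>K\<bar> * (fnorm H v)\<^sup>2)" unfolding fnorm_def[of B] by (rule real_sqrt_le_mono)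
    then show ?thesis by (simp add: real_sqrt_mult nrm_nonneg that)
  qed
  \<comment> \<open>The energy of the limit is compared with that of \<open>u n\<close> by the same
    expansion. The error is linear in the distance to the limit, and the quadratic remainder has the
    favourable sign.\<close>
  have "J w \<le> d + (1 / real (Suc n) + 2 * ((fnorm B w * sqrt \<bar>K\<bar> + L) * fnorm H (\<lambda>x. u n x - w x)))" for n
  proof -
    define v where "v x = u n x - w x" for x
    have v: "v \<in> V" unfolding v_def using u w by (intro V_diff)
    have "J (\<lambda>x. w x + 1 * v x) = J w + 2 * Re (cnj 1 * (B w v - cnj (f v))) + (cmod 1)\<^sup>2 * Re (B v v)"
      by (rule J_expand[OF w v])
    moreover have "(\<lambda>x. w x + 1 * v x) = u n" by (simp add: v_def)
    ultimately have "J w = J (u n) - 2 * Re (B w v - cnj (f v)) - Re (B v v)" by simp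
    also have "\<dots> \<le> J (u n) + 2 * (cmod (B w v) + cmod (f v))"
      using Bpos[OF v] abs_Re_le_cmod[of "B w v"] abs_Re_le_cmod[of "f v"] by simp
    also have "cmod (B w v) \<le> fnorm B w * (sqrt \<bar>K\<bar> * fnorm H v)"
      using psd_cauchy_schwarz[OF fun_space B Bpos w v] Kpos[OF v] fnorm_nonneg[OF fun_space B Bpos w]
      by (meson mult_left_mono order_trans)
    also have "cmod (f v) \<le> L * fnorm H v" by (rule fb[OF v])
    finally show ?thesis using u(2)[of n] by (simp add: v_def[abs_def] algebra_simps)
  qed
  moreover have "(\<lambda>n. d + (1 / real (Suc n) + 2 * ((fnorm B w * sqrt \<bar>K\<bar> + L) * fnorm H (\<lambda>x. u n x - w x)))) \<longlonglongrightarrow> d + (0 + 2 * ((fnorm B w * sqrt \<bar>K\<bar> + L) * 0))"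
    by (intro tendsto_intros lim LIMSEQ_Suc[OF lim_1_over_n])
  ultimately have Jw: "J w \<le> d" by (intro LIMSEQ_le_const) auto
  have "B w v = cnj (f v)" if v: "v \<in> V" for v
  proof (rule ccontr)
    assume ne: "B w v \<noteq> cnj (f v)"
    define z where "z = B w v - cnj (f v)"
    define b where "b = Re (B v v)"
    have zp: "(cmod z)\<^sup>2 > 0" using ne by (simp add: z_def)
    have q: "0 \<le> 2 * Re (cnj e * z) + (cmod e)\<^sup>2 * b" for e
      using J_expand[OF w v, of e] dle[OF V_add[OF w V_scale[OF v, of e]]] Jw by (simp add: z_def b_def)
    \<comment> \<open>A step of this length in the direction -z keeps the quadratic term below the
      linear one, so the energy would drop below its infimum.\<close>
    define t where "t = 1 / (b + 1)"
    have bp: "b \<ge> 0" using Bpos[OF v] by (simp add: b_def)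
    have t: "t > 0" "t * b < 1" using bp by (auto simp: t_def)
    have "cnj (- of_real t * z) * z = of_real (- t * (cmod z)\<^sup>2)"
      unfolding of_real_mult complex_norm_square by (simp add: mult_ac)
    then have "Re (cnj (- of_real t * z) * z) = - t * (cmod z)\<^sup>2" by (simp only: Re_complex_of_real)
    moreover have "(cmod (- of_real t * z))\<^sup>2 = t\<^sup>2 * (cmod z)\<^sup>2" by (simp add: norm_mult power_mult_distrib)
    ultimately have "0 \<le> 2 * (- t * (cmod z)\<^sup>2) + t\<^sup>2 * (cmod z)\<^sup>2 * b"
      using q[of "- of_real t * z"] by (simp only:)
    also have "\<dots> = (cmod z)\<^sup>2 * t * (t * b - 2)" by (simp add: algebra_simps power2_eq_square)
    also have "\<dots> < 0" using t zp by (intro mult_pos_neg) auto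
    finally show False by simp
  qed
  then show ?thesis using w by blast
qed

text \<open>A variational equation for u whose sources lie in the span of the functionals
  \<open>f s\<close>, with strengths linear in the scalar unknowns y, and one affine condition on
  each \<open>f r u\<close>. The same index set serves for functionals, conditions and unknowns, so
  eliminating u leaves a square system.\<close>

definition bordered where
  "bordered I f B C D h u y \<longleftrightarrow>
     (\<forall>v\<in>V. B u v = (\<Sum>s\<in>I. (\<Sum>j\<in>I. C s j * y j) * cnj (f s v))) \<and>
     (\<forall>r\<in>I. f r u = (\<Sum>j\<in>I. D r j * y j) + h r)"

text \<open>Let w_s represent \<open>f s\<close> for the form \<open>B p\<close>. Then u must be, up
  to a null function, the combination of the w_s with coefficients C y, and inserting it into the
  conditions leaves a linear system for y with matrix \<open>G p\<close>. The representers depend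
  continuously on p because coercivity is uniform, so \<open>perturbed_square_system\<close> applies
  with injectivity at \<open>p0\<close>.\<close>

theorem bordered_perturbation:
  fixes B :: "'p::metric_space \<Rightarrow> ('x \<Rightarrow> complex) \<Rightarrow> ('x \<Rightarrow> complex) \<Rightarrow> complex"
    and C D :: "'p \<Rightarrow> 'i \<Rightarrow> 'i \<Rightarrow> complex" and h :: "'i \<Rightarrow> complex"
  assumes I: "finite I" and p0: "p0 \<in> S" and c: "c > 0"
    and B: "\<And>p. p \<in> S \<Longrightarrow> herm_on V (B p)"
    and coer: "\<And>p u. p \<in> S \<Longrightarrow> u \<in> V \<Longrightarrow> c * (fnorm H u)\<^sup>2 \<le> Re (B p u u)"
    and bdd: "\<And>p u. p \<in> S \<Longrightarrow> u \<in> V \<Longrightarrow> Re (B p u u) \<le> K p * (fnorm H u)\<^sup>2"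
    and Bcont: "\<And>p e. p \<in> S \<Longrightarrow> e > 0 \<Longrightarrow> \<exists>d>0. \<forall>q\<in>S. dist q p < d \<longrightarrow>
        (\<forall>u\<in>V. \<forall>v\<in>V. cmod (B q u v - B p u v) \<le> e * fnorm H u * fnorm H v)"
    and f: "\<And>s. s \<in> I \<Longrightarrow> lin_on V (f s)"
    and fb: "\<And>s u. s \<in> I \<Longrightarrow> u \<in> V \<Longrightarrow> cmod (f s u) \<le> L * fnorm H u"
    and CD: "\<And>s j. s \<in> I \<Longrightarrow> j \<in> I \<Longrightarrow> continuous_on S (\<lambda>p. C p s j)"
      "\<And>s j. s \<in> I \<Longrightarrow> j \<in> I \<Longrightarrow> continuous_on S (\<lambda>p. D p s j)"
    and inj: "\<And>u y. u \<in> V \<Longrightarrow> bordered I f (B p0) (C p0) (D p0) (\<lambda>_. 0) u y \<Longrightarrow> \<forall>i\<in>I. y i = 0"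
  shows "\<exists>r>0. \<exists>U Y. (\<forall>p\<in>S \<inter> ball p0 r. U p \<in> V \<and> bordered I f (B p) (C p) (D p) h (U p) (Y p) \<and>
        (\<forall>u\<in>V. \<forall>y. bordered I f (B p) (C p) (D p) h u y \<longrightarrow>
            fnorm H (\<lambda>x. u x - U p x) = 0 \<and> (\<forall>i\<in>I. y i = Y p i)))
      \<and> (\<forall>i\<in>I. continuous_on (S \<inter> ball p0 r) (\<lambda>p. Y p i))
      \<and> (\<forall>p\<in>S \<inter> ball p0 r. ((\<lambda>q. fnorm H (\<lambda>x. U q x - U p x)) \<longlongrightarrow> 0) (at p within S \<inter> ball p0 r))"
proof -
  have "\<forall>p s. \<exists>w. p \<in> S \<longrightarrow> s \<in> I \<longrightarrow> w \<in> V \<and> (\<forall>v\<in>V. B p w v = cnj (f s v))"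
    using riesz[OF B c coer bdd f fb] by meson
  then obtain w where w: "\<And>p s. p \<in> S \<Longrightarrow> s \<in> I \<Longrightarrow> w p s \<in> V"
    "\<And>p s v. p \<in> S \<Longrightarrow> s \<in> I \<Longrightarrow> v \<in> V \<Longrightarrow> B p (w p s) v = cnj (f s v)" by metis
  \<comment> \<open>Coercivity of \<open>B q\<close> at the difference of the two representers,
    combined with their defining equations, leaves only \<open>B q\<close> - \<open>B p\<close>
    applied to the fixed function \<open>w p s\<close>.\<close>
  have wlim: "((\<lambda>q. fnorm H (\<lambda>x. w q s x - w p s x)) \<longlongrightarrow> 0) (at p within S)" if p: "p \<in> S" and s: "s \<in> I" for p s
    unfolding tendsto_iff eventually_at
  proof (intro allI impI)
    fix e :: real assume e: "e > 0"
    define n where "n = fnorm H (w p s)"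
    have n: "n \<ge> 0" unfolding n_def by (rule nrm_nonneg[OF w(1)[OF p s]])
    \<comment> \<open>The n + 1 in the tolerance covers n = 0 and makes the final inequality
      strict.\<close>
    obtain d where d: "d > 0" "\<And>q u v. q \<in> S \<Longrightarrow> dist q p < d \<Longrightarrow> u \<in> V \<Longrightarrow> v \<in> V \<Longrightarrow>
        cmod (B q u v - B p u v) \<le> (c * e / (n + 1)) * fnorm H u * fnorm H v"
      using Bcont[OF p, of "c * e / (n + 1)"] c e n by (auto simp: add_nonneg_pos)
    have "fnorm H (\<lambda>x. w q s x - w p s x) < e" if q: "q \<in> S" and qp: "dist q p < d" for q
    proof -
      define v where "v x = w q s x - w p s x" for x
      have v: "v \<in> V" unfolding v_def using w(1) p q s by (intro V_diff) auto
      have "B q v v = B q (w q s) v - B q (w p s) v"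
        using lin_on_diff[OF fun_space herm_on_lin[OF B[OF q] v] w(1)[OF q s] w(1)[OF p s], folded v_def[abs_def]] .
      also have "\<dots> = - (B q (w p s) v - B p (w p s) v)" using w(2)[OF q s v] w(2)[OF p s v] by simp
      finally have "c * (fnorm H v)\<^sup>2 \<le> cmod (B q (w p s) v - B p (w p s) v)"
        using coer[OF q v] complex_Re_le_cmod[of "B q v v"] by (metis norm_minus_cancel order_trans)
      also have "\<dots> \<le> (c * e / (n + 1)) * n * fnorm H v"
        unfolding n_def[symmetric] using d(2)[OF q qp w(1)[OF p s] v] by (simp add: n_def)
      finally have 1: "c * (fnorm H v)\<^sup>2 \<le> c * e / (n + 1) * n * fnorm H v" .
      have "n / (n + 1) < 1" using n by simp
      have "fnorm H v < e"
      proof (cases "fnorm H v = 0")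
        case False
        then have vp: "fnorm H v > 0" using nrm_nonneg[OF v] by simp
        have "c * fnorm H v \<le> c * e / (n + 1) * n"
          by (rule mult_right_le_imp_le[OF _ vp]) (use 1 in \<open>simp only: power2_eq_square mult.assoc\<close>)
        also have "\<dots> = c * e * (n / (n + 1))" by simp
        also have "\<dots> < c * e * 1" using \<open>n / (n + 1) < 1\<close> c e by (intro mult_strict_left_mono) auto
        finally show ?thesis using c by simp
      qed (use e in simp)
      then show ?thesis by (simp add: v_def[abs_def])
    qed
    then show "\<exists>d>0. \<forall>q\<in>S. q \<noteq> p \<and> dist q p < d \<longrightarrow> dist (fnorm H (\<lambda>x. w q s x - w p s x)) 0 < e"
      using d(1) nrm_nonneg[OF V_diff[OF w(1) w(1)]] p s by (auto simp: dist_real_def)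
  qed
  have fw: "continuous_on S (\<lambda>p. f r (w p s))" if r: "r \<in> I" and s: "s \<in> I" for r s
    unfolding continuous_on_def
  proof
    fix p assume p: "p \<in> S"
    have "((\<lambda>q. f r (w q s) - f r (w p s)) \<longlongrightarrow> 0) (at p within S)"
    proof (rule Lim_null_comparison)
      show "((\<lambda>q. L * fnorm H (\<lambda>x. w q s x - w p s x)) \<longlongrightarrow> 0) (at p within S)"
        using tendsto_mult_right_zero[OF wlim[OF p s]] .
      show "\<forall>\<^sub>F q in at p within S. cmod (f r (w q s) - f r (w p s)) \<le> L * fnorm H (\<lambda>x. w q s x - w p s x)"
        unfolding eventually_at_filter
      proof (rule always_eventually, intro allI impI)
        fix q assume "q \<noteq> p" and q: "q \<in> S"
        show "cmod (f r (w q s) - f r (w p s)) \<le> L * fnorm H (\<lambda>x. w q s x - w p s x)"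
          using fb[OF r V_diff[OF w(1)[OF q s] w(1)[OF p s]]]
            lin_on_diff[OF fun_space f[OF r] w(1)[OF q s] w(1)[OF p s]] by simp
      qed
    qed
    then show "((\<lambda>p. f r (w p s)) \<longlongrightarrow> f r (w p s)) (at p within S)" by (rule LIM_zero_cancel)
  qed
  define X where "X p y s = (\<Sum>j\<in>I. C p s j * y j)" for p y s
  define R where "R p y x = (\<Sum>s\<in>I. X p y s * w p s x)" for p y x
  define G where "G p r j = (\<Sum>s\<in>I. f r (w p s) * C p s j) - D p r j" for p r j
  have R: "R p y \<in> V" if "p \<in> S" for p y
    unfolding R_def[abs_def] by (rule V_sum[OF I]) (use w(1) that in auto)
  have fR: "f r (R p y) - (\<Sum>j\<in>I. D p r j * y j) = (\<Sum>j\<in>I. G p r j * y j)" if "p \<in> S" "r \<in> I" for p r y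
  proof -
    have "f r (R p y) = (\<Sum>s\<in>I. X p y s * f r (w p s))"
      unfolding R_def[abs_def] by (rule lin_on_sum[OF fun_space f[OF that(2)] I]) (use w(1) that in auto)
    also have "\<dots> = (\<Sum>j\<in>I. (\<Sum>s\<in>I. f r (w p s) * C p s j) * y j)"
      unfolding X_def sum_distrib_right by (subst sum.swap) (simp add: mult_ac)
    finally show ?thesis by (simp add: G_def left_diff_distrib sum_subtractf)
  qed
  have BR: "B p (R p y) v = (\<Sum>s\<in>I. X p y s * cnj (f s v))" if "p \<in> S" "v \<in> V" for p y v
  proof -
    have "B p (R p y) v = (\<Sum>s\<in>I. X p y s * B p (w p s) v)"
      unfolding R_def[abs_def] by (rule lin_on_sum[OF fun_space herm_on_lin[OF B] I]) (use w(1) that in auto)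
    then show ?thesis using w(2) that by simp
  qed
  \<comment> \<open>Stated for arbitrary u in V and arbitrary h: the case h = 0 transfers
    injectivity to the matrix G, the given h yields existence and uniqueness.\<close>
  have sys: "bordered I f (B p) (C p) (D p) h u y \<longleftrightarrow>
      fnorm H (\<lambda>x. u x - R p y x) = 0 \<and> (\<forall>r\<in>I. (\<Sum>j\<in>I. G p r j * y j) = h r)"
    if p: "p \<in> S" and u: "u \<in> V" for p u y h
  proof -
    have d: "(\<lambda>x. u x - R p y x) \<in> V" using u R[OF p] by (rule V_diff)
    have 1: "(\<forall>v\<in>V. B p u v = (\<Sum>s\<in>I. X p y s * cnj (f s v))) \<longleftrightarrow> fnorm H (\<lambda>x. u x - R p y x) = 0"
    proof
      assume *: "\<forall>v\<in>V. B p u v = (\<Sum>s\<in>I. X p y s * cnj (f s v))"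
      have "B p (\<lambda>x. u x - R p y x) (\<lambda>x. u x - R p y x) = 0"
        using lin_on_diff[OF fun_space herm_on_lin[OF B[OF p] d] u R[OF p]] * BR[OF p d] d by simp
      then have "c * (fnorm H (\<lambda>x. u x - R p y x))\<^sup>2 \<le> 0" using coer[OF p d] by simp
      then show "fnorm H (\<lambda>x. u x - R p y x) = 0" using c by (simp add: mult_le_0_iff)
    next
      assume *: "fnorm H (\<lambda>x. u x - R p y x) = 0"
      show "\<forall>v\<in>V. B p u v = (\<Sum>s\<in>I. X p y s * cnj (f s v))"
      proof
        fix v assume v: "v \<in> V"
        have pos: "0 \<le> Re (B p a a)" if "a \<in> V" for a
          using coer[OF p that] c by (meson dual_order.trans mult_nonneg_nonneg less_imp_le zero_le_power2)
        have "Re (B p (\<lambda>x. u x - R p y x) (\<lambda>x. u x - R p y x)) = 0"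
          using bdd[OF p d] pos[OF d] * by simp
        then have "fnorm (B p) (\<lambda>x. u x - R p y x) = 0" by (simp add: fnorm_def)
        \<comment> \<open>A difference of vanishing seminorm is invisible to \<open>B p\<close> by
          Cauchy-Schwarz for \<open>B p\<close> itself, which is bounded by the norm.\<close>
        then have "B p (\<lambda>x. u x - R p y x) v = 0"
          using psd_cauchy_schwarz[OF fun_space B[OF p] pos d v] by simp
        then show "B p u v = (\<Sum>s\<in>I. X p y s * cnj (f s v))"
          using lin_on_diff[OF fun_space herm_on_lin[OF B[OF p] v] u R[OF p]] BR[OF p v] by simp
      qed
    qed
    have 2: "f r u = f r (R p y)" if "fnorm H (\<lambda>x. u x - R p y x) = 0" "r \<in> I" for r
      using fb[OF that(2) d] that lin_on_diff[OF fun_space f[OF that(2)] u R[OF p]] by simp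
    show ?thesis unfolding bordered_def X_def[symmetric] 1
      using 2 fR[OF p] by (metis (no_types, lifting) add_diff_cancel_left' diff_add_cancel add.commute)
  qed
  have Gcont: "continuous_on S (\<lambda>p. G p r j)" if "r \<in> I" "j \<in> I" for r j
    unfolding G_def by (intro continuous_intros fw CD that)
  have Ginj: "y i = 0" if "\<And>r. r \<in> I \<Longrightarrow> (\<Sum>j\<in>I. G p0 r j * y j) = 0" "i \<in> I" for y i
  proof -
    have "bordered I f (B p0) (C p0) (D p0) (\<lambda>_. 0) (R p0 y) y"
      unfolding sys[OF p0 R[OF p0]] using that lin_on_zero[OF fun_space herm_on_lin[OF herm V_zero]]
      by (simp add: fnorm_def)
    then show ?thesis using inj R[OF p0] that(2) by blast
  qed
  have "\<exists>r>0. \<exists>Z. (\<forall>i\<in>I. \<forall>j\<in>I. continuous_on (S \<inter> ball p0 r) (\<lambda>p. Z p i j)) \<and>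
     (\<forall>p\<in>S \<inter> ball p0 r. \<forall>y h. (\<forall>i\<in>I. (\<Sum>j\<in>I. G p i j * y j) = h i) \<longleftrightarrow> (\<forall>i\<in>I. y i = (\<Sum>j\<in>I. Z p i j * h j)))"
    by (rule perturbed_square_system[OF I p0]) (fact Gcont, fact Ginj)
  then obtain r Z where r: "r > 0"
    and Zc: "\<And>i j. i \<in> I \<Longrightarrow> j \<in> I \<Longrightarrow> continuous_on (S \<inter> ball p0 r) (\<lambda>p. Z p i j)"
    and Z: "\<And>p y h. p \<in> S \<inter> ball p0 r \<Longrightarrow>
       (\<forall>i\<in>I. (\<Sum>j\<in>I. G p i j * y j) = h i) \<longleftrightarrow> (\<forall>i\<in>I. y i = (\<Sum>j\<in>I. Z p i j * h j))"
    by blast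
  define T where "T = S \<inter> ball p0 r"
  have TS: "p \<in> S" if "p \<in> T" for p using that by (simp add: T_def)
  define Y where "Y p i = (\<Sum>j\<in>I. Z p i j * h j)" for p i
  define U where "U p = R p (Y p)" for p
  have Ycont: "continuous_on T (\<lambda>p. Y p i)" if "i \<in> I" for i
    unfolding Y_def T_def by (intro continuous_intros Zc that)
  have Xcont: "continuous_on T (\<lambda>p. X p (Y p) s)" if "s \<in> I" for s
    unfolding X_def by (intro continuous_intros Ycont continuous_on_subset[OF CD(1)] that) (auto simp: T_def)
  have Rcong: "R p y = R p y'" if "\<And>i. i \<in> I \<Longrightarrow> y i = y' i" for p y y'
    unfolding R_def[abs_def] X_def using that by simp
  have U0: "fnorm H (\<lambda>x. U p x - R p (Y p) x) = 0" for p
    using lin_on_zero[OF fun_space herm_on_lin[OF herm V_zero]] by (simp add: U_def fnorm_def)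
  have Ulim: "((\<lambda>q. fnorm H (\<lambda>x. U q x - U p x)) \<longlongrightarrow> 0) (at p within T)" if p: "p \<in> T" for p
  proof (rule Lim_null_comparison)
    let ?g = "\<lambda>q. (\<Sum>s\<in>I. cmod (X q (Y q) s) * fnorm H (\<lambda>x. w q s x - w p s x)) +
        (\<Sum>s\<in>I. cmod (X q (Y q) s - X p (Y p) s) * fnorm H (w p s))"
    have "(?g \<longlongrightarrow> (\<Sum>s\<in>I. cmod (X p (Y p) s) * 0) + (\<Sum>s\<in>I. cmod (X p (Y p) s - X p (Y p) s) * fnorm H (w p s))) (at p within T)"
    proof (intro tendsto_intros)
      fix s assume s: "s \<in> I"
      show "((\<lambda>q. X q (Y q) s) \<longlongrightarrow> X p (Y p) s) (at p within T)"
        using Xcont[OF s] p by (simp add: continuous_on_def)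
      then show "((\<lambda>q. X q (Y q) s) \<longlongrightarrow> X p (Y p) s) (at p within T)" .
      show "((\<lambda>q. fnorm H (\<lambda>x. w q s x - w p s x)) \<longlongrightarrow> 0) (at p within T)"
        by (rule tendsto_within_subset[OF wlim[OF TS[OF p] s]]) (auto simp: T_def)
    qed
    then show "(?g \<longlongrightarrow> 0) (at p within T)" by simp
    show "\<forall>\<^sub>F q in at p within T. norm (fnorm H (\<lambda>x. U q x - U p x)) \<le> ?g q"
      unfolding eventually_at_filter
    proof (rule always_eventually, intro allI impI)
      fix q assume "q \<noteq> p" and q: "q \<in> T"
      \<comment> \<open>The increment of U splits into the change of the representers and the change
        of their coefficients.\<close>
      let ?a = "\<lambda>x. \<Sum>s\<in>I. X q (Y q) s * (w q s x - w p s x)"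
      let ?b = "\<lambda>x. \<Sum>s\<in>I. (X q (Y q) s - X p (Y p) s) * w p s x"
      have dw: "(\<lambda>x. w q s x - w p s x) \<in> V" "w p s \<in> V" if "s \<in> I" for s
        using w(1) TS p q that by (auto intro: V_diff)
      have e: "(\<lambda>x. U q x - U p x) = (\<lambda>x. ?a x + ?b x)"
        by (simp add: U_def R_def right_diff_distrib left_diff_distrib sum_subtractf)
      have "fnorm H (\<lambda>x. U q x - U p x) \<le> fnorm H ?a + fnorm H ?b"
        unfolding e by (rule fnorm_triangle[OF fun_space herm psd]) (auto intro!: V_sum[OF I] dw)
      also have "fnorm H ?a \<le> (\<Sum>s\<in>I. cmod (X q (Y q) s) * fnorm H (\<lambda>x. w q s x - w p s x))"
        by (rule nrm_sum[OF I]) (rule dw)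
      also have "fnorm H ?b \<le> (\<Sum>s\<in>I. cmod (X q (Y q) s - X p (Y p) s) * fnorm H (w p s))"
        by (rule nrm_sum[OF I]) (rule dw)
      finally have "fnorm H (\<lambda>x. U q x - U p x) \<le> ?g q" by simp
      moreover have "0 \<le> fnorm H (\<lambda>x. U q x - U p x)"
        unfolding U_def using R TS p q by (intro nrm_nonneg V_diff) auto
      ultimately show "norm (fnorm H (\<lambda>x. U q x - U p x)) \<le> ?g q" by simp
    qed
  qed
  show ?thesis
  proof (intro exI conjI ballI allI impI)
    show "r > 0" by (rule r)
    fix p assume p: "p \<in> S \<inter> ball p0 r"
    then have pS: "p \<in> S" by simp
    show UV: "U p \<in> V" unfolding U_def by (rule R[OF pS])
    show "bordered I f (B p) (C p) (D p) h (U p) (Y p)"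
      unfolding sys[OF pS UV] using U0 Z[OF p, of "Y p" h] by (simp add: Y_def)
    fix u y assume u: "u \<in> V" and s: "bordered I f (B p) (C p) (D p) h u y"
    have y: "\<forall>i\<in>I. y i = Y p i" using s Z[OF p, of y h] unfolding sys[OF pS u] by (simp add: Y_def)
    then show "y i = Y p i" if "i \<in> I" for i using that by blast
    show "fnorm H (\<lambda>x. u x - U p x) = 0" using s y Rcong[of y "Y p" p] unfolding sys[OF pS u] U_def by simp
  next
    fix p assume "p \<in> S \<inter> ball p0 r"
    then show "((\<lambda>q. fnorm H (\<lambda>x. U q x - U p x)) \<longlongrightarrow> 0) (at p within S \<inter> ball p0 r)"
      using Ulim[of p] by (simp add: T_def)
  qed (use Ycont in \<open>simp add: T_def\<close>)
qed

end

subsection \<open>The periodic Sobolev space\<close>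

text \<open>A derivative is determined by its values on the two unit vectors, so the choice operator
  in \<open>cgrad\<close> has no freedom at a point of differentiability.\<close>

lemma cgrad_unique:
  assumes "(F has_derivative (\<lambda>h. fst h *\<^sub>R a + snd h *\<^sub>R b)) (at x)"
  shows "cgrad F x = (a, b)"
proof -
  have "(F has_derivative (\<lambda>h. fst h *\<^sub>R fst (cgrad F x) + snd h *\<^sub>R snd (cgrad F x))) (at x)"
    unfolding cgrad_def by (rule someI[of _ "(a, b)"]) (use assms in simp)
  from has_derivative_unique[OF this assms]
  have e: "fst h *\<^sub>R fst (cgrad F x) + snd h *\<^sub>R snd (cgrad F x) = fst h *\<^sub>R a + snd h *\<^sub>R b" for h
    by (rule fun_cong)
  from e[of "(1, 0)"] e[of "(0, 1)"] show ?thesis by (simp add: prod_eq_iff)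
qed

section \<open>Smooth periodic functions and their partial derivatives\<close>

definition D1 :: "(pt \<Rightarrow> complex) \<Rightarrow> pt \<Rightarrow> complex" where "D1 F x = fst (cgrad F x)"
definition D2 :: "(pt \<Rightarrow> complex) \<Rightarrow> pt \<Rightarrow> complex" where "D2 F x = snd (cgrad F x)"

text \<open>Unfolds the coinductive definition once and identifies the partial derivatives hidden in
  it with \<open>D1 F\<close> and \<open>D2 F\<close>, so that differentiation can be iterated by
  name.\<close>

lemma smooth_cases:
  assumes "smooth_fun F"
  shows "(F has_derivative (\<lambda>h. fst h *\<^sub>R D1 F x + snd h *\<^sub>R D2 F x)) (at x)" "smooth_fun (D1 F)" "smooth_fun (D2 F)"
proof -
  obtain p1 p2 where p: "\<And>x. (F has_derivative (\<lambda>h. fst h *\<^sub>R p1 x + snd h *\<^sub>R p2 x)) (at x)"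
    "smooth_fun p1" "smooth_fun p2"
    using assms by (cases rule: smooth_fun.cases) blast
  have "cgrad F x = (p1 x, p2 x)" for x by (rule cgrad_unique[OF p(1)])
  then have "D1 F = p1" "D2 F = p2" by (auto simp: D1_def D2_def)
  then show "(F has_derivative (\<lambda>h. fst h *\<^sub>R D1 F x + snd h *\<^sub>R D2 F x)) (at x)" "smooth_fun (D1 F)" "smooth_fun (D2 F)"
    using p by auto
qed

lemma smooth_cont: "smooth_fun F \<Longrightarrow> continuous_on UNIV F"
  using smooth_cases(1) by (meson continuous_at_imp_continuous_on has_derivative_continuous)

lemma smooth_C1: "smooth_fun F \<Longrightarrow> C1_fun F (D1 F) (D2 F)"
  unfolding C1_fun_def using smooth_cases smooth_cont by blast

text \<open>Coinduction over the class of all constant functions, which is closed under both partial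
  derivatives.\<close>

lemma smooth_const: "smooth_fun (\<lambda>_. c)"
proof -
  have "smooth_fun (\<lambda>_. c)" if "\<exists>c. f = (\<lambda>_. c)" for f :: "pt \<Rightarrow> complex"
    by (coinduction arbitrary: c) (auto intro!: exI[of _ "\<lambda>_. 0"])
  then show ?thesis by blast
qed

lemma smooth_combine:
  assumes "smooth_fun F" "smooth_fun G"
  shows "smooth_fun (\<lambda>x. F x + c * G x)"
  using assms
proof (coinduction arbitrary: F G)
  case smooth_fun
  then show ?case
    by (intro exI[of _ "\<lambda>x. F x + c * G x"] exI[of _ "\<lambda>x. D1 F x + c * D1 G x"] exI[of _ "\<lambda>x. D2 F x + c * D2 G x"])
      (auto intro!: derivative_eq_intros smooth_cases simp: scaleR_conv_of_real algebra_simps)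
qed

lemma D_combine:
  assumes "smooth_fun F" "smooth_fun G"
  shows "D1 (\<lambda>x. F x + c * G x) = (\<lambda>x. D1 F x + c * D1 G x)" "D2 (\<lambda>x. F x + c * G x) = (\<lambda>x. D2 F x + c * D2 G x)"
proof -
  have "cgrad (\<lambda>x. F x + c * G x) x = (D1 F x + c * D1 G x, D2 F x + c * D2 G x)" for x
    by (rule cgrad_unique)
      (use assms in \<open>auto intro!: derivative_eq_intros smooth_cases simp: scaleR_conv_of_real algebra_simps\<close>)
  then show "D1 (\<lambda>x. F x + c * G x) = (\<lambda>x. D1 F x + c * D1 G x)" "D2 (\<lambda>x. F x + c * G x) = (\<lambda>x. D2 F x + c * D2 G x)"
    by (auto simp: D1_def D2_def)
qed

text \<open>F equals its translate by a period; the chain rule and uniqueness of the gradient carry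
  this over. The derivatives thereby become admissible as second arguments of Green's
  formula.\<close>

lemma D1_periodic:
  assumes F: "smooth_fun F" and per: "per_x1 F"
  shows "per_x1 (D1 F)" "per_x1 (D2 F)"
proof -
  have "cgrad F (x1, x2) = (D1 F (x1 + 2 * pi, x2), D2 F (x1 + 2 * pi, x2))" for x1 x2
  proof (rule cgrad_unique)
    have s: "((\<lambda>x. (fst x + 2 * pi, snd x)) has_derivative (\<lambda>h. h)) (at (x1, x2))"
      by (auto intro!: derivative_eq_intros)
    have "((\<lambda>x. F (fst x + 2 * pi, snd x)) has_derivative
        (\<lambda>h. fst h *\<^sub>R D1 F (x1 + 2 * pi, x2) + snd h *\<^sub>R D2 F (x1 + 2 * pi, x2))) (at (x1, x2))"
      using has_derivative_compose[OF s, of F] smooth_cases(1)[OF F, of "(x1 + 2 * pi, x2)"] by simp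
    moreover have "(\<lambda>x. F (fst x + 2 * pi, snd x)) = F"
      using per by (auto simp: per_x1_def)
    ultimately show "(F has_derivative (\<lambda>h. fst h *\<^sub>R D1 F (x1 + 2 * pi, x2) + snd h *\<^sub>R D2 F (x1 + 2 * pi, x2))) (at (x1, x2))"
      by simp
  qed
  then show "per_x1 (D1 F)" "per_x1 (D2 F)" by (auto simp: per_x1_def D1_def D2_def)
qed

lemma smooth_per_combine:
  "smooth_per F \<Longrightarrow> smooth_per G \<Longrightarrow> smooth_per (\<lambda>x. F x + c * G x)"
  by (simp add: smooth_per_def smooth_combine per_x1_def)

lemma sq_combine_le:
  assumes "sqint M f" "sqint M g"
  shows "sq M (\<lambda>x. f x + c * g x) \<le> 2 * sq M f + 2 * (cmod c)\<^sup>2 * sq M g"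
proof -
  have cg: "sqint M (\<lambda>x. c * g x)" by (rule sqint_scale[OF assms(2)])
  have "sq M (\<lambda>x. f x + c * g x) \<le> (\<integral>x. 2 * (cmod (f x))\<^sup>2 + 2 * (cmod (c * g x))\<^sup>2 \<partial>M)"
    unfolding sq_def
    by (rule integral_mono) (use sqint_add[OF assms(1) cg] assms(1) cg sq_norm_add_le in \<open>auto simp: sqint_def\<close>)
  also have "\<dots> = 2 * sq M f + 2 * sq M (\<lambda>x. c * g x)"
    unfolding sq_def using assms(1) cg by (simp add: sqint_def)
  also have "sq M (\<lambda>x. c * g x) = (cmod c)\<^sup>2 * sq M g" by (simp add: sq_def norm_mult power_mult_distrib)
  finally show ?thesis by simp
qed

lemma ip_diff_left:
  assumes "sqint M f" "sqint M g" "sqint M h" shows "ip M (\<lambda>x. f x - g x) h = ip M f h - ip M g h"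
  using lin_on_diff[OF fun_space_sqint herm_on_lin[OF herm_on_ip], of h M f g] assms by simp

lemma ip_limit:
  assumes f: "\<And>n. sqint M (f n)" and g: "sqint M g" and h: "sqint M h"
    and lim: "(\<lambda>n. sq M (\<lambda>x. g x - f n x)) \<longlonglongrightarrow> 0"
  shows "(\<lambda>n. ip M (f n) h) \<longlonglongrightarrow> ip M g h"
proof -
  have "(\<lambda>n. ip M (f n) h - ip M g h) \<longlonglongrightarrow> 0"
  proof (rule Lim_null_comparison)
    show "\<forall>\<^sub>F n in sequentially. cmod (ip M (f n) h - ip M g h) \<le> sqrt (sq M (\<lambda>x. g x - f n x)) * sqrt (sq M h)"
    proof (rule always_eventually, rule allI)
      fix n
      have "ip M (\<lambda>x. g x - f n x) h = ip M g h - ip M (f n) h" by (rule ip_diff_left[OF g f h])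
      moreover have "cmod (ip M (\<lambda>x. g x - f n x) h) \<le> sqrt (sq M (\<lambda>x. g x - f n x)) * sqrt (sq M h)"
        by (rule ip_cauchy_schwarz[OF sqint_diff[OF g f] h])
      ultimately show "cmod (ip M (f n) h - ip M g h) \<le> sqrt (sq M (\<lambda>x. g x - f n x)) * sqrt (sq M h)"
        by (simp add: norm_minus_commute)
    qed
    show "(\<lambda>n. sqrt (sq M (\<lambda>x. g x - f n x)) * sqrt (sq M h)) \<longlonglongrightarrow> 0"
      using tendsto_mult_left_zero[OF tendsto_real_sqrt[OF lim, simplified]] by simp
  qed
  then show ?thesis by (rule LIM_zero_cancel)
qed

text \<open>The reverse triangle inequality for the square roots.\<close>

lemma sq_limit:
  assumes f: "\<And>n. sqint M (f n)" and g: "sqint M g"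
    and lim: "(\<lambda>n. sq M (\<lambda>x. g x - f n x)) \<longlonglongrightarrow> 0"
  shows "(\<lambda>n. sq M (f n)) \<longlonglongrightarrow> sq M g"
proof -
  have "(\<lambda>n. sqrt (sq M (f n)) - sqrt (sq M g)) \<longlonglongrightarrow> 0"
  proof (rule Lim_null_comparison)
    show "\<forall>\<^sub>F n in sequentially. norm (sqrt (sq M (f n)) - sqrt (sq M g)) \<le> sqrt (sq M (\<lambda>x. g x - f n x))"
    proof (rule always_eventually, rule allI)
      fix n
      have "sqrt (sq M g) \<le> sqrt (sq M (\<lambda>x. g x - f n x)) + sqrt (sq M (f n))"
        using sq_triangle[OF sqint_diff[OF g f[of n]] f[of n]] by simp
      moreover have "sqrt (sq M (f n)) \<le> sqrt (sq M (\<lambda>x. f n x - g x)) + sqrt (sq M g)"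
        using sq_triangle[OF sqint_diff[OF f[of n] g] g] by simp
      ultimately show "norm (sqrt (sq M (f n)) - sqrt (sq M g)) \<le> sqrt (sq M (\<lambda>x. g x - f n x))"
        using sq_diff_commute[of M g "f n"] by (simp add: abs_le_iff)
    qed
    show "(\<lambda>n. sqrt (sq M (\<lambda>x. g x - f n x))) \<longlonglongrightarrow> 0" using tendsto_real_sqrt[OF lim] by simp
  qed
  then have "(\<lambda>n. sqrt (sq M (f n))) \<longlonglongrightarrow> sqrt (sq M g)" by (rule LIM_zero_cancel)
  from tendsto_power[OF this, of 2] show ?thesis by (simp add: sq_nonneg)
qed

section \<open>The period cell and approximation by smooth periodic functions\<close>

locale strip =
  fixes d0 :: real
  assumes d0: "d0 > 0"
begin

abbreviation "\<Omega> \<equiv> Omega0 d0"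
abbreviation "R \<equiv> cbox (-pi, -d0) (pi, d0)"
abbreviation "M \<equiv> restrict_space lborel \<Omega>"

lemma Omega_box: "\<Omega> = box (-pi, -d0) (pi, d0)"
  by (auto simp: Omega0_def mem_box Basis_prod_def inner_prod_def ball_Un)

lemma Omega_sets [measurable]: "\<Omega> \<in> sets lborel"
  unfolding Omega_box by simp

lemma Omega_sets': "\<Omega> \<inter> space lborel \<in> sets lborel"
  using Omega_sets by simp

text \<open>The boundary of the rectangle is a null set. This allows gauge integrals over the closed
  rectangle to stand for Lebesgue integrals over the open cell.\<close>

lemma Omega_R: "AE x in lborel. x \<in> R \<longleftrightarrow> x \<in> \<Omega>"
proof -
  have "emeasure lborel (R - \<Omega>) = emeasure lborel R - emeasure lborel \<Omega>"
    unfolding Omega_box by (rule emeasure_Diff) (auto simp: box_subset_cbox emeasure_lborel_box_eq)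
  also have "\<dots> = 0" unfolding Omega_box by (simp add: emeasure_lborel_box_eq emeasure_lborel_cbox_eq)
  finally have "R - \<Omega> \<in> null_sets lborel" unfolding Omega_box by (intro null_setsI) auto
  from AE_not_in[OF this] show ?thesis
  proof (rule AE_mp, intro AE_I2 impI)
    fix x assume "x \<notin> R - \<Omega>"
    then show "x \<in> R \<longleftrightarrow> x \<in> \<Omega>" using box_subset_cbox[of "(-pi, -d0)" "(pi, d0)"] unfolding Omega_box by blast
  qed
qed

lemma LINT_Omega: "(LINT x:\<Omega>|lborel. f x) = integral\<^sup>L M f" for f :: "pt \<Rightarrow> 'b::{banach, second_countable_topology}"
  by (simp add: integral_restrict_space[OF Omega_sets'] set_lebesgue_integral_def)

lemma AE_Omega: "(AE x in lborel. x \<in> \<Omega> \<longrightarrow> P x) \<longleftrightarrow> (AE x in M. P x)"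
  by (simp add: AE_restrict_space_iff[OF Omega_sets'])

lemma L2_sqint: "L2 d0 f \<longleftrightarrow> sqint M f"
  unfolding L2_def sqint_def set_borel_measurable_def set_integrable_def
  by (simp add: borel_measurable_restrict_space_iff[OF Omega_sets'] integrable_restrict_space[OF Omega_sets'])

text \<open>Stated for boxes inside the closed rectangle, since it serves the rectangle itself and
  the cells of the partition.\<close>

lemma LINT_R:
  fixes f :: "pt \<Rightarrow> 'b::euclidean_space"
  assumes "continuous_on UNIV f" and "A = cbox a b" "A \<subseteq> R"
  shows "integrable M (\<lambda>x. indicator A x *\<^sub>R f x)" "(\<integral>x. indicator A x *\<^sub>R f x \<partial>M) = integral A f"
proof -
  have i: "set_integrable lborel A f"
    unfolding set_integrable_def using assms by (auto intro!: borel_integrable_compact intro: continuous_on_subset)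
  have e: "AE x in lborel. indicator \<Omega> x *\<^sub>R (indicator A x *\<^sub>R f x) = indicator A x *\<^sub>R f x"
    using Omega_R by eventually_elim (use assms(3) in \<open>auto simp: indicator_def\<close>)
  have m: "(\<lambda>x. indicator A x *\<^sub>R f x) \<in> borel_measurable lborel"
    using i unfolding set_integrable_def by (rule borel_measurable_integrable)
  have m': "(\<lambda>x. indicator \<Omega> x *\<^sub>R (indicator A x *\<^sub>R f x)) \<in> borel_measurable lborel"
    using m by measurable
  show "integrable M (\<lambda>x. indicator A x *\<^sub>R f x)"
    using i integrable_cong_AE[OF m' m e] by (simp add: integrable_restrict_space[OF Omega_sets'] set_integrable_def)
  have "(\<integral>x. indicator A x *\<^sub>R f x \<partial>M) = (LINT x:A|lborel. f x)"
    using integral_cong_AE[OF m' m e] by (simp add: integral_restrict_space[OF Omega_sets'] set_lebesgue_integral_def)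
  also have "\<dots> = integral A f" by (rule set_borel_integral_eq_integral(2)[OF i])
  finally show "(\<integral>x. indicator A x *\<^sub>R f x \<partial>M) = integral A f" .
qed

lemma integral_M_cont:
  fixes f :: "pt \<Rightarrow> 'b::euclidean_space"
  assumes "continuous_on UNIV f"
  shows "integrable M f" "integral\<^sup>L M f = integral R f"
proof -
  have "\<Omega> \<subseteq> R" unfolding Omega_box by (rule box_subset_cbox)
  then have e: "indicator R x *\<^sub>R f x = f x" if "x \<in> space M" for x
    using that by (auto simp: space_restrict_space indicator_def)
  show "integrable M f"
    using LINT_R(1)[OF assms refl order_refl] Bochner_Integration.integrable_cong[OF refl e, of M] by simp
  show "integral\<^sup>L M f = integral R f" 
    using LINT_R(2)[OF assms refl order_refl] Bochner_Integration.integral_cong[OF refl e, of M] by simp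
qed

lemma sqint_cont:
  assumes "continuous_on UNIV f" shows "sqint M f"
proof -
  have "f \<in> borel_measurable M" using integral_M_cont(1)[OF assms] by (rule borel_measurable_integrable)
  moreover have "integrable M (\<lambda>x. (cmod (f x))\<^sup>2)" by (intro integral_M_cont continuous_intros assms)
  ultimately show ?thesis by (simp add: sqint_def)
qed

lemma sq_cont: "continuous_on UNIV f \<Longrightarrow> sq M f = integral R (\<lambda>x. (cmod (f x))\<^sup>2)"
  unfolding sq_def by (intro integral_M_cont continuous_intros)

lemma ip_cont: "continuous_on UNIV f \<Longrightarrow> continuous_on UNIV g \<Longrightarrow> ip M f g = cip (-pi, -d0) (pi, d0) f g"
  unfolding ip_def cip_def by (intro integral_M_cont continuous_intros)

lemma smooth_per_facts:
  assumes "smooth_per F"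
  shows "sqint M F" "sqint M (D1 F)" "sqint M (D2 F)"
    "C1_fun F (D1 F) (D2 F)" "per_x1 F"
    "continuous_on UNIV F" "continuous_on UNIV (D1 F)" "continuous_on UNIV (D2 F)"
  using assms smooth_cases smooth_cont smooth_C1 sqint_cont by (auto simp: smooth_per_def)

text \<open>\<open>approx_seq\<close> with the gradient split into components and square
  integrability built in, so that convergence is that of three separate sequences in L2.\<close>

definition appr :: "(pt \<Rightarrow> complex) \<Rightarrow> (pt \<Rightarrow> complex) \<Rightarrow> (pt \<Rightarrow> complex) \<Rightarrow> (nat \<Rightarrow> pt \<Rightarrow> complex) \<Rightarrow> bool" where
  "appr u g1 g2 F \<longleftrightarrow> sqint M u \<and> sqint M g1 \<and> sqint M g2 \<and> (\<forall>n. smooth_per (F n)) \<and>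
     (\<lambda>n. sq M (\<lambda>x. u x - F n x)) \<longlonglongrightarrow> 0 \<and> (\<lambda>n. sq M (\<lambda>x. g1 x - D1 (F n) x)) \<longlonglongrightarrow> 0 \<and>
     (\<lambda>n. sq M (\<lambda>x. g2 x - D2 (F n) x)) \<longlonglongrightarrow> 0"

lemma H1dist2_eq:
  assumes "sqint M u" "sqint M (\<lambda>x. fst (g x))" "sqint M (\<lambda>x. snd (g x))" "smooth_per F"
  shows "H1dist2 d0 u g F (cgrad F) = sq M (\<lambda>x. u x - F x) + sq M (\<lambda>x. fst (g x) - D1 F x) + sq M (\<lambda>x. snd (g x) - D2 F x)"
proof -
  have "integrable M (\<lambda>x. (cmod (u x - F x))\<^sup>2)" "integrable M (\<lambda>x. (cmod (fst (g x) - D1 F x))\<^sup>2)"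
    "integrable M (\<lambda>x. (cmod (snd (g x) - D2 F x))\<^sup>2)"
    using sqint_diff assms(1-3) smooth_per_facts[OF assms(4)] unfolding sqint_def by blast+
  then show ?thesis unfolding H1dist2_def LINT_Omega cnorm2_def sq_def
    by (simp add: D1_def D2_def)
qed

lemma approx_seq_iff:
  assumes "sqint M u" "sqint M (\<lambda>x. fst (g x))" "sqint M (\<lambda>x. snd (g x))"
  shows "approx_seq d0 u g F \<longleftrightarrow> appr u (\<lambda>x. fst (g x)) (\<lambda>x. snd (g x)) F"
proof (cases "\<forall>n. smooth_per (F n)")
  case True
  have "(\<lambda>n. H1dist2 d0 u g (F n) (cgrad (F n))) = (\<lambda>n. sq M (\<lambda>x. u x - F n x) + sq M (\<lambda>x. fst (g x) - D1 (F n) x) + sq M (\<lambda>x. snd (g x) - D2 (F n) x))"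
    using H1dist2_eq[OF assms] True by auto
  moreover have "(\<lambda>n. a n + b n + c n) \<longlonglongrightarrow> 0 \<longleftrightarrow> a \<longlonglongrightarrow> 0 \<and> b \<longlonglongrightarrow> 0 \<and> c \<longlonglongrightarrow> 0"
    if nn: "\<And>n. 0 \<le> a n" "\<And>n. 0 \<le> b n" "\<And>n. 0 \<le> c n" for a b c :: "nat \<Rightarrow> real"
  proof
    assume l: "(\<lambda>n. a n + b n + c n) \<longlonglongrightarrow> 0"
    have "f \<longlonglongrightarrow> 0" if "\<And>n. 0 \<le> f n" "\<And>n. f n \<le> a n + b n + c n" for f :: "nat \<Rightarrow> real"
      by (rule tendsto_sandwich[OF _ _ tendsto_const l]) (use that in auto)
    then show "a \<longlonglongrightarrow> 0 \<and> b \<longlonglongrightarrow> 0 \<and> c \<longlonglongrightarrow> 0" using nn by (simp add: add_increasing add_increasing2)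
  next
    assume "a \<longlonglongrightarrow> 0 \<and> b \<longlonglongrightarrow> 0 \<and> c \<longlonglongrightarrow> 0"
    then show "(\<lambda>n. a n + b n + c n) \<longlonglongrightarrow> 0" using tendsto_add[OF tendsto_add, of a 0 _ b 0 c 0] by simp
  qed
  ultimately show ?thesis using True assms by (simp add: approx_seq_def appr_def sq_nonneg)
qed (auto simp: approx_seq_def appr_def)

lemma H1per_g_iff: "H1per_g d0 u g \<longleftrightarrow> (\<exists>F. appr u (\<lambda>x. fst (g x)) (\<lambda>x. snd (g x)) F)"
  unfolding H1per_g_def L2_sqint using approx_seq_iff[of u g] by (auto simp: appr_def)

lemma appr_combine:
  assumes a: "appr u g1 g2 F" and b: "appr v h1 h2 G"
  shows "appr (\<lambda>x. u x + c * v x) (\<lambda>x. g1 x + c * h1 x) (\<lambda>x. g2 x + c * h2 x) (\<lambda>n x. F n x + c * G n x)"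
proof -
  have lim: "(\<lambda>n. sq M (\<lambda>x. (f x + c * f' x) - (p n x + c * q n x))) \<longlonglongrightarrow> 0"
    if "sqint M f" "sqint M f'" "\<And>n. sqint M (p n)" "\<And>n. sqint M (q n)"
      and l: "(\<lambda>n. sq M (\<lambda>x. f x - p n x)) \<longlonglongrightarrow> 0" "(\<lambda>n. sq M (\<lambda>x. f' x - q n x)) \<longlonglongrightarrow> 0" for f f' p q
  proof (rule tendsto_sandwich[OF _ _ tendsto_const])
    show "(\<lambda>n. 2 * sq M (\<lambda>x. f x - p n x) + 2 * (cmod c)\<^sup>2 * sq M (\<lambda>x. f' x - q n x)) \<longlonglongrightarrow> 0"
      using tendsto_add[OF tendsto_mult_right_zero[OF l(1), of 2] tendsto_mult_right_zero[OF l(2), of "2 * (cmod c)\<^sup>2"]] by simp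
    show "\<forall>\<^sub>F n in sequentially. sq M (\<lambda>x. (f x + c * f' x) - (p n x + c * q n x)) \<le> 2 * sq M (\<lambda>x. f x - p n x) + 2 * (cmod c)\<^sup>2 * sq M (\<lambda>x. f' x - q n x)"
    proof (rule always_eventually, rule allI)
      fix n
      show "sq M (\<lambda>x. (f x + c * f' x) - (p n x + c * q n x)) \<le> 2 * sq M (\<lambda>x. f x - p n x) + 2 * (cmod c)\<^sup>2 * sq M (\<lambda>x. f' x - q n x)"
        using sq_combine_le[OF sqint_diff[OF that(1) that(3)[of n]] sqint_diff[OF that(2) that(4)[of n]], of c]
        by (simp add: algebra_simps)
    qed
  qed (simp add: sq_nonneg)
  have s: "smooth_per (F n)" "smooth_per (G n)" for n using a b by (auto simp: appr_def)
  have sm: "smooth_fun (F n)" "smooth_fun (G n)" for n using s by (auto simp: smooth_per_def)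
  have A: "sqint M u" "sqint M g1" "sqint M g2" "(\<lambda>n. sq M (\<lambda>x. u x - F n x)) \<longlonglongrightarrow> 0"
    "(\<lambda>n. sq M (\<lambda>x. g1 x - D1 (F n) x)) \<longlonglongrightarrow> 0" "(\<lambda>n. sq M (\<lambda>x. g2 x - D2 (F n) x)) \<longlonglongrightarrow> 0"
    using a by (auto simp: appr_def)
  have B: "sqint M v" "sqint M h1" "sqint M h2" "(\<lambda>n. sq M (\<lambda>x. v x - G n x)) \<longlonglongrightarrow> 0"
    "(\<lambda>n. sq M (\<lambda>x. h1 x - D1 (G n) x)) \<longlonglongrightarrow> 0" "(\<lambda>n. sq M (\<lambda>x. h2 x - D2 (G n) x)) \<longlonglongrightarrow> 0"
    using b by (auto simp: appr_def)
  note sF = smooth_per_facts[OF s(1)] and sG = smooth_per_facts[OF s(2)]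
  show ?thesis unfolding appr_def D_combine[OF sm]
    using lim[OF A(1) B(1) sF(1) sG(1) A(4) B(4)] lim[OF A(2) B(2) sF(2) sG(2) A(5) B(5)]
      lim[OF A(3) B(3) sF(3) sG(3) A(6) B(6)] A(1-3) B(1-3) s
    by (simp add: sqint_add sqint_scale smooth_per_combine)
qed

lemma appr_zero: "appr (\<lambda>_. 0) (\<lambda>_. 0) (\<lambda>_. 0) (\<lambda>_ _. 0)"
proof -
  have "cgrad (\<lambda>_. 0) x = (0, 0)" for x by (rule cgrad_unique) auto
  then have "D1 (\<lambda>_. 0) = (\<lambda>_. 0)" "D2 (\<lambda>_. 0) = (\<lambda>_. 0)" by (auto simp: D1_def D2_def)
  then show ?thesis by (simp add: appr_def sqint_zero smooth_per_def smooth_const per_x1_def sq_def)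
qed

text \<open>The approximants are smooth, so \<open>\<langle>g\<^sub>1, \<partial>\<^sub>1 F\<^sub>k\<rangle>\<close> can be integrated by parts
  against \<open>\<partial>\<^sub>1 F\<^sub>k\<close> itself; no separate space of test functions is needed.\<close>

lemma appr_null_gradient:
  assumes a: "appr u g1 g2 F" and z: "AE x in M. u x = 0"
  shows "AE x in M. g1 x = 0" "AE x in M. g2 x = 0"
proof -
  have si: "sqint M u" "sqint M g1" "sqint M g2" and s: "\<And>n. smooth_per (F n)"
    and l: "(\<lambda>n. sq M (\<lambda>x. u x - F n x)) \<longlonglongrightarrow> 0" "(\<lambda>n. sq M (\<lambda>x. g1 x - D1 (F n) x)) \<longlonglongrightarrow> 0"
      "(\<lambda>n. sq M (\<lambda>x. g2 x - D2 (F n) x)) \<longlonglongrightarrow> 0"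
    using a by (auto simp: appr_def)
  note sF = smooth_per_facts[OF s]
  have sm: "smooth_fun (F n)" for n using s by (simp add: smooth_per_def)
  have sm1: "smooth_per (D1 (F n))" "smooth_per (D2 (F n))" for n
    using s smooth_cases[OF sm] D1_periodic[OF sm] by (auto simp: smooth_per_def)
  note s1F = smooth_per_facts[OF sm1(1)] and s2F = smooth_per_facts[OF sm1(2)]
  have F0: "(\<lambda>n. sq M (F n)) \<longlonglongrightarrow> 0"
    using sq_limit[OF sF(1) si(1) l(1)] z sq_eq_0_iff[OF si(1)] by simp
  have ipF0: "(\<lambda>n. ip M (F n) q) \<longlonglongrightarrow> 0" if q: "sqint M q" for q
  proof (rule Lim_null_comparison)
    show "\<forall>\<^sub>F n in sequentially. cmod (ip M (F n) q) \<le> sqrt (sq M (F n)) * sqrt (sq M q)"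
      by (rule always_eventually) (simp add: ip_cauchy_schwarz[OF sF(1) q])
    show "(\<lambda>n. sqrt (sq M (F n)) * sqrt (sq M q)) \<longlonglongrightarrow> 0"
      using tendsto_mult_left_zero[OF tendsto_real_sqrt[OF F0, simplified]] by simp
  qed
  \<comment> \<open>The traces on the horizontal edges must disappear in the limit, since Green's
    formula in the second variable has boundary terms there.\<close>
  have trace0: "(\<lambda>n. integral {-pi..pi} (\<lambda>x. (cmod (F n (x, e)))\<^sup>2)) \<longlonglongrightarrow> 0" (is "?t \<longlonglongrightarrow> 0")
    if e: "e \<in> {-d0..d0}" for e
  proof (rule LIMSEQ_I)
    fix r :: real assume r: "r > 0"
    obtain b where b: "b > 0" "\<And>n. sq M (D2 (F n)) \<le> b"
      using convergent_imp_Bseq[OF convergentI[OF sq_limit[OF sF(3) si(3) l(3)]]]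
      by (auto simp: Bseq_def sq_nonneg)
    \<comment> \<open>With this choice the vertical derivatives, bounded by b, contribute at most r
      / 2.\<close>
    define \<theta> where "\<theta> = 2 * b / r"
    have \<theta>: "\<theta> > 0" using b r by (simp add: \<theta>_def)
    define K where "K = 1 / (2 * d0) + \<theta>"
    have K: "K > 0" using d0 \<theta> by (simp add: K_def add_pos_pos)
    obtain n0 where n0: "\<And>n. n \<ge> n0 \<Longrightarrow> sq M (F n) < r / (2 * K)"
      using LIMSEQ_D[OF F0, of "r / (2 * K)"] r K by (auto simp: sq_nonneg)
    have "norm (?t n - 0) < r" if n: "n \<ge> n0" for n
    proof -
      have "0 \<le> ?t n" by (intro integral_nonneg integrable_continuous_real continuous_intros cont_slice sF) auto
      moreover have "?t n \<le> K * sq M (F n) + 1 / \<theta> * sq M (D2 (F n))"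
        using slice_trace_bound[OF sF(4) d0 e \<theta>] by (simp add: K_def sq_cont sF)
      moreover have "K * sq M (F n) < r / 2" using n0[OF n] K by (simp add: field_simps)
      moreover have "1 / \<theta> * sq M (D2 (F n)) \<le> 1 / \<theta> * b" using b(2) \<theta> by (intro mult_left_mono) auto
      moreover have "1 / \<theta> * b = r / 2" using b r by (simp add: \<theta>_def)
      ultimately show ?thesis by simp
    qed
    then show "\<exists>no. \<forall>n\<ge>no. norm (?t n - 0) < r" by blast
  qed
  have bd: "(\<lambda>n. cip (-pi) pi (\<lambda>x. F n (x, e)) (\<lambda>x. q (x, e))) \<longlonglongrightarrow> 0" if e: "e \<in> {-d0..d0}" and q: "continuous_on UNIV q" for e q
  proof (rule Lim_null_comparison)
    define Q where "Q = integral {-pi..pi} (\<lambda>x. (cmod (q (x, e)))\<^sup>2)"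
    show "\<forall>\<^sub>F n in sequentially. cmod (cip (-pi) pi (\<lambda>x. F n (x, e)) (\<lambda>x. q (x, e))) \<le> sqrt (?t e n * Q)"
    proof (rule always_eventually, rule allI)
      fix n
      have "(cmod (cip (-pi) pi (\<lambda>x. F n (x, e)) (\<lambda>x. q (x, e))))\<^sup>2 \<le> ?t e n * Q"
        using integral_cauchy_schwarz[of "-pi" pi "\<lambda>x. F n (x, e)" "\<lambda>x. q (x, e)"] cont_slice(1)[OF sF(6)] cont_slice(1)[OF q]
        by (simp add: cip_def Q_def)
      then show "cmod (cip (-pi) pi (\<lambda>x. F n (x, e)) (\<lambda>x. q (x, e))) \<le> sqrt (?t e n * Q)" by (rule real_le_rsqrt)
    qed
    show "(\<lambda>n. sqrt (?t e n * Q)) \<longlonglongrightarrow> 0"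
      using tendsto_real_sqrt[OF tendsto_mult_left_zero[OF trace0[OF e]]] by simp
  qed
  \<comment> \<open>For fixed k the derivative is moved from \<open>F n\<close> onto the smooth
    function \<open>D1 (F k)\<close>, and then \<open>F n\<close> tends to 0.\<close>
  have z1: "ip M g1 (D1 (F k)) = 0" for k
  proof (rule LIMSEQ_unique)
    show "(\<lambda>n. ip M (D1 (F n)) (D1 (F k))) \<longlonglongrightarrow> ip M g1 (D1 (F k))"
      by (rule ip_limit[OF sF(2) si(2) sF(2) l(2)])
    have "ip M (D1 (F n)) (D1 (F k)) = - ip M (F n) (D1 (D1 (F k)))" for n
      using green_x1[OF sF(4,5)[of n] s1F(4,5)[of k], of d0] by (simp add: ip_cont sF s1F)
    then show "(\<lambda>n. ip M (D1 (F n)) (D1 (F k))) \<longlonglongrightarrow> 0"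
      using tendsto_minus[OF ipF0[OF s1F(2)]] by simp
  qed
  have z2: "ip M g2 (D2 (F k)) = 0" for k
  proof (rule LIMSEQ_unique)
    show "(\<lambda>n. ip M (D2 (F n)) (D2 (F k))) \<longlonglongrightarrow> ip M g2 (D2 (F k))"
      by (rule ip_limit[OF sF(3) si(3) sF(3) l(3)])
    have e: "ip M (D2 (F n)) (D2 (F k)) = - ip M (F n) (D2 (D2 (F k))) +
      (cip (-pi) pi (\<lambda>x. F n (x, d0)) (\<lambda>x. D2 (F k) (x, d0)) - cip (-pi) pi (\<lambda>x. F n (x, -d0)) (\<lambda>x. D2 (F k) (x, -d0)))" for n
      using green_x2[OF sF(4)[of n] s2F(4)[of k] d0] by (simp add: ip_cont sF s2F)
    have "(\<lambda>n. - ip M (F n) (D2 (D2 (F k))) +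
      (cip (-pi) pi (\<lambda>x. F n (x, d0)) (\<lambda>x. D2 (F k) (x, d0)) - cip (-pi) pi (\<lambda>x. F n (x, -d0)) (\<lambda>x. D2 (F k) (x, -d0)))) \<longlonglongrightarrow> - 0 + (0 - 0)"
      by (intro tendsto_intros ipF0 bd s2F) (use d0 in \<open>auto intro: s2F sF\<close>)
    then show "(\<lambda>n. ip M (D2 (F n)) (D2 (F k))) \<longlonglongrightarrow> 0" unfolding e by simp
  qed
  \<comment> \<open>A function orthogonal to every member of a sequence that converges to it is
    orthogonal to itself.\<close>
  have self0: "AE x in M. g x = 0" if g: "sqint M g" and p: "\<And>n. sqint M (p n)" and lp: "(\<lambda>n. sq M (\<lambda>x. g x - p n x)) \<longlonglongrightarrow> 0"
    and z: "\<And>k. ip M g (p k) = 0" for g p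
  proof -
    have "(\<lambda>n. ip M (p n) g) \<longlonglongrightarrow> ip M g g" by (rule ip_limit[OF p g g lp])
    moreover have "ip M (p n) g = 0" for n
      using herm_on_sym[OF herm_on_ip, of g M "p n"] z g p by simp
    ultimately have "ip M g g = 0" using LIMSEQ_unique[OF _ tendsto_const[of 0]] by auto
    then show ?thesis using sq_eq_0_iff[OF g] by (simp add: ip_self)
  qed
  show "AE x in M. g1 x = 0" by (rule self0[OF si(2) sF(2) l(2) z1])
  show "AE x in M. g2 x = 0" by (rule self0[OF si(3) sF(3) l(3) z2])
qed

end

section \<open>The periodic Sobolev space as a Hilbert space of functions\<close>

context strip
begin

abbreviation "V \<equiv> {u. H1per d0 u}"

definition "G1 u x = fst (grad d0 u x)" for u :: "pt \<Rightarrow> complex"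
definition "G2 u x = snd (grad d0 u x)" for u :: "pt \<Rightarrow> complex"

lemma H1perI: "appr u g1 g2 F \<Longrightarrow> u \<in> V"
  using H1per_g_iff[of u "\<lambda>x. (g1 x, g2 x)"] by (auto simp: H1per_def)

text \<open>The choice in \<open>grad\<close> comes with an approximating sequence of its own, which
  need not be the one that witnessed membership in the space.\<close>

lemma grad_appr: assumes "u \<in> V" obtains F where "appr u (G1 u) (G2 u) F"
proof -
  have "H1per_g d0 u (grad d0 u)" 
    using assms someI_ex[of "H1per_g d0 u"] unfolding grad_def H1per_def by blast
  then show ?thesis using that unfolding H1per_g_iff G1_def[abs_def] G2_def[abs_def] by blast
qed

lemma appr_sqint: "appr u g1 g2 F \<Longrightarrow> sqint M u" "appr u g1 g2 F \<Longrightarrow> sqint M g1" "appr u g1 g2 F \<Longrightarrow> sqint M g2"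
  "appr u g1 g2 F \<Longrightarrow> smooth_per (F n)"
  by (auto simp: appr_def)

lemma appr_lim: "appr u g1 g2 F \<Longrightarrow> (\<lambda>n. sq M (\<lambda>x. u x - F n x)) \<longlonglongrightarrow> 0"
  "appr u g1 g2 F \<Longrightarrow> (\<lambda>n. sq M (\<lambda>x. g1 x - D1 (F n) x)) \<longlonglongrightarrow> 0"
  "appr u g1 g2 F \<Longrightarrow> (\<lambda>n. sq M (\<lambda>x. g2 x - D2 (F n) x)) \<longlonglongrightarrow> 0"
  by (auto simp: appr_def)

lemma V_sqint: assumes "u \<in> V" shows "sqint M u" "sqint M (G1 u)" "sqint M (G2 u)"
proof -
  obtain F where F: "appr u (G1 u) (G2 u) F" using grad_appr[OF assms] .
  show "sqint M u" "sqint M (G1 u)" "sqint M (G2 u)" using appr_sqint[OF F] by auto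
qed

text \<open>Subtraction reduces uniqueness of the weak gradient to
  \<open>appr_null_gradient\<close>. Since \<open>grad\<close> is defined by choice, this is what
  makes it linear up to null sets.\<close>

lemma appr_gradient_unique:
  assumes a: "appr u g1 g2 F" and b: "appr v h1 h2 G" and e: "AE x in M. u x = v x"
  shows "AE x in M. g1 x = h1 x" "AE x in M. g2 x = h2 x"
proof -
  have "AE x in M. u x + (-1) * v x = 0" using e by eventually_elim simp
  from appr_null_gradient[OF appr_combine[OF a b, of "-1"] this]
  show "AE x in M. g1 x = h1 x" "AE x in M. g2 x = h2 x" by simp_all
qed

lemma grad_AE:
  assumes "appr u g1 g2 F" shows "AE x in M. G1 u x = g1 x" "AE x in M. G2 u x = g2 x"
proof -
  obtain F' where "appr u (G1 u) (G2 u) F'" using grad_appr H1perI[OF assms] by blast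
  from appr_gradient_unique[OF this assms] show "AE x in M. G1 u x = g1 x" "AE x in M. G2 u x = g2 x" by auto
qed

lemma fun_space_V: "fun_space V"
proof -
  have "(\<lambda>x. u x + c * v x) \<in> V" if u: "u \<in> V" and v: "v \<in> V" for u v c
  proof -
    obtain F where F: "appr u (G1 u) (G2 u) F" using grad_appr[OF u] .
    obtain G where G: "appr v (G1 v) (G2 v) G" using grad_appr[OF v] .
    show ?thesis by (rule H1perI[OF appr_combine[OF F G]])
  qed
  note c = this
  have z: "(\<lambda>_. 0) \<in> V" by (rule H1perI[OF appr_zero])
  show ?thesis unfolding fun_space_def
  proof (intro conjI ballI allI z)
    fix u v assume "u \<in> V" "v \<in> V"
    from c[OF this, of 1] show "(\<lambda>x. u x + v x) \<in> V" by simp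
  next
    fix c u assume "u \<in> V"
    from c[OF z this, of c] show "(\<lambda>x. c * u x) \<in> V" by simp
  qed
qed

lemma grad_combine:
  assumes "u \<in> V" "v \<in> V"
  shows "AE x in M. G1 (\<lambda>x. u x + c * v x) x = G1 u x + c * G1 v x"
    "AE x in M. G2 (\<lambda>x. u x + c * v x) x = G2 u x + c * G2 v x"
proof -
  obtain F where F: "appr u (G1 u) (G2 u) F" using grad_appr[OF assms(1)] .
  obtain G where G: "appr v (G1 v) (G2 v) G" using grad_appr[OF assms(2)] .
  from grad_AE[OF appr_combine[OF F G, of c]]
  show "AE x in M. G1 (\<lambda>x. u x + c * v x) x = G1 u x + c * G1 v x"
    "AE x in M. G2 (\<lambda>x. u x + c * v x) x = G2 u x + c * G2 v x" by auto
qed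

lemma V_combine: "u \<in> V \<Longrightarrow> v \<in> V \<Longrightarrow> (\<lambda>x. u x + c * v x) \<in> V"
  using fun_spaceD(2)[OF fun_space_V _ fun_spaceD(3)[OF fun_space_V], of u v c] by simp

lemma lin_onI_combine:
  assumes V: "fun_space W" and c: "\<And>u v c. u \<in> W \<Longrightarrow> v \<in> W \<Longrightarrow> f (\<lambda>x. u x + c * v x) = f u + c * f v"
  shows "lin_on W f"
proof -
  have z: "(\<lambda>_. 0) \<in> W" by (rule fun_spaceD(1)[OF V])
  have "f (\<lambda>_. 0) = 0" using c[OF z z, of 1] by simp
  then have "f (\<lambda>x. c * u x) = c * f u" if "u \<in> W" for c u using c[OF z that, of c] by simp
  then show ?thesis using c[of _ _ 1] by (simp add: lin_on_def)
qed

lemma ip_combine: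
  assumes "AE x in M. f x = u x + c * v x" "sqint M f" "sqint M u" "sqint M v" "sqint M w"
  shows "ip M f w = ip M u w + c * ip M v w"
proof -
  have cv: "sqint M (\<lambda>x. c * v x)" by (rule sqint_scale[OF assms(4)])
  have "ip M f w = ip M (\<lambda>x. u x + c * v x) w"
    by (rule ip_cong_AE[OF assms(1)]) (use assms sqint_add[OF assms(3) cv] in \<open>auto intro: sqint_meas\<close>)
  then show ?thesis
    using lin_onD[OF herm_on_lin[OF herm_on_ip, of w M]] assms cv by simp
qed

lemma ip_linear:
  assumes "sqint M w"
  shows "lin_on V (\<lambda>u. ip M u w)" "lin_on V (\<lambda>u. ip M (G1 u) w)" "lin_on V (\<lambda>u. ip M (G2 u) w)"
  by (rule lin_onI_combine[OF fun_space_V], rule ip_combine,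
      auto intro: V_sqint grad_combine assms V_combine[simplified] simp: V_sqint V_combine)+

definition ipH :: "(pt \<Rightarrow> complex) \<Rightarrow> (pt \<Rightarrow> complex) \<Rightarrow> complex" where
  "ipH u v = ip M u v + ip M (G1 u) (G1 v) + ip M (G2 u) (G2 v)"

lemma lin_on_add: "lin_on W f \<Longrightarrow> lin_on W g \<Longrightarrow> lin_on W (\<lambda>u. f u + g u)"
  by (auto simp: lin_on_def distrib_left)

lemma ip_sym: "sqint M u \<Longrightarrow> sqint M v \<Longrightarrow> ip M v u = cnj (ip M u v)"
  by (rule herm_on_sym[OF herm_on_ip]) auto

lemma herm_on_ipH: "herm_on V ipH"
  unfolding herm_on_def
proof (intro conjI ballI)
  fix v assume "v \<in> V"
  then show "lin_on V (\<lambda>u. ipH u v)" unfolding ipH_def by (intro lin_on_add ip_linear V_sqint)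
next
  fix u v assume "u \<in> V" "v \<in> V"
  then show "ipH v u = cnj (ipH u v)" unfolding ipH_def
    using ip_sym[OF V_sqint(1) V_sqint(1), of u v] ip_sym[OF V_sqint(2) V_sqint(2), of u v]
      ip_sym[OF V_sqint(3) V_sqint(3), of u v] by simp
qed

lemma ipH_self: "Re (ipH u u) = sq M u + sq M (G1 u) + sq M (G2 u)"
  by (simp add: ipH_def ip_self)

lemma ipH_pos: "0 \<le> Re (ipH u u)"
  by (simp add: ipH_self sq_nonneg)

abbreviation "nH u \<equiv> fnorm ipH u"

lemma nH_sq: "(nH u)\<^sup>2 = sq M u + sq M (G1 u) + sq M (G2 u)"
  by (simp add: fnorm_def ipH_pos) (simp add: ipH_self)

lemma nH_nonneg [simp]: "0 \<le> nH u"
  by (simp add: fnorm_def ipH_pos)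

lemma nH_ge: "sqrt (sq M u) \<le> nH u" "sqrt (sq M (G1 u)) \<le> nH u" "sqrt (sq M (G2 u)) \<le> nH u"
  by (auto simp: fnorm_def ipH_self sq_nonneg)

lemma sq_grad_diff:
  assumes "u \<in> V" "v \<in> V"
  shows "sq M (G1 (\<lambda>x. u x - v x)) = sq M (\<lambda>x. G1 u x - G1 v x)" "sq M (G2 (\<lambda>x. u x - v x)) = sq M (\<lambda>x. G2 u x - G2 v x)"
proof -
  have d: "(\<lambda>x. u x - v x) \<in> V" using assms by (rule fun_space_diff[OF fun_space_V])
  have "AE x in M. G1 (\<lambda>x. u x - v x) x = G1 u x - G1 v x" "AE x in M. G2 (\<lambda>x. u x - v x) x = G2 u x - G2 v x"
    using grad_combine[OF assms, of "-1"] by simp_all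
  then show "sq M (G1 (\<lambda>x. u x - v x)) = sq M (\<lambda>x. G1 u x - G1 v x)" "sq M (G2 (\<lambda>x. u x - v x)) = sq M (\<lambda>x. G2 u x - G2 v x)"
    using V_sqint[OF d] V_sqint[OF assms(1)] V_sqint[OF assms(2)]
    by (auto intro!: sq_cong_AE sqint_meas sqint_diff)
qed

text \<open>The functions and their two gradient components converge separately in L2. That the
  limit belongs to the space requires one sequence of smooth functions: its n-th member is chosen
  within 1 / (n + 1) of \<open>u n\<close>, in function and gradient.\<close>

lemma H1_complete:
  assumes u: "\<And>n. u n \<in> V"
    and C: "\<And>e. e > 0 \<Longrightarrow> \<exists>N. \<forall>m\<ge>N. \<forall>n\<ge>N. nH (\<lambda>x. u m x - u n x) < e"
  shows "\<exists>w\<in>V. (\<lambda>n. nH (\<lambda>x. u n x - w x)) \<longlonglongrightarrow> 0"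
proof -
  have cau: "\<exists>N. \<forall>m\<ge>N. \<forall>n\<ge>N. sq M (\<lambda>x. f m x - f n x) < e"
    if "e > 0" and f: "\<And>m n. sq M (\<lambda>x. f m x - f n x) \<le> (nH (\<lambda>x. u m x - u n x))\<^sup>2" for e and f :: "nat \<Rightarrow> pt \<Rightarrow> complex"
  proof -
    obtain N where N: "\<And>m n. m \<ge> N \<Longrightarrow> n \<ge> N \<Longrightarrow> nH (\<lambda>x. u m x - u n x) < sqrt e"
      using C[of "sqrt e"] \<open>e > 0\<close> by auto
    have "sq M (\<lambda>x. f m x - f n x) < e" if "m \<ge> N" "n \<ge> N" for m n
    proof -
      have "(nH (\<lambda>x. u m x - u n x))\<^sup>2 < (sqrt e)\<^sup>2" by (rule power_strict_mono[OF N[OF that]]) auto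
      then show ?thesis using f[of m n] \<open>e > 0\<close> by simp
    qed
    then show ?thesis by blast
  qed
  have b: "sq M (\<lambda>x. u m x - u n x) \<le> (nH (\<lambda>x. u m x - u n x))\<^sup>2"
    "sq M (\<lambda>x. G1 (u m) x - G1 (u n) x) \<le> (nH (\<lambda>x. u m x - u n x))\<^sup>2"
    "sq M (\<lambda>x. G2 (u m) x - G2 (u n) x) \<le> (nH (\<lambda>x. u m x - u n x))\<^sup>2" for m n
    unfolding nH_sq sq_grad_diff[OF u u] by (simp_all add: sq_nonneg)
  obtain w where w: "sqint M w" "(\<lambda>n. sq M (\<lambda>x. u n x - w x)) \<longlonglongrightarrow> 0"
    using sqint_complete[OF V_sqint(1)[OF u] cau[OF _ b(1)]] by blast
  obtain h1 where h1: "sqint M h1" "(\<lambda>n. sq M (\<lambda>x. G1 (u n) x - h1 x)) \<longlonglongrightarrow> 0"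
    using sqint_complete[OF V_sqint(2)[OF u] cau[OF _ b(2)]] by blast
  obtain h2 where h2: "sqint M h2" "(\<lambda>n. sq M (\<lambda>x. G2 (u n) x - h2 x)) \<longlonglongrightarrow> 0"
    using sqint_complete[OF V_sqint(3)[OF u] cau[OF _ b(3)]] by blast
  have "\<exists>S. smooth_per S \<and> sq M (\<lambda>x. u n x - S x) < 1 / real (Suc n) \<and>
      sq M (\<lambda>x. G1 (u n) x - D1 S x) < 1 / real (Suc n) \<and> sq M (\<lambda>x. G2 (u n) x - D2 S x) < 1 / real (Suc n)" for n
  proof -
    obtain F where F: "appr (u n) (G1 (u n)) (G2 (u n)) F" using grad_appr u by blast
    have "\<forall>\<^sub>F k in sequentially. sq M (\<lambda>x. u n x - F k x) < 1 / real (Suc n) \<and>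
       sq M (\<lambda>x. G1 (u n) x - D1 (F k) x) < 1 / real (Suc n) \<and> sq M (\<lambda>x. G2 (u n) x - D2 (F k) x) < 1 / real (Suc n)"
      by (intro eventually_conj order_tendstoD(2)[OF appr_lim(1)[OF F]] order_tendstoD(2)[OF appr_lim(2)[OF F]]
          order_tendstoD(2)[OF appr_lim(3)[OF F]]) auto
    then show ?thesis using appr_sqint(4)[OF F] by (auto simp: eventually_sequentially)
  qed
  then have "\<exists>S. \<forall>n. smooth_per (S n) \<and> sq M (\<lambda>x. u n x - S n x) < 1 / real (Suc n) \<and>
      sq M (\<lambda>x. G1 (u n) x - D1 (S n) x) < 1 / real (Suc n) \<and> sq M (\<lambda>x. G2 (u n) x - D2 (S n) x) < 1 / real (Suc n)"
    by (intro choice allI)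
  then obtain S where S: "\<And>n. smooth_per (S n)" "\<And>n. sq M (\<lambda>x. u n x - S n x) < 1 / real (Suc n)"
    "\<And>n. sq M (\<lambda>x. G1 (u n) x - D1 (S n) x) < 1 / real (Suc n)"
    "\<And>n. sq M (\<lambda>x. G2 (u n) x - D2 (S n) x) < 1 / real (Suc n)" by blast
  have lim: "(\<lambda>n. sq M (\<lambda>x. g x - p n x)) \<longlonglongrightarrow> 0"
    if g: "sqint M g" "\<And>n. sqint M (f n)" "\<And>n. sqint M (p n)" and l: "(\<lambda>n. sq M (\<lambda>x. f n x - g x)) \<longlonglongrightarrow> 0"
      and s: "\<And>n. sq M (\<lambda>x. f n x - p n x) < 1 / real (Suc n)" for f p g
  proof (rule tendsto_sandwich[OF _ _ tendsto_const])
    show "(\<lambda>n. 2 * sq M (\<lambda>x. f n x - g x) + 2 * (1 / real (Suc n))) \<longlonglongrightarrow> 0"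
      using tendsto_add[OF tendsto_mult_right_zero[OF l, of 2] tendsto_mult_right_zero[OF LIMSEQ_Suc[OF lim_1_over_n], of 2]] by simp
    show "\<forall>\<^sub>F n in sequentially. sq M (\<lambda>x. g x - p n x) \<le> 2 * sq M (\<lambda>x. f n x - g x) + 2 * (1 / real (Suc n))"
    proof (rule always_eventually, rule allI)
      fix n
      have "sq M (\<lambda>x. g x - p n x) \<le> 2 * sq M (\<lambda>x. g x - f n x) + 2 * sq M (\<lambda>x. f n x - p n x)"
        using sq_combine_le[OF sqint_diff[OF g(1) g(2)[of n]] sqint_diff[OF g(2)[of n] g(3)[of n]], of 1] by simp
      then show "sq M (\<lambda>x. g x - p n x) \<le> 2 * sq M (\<lambda>x. f n x - g x) + 2 * (1 / real (Suc n))"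
        using s[of n] sq_diff_commute[of M g "f n"] by linarith
    qed
  qed (simp add: sq_nonneg)
  note sS = smooth_per_facts[OF S(1)]
  have ap: "appr w h1 h2 S"
    unfolding appr_def using w(1) h1(1) h2(1) S(1) lim[OF w(1) V_sqint(1)[OF u] sS(1) w(2) S(2)]
      lim[OF h1(1) V_sqint(2)[OF u] sS(2) h1(2) S(3)] lim[OF h2(1) V_sqint(3)[OF u] sS(3) h2(2) S(4)] by blast
  have wV: "w \<in> V" by (rule H1perI[OF ap])
  \<comment> \<open>The gradient chosen for w agrees almost everywhere with the limits
    \<open>h1\<close> and \<open>h2\<close>, so the norm may be computed with them.\<close>
  have e: "(nH (\<lambda>x. u n x - w x))\<^sup>2 = sq M (\<lambda>x. u n x - w x) + sq M (\<lambda>x. G1 (u n) x - h1 x) + sq M (\<lambda>x. G2 (u n) x - h2 x)" for n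
  proof -
    have "sq M (\<lambda>x. G1 (u n) x - G1 w x) = sq M (\<lambda>x. G1 (u n) x - h1 x)"
      by (rule sq_cong_AE, use grad_AE(1)[OF ap] in eventually_elim)
        (auto intro!: sqint_meas sqint_diff V_sqint[OF u] V_sqint[OF wV] h1)
    moreover have "sq M (\<lambda>x. G2 (u n) x - G2 w x) = sq M (\<lambda>x. G2 (u n) x - h2 x)"
      by (rule sq_cong_AE, use grad_AE(2)[OF ap] in eventually_elim)
        (auto intro!: sqint_meas sqint_diff V_sqint[OF u] V_sqint[OF wV] h2)
    ultimately show ?thesis unfolding nH_sq sq_grad_diff[OF u wV] by simp
  qed
  have "(\<lambda>n. (nH (\<lambda>x. u n x - w x))\<^sup>2) \<longlonglongrightarrow> 0 + 0 + 0"
    unfolding e by (intro tendsto_add w h1 h2)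
  from tendsto_real_sqrt[OF this] have "(\<lambda>n. nH (\<lambda>x. u n x - w x)) \<longlonglongrightarrow> 0" by simp
  then show ?thesis using wV by blast
qed

sublocale hilbert_funs V ipH
  by unfold_locales (use fun_space_V herm_on_ipH ipH_pos H1_complete in auto)

subsection \<open>Traces\<close>

definition tco :: "(pt \<Rightarrow> complex) \<Rightarrow> bool \<Rightarrow> int \<Rightarrow> complex" where
  "tco F fl m = integral {-pi..pi} (\<lambda>x. F (x, edge d0 fl) * cnj (phi m x))"

definition CT :: real where "CT = 2 + 1 / d0"

lemma CT_pos: "CT > 0"
  using d0 by (simp add: CT_def add_pos_pos)

lemma tco_LINT:
  assumes "continuous_on UNIV F"
  shows "(LINT x:{-pi..pi}|lborel. F (x, edge d0 fl) * cnj (phi m x)) = tco F fl m"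
  unfolding tco_def
  by (rule set_borel_integral_eq_integral(2))
    (auto simp: set_integrable_def intro!: borel_integrable_compact continuous_intros cont_slice(1)[OF assms])

lemma tco_combine:
  assumes "continuous_on UNIV F" "continuous_on UNIV G"
  shows "tco (\<lambda>x. F x + c * G x) fl m = tco F fl m + c * tco G fl m"
proof -
  have i: "(\<lambda>x. H (x, edge d0 fl) * cnj (phi m x)) integrable_on {-pi..pi}" if "continuous_on UNIV H" for H :: "pt \<Rightarrow> complex"
    by (intro integrable_continuous_real continuous_intros cont_slice(1)[OF that])
  have ic: "(\<lambda>x. c * (G (x, edge d0 fl) * cnj (phi m x))) integrable_on {-pi..pi}"
    by (intro integrable_continuous_real continuous_intros cont_slice(1)[OF assms(2)])
  have "tco (\<lambda>x. F x + c * G x) fl m = integral {-pi..pi} (\<lambda>x. F (x, edge d0 fl) * cnj (phi m x) + c * (G (x, edge d0 fl) * cnj (phi m x)))"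
    by (simp add: tco_def algebra_simps)
  also have "\<dots> = tco F fl m + c * tco G fl m"
    unfolding tco_def by (subst Henstock_Kurzweil_Integration.integral_add[OF i[OF assms(1)] ic]) simp
  finally show ?thesis .
qed

lemma tco_bound_sum:
  assumes F: "smooth_per F" and K: "finite K"
  shows "(\<Sum>m\<in>K. (1 + \<bar>real_of_int m\<bar>) * (cmod (tco F fl m))\<^sup>2) \<le> CT * (sq M F + sq M (D1 F) + sq M (D2 F))"
proof -
  note sF = smooth_per_facts[OF F]
  have "edge d0 fl \<in> {-d0..d0}" using d0 by (simp add: edge_def)
  from fourier_trace_bound[OF sF(4,5) d0 K this]
  show ?thesis by (simp add: tco_def CT_def sq_cont sF)
qed

lemma tco_bound:
  assumes "smooth_per F"
  shows "(cmod (tco F fl m))\<^sup>2 \<le> CT * (sq M F + sq M (D1 F) + sq M (D2 F))"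
proof -
  have "(cmod (tco F fl m))\<^sup>2 \<le> (1 + \<bar>real_of_int m\<bar>) * (cmod (tco F fl m))\<^sup>2"
    by (simp add: mult_le_cancel_right1)
  then show ?thesis using tco_bound_sum[OF assms, of "{m}" fl] by simp
qed

text \<open>Any two sequences approximating the same function, hence also any two tails of one sequence, have
  asymptotically equal traces.\<close>

lemma tco_diff_null:
  assumes F: "\<And>n. smooth_per (F n)" "\<And>n. smooth_per (G n)"
    and l: "(\<lambda>n. sq M (\<lambda>x. F n x - G n x)) \<longlonglongrightarrow> 0" "(\<lambda>n. sq M (\<lambda>x. D1 (F n) x - D1 (G n) x)) \<longlonglongrightarrow> 0"
      "(\<lambda>n. sq M (\<lambda>x. D2 (F n) x - D2 (G n) x)) \<longlonglongrightarrow> 0"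
  shows "(\<lambda>n. tco (F n) fl m - tco (G n) fl m) \<longlonglongrightarrow> 0"
proof (rule Lim_null_comparison)
  define E where "E n = sq M (\<lambda>x. F n x - G n x) + sq M (\<lambda>x. D1 (F n) x - D1 (G n) x) + sq M (\<lambda>x. D2 (F n) x - D2 (G n) x)" for n
  have "E \<longlonglongrightarrow> 0 + 0 + 0" unfolding E_def[abs_def] by (intro tendsto_add l)
  then show "(\<lambda>n. sqrt (CT * E n)) \<longlonglongrightarrow> 0"
    using tendsto_real_sqrt[OF tendsto_mult_right_zero[of E _ CT]] by simp
  show "\<forall>\<^sub>F n in sequentially. norm (tco (F n) fl m - tco (G n) fl m) \<le> sqrt (CT * E n)"
  proof (rule always_eventually, rule allI)
    fix n
    have sm: "smooth_fun (F n)" "smooth_fun (G n)" using F by (auto simp: smooth_per_def)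
    have "tco (F n) fl m - tco (G n) fl m = tco (\<lambda>x. F n x + (-1) * G n x) fl m"
      using tco_combine[OF smooth_cont[OF sm(1)] smooth_cont[OF sm(2)], of "-1"] by simp
    moreover have "(cmod (tco (\<lambda>x. F n x + (-1) * G n x) fl m))\<^sup>2 \<le> CT * E n"
      using tco_bound[OF smooth_per_combine[OF F(1)[of n] F(2)[of n], of "-1"], of fl m]
      unfolding D_combine[OF sm] E_def by simp
    ultimately show "norm (tco (F n) fl m - tco (G n) fl m) \<le> sqrt (CT * E n)"
      by (metis real_le_rsqrt)
  qed
qed

lemma sq_diff_null:
  assumes "sqint M g" "\<And>n. sqint M (p n)" "\<And>n. sqint M (q n)"
    and "(\<lambda>n. sq M (\<lambda>x. g x - p n x)) \<longlonglongrightarrow> 0" "(\<lambda>n. sq M (\<lambda>x. g x - q n x)) \<longlonglongrightarrow> 0"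
  shows "(\<lambda>n. sq M (\<lambda>x. p n x - q n x)) \<longlonglongrightarrow> 0"
proof (rule tendsto_sandwich[OF _ _ tendsto_const])
  show "(\<lambda>n. 2 * sq M (\<lambda>x. g x - p n x) + 2 * sq M (\<lambda>x. g x - q n x)) \<longlonglongrightarrow> 0"
    using tendsto_add[OF tendsto_mult_right_zero[OF assms(4), of 2] tendsto_mult_right_zero[OF assms(5), of 2]] by simp
  show "\<forall>\<^sub>F n in sequentially. sq M (\<lambda>x. p n x - q n x) \<le> 2 * sq M (\<lambda>x. g x - p n x) + 2 * sq M (\<lambda>x. g x - q n x)"
  proof (rule always_eventually, rule allI)
    fix n
    have "sq M (\<lambda>x. p n x - q n x) \<le> 2 * sq M (\<lambda>x. p n x - g x) + 2 * sq M (\<lambda>x. g x - q n x)"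
      using sq_combine_le[OF sqint_diff[OF assms(2)[of n] assms(1)] sqint_diff[OF assms(1) assms(3)[of n]], of 1] by simp
    then show "sq M (\<lambda>x. p n x - q n x) \<le> 2 * sq M (\<lambda>x. g x - p n x) + 2 * sq M (\<lambda>x. g x - q n x)"
      using sq_diff_commute[of M g "p n"] by simp
  qed
qed (simp add: sq_nonneg)

lemma appr_tco_diff:
  assumes a: "appr u g1 g2 F" and b: "appr u g1 g2 G"
  shows "(\<lambda>n. tco (F n) fl m - tco (G n) fl m) \<longlonglongrightarrow> 0"
proof -
  note sF = smooth_per_facts[OF appr_sqint(4)[OF a]] and sG = smooth_per_facts[OF appr_sqint(4)[OF b]]
  show ?thesis
    by (rule tco_diff_null[OF appr_sqint(4)[OF a] appr_sqint(4)[OF b]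
        sq_diff_null[OF appr_sqint(1)[OF a] sF(1) sG(1) appr_lim(1)[OF a] appr_lim(1)[OF b]]
        sq_diff_null[OF appr_sqint(2)[OF a] sF(2) sG(2) appr_lim(2)[OF a] appr_lim(2)[OF b]]
        sq_diff_null[OF appr_sqint(3)[OF a] sF(3) sG(3) appr_lim(3)[OF a] appr_lim(3)[OF b]]])
qed

text \<open>If the traces were not Cauchy, two index sequences tending to infinity would keep them
  apart; but both subsequences approximate the same function, against
  \<open>appr_tco_diff\<close>.\<close>

lemma appr_tco_convergent:
  assumes a: "appr u g1 g2 F"
  shows "convergent (\<lambda>n. tco (F n) fl m)"
proof -
  have "Cauchy (\<lambda>n. tco (F n) fl m)"
  proof (rule ccontr)
    assume "\<not> Cauchy (\<lambda>n. tco (F n) fl m)"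
    then obtain e where e: "e > 0" "\<And>N. \<exists>i\<ge>N. \<exists>j\<ge>N. \<not> dist (tco (F i) fl m) (tco (F j) fl m) < e"
      unfolding Cauchy_def by blast
    obtain I J where IJ: "\<And>N. I N \<ge> N" "\<And>N. J N \<ge> N" "\<And>N. \<not> dist (tco (F (I N)) fl m) (tco (F (J N)) fl m) < e"
      using e(2) by metis
    have fl: "filterlim I sequentially sequentially" "filterlim J sequentially sequentially"
      using IJ(1,2) by (auto intro: filterlim_at_top_mono[OF filterlim_ident])
    have ap: "appr u g1 g2 (\<lambda>n. F (I n))" "appr u g1 g2 (\<lambda>n. F (J n))"
      using a filterlim_compose[OF _ fl(1)] filterlim_compose[OF _ fl(2)] unfolding appr_def by blast+
    have "\<forall>\<^sub>F n in sequentially. dist (tco (F (I n)) fl m - tco (F (J n)) fl m) 0 < e"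
      by (rule tendstoD[OF appr_tco_diff[OF ap] e(1)])
    then show False using IJ(3) by (auto simp: eventually_sequentially dist_norm)
  qed
  then show ?thesis by (simp add: Cauchy_convergent_iff)
qed

text \<open>\<open>trco\<close> refers to sequences approximating the chosen gradient; this passes
  to it from any other version of the gradient.\<close>

lemma appr_change_gradient:
  assumes "appr u g1 g2 F" "AE x in M. u x = v x" "AE x in M. g1 x = h1 x" "AE x in M. g2 x = h2 x"
    "sqint M v" "sqint M h1" "sqint M h2"
  shows "appr v h1 h2 F"
proof -
  have "sq M (\<lambda>x. g x - p x) = sq M (\<lambda>x. h x - p x)" if "AE x in M. g x = h x" "sqint M g" "sqint M h" "sqint M p" for g h p
    by (rule sq_cong_AE, use that(1) in eventually_elim) (use that in \<open>auto intro!: sqint_meas sqint_diff\<close>)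
  note e = this
  note a = assms(1)
  note sF = smooth_per_facts[OF appr_sqint(4)[OF a]]
  show ?thesis
    using a assms(5-7) e[OF assms(2) appr_sqint(1)[OF a] assms(5) sF(1)] e[OF assms(3) appr_sqint(2)[OF a] assms(6) sF(2)]
      e[OF assms(4) appr_sqint(3)[OF a] assms(7) sF(3)] unfolding appr_def by simp
qed

text \<open>The definite description in \<open>trco\<close> is resolved here: the limit exists along
  one sequence and is the same along every other. Linearity and bounds of the trace follow by
  passing to the limit.\<close>

lemma trco_limit:
  assumes a: "appr u g1 g2 F"
  shows "(\<lambda>n. tco (F n) fl m) \<longlonglongrightarrow> trco d0 u fl m"
proof -
  have uV: "u \<in> V" by (rule H1perI[OF a])
  note si = V_sqint[OF uV]
  have a': "appr u (G1 u) (G2 u) F"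
    by (rule appr_change_gradient[OF a]) (use grad_AE[OF a] si in \<open>auto elim: AE_mp\<close>)
  have iff: "approx_seq d0 u (grad d0 u) G \<longleftrightarrow> appr u (G1 u) (G2 u) G" for G
    using approx_seq_iff[of u "grad d0 u" G] si by (simp add: G1_def[abs_def] G2_def[abs_def])
  obtain t where t: "(\<lambda>n. tco (F n) fl m) \<longlonglongrightarrow> t" using appr_tco_convergent[OF a'] by (auto simp: convergent_def)
  have lint: "(\<lambda>n. LINT x:{-pi..pi}|lborel. G n (x, edge d0 fl) * cnj (phi m x)) = (\<lambda>n. tco (G n) fl m)"
    if "appr u (G1 u) (G2 u) G" for G
    using tco_LINT[OF smooth_per_facts(6)[OF appr_sqint(4)[OF that]]] by auto
  have "trco d0 u fl m = t" unfolding trco_def iff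
  proof (rule the_equality, intro allI impI)
    fix G assume G: "appr u (G1 u) (G2 u) G"
    have "(\<lambda>n. tco (F n) fl m - (tco (F n) fl m - tco (G n) fl m)) \<longlonglongrightarrow> t - 0"
      by (intro tendsto_diff t appr_tco_diff[OF a' G])
    then show "(\<lambda>n. LINT x:{-pi..pi}|lborel. G n (x, edge d0 fl) * cnj (phi m x)) \<longlonglongrightarrow> t" unfolding lint[OF G] by simp
  next
    fix c assume *: "\<forall>G. appr u (G1 u) (G2 u) G \<longrightarrow> (\<lambda>n. LINT x:{-pi..pi}|lborel. G n (x, edge d0 fl) * cnj (phi m x)) \<longlonglongrightarrow> c"
    have "(\<lambda>n. tco (F n) fl m) \<longlonglongrightarrow> c" using *[rule_format, OF a'] unfolding lint[OF a'] .
    then show "c = t" using t by (rule LIMSEQ_unique)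
  qed
  then show ?thesis using t by simp
qed

lemma trco_linear: "lin_on V (\<lambda>u. trco d0 u fl m)"
proof (rule lin_onI_combine[OF fun_space_V])
  fix u v c assume "u \<in> V" "v \<in> V"
  then obtain F where F: "appr u (G1 u) (G2 u) F" using grad_appr by blast
  obtain G where G: "appr v (G1 v) (G2 v) G" using grad_appr[OF \<open>v \<in> V\<close>] .
  have "(\<lambda>n. tco (\<lambda>x. F n x + c * G n x) fl m) \<longlonglongrightarrow> trco d0 (\<lambda>x. u x + c * v x) fl m"
    by (rule trco_limit[OF appr_combine[OF F G]])
  moreover have "(\<lambda>n. tco (F n) fl m + c * tco (G n) fl m) \<longlonglongrightarrow> trco d0 u fl m + c * trco d0 v fl m"
    by (intro tendsto_intros trco_limit[OF F] trco_limit[OF G])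
  ultimately show "trco d0 (\<lambda>x. u x + c * v x) fl m = trco d0 u fl m + c * trco d0 v fl m"
    using tco_combine[OF smooth_per_facts(6)[OF appr_sqint(4)[OF F]] smooth_per_facts(6)[OF appr_sqint(4)[OF G]]]
    by (simp add: LIMSEQ_unique)
qed

lemma appr_energy_limit:
  assumes a: "appr u g1 g2 F"
  shows "(\<lambda>n. sq M (F n)) \<longlonglongrightarrow> sq M u" "(\<lambda>n. sq M (D1 (F n))) \<longlonglongrightarrow> sq M g1" "(\<lambda>n. sq M (D2 (F n))) \<longlonglongrightarrow> sq M g2"
proof -
  note sF = smooth_per_facts[OF appr_sqint(4)[OF a]]
  show "(\<lambda>n. sq M (F n)) \<longlonglongrightarrow> sq M u" "(\<lambda>n. sq M (D1 (F n))) \<longlonglongrightarrow> sq M g1" "(\<lambda>n. sq M (D2 (F n))) \<longlonglongrightarrow> sq M g2"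
    using sq_limit[OF sF(1) appr_sqint(1)[OF a] appr_lim(1)[OF a]] sq_limit[OF sF(2) appr_sqint(2)[OF a] appr_lim(2)[OF a]]
      sq_limit[OF sF(3) appr_sqint(3)[OF a] appr_lim(3)[OF a]] by auto
qed

text \<open>Continuity of the trace into the Sobolev space of order 1/2, expressed by finite partial
  sums; since the bound does not depend on K, they control the infinite series of the boundary
  form.\<close>

lemma trace_bound:
  assumes u: "u \<in> V" and K: "finite K"
  shows "(\<Sum>m\<in>K. (1 + \<bar>real_of_int m\<bar>) * (cmod (trco d0 u fl m))\<^sup>2) \<le> CT * (nH u)\<^sup>2"
proof -
  obtain F where F: "appr u (G1 u) (G2 u) F" using grad_appr[OF u] .
  have "(\<lambda>n. \<Sum>m\<in>K. (1 + \<bar>real_of_int m\<bar>) * (cmod (tco (F n) fl m))\<^sup>2) \<longlonglongrightarrow> (\<Sum>m\<in>K. (1 + \<bar>real_of_int m\<bar>) * (cmod (trco d0 u fl m))\<^sup>2)"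
    by (intro tendsto_intros trco_limit[OF F])
  moreover have "(\<lambda>n. CT * (sq M (F n) + sq M (D1 (F n)) + sq M (D2 (F n)))) \<longlonglongrightarrow> CT * (nH u)\<^sup>2"
    unfolding nH_sq by (intro tendsto_intros appr_energy_limit[OF F])
  ultimately show ?thesis
    by (rule LIMSEQ_le) (use tco_bound_sum[OF appr_sqint(4)[OF F] K] in blast)
qed

subsection \<open>Control of the \<open>L\<^sup>2\<close> norm by finitely many averages\<close>

definition cell :: "nat \<Rightarrow> nat \<Rightarrow> nat \<Rightarrow> pt set" where
  "cell n i j = cbox (-pi + real i * (2 * pi / real n), -d0 + real j * (2 * d0 / real n))
     (-pi + real (Suc i) * (2 * pi / real n), -d0 + real (Suc j) * (2 * d0 / real n))"

text \<open>The plain integral of u over the cell, not divided by the area. As an inner product with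
  an indicator function it is evidently continuous in L2.\<close>

definition avg :: "nat \<Rightarrow> nat \<Rightarrow> nat \<Rightarrow> (pt \<Rightarrow> complex) \<Rightarrow> complex" where
  "avg n i j u = ip M u (indicator (cell n i j))"

lemma cell_subset:
  assumes "i < n" "j < n" shows "cell n i j \<subseteq> R"
proof -
  have "0 \<le> real k * (2 * a / real n)" "real (Suc k) * (2 * a / real n) \<le> 2 * a" if "k < n" "a > 0" for k a
  proof -
    have "real (Suc k) * (2 * a / real n) \<le> real n * (2 * a / real n)" using that by (intro mult_right_mono) auto
    then show "real (Suc k) * (2 * a / real n) \<le> 2 * a" using that by simp
  qed (use that in simp)
  note b = this(1)[OF assms(1) pi_gt_zero] this(2)[OF assms(1) pi_gt_zero] this(1)[OF assms(2) d0] this(2)[OF assms(2) d0]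
  show ?thesis unfolding cell_def cbox_Pair_eq box_real
  proof (rule Sigma_mono)
    show "{-pi + real i * (2 * pi / real n)..-pi + real (Suc i) * (2 * pi / real n)} \<subseteq> {-pi..pi}"
      unfolding atLeastatMost_subset_iff using b by linarith
    show "{-d0 + real j * (2 * d0 / real n)..-d0 + real (Suc j) * (2 * d0 / real n)} \<subseteq> {-d0..d0}"
      unfolding atLeastatMost_subset_iff using b by linarith
  qed
qed

lemma sqint_indicator_cell:
  assumes "i < n" "j < n" shows "sqint M (indicator (cell n i j) :: pt \<Rightarrow> complex)"
proof -
  have c: "cell n i j = cbox (-pi + real i * (2 * pi / real n), -d0 + real j * (2 * d0 / real n))
     (-pi + real (Suc i) * (2 * pi / real n), -d0 + real (Suc j) * (2 * d0 / real n))" by (simp add: cell_def)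
  have "integrable M (\<lambda>x. indicator (cell n i j) x *\<^sub>R (1::real))" "integrable M (\<lambda>x. indicator (cell n i j) x *\<^sub>R (1::complex))"
    by (rule LINT_R(1)[OF continuous_on_const c cell_subset[OF assms]])+
  moreover have "indicator (cell n i j) x *\<^sub>R (1::complex) = indicator (cell n i j) x" for x by (simp add: indicator_def)
  moreover have "(\<lambda>x. (cmod (indicator (cell n i j) x))\<^sup>2) = (\<lambda>x. indicator (cell n i j) x *\<^sub>R (1::real))" by (auto simp: indicator_def)
  ultimately show ?thesis by (simp add: sqint_def borel_measurable_integrable)
qed

lemma avg_smooth:
  assumes "i < n" "j < n" "continuous_on UNIV F" shows "avg n i j F = integral (cell n i j) F"
proof -
  have "avg n i j F = (\<integral>x. indicator (cell n i j) x *\<^sub>R F x \<partial>M)"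
    unfolding avg_def ip_def by (rule Bochner_Integration.integral_cong) (auto simp: indicator_def)
  also have "\<dots> = integral (cell n i j) F"
    by (rule LINT_R(2)[OF assms(3) cell_def cell_subset[OF assms(1,2)]])
  finally show ?thesis .
qed

lemma avg_linear: "i < n \<Longrightarrow> j < n \<Longrightarrow> lin_on V (avg n i j)"
  unfolding avg_def[abs_def] by (rule ip_linear(1)[OF sqint_indicator_cell])

lemma poincare_V:
  assumes u: "u \<in> V" and n: "n > 0"
  shows "sq M u \<le> 4 / (2 * pi / real n * (2 * d0 / real n)) * (\<Sum>i<n. \<Sum>j<n. (cmod (avg n i j u))\<^sup>2)
     + 2 * (2 * pi / real n)\<^sup>2 * sq M (G1 u) + 4 * (2 * d0 / real n)\<^sup>2 * sq M (G2 u)"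
proof -
  obtain F where F: "appr u (G1 u) (G2 u) F" using grad_appr[OF u] .
  note sF = smooth_per_facts[OF appr_sqint(4)[OF F]]
  have pF: "sq M (F k) \<le> 4 / (2 * pi / real n * (2 * d0 / real n)) * (\<Sum>i<n. \<Sum>j<n. (cmod (avg n i j (F k)))\<^sup>2)
     + 2 * (2 * pi / real n)\<^sup>2 * sq M (D1 (F k)) + 4 * (2 * d0 / real n)\<^sup>2 * sq M (D2 (F k))" for k
    using poincare_cells[OF sF(4)[of k], of "-pi" pi "-d0" d0 n "2 * pi / real n" "2 * d0 / real n"] n d0
    by (simp add: sq_cont sF avg_smooth cell_def)
  have avl: "(\<lambda>k. avg n i j (F k)) \<longlonglongrightarrow> avg n i j u" if "i < n" "j < n" for i j
    unfolding avg_def by (rule ip_limit[OF sF(1) appr_sqint(1)[OF F] sqint_indicator_cell[OF that] appr_lim(1)[OF F]])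
  have "(\<lambda>k. 4 / (2 * pi / real n * (2 * d0 / real n)) * (\<Sum>i<n. \<Sum>j<n. (cmod (avg n i j (F k)))\<^sup>2)
     + 2 * (2 * pi / real n)\<^sup>2 * sq M (D1 (F k)) + 4 * (2 * d0 / real n)\<^sup>2 * sq M (D2 (F k))) \<longlonglongrightarrow>
     4 / (2 * pi / real n * (2 * d0 / real n)) * (\<Sum>i<n. \<Sum>j<n. (cmod (avg n i j u))\<^sup>2)
     + 2 * (2 * pi / real n)\<^sup>2 * sq M (G1 u) + 4 * (2 * d0 / real n)\<^sup>2 * sq M (G2 u)"
    by (intro tendsto_add tendsto_mult_left tendsto_sum tendsto_power tendsto_norm avl appr_energy_limit[OF F]) auto
  from LIMSEQ_le[OF appr_energy_limit(1)[OF F] this] pF show ?thesis by blast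
qed

text \<open>The substitute for the compact embedding of H1 into L2: up to a small multiple of the
  gradient energy, the L2 norm is controlled by finitely many linear functionals.\<close>

lemma ehrling:
  assumes \<eta>: "\<eta> > 0"
  shows "\<exists>n>0. \<exists>C\<ge>0. \<forall>u\<in>V. sq M u \<le> \<eta> * (sq M (G1 u) + sq M (G2 u)) + C * (\<Sum>i<n. \<Sum>j<n. (cmod (avg n i j u))\<^sup>2)"
proof -
  \<comment> \<open>8 pi^2 and 16 d0^2 are n^2 times the two gradient coefficients of
    \<open>poincare_V\<close>; n > a / \<open>\<eta>\<close> gives a / n^2 <= \<open>\<eta>\<close>
    because n >= 1.\<close>
  define a where "a = 8 * pi\<^sup>2 + 16 * d0\<^sup>2"
  obtain n :: nat where n: "n > 0" "a / \<eta> < real n"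
    using reals_Archimedean2[of "a / \<eta>"] \<eta> by (metis a_def add_nonneg_nonneg gr0I less_eq_real_def mult_nonneg_nonneg not_less of_nat_0 zero_le_divide_iff zero_le_numeral zero_le_power2)
  have an: "a / (real n)\<^sup>2 \<le> \<eta>"
  proof -
    have "a < \<eta> * real n" using n \<eta> by (simp add: field_simps)
    also have "\<dots> \<le> \<eta> * (real n)\<^sup>2" using n \<eta> by (simp add: power2_eq_square)
    finally show ?thesis using n by (simp add: field_simps)
  qed
  have h: "2 * (2 * pi / real n)\<^sup>2 \<le> \<eta>" "4 * (2 * d0 / real n)\<^sup>2 \<le> \<eta>"
  proof -
    have "2 * (2 * pi / real n)\<^sup>2 = 8 * pi\<^sup>2 / (real n)\<^sup>2" "4 * (2 * d0 / real n)\<^sup>2 = 16 * d0\<^sup>2 / (real n)\<^sup>2"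
      by (simp_all add: power_divide power_mult_distrib)
    moreover have "8 * pi\<^sup>2 / (real n)\<^sup>2 \<le> a / (real n)\<^sup>2" "16 * d0\<^sup>2 / (real n)\<^sup>2 \<le> a / (real n)\<^sup>2"
      by (auto simp: a_def intro!: divide_right_mono)
    ultimately show "2 * (2 * pi / real n)\<^sup>2 \<le> \<eta>" "4 * (2 * d0 / real n)\<^sup>2 \<le> \<eta>" using an by linarith+
  qed
  define C where "C = 4 / (2 * pi / real n * (2 * d0 / real n))"
  have C: "C \<ge> 0" using d0 by (simp add: C_def)
  have "sq M u \<le> \<eta> * (sq M (G1 u) + sq M (G2 u)) + C * (\<Sum>i<n. \<Sum>j<n. (cmod (avg n i j u))\<^sup>2)" if u: "u \<in> V" for u
    using poincare_V[OF u n(1), folded C_def] mult_right_mono[OF h(1) sq_nonneg[of M "G1 u"]]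
      mult_right_mono[OF h(2) sq_nonneg[of M "G2 u"]] unfolding distrib_left by linarith
  then show ?thesis using n(1) C by blast
qed

end

subsection \<open>Propagating and evanescent orders\<close>

lemma alpha_eq_0_iff: "alpha \<beta> k m = 0 \<longleftrightarrow> k\<^sup>2 = (of_int m + \<beta>)\<^sup>2"
  unfolding alpha_def by (metis csqrt_eq_0 of_real_eq_0_iff right_minus_eq)

lemma alpha_propagating: "m \<in> Z0 \<beta> k \<Longrightarrow> alpha \<beta> k m = of_real (sqrt (k\<^sup>2 - (of_int m + \<beta>)\<^sup>2))"
  unfolding alpha_def by (subst csqrt_of_real_nonneg) (auto simp: Z0_def)

lemma csqrt_alpha_propagating: "m \<in> Z0 \<beta> k \<Longrightarrow> csqrt (alpha \<beta> k m) = of_real (sqrt (sqrt (k\<^sup>2 - (of_int m + \<beta>)\<^sup>2)))"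
  unfolding alpha_propagating by (subst csqrt_of_real_nonneg) (auto simp: Z0_def)

text \<open>The decay rate of an evanescent order. It is set to 0 on the propagating orders so that
  the boundary form built from it ignores them.\<close>

definition gam :: "real \<Rightarrow> real \<Rightarrow> int \<Rightarrow> real" where
  "gam \<beta> k m = (if m \<in> Z0 \<beta> k then 0 else sqrt ((of_int m + \<beta>)\<^sup>2 - k\<^sup>2))"

lemma alpha_evanescent: "m \<notin> Z0 \<beta> k \<Longrightarrow> alpha \<beta> k m = \<i> * of_real (gam \<beta> k m)"
  unfolding alpha_def by (subst csqrt_of_real_nonpos) (auto simp: Z0_def gam_def)

lemma finite_Z0: "finite (Z0 \<beta> k)"
proof (rule finite_subset)
  show "Z0 \<beta> k \<subseteq> {- \<lceil>\<bar>k\<bar> + \<bar>\<beta>\<bar>\<rceil> .. \<lceil>\<bar>k\<bar> + \<bar>\<beta>\<bar>\<rceil>}"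
  proof
    fix m assume "m \<in> Z0 \<beta> k"
    then have "\<bar>of_int m + \<beta>\<bar>\<^sup>2 < \<bar>k\<bar>\<^sup>2" by (simp add: Z0_def)
    then have "\<bar>of_int m + \<beta>\<bar> < \<bar>k\<bar>" by (rule power2_less_imp_less) simp
    then have "\<bar>of_int m\<bar> \<le> \<bar>k\<bar> + \<bar>\<beta>\<bar>" by linarith
    then show "m \<in> {- \<lceil>\<bar>k\<bar> + \<bar>\<beta>\<bar>\<rceil> .. \<lceil>\<bar>k\<bar> + \<bar>\<beta>\<bar>\<rceil>}" by (simp add: abs_le_iff) linarith
  qed
qed simp

lemma finite_Idx: "finite (Idx \<beta> k)"
  by (simp add: Idx_def finite_Z0)

lemma Z0_abs: "k > 0 \<Longrightarrow> m \<in> Z0 \<beta> k \<longleftrightarrow> \<bar>of_int m + \<beta>\<bar> < k"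
  using power2_less_imp_less[of "\<bar>of_int m + \<beta>\<bar>" k] power_strict_mono[of "\<bar>of_int m + \<beta>\<bar>" k 2]
  by (auto simp: Z0_def)

text \<open>The distances of |m + \<beta>s| from \<open>ks\<close> are positive and all but finitely
  many are at least 1, so they have a positive lower bound. This uniformity in m keeps the set of
  propagating orders and the distance from cut-off stable near the point.\<close>

lemma spectral_gap:
  assumes k: "ks > \<bar>\<beta>s\<bar>" and a: "\<And>m. alpha \<beta>s ks m \<noteq> 0"
  shows "\<exists>\<rho>>0. \<exists>c>0. \<forall>\<beta> k. \<bar>\<beta> - \<beta>s\<bar> < \<rho> \<longrightarrow> \<bar>k - ks\<bar> < \<rho> \<longrightarrow>
     \<bar>\<beta>\<bar> < k \<and> k < 2 * ks \<and> \<bar>\<beta>\<bar> \<le> \<bar>\<beta>s\<bar> + 1 \<and> Z0 \<beta> k = Z0 \<beta>s ks \<and> (\<forall>m. c \<le> \<bar>k\<^sup>2 - (of_int m + \<beta>)\<^sup>2\<bar>)"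
proof -
  have ks: "ks > 0" using k by linarith
  define D where "D m = \<bar>\<bar>of_int m + \<beta>s\<bar> - ks\<bar>" for m :: int
  define S where "S = {m::int. \<bar>of_int m + \<beta>s\<bar> \<le> ks + 1}"
  have "S \<subseteq> Z0 \<beta>s (ks + 2)" using ks by (auto simp: S_def Z0_abs)
  then have fS: "finite S" using finite_Z0 finite_subset by blast
  have Dp: "D m > 0" for m
  proof -
    have "\<bar>of_int m + \<beta>s\<bar> \<noteq> ks" using a[of m] unfolding alpha_eq_0_iff by (metis power2_abs)
    then show ?thesis by (simp add: D_def)
  qed
  define d where "d = Min (insert 1 (D ` S))"
  have d: "d > 0" "d \<le> 1" using fS Dp by (auto simp: d_def)
  have Dd: "d \<le> D m" for m
  proof (cases "m \<in> S")
    case True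
    then show ?thesis unfolding d_def using fS by (intro Min_le) auto
  next
    case False
    then have "D m \<ge> 1" by (simp add: S_def D_def)
    then show ?thesis using d(2) by linarith
  qed
  \<comment> \<open>d / 4 for each parameter moves |m + \<beta>| - k by less than d / 2;
    \<open>ks\<close> / 2 keeps k between \<open>ks\<close> / 2 and 2 \<open>ks\<close>; the last
    bound preserves |\<beta>| < k.\<close>
  define \<rho> where "\<rho> = min (d / 4) (min (ks / 2) ((ks - \<bar>\<beta>s\<bar>) / 4))"
  have \<rho>1: "\<rho> > 0" using d ks k by (simp add: \<rho>_def)
  have \<rho>2: "\<rho> \<le> d / 4" "\<rho> \<le> ks / 2" "\<rho> \<le> (ks - \<bar>\<beta>s\<bar>) / 4"
    unfolding \<rho>_def by (intro min.cobounded1 min.coboundedI2 min.cobounded2)+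
  note \<rho> = \<rho>1 \<rho>2
  have "\<bar>\<beta>\<bar> < k \<and> k < 2 * ks \<and> \<bar>\<beta>\<bar> \<le> \<bar>\<beta>s\<bar> + 1 \<and> Z0 \<beta> k = Z0 \<beta>s ks \<and> (\<forall>m. d / 2 * (ks / 2) \<le> \<bar>k\<^sup>2 - (of_int m + \<beta>)\<^sup>2\<bar>)"
    if b: "\<bar>\<beta> - \<beta>s\<bar> < \<rho>" and kk: "\<bar>k - ks\<bar> < \<rho>" for \<beta> k
  proof -
    have k1: "k > ks / 2" "k < 2 * ks" using kk \<rho> ks by linarith+
    have kp: "k > 0" using k1 ks by linarith
    have bk: "\<bar>\<beta>\<bar> < k" using b kk \<rho> k by (simp add: field_simps)
    have near: "\<bar>\<bar>of_int m + \<beta>\<bar> - k - (\<bar>of_int m + \<beta>s\<bar> - ks)\<bar> < d / 2" for m :: int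
      using b kk \<rho>(2) by linarith
    have "(\<bar>of_int m + \<beta>\<bar> < k) = (\<bar>of_int m + \<beta>s\<bar> < ks)" for m :: int
      using near[of m] Dd[of m] d(1) unfolding D_def by linarith
    then have Z: "Z0 \<beta> k = Z0 \<beta>s ks" using kp ks by (auto simp: Z0_abs)
    have "d / 2 * (ks / 2) \<le> \<bar>k\<^sup>2 - (of_int m + \<beta>)\<^sup>2\<bar>" for m :: int
    proof -
      \<comment> \<open>One factor is the gap between k and |m + \<beta>|, at least d / 2; the other
        is at least \<open>ks\<close> / 2.\<close>
      have "k\<^sup>2 - (of_int m + \<beta>)\<^sup>2 = k\<^sup>2 - \<bar>of_int m + \<beta>\<bar>\<^sup>2" by simp
      also have "\<dots> = (k - \<bar>of_int m + \<beta>\<bar>) * (k + \<bar>of_int m + \<beta>\<bar>)" by (simp only: power2_eq_square square_diff_square_factored mult.commute)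
      finally have "\<bar>k\<^sup>2 - (of_int m + \<beta>)\<^sup>2\<bar> = \<bar>k - \<bar>of_int m + \<beta>\<bar>\<bar> * (k + \<bar>of_int m + \<beta>\<bar>)" using kp by (simp add: abs_mult)
      moreover have "\<bar>k - \<bar>of_int m + \<beta>\<bar>\<bar> \<ge> d / 2" using near[of m] Dd[of m] unfolding D_def by linarith
      moreover have "ks / 2 \<le> k + \<bar>of_int m + \<beta>\<bar>" using k1 by linarith
      ultimately show ?thesis using d(1) ks by (simp only:) (intro mult_mono, auto)
    qed
    moreover have "\<bar>\<beta>\<bar> \<le> \<bar>\<beta>s\<bar> + 1" using b \<rho>(2) d(2) by linarith
    ultimately show ?thesis using bk k1(2) Z by blast
  qed
  moreover have "d / 2 * (ks / 2) > 0" using d(1) ks by simp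
  ultimately show ?thesis using \<rho>1 by blast
qed

lemma gam_le: "gam \<beta> k m \<le> (1 + \<bar>\<beta>\<bar>) * (1 + \<bar>real_of_int m\<bar>)"
proof (cases "m \<in> Z0 \<beta> k")
  case False
  have "gam \<beta> k m \<le> sqrt ((of_int m + \<beta>)\<^sup>2)" using False by (simp add: gam_def del: real_sqrt_abs)
  also have "\<dots> \<le> \<bar>real_of_int m\<bar> + \<bar>\<beta>\<bar>" by simp
  also have "\<dots> \<le> (1 + \<bar>\<beta>\<bar>) * (1 + \<bar>real_of_int m\<bar>)" by (simp add: algebra_simps)
  finally show ?thesis .
qed (simp add: gam_def)

lemma gam_nonneg: "0 \<le> gam \<beta> k m"
  by (auto simp: gam_def Z0_def)

lemma sqrt_diff_le: "0 \<le> x \<Longrightarrow> 0 \<le> y \<Longrightarrow> \<bar>sqrt x - sqrt y\<bar> \<le> sqrt \<bar>x - y\<bar>"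
proof (induction x y rule: linorder_wlog)
  case (le x y)
  have "sqrt y \<le> sqrt (x + (y - x))" by simp
  also have "\<dots> \<le> sqrt x + sqrt (y - x)" by (rule sqrt_add_le_add_sqrt) (use le in auto)
  finally show ?case using le by simp
next
  case (sym x y)
  then show ?case by (simp add: abs_minus_commute)
qed

text \<open>The difference of the radicands grows at most linearly in m, so after taking roots the
  factor 1 + |m|, which the trace bound can absorb, is more than enough. The modulus in the
  parameters is only a square root, but it tends to 0, which is what continuity of the form
  requires.\<close>

lemma gam_diff_le:
  assumes Z: "Z0 \<beta> k = Z0 \<beta>' k'" and b: "\<bar>\<beta>\<bar> \<le> b" "\<bar>\<beta>'\<bar> \<le> b"
  shows "\<bar>gam \<beta> k m - gam \<beta>' k' m\<bar> \<le> sqrt (\<bar>\<beta> - \<beta>'\<bar> * (2 + 2 * b) + \<bar>k\<^sup>2 - k'\<^sup>2\<bar>) * (1 + \<bar>real_of_int m\<bar>)"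
proof (cases "m \<in> Z0 \<beta> k")
  case True
  then show ?thesis using Z b by (simp add: gam_def)
next
  case False
  define Q where "Q = \<bar>\<beta> - \<beta>'\<bar> * (2 + 2 * b) + \<bar>k\<^sup>2 - k'\<^sup>2\<bar>"
  define r where "r = 1 + \<bar>real_of_int m\<bar>"
  have r: "r \<ge> 1" by (simp add: r_def)
  have Q: "Q \<ge> 0" using b by (simp add: Q_def)
  have F': "m \<notin> Z0 \<beta>' k'" using False Z by simp
  have "\<bar>gam \<beta> k m - gam \<beta>' k' m\<bar> \<le> sqrt \<bar>((of_int m + \<beta>)\<^sup>2 - k\<^sup>2) - ((of_int m + \<beta>')\<^sup>2 - k'\<^sup>2)\<bar>"
    using False F' sqrt_diff_le[of "(of_int m + \<beta>)\<^sup>2 - k\<^sup>2" "(of_int m + \<beta>')\<^sup>2 - k'\<^sup>2"] by (simp add: gam_def Z0_def)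
  also have "\<dots> \<le> sqrt (Q * r\<^sup>2)"
  proof (rule real_sqrt_le_mono)
    have "(of_int m + \<beta>)\<^sup>2 - (of_int m + \<beta>')\<^sup>2 = (\<beta> - \<beta>') * (2 * of_int m + \<beta> + \<beta>')"
      by (simp add: power2_eq_square algebra_simps)
    then have "\<bar>(of_int m + \<beta>)\<^sup>2 - (of_int m + \<beta>')\<^sup>2\<bar> = \<bar>\<beta> - \<beta>'\<bar> * \<bar>2 * of_int m + \<beta> + \<beta>'\<bar>" by (simp add: abs_mult)
    also have "\<dots> \<le> \<bar>\<beta> - \<beta>'\<bar> * ((2 + 2 * b) * r)"
    proof (rule mult_left_mono)
      have "\<bar>2 * of_int m + \<beta> + \<beta>'\<bar> \<le> 2 * \<bar>real_of_int m\<bar> + 2 * b" using b by linarith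
      also have "\<dots> \<le> (2 + 2 * b) * r" using b abs_ge_zero[of \<beta>] unfolding r_def by (simp add: algebra_simps)
      finally show "\<bar>2 * of_int m + \<beta> + \<beta>'\<bar> \<le> (2 + 2 * b) * r" .
    qed simp
    finally have 1: "\<bar>(of_int m + \<beta>)\<^sup>2 - (of_int m + \<beta>')\<^sup>2\<bar> \<le> \<bar>\<beta> - \<beta>'\<bar> * (2 + 2 * b) * r" by (simp add: mult.assoc)
    have 2: "\<bar>k\<^sup>2 - k'\<^sup>2\<bar> \<le> \<bar>k\<^sup>2 - k'\<^sup>2\<bar> * r" using r by (simp add: mult_le_cancel_left1)
    have "\<bar>((of_int m + \<beta>)\<^sup>2 - k\<^sup>2) - ((of_int m + \<beta>')\<^sup>2 - k'\<^sup>2)\<bar> \<le> Q * r"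
      using 1 2 unfolding Q_def distrib_right by linarith
    also have "\<dots> \<le> Q * r\<^sup>2" using Q r by (intro mult_left_mono) (auto simp: power2_eq_square)
    finally show "\<bar>((of_int m + \<beta>)\<^sup>2 - k\<^sup>2) - ((of_int m + \<beta>')\<^sup>2 - k'\<^sup>2)\<bar> \<le> Q * r\<^sup>2" .
  qed
  also have "\<dots> = sqrt Q * r" using r by (simp add: real_sqrt_mult)
  finally show ?thesis by (simp add: Q_def r_def)
qed

section \<open>The boundary form, the gradient form and the mass form\<close>

context strip
begin

text \<open>The boundary form with a general real weight. The weight \<open>gam\<close> gives, up to
  sign, the evanescent part of the Dirichlet-to-Neumann maps, differences of such weights its change
  with the parameters, and \<open>om\<close> its difference quotient in k^2.\<close>

definition Tf :: "(int \<Rightarrow> real) \<Rightarrow> (pt \<Rightarrow> complex) \<Rightarrow> (pt \<Rightarrow> complex) \<Rightarrow> complex" where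
  "Tf w u v = (\<Sum>fl\<in>UNIV. infsum (\<lambda>m. of_real (w m) * trco d0 u fl m * cnj (trco d0 v fl m)) UNIV)"

text \<open>Cauchy-Schwarz for finite sums, with the weight 1 + |m| split evenly between the two
  traces.\<close>

lemma trace_pair_sum:
  assumes u: "u \<in> V" and v: "v \<in> V" and K: "finite K" and w: "\<And>m. \<bar>w m\<bar> \<le> W * (1 + \<bar>real_of_int m\<bar>)" and W: "W \<ge> 0"
  shows "(\<Sum>m\<in>K. cmod (of_real (w m) * trco d0 u fl m * cnj (trco d0 v fl m))) \<le> W * CT * nH u * nH v"
proof -
  define r where "r m = 1 + \<bar>real_of_int m\<bar>" for m
  have r: "r m \<ge> 0" for m by (simp add: r_def)
  define f where "f x m = sqrt (r m) * cmod (trco d0 x fl m)" for x m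
  have f2: "(\<Sum>m\<in>K. (f x m)\<^sup>2) \<le> CT * (nH x)\<^sup>2" if "x \<in> V" for x
    using trace_bound[OF that K, of fl] r by (simp add: f_def power_mult_distrib r_def)
  have "(\<Sum>m\<in>K. cmod (of_real (w m) * trco d0 u fl m * cnj (trco d0 v fl m))) \<le> (\<Sum>m\<in>K. W * (f u m * f v m))"
  proof (rule sum_mono)
    fix m
    have "cmod (of_real (w m) * trco d0 u fl m * cnj (trco d0 v fl m)) \<le> W * r m * (cmod (trco d0 u fl m) * cmod (trco d0 v fl m))"
      unfolding norm_mult mult.assoc using w[of m] by (simp add: r_def mult_right_mono flip: mult.assoc)
    also have "r m = sqrt (r m) * sqrt (r m)" using r[of m] by simp
    finally show "cmod (of_real (w m) * trco d0 u fl m * cnj (trco d0 v fl m)) \<le> W * (f u m * f v m)"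
      by (simp only: f_def mult_ac)
  qed
  also have "\<dots> = W * (\<Sum>m\<in>K. f u m * f v m)" by (simp add: sum_distrib_left)
  also have "\<dots> \<le> W * (CT * nH u * nH v)"
  proof (rule mult_left_mono[OF _ W])
    have "(\<Sum>m\<in>K. f u m * f v m)\<^sup>2 \<le> (\<Sum>m\<in>K. (f u m)\<^sup>2) * (\<Sum>m\<in>K. (f v m)\<^sup>2)" by (rule Cauchy_Schwarz_ineq_sum)
    also have "\<dots> \<le> (CT * (nH u)\<^sup>2) * (CT * (nH v)\<^sup>2)"
      using CT_pos by (intro mult_mono f2 u v) (auto intro: sum_nonneg)
    also have "\<dots> = (CT * nH u * nH v)\<^sup>2" by (simp add: power_mult_distrib power2_eq_square)
    finally show "(\<Sum>m\<in>K. f u m * f v m) \<le> CT * nH u * nH v"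
      by (rule power2_le_imp_le) (use CT_pos in \<open>auto intro!: mult_nonneg_nonneg\<close>)
  qed
  finally show ?thesis by (simp add: mult_ac)
qed

lemma trace_pair_summable:
  assumes "u \<in> V" "v \<in> V" "\<And>m. \<bar>w m\<bar> \<le> W * (1 + \<bar>real_of_int m\<bar>)" "W \<ge> 0"
  shows "(\<lambda>m. cmod (of_real (w m) * trco d0 u fl m * cnj (trco d0 v fl m))) summable_on UNIV"
    "cmod (infsum (\<lambda>m. of_real (w m) * trco d0 u fl m * cnj (trco d0 v fl m)) UNIV) \<le> W * CT * nH u * nH v"
proof -
  let ?f = "\<lambda>m. of_real (w m) * trco d0 u fl m * cnj (trco d0 v fl m)"
  note b = trace_pair_sum[OF assms(1,2) _ assms(3,4), of _ fl]
  show s: "(\<lambda>m. cmod (?f m)) summable_on UNIV"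
    by (rule nonneg_bdd_above_summable_on) (use b in \<open>auto intro!: bdd_aboveI2\<close>)
  have "cmod (infsum ?f UNIV) \<le> infsum (\<lambda>m. cmod (?f m)) UNIV" by (rule norm_infsum_bound[OF s])
  also have "\<dots> \<le> W * CT * nH u * nH v" by (rule infsum_le_finite_sums[OF s]) (use b in auto)
  finally show "cmod (infsum ?f UNIV) \<le> W * CT * nH u * nH v" .
qed

lemma Tf_bound:
  assumes "u \<in> V" "v \<in> V" "\<And>m. \<bar>w m\<bar> \<le> W * (1 + \<bar>real_of_int m\<bar>)" "W \<ge> 0"
  shows "cmod (Tf w u v) \<le> 2 * W * CT * nH u * nH v"
proof -
  have "cmod (Tf w u v) \<le> (\<Sum>fl::bool\<in>UNIV. W * CT * nH u * nH v)"
    unfolding Tf_def by (rule order_trans[OF norm_sum sum_mono]) (rule trace_pair_summable(2)[OF assms])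
  then show ?thesis by simp
qed

lemma Tf_herm:
  assumes w: "\<And>m. \<bar>w m\<bar> \<le> W * (1 + \<bar>real_of_int m\<bar>)" "W \<ge> 0"
  shows "herm_on V (Tf w)"
  unfolding herm_on_def
proof (intro conjI ballI)
  fix v assume v: "v \<in> V"
  show "lin_on V (\<lambda>u. Tf w u v)"
  proof (rule lin_onI_combine[OF fun_space_V])
    fix u u' c assume u: "u \<in> V" "u' \<in> V"
    note s = abs_summable_summable[OF trace_pair_summable(1)[OF u(1) v w]]
      abs_summable_summable[OF trace_pair_summable(1)[OF u(2) v w]]
    have "trco d0 (\<lambda>x. u x + c * u' x) fl m = trco d0 u fl m + c * trco d0 u' fl m" for fl m
      using lin_onD(1)[OF trco_linear u(1) fun_spaceD(3)[OF fun_space_V u(2)]] lin_onD(2)[OF trco_linear u(2)] by simp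
    then have "infsum (\<lambda>m. of_real (w m) * trco d0 (\<lambda>x. u x + c * u' x) fl m * cnj (trco d0 v fl m)) UNIV =
      infsum (\<lambda>m. of_real (w m) * trco d0 u fl m * cnj (trco d0 v fl m) + c * (of_real (w m) * trco d0 u' fl m * cnj (trco d0 v fl m))) UNIV" for fl
      by (intro infsum_cong) (simp add: algebra_simps)
    also have "\<dots> fl = infsum (\<lambda>m. of_real (w m) * trco d0 u fl m * cnj (trco d0 v fl m)) UNIV + c * infsum (\<lambda>m. of_real (w m) * trco d0 u' fl m * cnj (trco d0 v fl m)) UNIV" for fl
      by (subst infsum_add[OF s(1) summable_on_cmult_right[OF s(2)]]) (simp add: infsum_cmult_right[OF s(2)])
    finally show "Tf w (\<lambda>x. u x + c * u' x) v = Tf w u v + c * Tf w u' v"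
      by (simp add: Tf_def sum.distrib sum_distrib_left)
  qed
next
  fix u v
  show "Tf w v u = cnj (Tf w u v)"
    unfolding Tf_def cnj_sum infsum_cnj[symmetric] by (simp add: mult_ac)
qed

lemma Tf_diff:
  assumes "u \<in> V" "v \<in> V" "\<And>m. \<bar>w m\<bar> \<le> W * (1 + \<bar>real_of_int m\<bar>)" "W \<ge> 0" "\<And>m. \<bar>w' m\<bar> \<le> W' * (1 + \<bar>real_of_int m\<bar>)" "W' \<ge> 0"
  shows "Tf w u v - Tf w' u v = Tf (\<lambda>m. w m - w' m) u v"
proof -
  have ww: "\<bar>w m - w' m\<bar> \<le> (W + W') * (1 + \<bar>real_of_int m\<bar>)" for m
    using assms(3)[of m] assms(5)[of m] unfolding distrib_right by linarith
  have "Tf w u v = Tf w' u v + Tf (\<lambda>m. w m - w' m) u v"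
    unfolding Tf_def sum.distrib[symmetric]
  proof (rule sum.cong[OF refl])
    fix fl
    note s = abs_summable_summable[OF trace_pair_summable(1)[OF assms(1,2,5,6), of fl]]
      abs_summable_summable[OF trace_pair_summable(1)[OF assms(1,2) ww, of fl]]
    show "infsum (\<lambda>m. of_real (w m) * trco d0 u fl m * cnj (trco d0 v fl m)) UNIV =
       infsum (\<lambda>m. of_real (w' m) * trco d0 u fl m * cnj (trco d0 v fl m)) UNIV +
       infsum (\<lambda>m. of_real (w m - w' m) * trco d0 u fl m * cnj (trco d0 v fl m)) UNIV"
      using assms(4,6) by (subst infsum_add[OF s, symmetric]) (auto simp: algebra_simps)
  qed
  then show ?thesis by simp
qed

lemma Tf_scale: "Tf (\<lambda>m. r * w m) u v = of_real r * Tf w u v"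
  unfolding Tf_def sum_distrib_left infsum_cmult_right'[symmetric] by (simp add: mult_ac)

lemma Tf_pos:
  assumes "u \<in> V" "\<And>m. 0 \<le> w m"
  shows "0 \<le> Re (Tf w u u)"
proof -
  have "0 \<le> Re (infsum (\<lambda>m. of_real (w m) * trco d0 u fl m * cnj (trco d0 u fl m)) UNIV)" for fl
  proof -
    let ?f = "\<lambda>m. of_real (w m) * trco d0 u fl m * cnj (trco d0 u fl m)"
    have e: "?f m = of_real (w m * (cmod (trco d0 u fl m))\<^sup>2)" for m
      unfolding of_real_mult complex_norm_square by (simp add: mult.assoc)
    have "0 \<le> Re (?f m)" for m unfolding e Re_complex_of_real using assms(2) by simp
    then show ?thesis
      by (cases "?f summable_on UNIV") (auto simp: infsum_Re[symmetric] infsum_not_exists intro!: infsum_nonneg)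
  qed
  then show ?thesis unfolding Tf_def Re_sum by (intro sum_nonneg)
qed

text \<open>The inner product of the shifted gradients, expanded so that the dependence on \<beta>
  is polynomial.\<close>

definition GF :: "real \<Rightarrow> (pt \<Rightarrow> complex) \<Rightarrow> (pt \<Rightarrow> complex) \<Rightarrow> complex" where
  "GF \<beta> u v = ip M (G1 u) (G1 v) + ip M (G2 u) (G2 v) + of_real (\<beta>\<^sup>2) * ip M u v
     + \<i> * of_real \<beta> * (ip M u (G1 v) - ip M (G1 u) v)"

lemma lin_on_scale: "lin_on W f \<Longrightarrow> lin_on W (\<lambda>u. c * f u)"
  by (auto simp: lin_on_def algebra_simps)

lemma lin_on_minus: "lin_on W f \<Longrightarrow> lin_on W g \<Longrightarrow> lin_on W (\<lambda>u. f u - g u)"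
  by (auto simp: lin_on_def algebra_simps)

lemma GF_herm: "herm_on V (GF \<beta>)"
  unfolding herm_on_def
proof (intro conjI ballI)
  fix v assume "v \<in> V"
  then show "lin_on V (\<lambda>u. GF \<beta> u v)" unfolding GF_def by (intro lin_on_add lin_on_minus lin_on_scale ip_linear V_sqint)
next
  fix u v assume u: "u \<in> V" and v: "v \<in> V"
  note si = V_sqint[OF u] V_sqint[OF v]
  show "GF \<beta> v u = cnj (GF \<beta> u v)" unfolding GF_def
    using ip_sym[OF si(2) si(5)] ip_sym[OF si(3) si(6)] ip_sym[OF si(1) si(4)] ip_sym[OF si(1) si(5)] ip_sym[OF si(2) si(4)]
    by (simp add: algebra_simps)
qed

lemma GF_LINT:
  assumes u: "u \<in> V" and v: "v \<in> V"
  shows "(LINT x:\<Omega>|lborel. fst (shgrad d0 \<beta> u x) * cnj (fst (shgrad d0 \<beta> v x)) + snd (shgrad d0 \<beta> u x) * cnj (snd (shgrad d0 \<beta> v x))) = GF \<beta> u v"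
proof -
  note si = V_sqint[OF u] V_sqint[OF v]
  note i = sqint_integrable_mult[OF si(2) si(5)] sqint_integrable_mult[OF si(3) si(6)] sqint_integrable_mult[OF si(1) si(4)]
    sqint_integrable_mult[OF si(1) si(5)] sqint_integrable_mult[OF si(2) si(4)]
  have "(LINT x:\<Omega>|lborel. fst (shgrad d0 \<beta> u x) * cnj (fst (shgrad d0 \<beta> v x)) + snd (shgrad d0 \<beta> u x) * cnj (snd (shgrad d0 \<beta> v x))) =
     (\<integral>x. G1 u x * cnj (G1 v x) + G2 u x * cnj (G2 v x) + of_real (\<beta>\<^sup>2) * (u x * cnj (v x))
       + \<i> * of_real \<beta> * (u x * cnj (G1 v x) - G1 u x * cnj (v x)) \<partial>M)"
    unfolding LINT_Omega
    by (rule Bochner_Integration.integral_cong) (simp_all add: shgrad_def G1_def G2_def algebra_simps power2_eq_square)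
  also have "\<dots> = GF \<beta> u v" using i by (simp add: GF_def ip_def)
  finally show ?thesis .
qed

lemma ip_nH:
  assumes "u \<in> V" "v \<in> V"
  shows "cmod (ip M u v) \<le> nH u * nH v" "cmod (ip M u (G1 v)) \<le> nH u * nH v" "cmod (ip M (G1 u) v) \<le> nH u * nH v"
    "cmod (ip M (G1 u) (G1 v)) \<le> nH u * nH v" "cmod (ip M (G2 u) (G2 v)) \<le> nH u * nH v"
  using ip_cauchy_schwarz nH_ge V_sqint[OF assms(1)] V_sqint[OF assms(2)]
  by (meson mult_mono nH_nonneg order_trans real_sqrt_ge_zero sq_nonneg)+

lemma GF_diff:
  assumes "u \<in> V" "v \<in> V"
  shows "cmod (GF \<beta> u v - GF \<beta>' u v) \<le> (\<bar>\<beta>\<^sup>2 - \<beta>'\<^sup>2\<bar> + 2 * \<bar>\<beta> - \<beta>'\<bar>) * (nH u * nH v)"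
proof -
  have "GF \<beta> u v - GF \<beta>' u v = of_real (\<beta>\<^sup>2 - \<beta>'\<^sup>2) * ip M u v + \<i> * of_real (\<beta> - \<beta>') * (ip M u (G1 v) - ip M (G1 u) v)"
    by (simp add: GF_def algebra_simps)
  also have "cmod \<dots> \<le> \<bar>\<beta>\<^sup>2 - \<beta>'\<^sup>2\<bar> * cmod (ip M u v) + \<bar>\<beta> - \<beta>'\<bar> * cmod (ip M u (G1 v) - ip M (G1 u) v)"
    by (rule order_trans[OF norm_triangle_ineq]) (simp add: norm_mult flip: of_real_power of_real_diff)
  also have "\<dots> \<le> \<bar>\<beta>\<^sup>2 - \<beta>'\<^sup>2\<bar> * (nH u * nH v) + \<bar>\<beta> - \<beta>'\<bar> * (nH u * nH v + nH u * nH v)"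
    by (intro add_mono mult_left_mono ip_nH assms order_trans[OF norm_triangle_ineq4]) auto
  finally show ?thesis by (simp add: algebra_simps)
qed

text \<open>Young's inequality spends half of the horizontal energy on the cross term; the rest of
  the cross term is a multiple of \<beta>^2 times the L2 norm.\<close>

lemma GF_coercive:
  assumes u: "u \<in> V"
  shows "(sq M (G1 u) + sq M (G2 u)) / 2 - \<beta>\<^sup>2 * sq M u \<le> Re (GF \<beta> u u)"
proof -
  define s where "s = sqrt (sq M u)"
  define g where "g = sqrt (sq M (G1 u))"
  have sg: "s\<^sup>2 = sq M u" "g\<^sup>2 = sq M (G1 u)" by (simp_all add: s_def g_def sq_nonneg)
  have c: "cmod (ip M u (G1 u)) \<le> s * g" "cmod (ip M (G1 u) u) \<le> s * g"
    using ip_cauchy_schwarz[OF V_sqint(1,2)[OF u]] ip_cauchy_schwarz[OF V_sqint(2,1)[OF u]]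
    by (simp_all add: s_def g_def mult.commute)
  have "cmod (\<i> * of_real \<beta> * (ip M u (G1 u) - ip M (G1 u) u)) \<le> \<bar>\<beta>\<bar> * (s * g + s * g)"
  proof -
    have "cmod (ip M u (G1 u) - ip M (G1 u) u) \<le> s * g + s * g"
      using norm_triangle_ineq4[of "ip M u (G1 u)" "ip M (G1 u) u"] c by linarith
    from mult_left_mono[OF this abs_ge_zero[of \<beta>]] show ?thesis by (simp add: norm_mult)
  qed
  also have "\<dots> = 2 * ((2 * \<bar>\<beta>\<bar> * s) * (g / 2) * 1) " by simp
  also have "\<dots> = 2 * ((sqrt 2 * \<bar>\<beta>\<bar> * s) * (g / sqrt 2))" by simp
  also have "\<dots> \<le> (sqrt 2 * \<bar>\<beta>\<bar> * s)\<^sup>2 + (g / sqrt 2)\<^sup>2" by (rule two_mult_le_squares)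
  also have "\<dots> = 2 * \<beta>\<^sup>2 * s\<^sup>2 + g\<^sup>2 / 2" by (simp add: power_mult_distrib power_divide)
  finally have "- (2 * \<beta>\<^sup>2 * s\<^sup>2 + g\<^sup>2 / 2) \<le> Re (\<i> * of_real \<beta> * (ip M u (G1 u) - ip M (G1 u) u))"
    using abs_Re_le_cmod[of "\<i> * of_real \<beta> * (ip M u (G1 u) - ip M (G1 u) u)"] by linarith
  moreover have "Re (GF \<beta> u u) = sq M (G1 u) + sq M (G2 u) + \<beta>\<^sup>2 * sq M u + Re (\<i> * of_real \<beta> * (ip M u (G1 u) - ip M (G1 u) u))"
    unfolding GF_def ip_self plus_complex.simps by (simp flip: of_real_mult)
  ultimately show ?thesis using sq_nonneg[of M "G2 u"] unfolding sg by (simp add: field_simps)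
qed

text \<open>The weight may be any bounded function, so that differences of two permittivities are
  covered as well.\<close>

definition EF :: "(pt \<Rightarrow> real) \<Rightarrow> (pt \<Rightarrow> complex) \<Rightarrow> (pt \<Rightarrow> complex) \<Rightarrow> complex" where
  "EF e u v = ip M (\<lambda>x. of_real (e x) * u x) v"

lemma EF_sq:
  assumes e: "e \<in> borel_measurable M" "AE x in M. \<bar>e x\<bar> \<le> E" "E \<ge> 0" and u: "sqint M u"
  shows "sqint M (\<lambda>x. of_real (e x) * u x)" "sqrt (sq M (\<lambda>x. of_real (e x) * u x)) \<le> E * sqrt (sq M u)"
proof -
  have m: "(\<lambda>x. of_real (e x) * u x) \<in> borel_measurable M" using e(1) sqint_meas[OF u] by measurable
  have i: "integrable M (\<lambda>x. E\<^sup>2 * (cmod (u x))\<^sup>2)" using u by (simp add: sqint_def)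
  have le: "AE x in M. (cmod (of_real (e x) * u x))\<^sup>2 \<le> E\<^sup>2 * (cmod (u x))\<^sup>2"
    using e(2)
  proof eventually_elim
    case (elim x)
    then have "(\<bar>e x\<bar>)\<^sup>2 \<le> E\<^sup>2" by (intro power_mono) auto
    then show ?case by (simp add: norm_mult power_mult_distrib mult_right_mono)
  qed
  have i2: "integrable M (\<lambda>x. (cmod (of_real (e x) * u x))\<^sup>2)"
    by (rule Bochner_Integration.integrable_bound[OF i]) (use m le in auto)
  then show s: "sqint M (\<lambda>x. of_real (e x) * u x)" using m by (simp add: sqint_def)
  have "sq M (\<lambda>x. of_real (e x) * u x) \<le> (\<integral>x. E\<^sup>2 * (cmod (u x))\<^sup>2 \<partial>M)"
    unfolding sq_def by (rule integral_mono_AE[OF i2 i le])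
  also have "\<dots> = E\<^sup>2 * sq M u" by (simp add: sq_def)
  finally have "sqrt (sq M (\<lambda>x. of_real (e x) * u x)) \<le> sqrt (E\<^sup>2 * sq M u)" by (rule real_sqrt_le_mono)
  then show "sqrt (sq M (\<lambda>x. of_real (e x) * u x)) \<le> E * sqrt (sq M u)" using e(3) by (simp add: real_sqrt_mult)
qed

lemma EF_bound:
  assumes e: "e \<in> borel_measurable M" "AE x in M. \<bar>e x\<bar> \<le> E" "E \<ge> 0" and uv: "u \<in> V" "v \<in> V"
  shows "cmod (EF e u v) \<le> E * (nH u * nH v)"
proof -
  note si = V_sqint(1)[OF uv(1)] V_sqint(1)[OF uv(2)]
  have "cmod (EF e u v) \<le> sqrt (sq M (\<lambda>x. of_real (e x) * u x)) * sqrt (sq M v)"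
    unfolding EF_def by (rule ip_cauchy_schwarz[OF EF_sq(1)[OF e si(1)] si(2)])
  also have "\<dots> \<le> (E * sqrt (sq M u)) * sqrt (sq M v)" by (intro mult_right_mono EF_sq(2)[OF e si(1)]) (simp add: sq_nonneg)
  also have "\<dots> \<le> (E * nH u) * nH v" by (intro mult_mono mult_left_mono nH_ge e(3) mult_nonneg_nonneg) (auto simp: sq_nonneg)
  finally show ?thesis by (simp add: mult.assoc)
qed

lemma EF_herm:
  assumes e: "e \<in> borel_measurable M" "AE x in M. \<bar>e x\<bar> \<le> E" "E \<ge> 0"
  shows "herm_on V (EF e)"
  unfolding herm_on_def
proof (intro conjI ballI)
  fix v assume v: "v \<in> V"
  show "lin_on V (\<lambda>u. EF e u v)"
  proof (rule lin_onI_combine[OF fun_space_V])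
    fix u u' c assume "u \<in> V" "u' \<in> V"
    note s = EF_sq(1)[OF e V_sqint(1)[OF this(1)]] EF_sq(1)[OF e V_sqint(1)[OF this(2)]]
    show "EF e (\<lambda>x. u x + c * u' x) v = EF e u v + c * EF e u' v" unfolding EF_def
      by (rule ip_combine[OF _ _ s V_sqint(1)[OF v]])
        (use sqint_add[OF s(1) sqint_scale[OF s(2), of c]] in \<open>auto simp: algebra_simps\<close>)
  qed
next
  fix u v
  show "EF e v u = cnj (EF e u v)"
    unfolding EF_def ip_def Bochner_Integration.integral_cnj[symmetric] by (simp add: mult_ac)
qed

lemma EF_diff:
  assumes e: "e \<in> borel_measurable M" "AE x in M. \<bar>e x\<bar> \<le> E" "E \<ge> 0" and e': "e' \<in> borel_measurable M" "AE x in M. \<bar>e' x\<bar> \<le> E'" "E' \<ge> 0"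
    and uv: "u \<in> V" "v \<in> V"
  shows "EF e u v - EF e' u v = EF (\<lambda>x. e x - e' x) u v"
  unfolding EF_def
  by (subst ip_diff_left[OF EF_sq(1)[OF e V_sqint(1)[OF uv(1)]] EF_sq(1)[OF e' V_sqint(1)[OF uv(1)]] V_sqint(1)[OF uv(2)], symmetric])
    (simp add: left_diff_distrib)

lemma EF_self:
  "EF e u u = of_real (\<integral>x. e x * (cmod (u x))\<^sup>2 \<partial>M)"
  unfolding EF_def ip_def integral_complex_of_real[symmetric] of_real_mult complex_norm_square by (simp add: mult.assoc)

end

subsection \<open>The scattering form\<close>

text \<open>\<rho> and c are meant to be those of \<open>spectral_gap\<close>: within \<rho> of the
  reference values the propagating orders are fixed, and c bounds the distance from cut-off
  uniformly in m.\<close>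

locale grating_window = strip d0 for d0 :: real +
  fixes eps :: "pt \<Rightarrow> real^'n \<Rightarrow> real" and W1 :: "(real^'n) set" and emin emax \<beta>s ks \<rho> c :: real
  assumes eps_ok: "eps_ok d0 eps W1 emin emax" and ks: "ks > 0" and c: "c > 0"
    and window: "\<And>\<beta> k. \<bar>\<beta> - \<beta>s\<bar> < \<rho> \<Longrightarrow> \<bar>k - ks\<bar> < \<rho> \<Longrightarrow>
     \<bar>\<beta>\<bar> < k \<and> k < 2 * ks \<and> \<bar>\<beta>\<bar> \<le> \<bar>\<beta>s\<bar> + 1 \<and> Z0 \<beta> k = Z0 \<beta>s ks \<and> (\<forall>m. c \<le> \<bar>k\<^sup>2 - (of_int m + \<beta>)\<^sup>2\<bar>)"
begin

text \<open>\<beta> ranges over a full interval around \<beta>s. The restriction to [-1/2, 1/2) is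
  imposed only when the original problem is restored, so the linear analysis does not see its
  endpoints.\<close>

definition S :: "(real \<times> (real^'n) \<times> real) set" where
  "S = {(\<beta>, \<delta>, k). \<bar>\<beta> - \<beta>s\<bar> < \<rho> \<and> \<delta> \<in> W1 \<and> \<bar>k - ks\<bar> < \<rho>}"

abbreviation "I \<equiv> Idx \<beta>s ks"

lemma emin: "emin > 0" "emin \<le> emax" "emax > 0"
  using eps_ok by (auto simp: eps_ok_def)

lemma open_W1: "open W1"
  using eps_ok by (simp add: eps_ok_def)

lemma eps_meas: "\<delta> \<in> W1 \<Longrightarrow> (\<lambda>x. eps x \<delta>) \<in> borel_measurable M"
  using eps_ok by (auto simp: eps_ok_def intro!: measurable_restrict_space1)

lemma eps_range: "\<delta> \<in> W1 \<Longrightarrow> emin \<le> eps x \<delta>" "\<delta> \<in> W1 \<Longrightarrow> eps x \<delta> \<le> emax"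
  using eps_ok unfolding eps_ok_def by blast+

lemma eps_bdd: "\<delta> \<in> W1 \<Longrightarrow> AE x in M. \<bar>eps x \<delta>\<bar> \<le> emax"
  using eps_range emin by (intro AE_I2) (smt (verit))

lemma eps_cont:
  assumes "\<delta>0 \<in> W1" "e > 0"
  shows "\<exists>r>0. \<forall>\<delta>\<in>W1. dist \<delta> \<delta>0 < r \<longrightarrow> (AE x in M. \<bar>eps x \<delta> - eps x \<delta>0\<bar> \<le> e)"
proof -
  have "\<forall>\<delta>0\<in>W1. \<forall>e>0. \<exists>r>0. \<forall>\<delta>\<in>W1. dist \<delta> \<delta>0 < r \<longrightarrow> (AE x in lborel. \<bar>eps x \<delta> - eps x \<delta>0\<bar> \<le> e)"
    using eps_ok unfolding eps_ok_def by (elim conjE)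
  from this[rule_format, OF assms] obtain r where r: "r > 0" "\<forall>\<delta>\<in>W1. dist \<delta> \<delta>0 < r \<longrightarrow> (AE x in lborel. \<bar>eps x \<delta> - eps x \<delta>0\<bar> \<le> e)"
    by (elim exE conjE)
  have "AE x in M. \<bar>eps x \<delta> - eps x \<delta>0\<bar> \<le> e" if "\<delta> \<in> W1" "dist \<delta> \<delta>0 < r" for \<delta>
    unfolding AE_Omega[symmetric] using r(2)[rule_format, OF that] by eventually_elim simp
  then show ?thesis using r(1) by blast
qed

definition Af :: "real \<Rightarrow> real^'n \<Rightarrow> real \<Rightarrow> (pt \<Rightarrow> complex) \<Rightarrow> (pt \<Rightarrow> complex) \<Rightarrow> complex" where
  "Af \<beta> \<delta> k u v = GF \<beta> u v - of_real (k\<^sup>2) * EF (\<lambda>x. eps x \<delta>) u v + Tf (gam \<beta> k) u v"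

lemma gam_weight: "\<bar>gam \<beta> k m\<bar> \<le> (1 + \<bar>\<beta>\<bar>) * (1 + \<bar>real_of_int m\<bar>)"
  using gam_le[of \<beta> k m] gam_nonneg[of \<beta> k m] by simp

lemma weight_nonneg: "0 \<le> 1 + \<bar>\<beta>::real\<bar>"
  by simp

lemma Tf_gam_herm: "herm_on V (Tf (gam \<beta> k))"
  by (rule Tf_herm[OF gam_weight weight_nonneg])

lemma EF_eps_herm: "\<delta> \<in> W1 \<Longrightarrow> herm_on V (EF (\<lambda>x. eps x \<delta>))"
  by (rule EF_herm[OF eps_meas eps_bdd]) (use emin in auto)

lemma Af_herm:
  assumes d: "\<delta> \<in> W1" shows "herm_on V (Af \<beta> \<delta> k)"
  unfolding herm_on_def
proof (intro conjI ballI)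
  fix v assume v: "v \<in> V"
  show "lin_on V (\<lambda>u. Af \<beta> \<delta> k u v)" unfolding Af_def
    by (intro lin_on_add lin_on_minus lin_on_scale herm_on_lin[OF GF_herm v] herm_on_lin[OF Tf_gam_herm v] herm_on_lin[OF EF_eps_herm[OF d] v])
next
  fix u v assume uv: "u \<in> V" "v \<in> V"
  show "Af \<beta> \<delta> k v u = cnj (Af \<beta> \<delta> k u v)" unfolding Af_def
    using herm_on_sym[OF GF_herm uv, of \<beta>] herm_on_sym[OF Tf_gam_herm uv, of \<beta> k] herm_on_sym[OF EF_eps_herm[OF d] uv]
    by simp
qed

text \<open>The propagating channels contribute the skew part of \<open>aform\<close>, the evanescent ones the
  positive boundary term of \<open>Af\<close>.\<close>

lemma aform_eq:
  assumes u: "u \<in> V" and v: "v \<in> V"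
  shows "aform d0 eps \<beta> \<delta> k u v = Af \<beta> \<delta> k u v
    - (\<Sum>(fl, m)\<in>Idx \<beta> k. \<i> * alpha \<beta> k m * trco d0 u fl m * cnj (trco d0 v fl m))"
proof -
  let ?t = "\<lambda>fl m. trco d0 u fl m * cnj (trco d0 v fl m)"
  have inf: "infsum (\<lambda>m. \<i> * alpha \<beta> k m * trco d0 u fl m * cnj (trco d0 v fl m)) UNIV =
     - infsum (\<lambda>m. of_real (gam \<beta> k m) * trco d0 u fl m * cnj (trco d0 v fl m)) UNIV + (\<Sum>m\<in>Z0 \<beta> k. \<i> * alpha \<beta> k m * ?t fl m)" for fl
  proof -
    let ?g = "\<lambda>m. of_real (gam \<beta> k m) * trco d0 u fl m * cnj (trco d0 v fl m)"
    let ?z = "\<lambda>m. if m \<in> Z0 \<beta> k then \<i> * alpha \<beta> k m * ?t fl m else 0"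
    have sg: "?g summable_on UNIV"
      by (rule abs_summable_summable[OF trace_pair_summable(1)[OF u v gam_weight weight_nonneg]])
    have sz: "?z summable_on UNIV" "infsum ?z UNIV = (\<Sum>m\<in>Z0 \<beta> k. \<i> * alpha \<beta> k m * ?t fl m)"
    proof -
      have hs: "(?z has_sum (\<Sum>m\<in>Z0 \<beta> k. \<i> * alpha \<beta> k m * ?t fl m)) UNIV"
      proof (rule has_sum_cong_neutral[THEN iffD1, OF _ _ _ has_sum_finite[OF finite_Z0[of \<beta> k]]])
      qed auto
      then show "?z summable_on UNIV" "infsum ?z UNIV = (\<Sum>m\<in>Z0 \<beta> k. \<i> * alpha \<beta> k m * ?t fl m)"
        by (auto intro: has_sum_imp_summable infsumI)
    qed
    \<comment> \<open>On the evanescent orders i \<alpha>_m is minus \<open>gam\<close>, and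
      \<open>gam\<close> vanishes on the propagating ones, so the two series have disjoint
      supports.\<close>
    have "infsum (\<lambda>m. \<i> * alpha \<beta> k m * trco d0 u fl m * cnj (trco d0 v fl m)) UNIV = infsum (\<lambda>m. - ?g m + ?z m) UNIV"
      by (rule infsum_cong) (auto simp: alpha_evanescent gam_def[of \<beta> k] mult.assoc split: if_splits)
    also have "\<dots> = - infsum ?g UNIV + infsum ?z UNIV"
      using infsum_add[OF summable_on_uminus[THEN iffD2, OF sg] sz(1)] by (simp add: infsum_uminus)
    finally show ?thesis unfolding sz(2) .
  qed
  have e: "(LINT x:\<Omega>|lborel. of_real (eps x \<delta>) * u x * cnj (v x)) = EF (\<lambda>x. eps x \<delta>) u v"
    unfolding LINT_Omega EF_def ip_def ..
  have "(\<Sum>(fl, m)\<in>Idx \<beta> k. \<i> * alpha \<beta> k m * trco d0 u fl m * cnj (trco d0 v fl m)) =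
     (\<Sum>fl\<in>UNIV. \<Sum>m\<in>Z0 \<beta> k. \<i> * alpha \<beta> k m * ?t fl m)"
    unfolding Idx_def by (subst sum.cartesian_product[symmetric]) (simp add: mult.assoc)
  then show ?thesis
    unfolding aform_def GF_LINT[OF u v] e inf Af_def Tf_def by (simp add: sum_negf sum_subtractf)
qed

section \<open>Garding inequality and continuity of the Hermitian form in the parameters\<close>

definition Lam :: real where "Lam = (\<bar>\<beta>s\<bar> + 1)\<^sup>2 + (2 * ks)\<^sup>2 * emax"

lemma Lam_pos: "Lam > 0"
  using emin ks by (simp add: Lam_def add_pos_pos)

lemma S_D:
  assumes "(\<beta>, \<delta>, k) \<in> S"
  shows "\<delta> \<in> W1" "0 < k" "\<bar>\<beta>\<bar> < k" "k < 2 * ks" "\<bar>\<beta>\<bar> \<le> \<bar>\<beta>s\<bar> + 1" "Z0 \<beta> k = Z0 \<beta>s ks" "Idx \<beta> k = I"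
    "\<And>m. c \<le> \<bar>k\<^sup>2 - (of_int m + \<beta>)\<^sup>2\<bar>"
  using window[of \<beta> k] assms by (auto simp: S_def Idx_def)

lemma S_k_sq: "(\<beta>, \<delta>, k) \<in> S \<Longrightarrow> k\<^sup>2 \<le> (2 * ks)\<^sup>2"
  using S_D[of \<beta> \<delta> k] by (intro power_mono) auto

text \<open>The evanescent boundary term is nonnegative and is dropped; the L2 terms with factors
  \<beta>^2 and k^2 \<open>emax\<close> are bounded over the whole window by
  \<open>Lam\<close>.\<close>

lemma Af_garding:
  assumes p: "(\<beta>, \<delta>, k) \<in> S" and u: "u \<in> V"
  shows "(sq M (G1 u) + sq M (G2 u)) / 2 - Lam * sq M u \<le> Re (Af \<beta> \<delta> k u u)"
proof -
  note D = S_D[OF p]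
  have "cmod (EF (\<lambda>x. eps x \<delta>) u u) \<le> sqrt (sq M (\<lambda>x. of_real (eps x \<delta>) * u x)) * sqrt (sq M u)"
    unfolding EF_def by (rule ip_cauchy_schwarz[OF EF_sq(1)[OF eps_meas[OF D(1)] eps_bdd[OF D(1)] _ V_sqint(1)[OF u]] V_sqint(1)[OF u]]) (use emin in simp)
  also have "\<dots> \<le> (emax * sqrt (sq M u)) * sqrt (sq M u)"
    by (intro mult_right_mono EF_sq(2)[OF eps_meas[OF D(1)] eps_bdd[OF D(1)] _ V_sqint(1)[OF u]]) (use emin in \<open>auto simp: sq_nonneg\<close>)
  also have "\<dots> = emax * sq M u" by (simp add: sq_nonneg)
  finally have "Re (EF (\<lambda>x. eps x \<delta>) u u) \<le> emax * sq M u" using complex_Re_le_cmod order_trans by blast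
  then have "k\<^sup>2 * Re (EF (\<lambda>x. eps x \<delta>) u u) \<le> k\<^sup>2 * (emax * sq M u)" by (intro mult_left_mono) auto
  also have "\<dots> \<le> (2 * ks)\<^sup>2 * (emax * sq M u)" by (intro mult_right_mono S_k_sq[OF p]) (use emin sq_nonneg[of M u] in simp)
  finally have 1: "k\<^sup>2 * Re (EF (\<lambda>x. eps x \<delta>) u u) \<le> (2 * ks)\<^sup>2 * (emax * sq M u)" .
  have "\<beta>\<^sup>2 \<le> (\<bar>\<beta>s\<bar> + 1)\<^sup>2" using D(5) by (metis power2_abs power_mono abs_ge_zero)
  then have 2: "\<beta>\<^sup>2 * sq M u \<le> (\<bar>\<beta>s\<bar> + 1)\<^sup>2 * sq M u" by (intro mult_right_mono sq_nonneg)
  have 3: "0 \<le> Re (Tf (gam \<beta> k) u u)" by (rule Tf_pos[OF u gam_nonneg])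
  have "Re (Af \<beta> \<delta> k u u) = Re (GF \<beta> u u) - k\<^sup>2 * Re (EF (\<lambda>x. eps x \<delta>) u u) + Re (Tf (gam \<beta> k) u u)"
    unfolding Af_def by simp
  then show ?thesis using 1 2 3 GF_coercive[OF u, of \<beta>] unfolding Lam_def distrib_right mult.assoc by linarith
qed

lemma GF_zero_bound:
  assumes "u \<in> V" "v \<in> V" shows "cmod (GF 0 u v) \<le> 2 * (nH u * nH v)"
  using norm_triangle_ineq[of "ip M (G1 u) (G1 v)" "ip M (G2 u) (G2 v)"] ip_nH(4,5)[OF assms] by (simp add: GF_def)

lemma Af_bound:
  assumes p: "(\<beta>, \<delta>, k) \<in> S"
  shows "\<exists>K. \<forall>u\<in>V. \<forall>v\<in>V. cmod (Af \<beta> \<delta> k u v) \<le> K * (nH u * nH v)"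
proof (intro exI ballI)
  fix u v assume u: "u \<in> V" and v: "v \<in> V"
  note D = S_D[OF p]
  have "cmod (GF \<beta> u v) \<le> cmod (GF \<beta> u v - GF 0 u v) + cmod (GF 0 u v)"
    using norm_triangle_ineq[of "GF \<beta> u v - GF 0 u v" "GF 0 u v"] by simp
  then have 1: "cmod (GF \<beta> u v) \<le> (\<bar>\<beta>\<^sup>2\<bar> + 2 * \<bar>\<beta>\<bar>) * (nH u * nH v) + 2 * (nH u * nH v)"
    using GF_diff[OF u v, of \<beta> 0] GF_zero_bound[OF u v] by simp
  have 2: "cmod (of_real (k\<^sup>2) * EF (\<lambda>x. eps x \<delta>) u v) \<le> k\<^sup>2 * (emax * (nH u * nH v))"
    unfolding norm_mult norm_of_real using EF_bound[OF eps_meas[OF D(1)] eps_bdd[OF D(1)] _ u v] emin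
    by (simp add: mult_left_mono)
  have 3: "cmod (Tf (gam \<beta> k) u v) \<le> 2 * (1 + \<bar>\<beta>\<bar>) * CT * nH u * nH v"
    by (rule Tf_bound[OF u v gam_weight weight_nonneg])
  have "cmod (Af \<beta> \<delta> k u v) \<le> cmod (GF \<beta> u v) + cmod (of_real (k\<^sup>2) * EF (\<lambda>x. eps x \<delta>) u v) + cmod (Tf (gam \<beta> k) u v)"
    unfolding Af_def by (rule order_trans[OF norm_triangle_ineq add_right_mono[OF norm_triangle_ineq4]])
  also have "\<dots> \<le> (\<bar>\<beta>\<^sup>2\<bar> + 2 * \<bar>\<beta>\<bar> + 2 + k\<^sup>2 * emax + 2 * (1 + \<bar>\<beta>\<bar>) * CT) * (nH u * nH v)"
    using 1 2 3 by (simp add: algebra_simps)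
  finally show "cmod (Af \<beta> \<delta> k u v) \<le> (\<bar>\<beta>\<^sup>2\<bar> + 2 * \<bar>\<beta>\<bar> + 2 + k\<^sup>2 * emax + 2 * (1 + \<bar>\<beta>\<bar>) * CT) * (nH u * nH v)" .
qed

text \<open>A modulus of continuity in (\<beta>, k): the first two terms come from the gradient
  form, the third from the factor k^2 of the mass form, the last from the decay rates through
  \<open>gam_diff_le\<close>. It enters the limit argument through its continuity and its value 0 on
  the diagonal.\<close>

definition mdl :: "real \<Rightarrow> real \<Rightarrow> real \<Rightarrow> real \<Rightarrow> real" where
  "mdl \<beta> k \<beta>' k' = \<bar>\<beta>'\<^sup>2 - \<beta>\<^sup>2\<bar> + 2 * \<bar>\<beta>' - \<beta>\<bar> + \<bar>k'\<^sup>2 - k\<^sup>2\<bar> * emax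
     + 2 * sqrt (\<bar>\<beta>' - \<beta>\<bar> * (2 + 2 * (\<bar>\<beta>s\<bar> + 1)) + \<bar>k'\<^sup>2 - k\<^sup>2\<bar>) * CT"

lemma Af_diff:
  assumes p: "(\<beta>, \<delta>, k) \<in> S" and q: "(\<beta>', \<delta>', k') \<in> S" and e: "AE x in M. \<bar>eps x \<delta>' - eps x \<delta>\<bar> \<le> e" "e \<ge> 0"
    and u: "u \<in> V" and v: "v \<in> V"
  shows "cmod (Af \<beta>' \<delta>' k' u v - Af \<beta> \<delta> k u v) \<le> (mdl \<beta> k \<beta>' k' + (2 * ks)\<^sup>2 * e) * (nH u * nH v)"
proof -
  note D = S_D[OF p] and D' = S_D[OF q]
  let ?W = "sqrt (\<bar>\<beta>' - \<beta>\<bar> * (2 + 2 * (\<bar>\<beta>s\<bar> + 1)) + \<bar>k'\<^sup>2 - k\<^sup>2\<bar>)"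
  have ex: "emax \<ge> 0" using emin by simp
  note me = eps_meas[OF D(1)] eps_bdd[OF D(1)] ex and me' = eps_meas[OF D'(1)] eps_bdd[OF D'(1)] ex
  have 1: "cmod (GF \<beta>' u v - GF \<beta> u v) \<le> (\<bar>\<beta>'\<^sup>2 - \<beta>\<^sup>2\<bar> + 2 * \<bar>\<beta>' - \<beta>\<bar>) * (nH u * nH v)" by (rule GF_diff[OF u v])
  have gd: "\<bar>gam \<beta>' k' m - gam \<beta> k m\<bar> \<le> ?W * (1 + \<bar>real_of_int m\<bar>)" for m
    by (rule gam_diff_le) (use D D' in auto)
  have W: "?W \<ge> 0" by simp
  have 2: "cmod (Tf (gam \<beta>' k') u v - Tf (gam \<beta> k) u v) \<le> 2 * ?W * CT * nH u * nH v"
    unfolding Tf_diff[OF u v gam_weight weight_nonneg gam_weight weight_nonneg] by (rule Tf_bound[OF u v gd W])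
  have "cmod (EF (\<lambda>x. eps x \<delta>') u v - EF (\<lambda>x. eps x \<delta>) u v) \<le> e * (nH u * nH v)"
    unfolding EF_diff[OF me' me u v] by (rule EF_bound[OF _ e u v]) (use me(1) me'(1) in measurable)
  then have "cmod (of_real (k\<^sup>2) * (EF (\<lambda>x. eps x \<delta>') u v - EF (\<lambda>x. eps x \<delta>) u v)) \<le> k\<^sup>2 * (e * (nH u * nH v))"
    unfolding norm_mult norm_of_real by (simp add: mult_left_mono)
  also have "\<dots> \<le> (2 * ks)\<^sup>2 * (e * (nH u * nH v))" by (intro mult_right_mono S_k_sq[OF p] mult_nonneg_nonneg e(2)) auto
  finally have 3: "cmod (of_real (k\<^sup>2) * (EF (\<lambda>x. eps x \<delta>') u v - EF (\<lambda>x. eps x \<delta>) u v)) \<le> (2 * ks)\<^sup>2 * (e * (nH u * nH v))" .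
  have 4: "cmod (of_real (k'\<^sup>2 - k\<^sup>2) * EF (\<lambda>x. eps x \<delta>') u v) \<le> \<bar>k'\<^sup>2 - k\<^sup>2\<bar> * (emax * (nH u * nH v))"
    unfolding norm_mult norm_of_real by (intro mult_left_mono EF_bound[OF me' u v]) simp
  have norm4: "cmod (w - x - y + z) \<le> cmod w + cmod x + cmod y + cmod z" for w x y z
    using norm_triangle_ineq[of "w - x - y" z] norm_triangle_ineq4[of "w - x" y] norm_triangle_ineq4[of w x] by linarith
  have eq: "Af \<beta>' \<delta>' k' u v - Af \<beta> \<delta> k u v = (GF \<beta>' u v - GF \<beta> u v) - of_real (k'\<^sup>2 - k\<^sup>2) * EF (\<lambda>x. eps x \<delta>') u v
     - of_real (k\<^sup>2) * (EF (\<lambda>x. eps x \<delta>') u v - EF (\<lambda>x. eps x \<delta>) u v) + (Tf (gam \<beta>' k') u v - Tf (gam \<beta> k) u v)"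
    by (simp add: Af_def algebra_simps)
  have "cmod (Af \<beta>' \<delta>' k' u v - Af \<beta> \<delta> k u v) \<le> cmod (GF \<beta>' u v - GF \<beta> u v) + cmod (of_real (k'\<^sup>2 - k\<^sup>2) * EF (\<lambda>x. eps x \<delta>') u v)
     + cmod (of_real (k\<^sup>2) * (EF (\<lambda>x. eps x \<delta>') u v - EF (\<lambda>x. eps x \<delta>) u v)) + cmod (Tf (gam \<beta>' k') u v - Tf (gam \<beta> k) u v)"
    unfolding eq by (rule norm4)
  also have "\<dots> \<le> (\<bar>\<beta>'\<^sup>2 - \<beta>\<^sup>2\<bar> + 2 * \<bar>\<beta>' - \<beta>\<bar>) * (nH u * nH v) + \<bar>k'\<^sup>2 - k\<^sup>2\<bar> * (emax * (nH u * nH v))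
     + (2 * ks)\<^sup>2 * (e * (nH u * nH v)) + 2 * ?W * CT * nH u * nH v"
    by (rule add_mono[OF add_mono[OF add_mono[OF 1 4] 3] 2])
  also have "\<dots> = (mdl \<beta> k \<beta>' k' + (2 * ks)\<^sup>2 * e) * (nH u * nH v)"
  proof -
    have "(a1 + a2) * (x * y) + a3 * (a4 * (x * y)) + a5 * (a6 * (x * y)) + 2 * a7 * a8 * x * y =
      (a1 + a2 + a3 * a4 + 2 * a7 * a8 + a5 * a6) * (x * y)" for a1 a2 a3 a4 a5 a6 a7 a8 x y :: real
      by (simp add: algebra_simps)
    then show ?thesis unfolding mdl_def .
  qed
  finally show ?thesis .
qed

lemma Af_cont:
  assumes p: "(\<beta>, \<delta>, k) \<in> S" and e: "e > 0"
  shows "\<exists>d>0. \<forall>\<beta>' \<delta>' k'. (\<beta>', \<delta>', k') \<in> S \<longrightarrow> dist (\<beta>', \<delta>', k') (\<beta>, \<delta>, k) < d \<longrightarrow>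
     (\<forall>u\<in>V. \<forall>v\<in>V. cmod (Af \<beta>' \<delta>' k' u v - Af \<beta> \<delta> k u v) \<le> e * (nH u * nH v))"
proof -
  \<comment> \<open>Half of e is reserved for the change of permittivity, whose factor k^2 is at
    most (2 ks)^2; the other half goes to \<open>mdl\<close>.\<close>
  have ep: "e / 2 / (2 * ks)\<^sup>2 > 0" using e ks by simp
  obtain r where r: "r > 0" "\<And>\<delta>'. \<delta>' \<in> W1 \<Longrightarrow> dist \<delta>' \<delta> < r \<Longrightarrow> AE x in M. \<bar>eps x \<delta>' - eps x \<delta>\<bar> \<le> e / 2 / (2 * ks)\<^sup>2"
    using eps_cont[OF S_D(1)[OF p] ep] by blast
  have "isCont (\<lambda>z. mdl \<beta> k (fst z) (snd z)) (\<beta>, k)" unfolding mdl_def by (intro continuous_intros)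
  moreover have "mdl \<beta> k \<beta> k = 0" by (simp add: mdl_def)
  ultimately obtain s where s: "s > 0" "\<And>z. dist z (\<beta>, k) < s \<Longrightarrow> \<bar>mdl \<beta> k (fst z) (snd z)\<bar> < e / 2"
    unfolding continuous_at_eps_delta using e by (metis dist_real_def diff_zero fst_conv snd_conv half_gt_zero)
  have "cmod (Af \<beta>' \<delta>' k' u v - Af \<beta> \<delta> k u v) \<le> e * (nH u * nH v)"
    if q: "(\<beta>', \<delta>', k') \<in> S" and d: "dist (\<beta>', \<delta>', k') (\<beta>, \<delta>, k) < min r s" and uv: "u \<in> V" "v \<in> V" for \<beta>' \<delta>' k' u v
  proof -
    have "dist (\<delta>', k') (\<delta>, k) \<le> dist (\<beta>', \<delta>', k') (\<beta>, \<delta>, k)" using dist_snd_le[of "(\<beta>', \<delta>', k')" "(\<beta>, \<delta>, k)"] by simp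
    then have dd: "dist \<delta>' \<delta> < r" using dist_fst_le[of "(\<delta>', k')" "(\<delta>, k)"] d by simp
    have "(dist \<beta>' \<beta>)\<^sup>2 + (dist k' k)\<^sup>2 \<le> (dist \<beta>' \<beta>)\<^sup>2 + ((dist \<delta>' \<delta>)\<^sup>2 + (dist k' k)\<^sup>2)" by simp
    then have "dist (\<beta>', k') (\<beta>, k) \<le> dist (\<beta>', \<delta>', k') (\<beta>, \<delta>, k)" by (simp add: dist_Pair_Pair)
    then have "mdl \<beta> k \<beta>' k' < e / 2" using s(2)[of "(\<beta>', k')"] d by simp
    moreover have "(2 * ks)\<^sup>2 * (e / 2 / (2 * ks)\<^sup>2) = e / 2" using ks by simp
    ultimately have "mdl \<beta> k \<beta>' k' + (2 * ks)\<^sup>2 * (e / 2 / (2 * ks)\<^sup>2) \<le> e" by simp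
    then have "(mdl \<beta> k \<beta>' k' + (2 * ks)\<^sup>2 * (e / 2 / (2 * ks)\<^sup>2)) * (nH u * nH v) \<le> e * (nH u * nH v)"
      by (rule mult_right_mono) simp
    then show ?thesis
      using Af_diff[OF p q r(2)[OF S_D(1)[OF q] dd] less_imp_le[OF ep] uv] by linarith
  qed
  then show ?thesis using r(1) s(1) by (intro exI[of _ "min r s"]) auto
qed

text \<open>Minus the difference quotient of \<open>gam\<close> in k^2, since the squares of the two
  decay rates differ by k2^2 - k1^2. It is nonnegative, so the evanescent modes support the
  monotonicity in k.\<close>

definition om :: "real \<Rightarrow> real \<Rightarrow> real \<Rightarrow> int \<Rightarrow> real" where
  "om \<beta> k1 k2 m = (if m \<in> Z0 \<beta>s ks then 0 else 1 / (gam \<beta> k1 m + gam \<beta> k2 m))"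

text \<open>Minus the divided difference of \<open>Af\<close> in k^2: an exact substitute for the
  derivative that stays Hermitian and positive at two distinct frequencies.\<close>

definition Ef :: "real \<Rightarrow> real^'n \<Rightarrow> real \<Rightarrow> real \<Rightarrow> (pt \<Rightarrow> complex) \<Rightarrow> (pt \<Rightarrow> complex) \<Rightarrow> complex" where
  "Ef \<beta> \<delta> k1 k2 u v = EF (\<lambda>x. eps x \<delta>) u v + Tf (om \<beta> k1 k2) u v"

definition KE :: real where "KE = emax + 2 * (1 / (2 * sqrt c)) * CT"

lemma KE_pos: "KE > 0"
  using emin c CT_pos by (simp add: KE_def add_pos_nonneg)

lemma gam_ge:
  assumes p: "(\<beta>, \<delta>, k) \<in> S" and m: "m \<notin> Z0 \<beta>s ks"
  shows "sqrt c \<le> gam \<beta> k m" "(gam \<beta> k m)\<^sup>2 = (of_int m + \<beta>)\<^sup>2 - k\<^sup>2"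
proof -
  have m': "m \<notin> Z0 \<beta> k" using m S_D(6)[OF p] by simp
  then have g: "gam \<beta> k m = sqrt ((of_int m + \<beta>)\<^sup>2 - k\<^sup>2)" and n: "0 \<le> (of_int m + \<beta>)\<^sup>2 - k\<^sup>2"
    by (simp_all add: gam_def Z0_def)
  show "(gam \<beta> k m)\<^sup>2 = (of_int m + \<beta>)\<^sup>2 - k\<^sup>2" using n by (simp add: g)
  show "sqrt c \<le> gam \<beta> k m" unfolding g using S_D(8)[OF p, of m] n by (intro real_sqrt_le_mono) linarith
qed

lemma om_bound:
  assumes "(\<beta>, \<delta>, k1) \<in> S" "(\<beta>, \<delta>, k2) \<in> S"
  shows "0 \<le> om \<beta> k1 k2 m" "\<bar>om \<beta> k1 k2 m\<bar> \<le> 1 / (2 * sqrt c) * (1 + \<bar>real_of_int m\<bar>)"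
proof -
  show n: "0 \<le> om \<beta> k1 k2 m" by (simp add: om_def gam_nonneg)
  have sc: "sqrt c > 0" using c by simp
  have "om \<beta> k1 k2 m \<le> 1 / (2 * sqrt c)"
  proof (cases "m \<in> Z0 \<beta>s ks")
    case False
    then show ?thesis using gam_ge(1)[OF assms(1) False] gam_ge(1)[OF assms(2) False] sc
      by (simp add: om_def frac_le)
  qed (use sc in \<open>simp add: om_def\<close>)
  also have "\<dots> \<le> 1 / (2 * sqrt c) * (1 + \<bar>real_of_int m\<bar>)" using sc by (simp add: field_simps)
  finally show "\<bar>om \<beta> k1 k2 m\<bar> \<le> 1 / (2 * sqrt c) * (1 + \<bar>real_of_int m\<bar>)" using n by simp
qed

lemma om_W: "0 \<le> 1 / (2 * sqrt c)"
  using c by simp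

lemma Af_k_diff:
  assumes p: "(\<beta>, \<delta>, k1) \<in> S" "(\<beta>, \<delta>, k2) \<in> S" and uv: "u \<in> V" "v \<in> V"
  shows "Af \<beta> \<delta> k1 u v - Af \<beta> \<delta> k2 u v = - of_real (k1\<^sup>2 - k2\<^sup>2) * Ef \<beta> \<delta> k1 k2 u v"
proof -
  have "gam \<beta> k1 m - gam \<beta> k2 m = - (k1\<^sup>2 - k2\<^sup>2) * om \<beta> k1 k2 m" for m
  proof (cases "m \<in> Z0 \<beta>s ks")
    case True
    then show ?thesis using S_D(6)[OF p(1)] S_D(6)[OF p(2)] by (simp add: gam_def om_def)
  next
    case False
    note g = gam_ge[OF p(1) False] gam_ge[OF p(2) False]
    have sc: "sqrt c > 0" using c by simp
    have "(gam \<beta> k1 m - gam \<beta> k2 m) * (gam \<beta> k1 m + gam \<beta> k2 m) = - (k1\<^sup>2 - k2\<^sup>2)"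
      using g(2,4) by (simp add: power2_eq_square algebra_simps)
    moreover have "gam \<beta> k1 m + gam \<beta> k2 m > 0" using g(1,3) sc by linarith
    ultimately show ?thesis using False by (simp add: om_def field_simps)
  qed
  then have e: "(\<lambda>m. gam \<beta> k1 m - gam \<beta> k2 m) = (\<lambda>m. - (k1\<^sup>2 - k2\<^sup>2) * om \<beta> k1 k2 m)" by (rule ext)
  have "Tf (gam \<beta> k1) u v - Tf (gam \<beta> k2) u v = of_real (- (k1\<^sup>2 - k2\<^sup>2)) * Tf (om \<beta> k1 k2) u v"
    unfolding Tf_diff[OF uv gam_weight weight_nonneg gam_weight weight_nonneg] e by (rule Tf_scale)
  then show ?thesis unfolding Af_def Ef_def by (simp add: algebra_simps)
qed

lemma Ef_herm:
  assumes p: "(\<beta>, \<delta>, k1) \<in> S" "(\<beta>, \<delta>, k2) \<in> S"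
  shows "herm_on V (Ef \<beta> \<delta> k1 k2)"
  unfolding herm_on_def
proof (intro conjI ballI)
  note h = EF_eps_herm[OF S_D(1)[OF p(1)]] Tf_herm[OF om_bound(2)[OF p] om_W]
  fix v assume v: "v \<in> V"
  show "lin_on V (\<lambda>u. Ef \<beta> \<delta> k1 k2 u v)" unfolding Ef_def
    by (intro lin_on_add herm_on_lin[OF h(1) v] herm_on_lin[OF h(2) v])
next
  note h = EF_eps_herm[OF S_D(1)[OF p(1)]] Tf_herm[OF om_bound(2)[OF p] om_W]
  fix u v assume uv: "u \<in> V" "v \<in> V"
  show "Ef \<beta> \<delta> k1 k2 v u = cnj (Ef \<beta> \<delta> k1 k2 u v)" unfolding Ef_def
    using herm_on_sym[OF h(1) uv] herm_on_sym[OF h(2) uv] by simp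
qed

lemma Ef_bound:
  assumes p: "(\<beta>, \<delta>, k1) \<in> S" "(\<beta>, \<delta>, k2) \<in> S" and uv: "u \<in> V" "v \<in> V"
  shows "cmod (Ef \<beta> \<delta> k1 k2 u v) \<le> KE * (nH u * nH v)"
proof -
  note d = S_D(1)[OF p(1)]
  have "cmod (EF (\<lambda>x. eps x \<delta>) u v) \<le> emax * (nH u * nH v)" by (rule EF_bound[OF eps_meas[OF d] eps_bdd[OF d] _ uv]) (use emin in simp)
  moreover have "cmod (Tf (om \<beta> k1 k2) u v) \<le> 2 * (1 / (2 * sqrt c)) * CT * nH u * nH v" by (rule Tf_bound[OF uv om_bound(2)[OF p] om_W])
  ultimately show ?thesis using norm_triangle_ineq[of "EF (\<lambda>x. eps x \<delta>) u v" "Tf (om \<beta> k1 k2) u v"]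
    unfolding Ef_def KE_def distrib_right by (simp only: mult.assoc)
qed

text \<open>The boundary part is nonnegative, and the mass part alone provides the lower bound,
  uniformly over the window.\<close>

lemma Ef_pos:
  assumes p: "(\<beta>, \<delta>, k1) \<in> S" "(\<beta>, \<delta>, k2) \<in> S" and u: "u \<in> V"
  shows "emin * sq M u \<le> Re (Ef \<beta> \<delta> k1 k2 u u)"
proof -
  note d = S_D(1)[OF p(1)]
  note s = V_sqint(1)[OF u]
  have i: "integrable M (\<lambda>x. (cmod (u x))\<^sup>2)" using s by (simp add: sqint_def)
  have "emin * sq M u = (\<integral>x. emin * (cmod (u x))\<^sup>2 \<partial>M)" by (simp add: sq_def)
  also have "\<dots> \<le> (\<integral>x. eps x \<delta> * (cmod (u x))\<^sup>2 \<partial>M)"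
  proof (rule integral_mono)
    show "integrable M (\<lambda>x. eps x \<delta> * (cmod (u x))\<^sup>2)"
    proof (rule Bochner_Integration.integrable_bound[of M "\<lambda>x. emax * (cmod (u x))\<^sup>2"])
      show "integrable M (\<lambda>x. emax * (cmod (u x))\<^sup>2)" using i by simp
      show "(\<lambda>x. eps x \<delta> * (cmod (u x))\<^sup>2) \<in> borel_measurable M"
        using eps_meas[OF d] sqint_meas[OF s] by measurable
      have "\<bar>eps x \<delta>\<bar> \<le> \<bar>emax\<bar>" for x using eps_range[OF d, of x] emin by linarith
      then show "AE x in M. norm (eps x \<delta> * (cmod (u x))\<^sup>2) \<le> norm (emax * (cmod (u x))\<^sup>2)"
        by (intro AE_I2) (simp add: abs_mult mult_right_mono)
    qed
  qed (use i eps_range[OF d] in \<open>auto intro: mult_right_mono\<close>)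
  also have "\<dots> = Re (EF (\<lambda>x. eps x \<delta>) u u)" by (simp add: EF_self)
  also have "\<dots> \<le> Re (Ef \<beta> \<delta> k1 k2 u u)" unfolding Ef_def using Tf_pos[OF u om_bound(1)[OF p]] by simp
  finally show ?thesis .
qed

end

subsection \<open>The branch of solutions\<close>

text \<open>The signs at the two ends of the interval persist for nearby p, the intermediate value
  theorem gives a root, and strict monotonicity makes it unique. The same persistence of signs on a
  shorter interval around a root gives continuity.\<close>

lemma monotone_root:
  fixes f :: "'p::metric_space \<Rightarrow> real \<Rightarrow> real"
  assumes r: "r > 0" and p0: "p0 \<in> P"
    and cont: "continuous_on (P \<times> {k0 - r..k0 + r}) (\<lambda>(p, k). f p k)"
    and mono: "\<And>p k k'. p \<in> P \<Longrightarrow> k \<in> {k0 - r..k0 + r} \<Longrightarrow> k' \<in> {k0 - r..k0 + r} \<Longrightarrow> k < k' \<Longrightarrow> f p k < f p k'"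
    and z: "f p0 k0 = 0"
  shows "\<exists>d>0. \<exists>K. (\<forall>p\<in>P \<inter> ball p0 d. K p \<in> {k0 - r<..<k0 + r} \<and> f p (K p) = 0 \<and>
       (\<forall>k\<in>{k0 - r<..<k0 + r}. f p k = 0 \<longrightarrow> k = K p)) \<and> continuous_on (P \<inter> ball p0 d) K \<and> K p0 = k0"
proof -
  have cp: "continuous_on P (\<lambda>p. f p k)" if "k \<in> {k0 - r..k0 + r}" for k
  proof -
    have "continuous_on P (\<lambda>p. case (p, k) of (p, k) \<Rightarrow> f p k)"
      by (rule continuous_on_compose2[OF cont]) (use that in \<open>auto intro!: continuous_intros\<close>)
    then show ?thesis by simp
  qed
  have ck: "continuous_on {k0 - r..k0 + r} (f p)" if "p \<in> P" for p
  proof -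
    have "continuous_on {k0 - r..k0 + r} (\<lambda>k. case (p, k) of (p, k) \<Rightarrow> f p k)"
      by (rule continuous_on_compose2[OF cont]) (use that in \<open>auto intro!: continuous_intros\<close>)
    then show ?thesis by simp
  qed
  have sign: "\<exists>d>0. \<forall>p\<in>P. dist p p1 < d \<longrightarrow> f p k < 0 \<and> 0 < f p k'"
    if a: "p1 \<in> P" "k \<in> {k0 - r..k0 + r}" "k' \<in> {k0 - r..k0 + r}" and n: "f p1 k < 0" "0 < f p1 k'" for p1 k k'
  proof -
    obtain d1 where d1: "d1 > 0" "\<And>p. p \<in> P \<Longrightarrow> dist p p1 < d1 \<Longrightarrow> dist (f p k) (f p1 k) < - f p1 k"
      using cp[OF a(2)] a(1) n(1) unfolding continuous_on_iff by (metis neg_0_less_iff_less)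
    obtain d2 where d2: "d2 > 0" "\<And>p. p \<in> P \<Longrightarrow> dist p p1 < d2 \<Longrightarrow> dist (f p k') (f p1 k') < f p1 k'"
      using cp[OF a(3)] a(1) n(2) unfolding continuous_on_iff by metis
    have "f p k < 0 \<and> 0 < f p k'" if "p \<in> P" "dist p p1 < min d1 d2" for p
    proof -
      have "\<bar>f p k - f p1 k\<bar> < - f p1 k" "\<bar>f p k' - f p1 k'\<bar> < f p1 k'"
        using d1(2)[of p] d2(2)[of p] that by (auto simp: dist_real_def)
      then show ?thesis by linarith
    qed
    then show ?thesis using d1(1) d2(1) by (intro exI[of _ "min d1 d2"]) auto
  qed
  have "f p0 (k0 - r) < 0" "0 < f p0 (k0 + r)"
    using mono[OF p0, of "k0 - r" k0] mono[OF p0, of k0 "k0 + r"] z r by auto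
  from sign[OF p0 _ _ this] r obtain d where d: "d > 0"
    "\<And>p. p \<in> P \<Longrightarrow> dist p p0 < d \<Longrightarrow> f p (k0 - r) < 0 \<and> 0 < f p (k0 + r)" by auto
  define Q where "Q = P \<inter> ball p0 d"
  have root: "\<exists>k\<in>{k0 - r<..<k0 + r}. f p k = 0" if p: "p \<in> Q" for p
  proof -
    have s: "f p (k0 - r) < 0" "0 < f p (k0 + r)" and pP: "p \<in> P" using d(2)[of p] p by (auto simp: Q_def dist_commute)
    obtain k where k: "k0 - r \<le> k" "k \<le> k0 + r" "f p k = 0"
      using IVT'[of "f p" "k0 - r" 0 "k0 + r"] s r ck[OF pP] by auto
    moreover have "k \<noteq> k0 - r" "k \<noteq> k0 + r" using k s by auto
    ultimately show ?thesis by force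
  qed
  define K where "K p = (SOME k. k \<in> {k0 - r<..<k0 + r} \<and> f p k = 0)" for p
  have K: "K p \<in> {k0 - r<..<k0 + r}" "f p (K p) = 0" if "p \<in> Q" for p
    using someI_ex[of "\<lambda>k. k \<in> {k0 - r<..<k0 + r} \<and> f p k = 0"] root[OF that] unfolding K_def by blast+
  have uniq: "k = K p" if p: "p \<in> Q" and k: "k \<in> {k0 - r<..<k0 + r}" "f p k = 0" for p k
  proof (rule ccontr)
    assume "k \<noteq> K p"
    moreover have "p \<in> P" using p by (simp add: Q_def)
    ultimately show False
      using mono[of p k "K p"] mono[of p "K p" k] K[OF p] k by (cases "k < K p") auto
  qed
  have "continuous_on Q K"
    unfolding continuous_on_iff
  proof (intro ballI allI impI)
    fix p1 and e :: real assume p1: "p1 \<in> Q" and e: "e > 0"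
    have p1P: "p1 \<in> P" using p1 by (simp add: Q_def)
    \<comment> \<open>Half the distance to either end keeps both test points strictly inside the
      interval; half of e makes the final estimate strict.\<close>
    define e' where "e' = min (e / 2) (min ((K p1 - (k0 - r)) / 2) ((k0 + r - K p1) / 2))"
    have e': "e' > 0" "e' < e" "K p1 - e' > k0 - r" "K p1 + e' < k0 + r"
      using K(1)[OF p1] e unfolding e'_def by (auto simp: min_def field_simps)
    have i: "K p1 - e' \<in> {k0 - r..k0 + r}" "K p1 + e' \<in> {k0 - r..k0 + r}" "K p1 \<in> {k0 - r..k0 + r}"
      using e' K(1)[OF p1] by auto
    have "f p1 (K p1 - e') < 0" "0 < f p1 (K p1 + e')"
      using mono[OF p1P i(1,3)] mono[OF p1P i(3,2)] e'(1) K(2)[OF p1] by auto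
    from sign[OF p1P i(1,2) this] obtain d' where d': "d' > 0"
      "\<And>p. p \<in> P \<Longrightarrow> dist p p1 < d' \<Longrightarrow> f p (K p1 - e') < 0 \<and> 0 < f p (K p1 + e')" by blast
    have "dist (K p) (K p1) < e" if p: "p \<in> Q" and pd: "dist p p1 < d'" for p
    proof -
      have pP: "p \<in> P" using p by (simp add: Q_def)
      have s: "f p (K p1 - e') < 0" "0 < f p (K p1 + e')" using d'(2)[OF pP pd] by auto
      have Ki: "K p \<in> {k0 - r..k0 + r}" using K(1)[OF p] by auto
      have "K p1 - e' < K p" using mono[OF pP Ki i(1)] s(1) K(2)[OF p] by (cases "K p = K p1 - e'") (auto simp: not_less_iff_gr_or_eq intro: ccontr)
      moreover have "K p < K p1 + e'" using mono[OF pP i(2) Ki] s(2) K(2)[OF p] by (cases "K p = K p1 + e'") (auto simp: not_less_iff_gr_or_eq intro: ccontr)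
      ultimately show ?thesis using e'(2) by (simp add: dist_real_def abs_less_iff)
    qed
    then show "\<exists>d>0. \<forall>p\<in>Q. dist p p1 < d \<longrightarrow> dist (K p) (K p1) < e" using d'(1) by blast
  qed
  moreover have "K p0 = k0"
    using uniq[of p0 k0] p0 z d(1) r by (auto simp: Q_def)
  ultimately show ?thesis using d(1) K uniq unfolding Q_def by blast
qed

text \<open>For the ratio r of the roots, |r - 1| <= |r^2 - 1| because r + 1 >= 1. With x and y the
  propagation constants of one order at two frequencies, x^2 - y^2 is the difference of the k^2, so
  the mismatch of the channel factors is linear in that difference.\<close>

lemma sqrt_ratio_le:
  assumes c: "c > 0" and x: "sqrt c \<le> x" and y: "sqrt c \<le> y"
  shows "\<bar>sqrt x / sqrt y - 1\<bar> \<le> \<bar>x\<^sup>2 - y\<^sup>2\<bar> / (2 * c)"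
proof -
  have sc: "sqrt c > 0" using c by simp
  have xy: "x > 0" "y > 0" using x y sc by linarith+
  define r where "r = sqrt x / sqrt y"
  have r: "r > 0" "r\<^sup>2 = x / y" using xy by (simp_all add: r_def power_divide)
  have "\<bar>r - 1\<bar> \<le> \<bar>r - 1\<bar> * (r + 1)" using r by (simp add: mult_le_cancel_left1)
  also have "\<dots> = \<bar>r\<^sup>2 - 1\<bar>" using r(1) by (simp add: abs_mult power2_eq_square square_diff_one_factored)
  also have "\<dots> = \<bar>x - y\<bar> / y" 
  proof -
    have "x / y - 1 = (x - y) / y" using xy by (simp add: diff_divide_distrib)
    then show ?thesis using xy by (simp add: r(2))
  qed
  also have "\<dots> = \<bar>x\<^sup>2 - y\<^sup>2\<bar> / ((x + y) * y)"
  proof -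
    have "x\<^sup>2 - y\<^sup>2 = (x - y) * (x + y)" by (simp add: power2_eq_square algebra_simps)
    then show ?thesis using xy by (simp add: abs_mult)
  qed
  also have "\<dots> \<le> \<bar>x\<^sup>2 - y\<^sup>2\<bar> / (2 * c)"
  proof (rule divide_left_mono)
    have "2 * c = (sqrt c + sqrt c) * sqrt c" using c by (simp add: algebra_simps)
    also have "\<dots> \<le> (x + y) * y" using x y sc xy by (intro mult_mono add_mono) auto
    finally show "2 * c \<le> (x + y) * y" .
  qed (use c xy in auto)
  finally show ?thesis by (simp add: r_def)
qed

text \<open>Unknowns of the finite system: cell averages, incident amplitudes, and the multiplier of the
  normalisation \<open>ip M u us = sq M us\<close>.\<close>

datatype site = Cell nat nat | Port "bool \<times> int" | Mode

definition sites :: "nat \<Rightarrow> (bool \<times> int) set \<Rightarrow> site set" where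
  "sites n I = (\<lambda>(i, j). Cell i j) ` ({..<n} \<times> {..<n}) \<union> Port ` I \<union> {Mode}"

lemma finite_sites: "finite I \<Longrightarrow> finite (sites n I)"
  by (simp add: sites_def)

lemma sum_sites:
  assumes "finite I"
  shows "(\<Sum>s\<in>sites n I. g s) = (\<Sum>i<n. \<Sum>j<n. g (Cell i j)) + (\<Sum>i\<in>I. g (Port i)) + g Mode"
proof -
  have "(\<Sum>s\<in>sites n I. g s) = sum g ((\<lambda>(i, j). Cell i j) ` ({..<n} \<times> {..<n}) \<union> Port ` I) + sum g {Mode}"
    unfolding sites_def by (rule sum.union_disjoint) (use assms in auto)
  also have "sum g ((\<lambda>(i, j). Cell i j) ` ({..<n} \<times> {..<n}) \<union> Port ` I) =
      sum g ((\<lambda>(i, j). Cell i j) ` ({..<n} \<times> {..<n})) + sum g (Port ` I)"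
    by (rule sum.union_disjoint) (use assms in auto)
  also have "sum g ((\<lambda>(i, j). Cell i j) ` ({..<n} \<times> {..<n})) = (\<Sum>i<n. \<Sum>j<n. g (Cell i j))"
    by (subst sum.reindex) (auto simp: inj_on_def sum.cartesian_product intro!: sum.cong)
  also have "sum g (Port ` I) = (\<Sum>i\<in>I. g (Port i))"
    by (subst sum.reindex) (auto simp: inj_on_def)
  finally show ?thesis by simp
qed

text \<open>\<open>us_null\<close> is the homogeneous equation for the Hermitian form: as the
  propagating traces of the BIC vanish, the scattering form and \<open>Af\<close> agree with
  \<open>us\<close> in the first argument.\<close>

locale channel_problem = grating_window d0 eps W1 emin emax \<beta>s ks \<rho> c
  for d0 :: real and eps :: "pt \<Rightarrow> real^'n \<Rightarrow> real" and W1 emin emax \<beta>s ks \<rho> c +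
  fixes Mx :: "bool \<times> int \<Rightarrow> bool \<times> int \<Rightarrow> complex" and \<delta>s :: "real^'n" and us :: "pt \<Rightarrow> complex"
  assumes star: "(\<beta>s, \<delta>s, ks) \<in> S" and Mx: "unitary_on I Mx"
    and us: "us \<in> V" and us_pos: "sq M us > 0"
    and us_trace: "\<And>fl m. (fl, m) \<in> I \<Longrightarrow> trco d0 us fl m = 0"
    and us_null: "\<And>v. v \<in> V \<Longrightarrow> Af \<beta>s \<delta>s ks us v = 0"
begin

lemma fin_I: "finite I"
  by (rule finite_Idx)

text \<open>The square root of \<alpha>_m on the propagating orders, where it is a positive real
  number.\<close>

definition sa :: "real \<Rightarrow> real \<Rightarrow> int \<Rightarrow> real" where
  "sa \<beta> k m = sqrt (sqrt (k\<^sup>2 - (of_int m + \<beta>)\<^sup>2))"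

abbreviation "out a \<equiv> matvec I Mx a"

text \<open>The relation b = M a, with b eliminated by its definition.\<close>

definition chan :: "real \<Rightarrow> real \<Rightarrow> (bool \<times> int \<Rightarrow> complex) \<Rightarrow> (pt \<Rightarrow> complex) \<Rightarrow> bool" where
  "chan \<beta> k a u \<longleftrightarrow> (\<forall>i\<in>I. of_real (sa \<beta> k (snd i)) * trco d0 u (fst i) (snd i) = a i + out a i)"

text \<open>What remains of the sources and the propagating boundary terms once b = M a is inserted:
  each channel contributes i \<alpha>_m^(1/2) (b - a) against the trace of v.\<close>

definition flux :: "real \<Rightarrow> real \<Rightarrow> (bool \<times> int \<Rightarrow> complex) \<Rightarrow> (pt \<Rightarrow> complex) \<Rightarrow> complex" where
  "flux \<beta> k a v = (\<Sum>i\<in>I. \<i> * of_real (sa \<beta> k (snd i)) * (out a i - a i) * cnj (trco d0 v (fst i) (snd i)))"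

lemma sa_facts:
  assumes p: "(\<beta>, \<delta>, k) \<in> S" and i: "i \<in> I"
  shows "csqrt (alpha \<beta> k (snd i)) = of_real (sa \<beta> k (snd i))" "alpha \<beta> k (snd i) = of_real ((sa \<beta> k (snd i))\<^sup>2)"
    "sa \<beta> k (snd i) > 0" "sqrt c \<le> sqrt (k\<^sup>2 - (of_int (snd i) + \<beta>)\<^sup>2)" "0 \<le> k\<^sup>2 - (of_int (snd i) + \<beta>)\<^sup>2"
proof -
  have z: "snd i \<in> Z0 \<beta> k" using i unfolding S_D(6)[OF p] Idx_def by (simp add: mem_Times_iff)
  show n: "0 \<le> k\<^sup>2 - (of_int (snd i) + \<beta>)\<^sup>2" using z by (simp add: Z0_def)
  show "csqrt (alpha \<beta> k (snd i)) = of_real (sa \<beta> k (snd i))" unfolding sa_def by (rule csqrt_alpha_propagating[OF z])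
  show "alpha \<beta> k (snd i) = of_real ((sa \<beta> k (snd i))\<^sup>2)" using n by (simp add: alpha_propagating[OF z] sa_def)
  have "c \<le> k\<^sup>2 - (of_int (snd i) + \<beta>)\<^sup>2" using S_D(8)[OF p, of "snd i"] n by linarith
  then show le: "sqrt c \<le> sqrt (k\<^sup>2 - (of_int (snd i) + \<beta>)\<^sup>2)" by (rule real_sqrt_le_mono)
  have "0 < sqrt c" using c by simp
  then have "0 < sqrt (k\<^sup>2 - (of_int (snd i) + \<beta>)\<^sup>2)" using le by (rule less_le_trans)
  then show "sa \<beta> k (snd i) > 0" unfolding sa_def by (rule real_sqrt_gt_zero)
qed

lemma out_cong: "(\<And>i. i \<in> I \<Longrightarrow> a i = b i) \<Longrightarrow> out a = out b"
  by (auto simp: matvec_def fun_eq_iff intro!: sum.cong)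

text \<open>The propagating boundary terms are moved to the right, and \<alpha>_m^(1/2) times the
  trace of u is replaced by a + b; this turns the sources -2 i a into i (b - a).\<close>

lemma solves_governed_iff:
  assumes p: "(\<beta>, \<delta>, k) \<in> S"
  shows "solves d0 eps \<beta> \<delta> k a u \<and> governed d0 \<beta> k Mx a u \<longleftrightarrow>
     u \<in> V \<and> vec_on I a \<and> chan \<beta> k a u \<and> (\<forall>v\<in>V. Af \<beta> \<delta> k u v = flux \<beta> k a v)"
proof -
  note D = S_D[OF p] and f = sa_facts[OF p]
  have gov: "governed d0 \<beta> k Mx a u \<longleftrightarrow> chan \<beta> k a u"
  proof -
    have "governed d0 \<beta> k Mx a u \<longleftrightarrow> (\<forall>i\<in>I. csqrt (alpha \<beta> k (snd i)) * trco d0 u (fst i) (snd i) - a i = out a i)"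
      unfolding governed_def bvec_def D(7) fun_eq_iff by (auto simp: matvec_def split: prod.splits)
    also have "\<dots> \<longleftrightarrow> chan \<beta> k a u" unfolding chan_def by (intro ball_cong refl) (simp add: f(1) algebra_simps)
    finally show ?thesis .
  qed
  have "aform d0 eps \<beta> \<delta> k u v = (\<Sum>(fl, m)\<in>Idx \<beta> k. - 2 * \<i> * a (fl, m) * csqrt (alpha \<beta> k m) * cnj (trco d0 v fl m))
      \<longleftrightarrow> Af \<beta> \<delta> k u v = flux \<beta> k a v" if uv: "u \<in> V" "v \<in> V" and ch: "chan \<beta> k a u" for v
  proof -
    have "(\<Sum>(fl, m)\<in>Idx \<beta> k. - 2 * \<i> * a (fl, m) * csqrt (alpha \<beta> k m) * cnj (trco d0 v fl m))
       + (\<Sum>(fl, m)\<in>Idx \<beta> k. \<i> * alpha \<beta> k m * trco d0 u fl m * cnj (trco d0 v fl m)) = flux \<beta> k a v"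
      unfolding D(7) flux_def sum.distrib[symmetric]
    proof (rule sum.cong[OF refl])
      fix i assume i: "i \<in> I"
      have t: "of_real (sa \<beta> k (snd i)) * trco d0 u (fst i) (snd i) = a i + out a i" using ch i by (simp add: chan_def)
      have "- 2 * \<i> * a i * csqrt (alpha \<beta> k (snd i)) * cnj (trco d0 v (fst i) (snd i)) +
          \<i> * alpha \<beta> k (snd i) * trco d0 u (fst i) (snd i) * cnj (trco d0 v (fst i) (snd i)) =
          \<i> * of_real (sa \<beta> k (snd i)) * (of_real (sa \<beta> k (snd i)) * trco d0 u (fst i) (snd i) - 2 * a i) * cnj (trco d0 v (fst i) (snd i))"
        unfolding f(1)[OF i] unfolding f(2)[OF i] by (simp add: algebra_simps power2_eq_square)
      also have "\<dots> = \<i> * of_real (sa \<beta> k (snd i)) * (out a i - a i) * cnj (trco d0 v (fst i) (snd i))" unfolding t by simp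
      finally show "(case i of (fl, m) \<Rightarrow> - 2 * \<i> * a (fl, m) * csqrt (alpha \<beta> k m) * cnj (trco d0 v fl m)) +
          (case i of (fl, m) \<Rightarrow> \<i> * alpha \<beta> k m * trco d0 u fl m * cnj (trco d0 v fl m)) =
          \<i> * of_real (sa \<beta> k (snd i)) * (out a i - a i) * cnj (trco d0 v (fst i) (snd i))" by (cases i) simp
    qed
    then show ?thesis unfolding aform_eq[OF uv] diff_eq_eq by (rule arg_cong)
  qed
  then show ?thesis unfolding gov solves_def D(7) by (auto simp: D(7))
qed

abbreviation "Hs \<equiv> sq M us"

text \<open>The original problem with its normalisation is the case h = \<open>Hs\<close>, \<tau> =
  0; the case h = 0 expresses injectivity. The multiplier acts through the same functional whose
  value is prescribed.\<close>

definition sys :: "real \<Rightarrow> real^'n \<Rightarrow> real \<Rightarrow> complex \<Rightarrow> (pt \<Rightarrow> complex) \<Rightarrow> (bool \<times> int \<Rightarrow> complex) \<Rightarrow> complex \<Rightarrow> bool" where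
  "sys \<beta> \<delta> k h u a \<tau> \<longleftrightarrow> chan \<beta> k a u \<and> ip M u us = h \<and>
     (\<forall>v\<in>V. Af \<beta> \<delta> k u v = flux \<beta> k a v - \<tau> * cnj (ip M v us))"

text \<open>The test function satisfies a channel relation of its own, possibly at other parameters,
  so its traces can be replaced by its amplitudes; the mismatch of the parameters is the ratio of
  the \<open>sa\<close>.\<close>

lemma flux_chan:
  assumes p: "(\<beta>, \<delta>, k) \<in> S" and p': "(\<beta>', \<delta>', k') \<in> S" and ch: "chan \<beta>' k' a' v"
  shows "flux \<beta> k a v = \<i> * (\<Sum>i\<in>I. of_real (sa \<beta> k (snd i) / sa \<beta>' k' (snd i)) * ((out a i - a i) * cnj (a' i + out a' i)))"
  unfolding flux_def sum_distrib_left
proof (rule sum.cong[OF refl])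
  fix i assume i: "i \<in> I"
  have "cnj (of_real (sa \<beta>' k' (snd i)) * trco d0 v (fst i) (snd i)) = cnj (a' i + out a' i)" using ch i by (simp add: chan_def)
  then have "cnj (a' i + out a' i) = of_real (sa \<beta>' k' (snd i)) * cnj (trco d0 v (fst i) (snd i))" by simp
  then show "\<i> * of_real (sa \<beta> k (snd i)) * (out a i - a i) * cnj (trco d0 v (fst i) (snd i)) =
     \<i> * (of_real (sa \<beta> k (snd i) / sa \<beta>' k' (snd i)) * ((out a i - a i) * cnj (a' i + out a' i)))"
    using sa_facts(3)[OF p' i] by (simp add: field_simps)
qed

text \<open>After expansion only 2 (M a, M b) - 2 (a, b) survives, and this vanishes by
  unitarity.\<close>

lemma unitary_cross: "(\<Sum>i\<in>I. (out a i - a i) * cnj (b i + out b i) + cnj (out b i - b i) * (a i + out a i)) = 0"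
proof -
  have "(\<Sum>i\<in>I. (out a i - a i) * cnj (b i + out b i) + cnj (out b i - b i) * (a i + out a i)) =
     (\<Sum>i\<in>I. 2 * (out a i * cnj (out b i)) - 2 * (a i * cnj (b i)))"
    by (rule sum.cong) (auto simp: algebra_simps)
  also have "\<dots> = 0" unfolding sum_subtractf sum_distrib_left[symmetric] unitary_on_inner[OF fin_I Mx] by simp
  finally show ?thesis .
qed

text \<open>With v = u the Hermitian form is real, and by unitarity so is the flux. This turns the
  complex condition \<tau> = 0 into one real equation for k.\<close>

lemma tau_real:
  assumes p: "(\<beta>, \<delta>, k) \<in> S" and u: "u \<in> V" and s: "sys \<beta> \<delta> k (of_real Hs) u a \<tau>"
  shows "Im \<tau> = 0"
proof -
  have ch: "chan \<beta> k a u" and e: "Af \<beta> \<delta> k u u = flux \<beta> k a u - \<tau> * of_real Hs" using s u by (auto simp: sys_def)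
  define X where "X = (\<Sum>i\<in>I. (out a i - a i) * cnj (a i + out a i))"
  have "flux \<beta> k a u = \<i> * X"
  proof -
    have "sa \<beta> k (snd i) / sa \<beta> k (snd i) = 1" if "i \<in> I" for i using sa_facts(3)[OF p that] by simp
    then show ?thesis unfolding flux_chan[OF p p ch] X_def by (simp cong: sum.cong)
  qed
  moreover have "X + cnj X = 0"
    unfolding X_def cnj_sum sum.distrib[symmetric] using unitary_cross[of a a] by (simp add: mult_ac)
  then have "Re X = 0" by (simp add: complex_eq_iff)
  moreover have "Im (Af \<beta> \<delta> k u u) = 0"
    using herm_on_diag[OF Af_herm[OF S_D(1)[OF p]] u, of \<beta> k] by (metis Im_complex_of_real)
  ultimately have "Im \<tau> * Hs = 0" using e by simp
  then show ?thesis using us_pos by simp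
qed

text \<open>The equation at k1 is tested with \<open>u2\<close>, that at k2 with \<open>u1\<close>,
  and the second is conjugated. The forms differ by \<Delta> times \<open>Ef\<close>, and with equal
  channel factors the fluxes would cancel by unitarity. Their actual mismatch is of order \<Delta>
  times products of small amplitudes, while \<open>Ef\<close> at \<open>us\<close> is at least
  \<open>emin\<close> times \<open>Hs\<close>.\<close>

lemma tau_mono:
  assumes p: "(\<beta>, \<delta>, k1) \<in> S" "(\<beta>, \<delta>, k2) \<in> S" and k: "k2 < k1"
    and u: "u1 \<in> V" "u2 \<in> V" and s: "sys \<beta> \<delta> k1 (of_real Hs) u1 a1 \<tau>1" "sys \<beta> \<delta> k2 (of_real Hs) u2 a2 \<tau>2"
    and near: "nH (\<lambda>x. u1 x - us x) \<le> \<eta>" "nH (\<lambda>x. u2 x - us x) \<le> \<eta>"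
    and small: "\<And>i. i \<in> I \<Longrightarrow> cmod (a1 i) \<le> \<epsilon> \<and> cmod (a2 i) \<le> \<epsilon> \<and> cmod (out a1 i) \<le> \<epsilon> \<and> cmod (out a2 i) \<le> \<epsilon>"
    and \<eta>: "KE * (\<eta> * (nH us + \<eta>) + nH us * \<eta>) \<le> emin * Hs / 4"
    and \<epsilon>: "real (card I) * (8 * \<epsilon>\<^sup>2) / (2 * c) \<le> emin * Hs / 4"
  shows "Re \<tau>2 < Re \<tau>1"
proof -
  define \<Delta> where "\<Delta> = k1\<^sup>2 - k2\<^sup>2"
  have \<Delta>: "\<Delta> > 0" unfolding \<Delta>_def using k S_D(2)[OF p(2)] by (simp add: power_strict_mono)
  have ch: "chan \<beta> k1 a1 u1" "chan \<beta> k2 a2 u2" using s by (auto simp: sys_def)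
  define r where "r i = sa \<beta> k1 (snd i) / sa \<beta> k2 (snd i)" for i :: "bool \<times> int"
  define r' where "r' i = sa \<beta> k2 (snd i) / sa \<beta> k1 (snd i)" for i :: "bool \<times> int"
  define P where "P i = (out a1 i - a1 i) * cnj (a2 i + out a2 i)" for i
  define Q where "Q i = cnj (out a2 i - a2 i) * (a1 i + out a1 i)" for i
  have e1: "Af \<beta> \<delta> k1 u1 u2 = \<i> * (\<Sum>i\<in>I. of_real (r i) * P i) - \<tau>1 * of_real Hs"
    using s(1) s(2) u(2) unfolding sys_def by (simp add: flux_chan[OF p ch(2)] r_def P_def)
  have "Af \<beta> \<delta> k2 u2 u1 = \<i> * (\<Sum>i\<in>I. of_real (r' i) * ((out a2 i - a2 i) * cnj (a1 i + out a1 i))) - \<tau>2 * of_real Hs"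
    using s(1) s(2) u(1) unfolding sys_def by (simp add: flux_chan[OF p(2) p(1) ch(1)] r'_def)
  then have "cnj (Af \<beta> \<delta> k2 u2 u1) = - \<i> * (\<Sum>i\<in>I. of_real (r' i) * Q i) - cnj \<tau>2 * of_real Hs"
    by (simp add: Q_def mult_ac)
  then have e2: "Af \<beta> \<delta> k2 u1 u2 = - \<i> * (\<Sum>i\<in>I. of_real (r' i) * Q i) - cnj \<tau>2 * of_real Hs"
    using herm_on_sym[OF Af_herm[OF S_D(1)[OF p(2)]] u(2,1), of \<beta> k2] by simp
  \<comment> \<open>What is left of the fluxes after subtracting the identity that holds when all
    ratios are 1.\<close>
  define Er where "Er = (\<Sum>i\<in>I. of_real (r i - 1) * P i + of_real (r' i - 1) * Q i)"
  have "(\<Sum>i\<in>I. of_real (r i) * P i) + (\<Sum>i\<in>I. of_real (r' i) * Q i) = Er + (\<Sum>i\<in>I. P i + Q i)"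
    unfolding Er_def sum.distrib[symmetric] by (rule sum.cong) (auto simp: algebra_simps)
  also have "(\<Sum>i\<in>I. P i + Q i) = 0" unfolding P_def Q_def by (rule unitary_cross)
  finally have PQ: "(\<Sum>i\<in>I. of_real (r i) * P i) + (\<Sum>i\<in>I. of_real (r' i) * Q i) = Er" by simp
  have "- of_real \<Delta> * Ef \<beta> \<delta> k1 k2 u1 u2 = \<i> * Er - (\<tau>1 - cnj \<tau>2) * of_real Hs"
    using Af_k_diff[OF p u] e1 e2 unfolding PQ[symmetric] \<Delta>_def by (simp add: algebra_simps)
  then have "(\<tau>1 - cnj \<tau>2) * of_real Hs = of_real \<Delta> * Ef \<beta> \<delta> k1 k2 u1 u2 + \<i> * Er" by (simp add: algebra_simps)
  then have "Re ((\<tau>1 - cnj \<tau>2) * of_real Hs) = Re (of_real \<Delta> * Ef \<beta> \<delta> k1 k2 u1 u2 + \<i> * Er)" by simp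
  then have re: "(Re \<tau>1 - Re \<tau>2) * Hs = \<Delta> * Re (Ef \<beta> \<delta> k1 k2 u1 u2) - Im Er" by simp
  have PQb: "cmod (P i) \<le> 4 * \<epsilon>\<^sup>2" "cmod (Q i) \<le> 4 * \<epsilon>\<^sup>2" if i: "i \<in> I" for i
  proof -
    note sm = small[OF i]
    have "cmod (out a1 i - a1 i) \<le> 2 * \<epsilon>" "cmod (out a2 i - a2 i) \<le> 2 * \<epsilon>" "cmod (a1 i + out a1 i) \<le> 2 * \<epsilon>" "cmod (a2 i + out a2 i) \<le> 2 * \<epsilon>"
      using norm_triangle_ineq4[of "out a1 i" "a1 i"] norm_triangle_ineq4[of "out a2 i" "a2 i"]
        norm_triangle_ineq[of "a1 i" "out a1 i"] norm_triangle_ineq[of "a2 i" "out a2 i"] sm by linarith+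
    then have "cmod (P i) \<le> (2 * \<epsilon>) * (2 * \<epsilon>)" "cmod (Q i) \<le> (2 * \<epsilon>) * (2 * \<epsilon>)"
      unfolding P_def Q_def norm_mult complex_mod_cnj using order_trans[OF norm_ge_zero]
      by (intro mult_mono; force)+
    then show "cmod (P i) \<le> 4 * \<epsilon>\<^sup>2" "cmod (Q i) \<le> 4 * \<epsilon>\<^sup>2" by (simp_all add: power2_eq_square)
  qed
  have rb: "\<bar>r i - 1\<bar> \<le> \<Delta> / (2 * c)" "\<bar>r' i - 1\<bar> \<le> \<Delta> / (2 * c)" if i: "i \<in> I" for i
  proof -
    note f1 = sa_facts[OF p(1) i] and f2 = sa_facts[OF p(2) i]
    have "\<bar>(sqrt (k1\<^sup>2 - (of_int (snd i) + \<beta>)\<^sup>2))\<^sup>2 - (sqrt (k2\<^sup>2 - (of_int (snd i) + \<beta>)\<^sup>2))\<^sup>2\<bar> = \<Delta>"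
      using f1(5) f2(5) \<Delta> by (simp add: \<Delta>_def)
    then show "\<bar>r i - 1\<bar> \<le> \<Delta> / (2 * c)" "\<bar>r' i - 1\<bar> \<le> \<Delta> / (2 * c)"
      using sqrt_ratio_le[OF c f1(4) f2(4)] sqrt_ratio_le[OF c f2(4) f1(4)]
      unfolding r_def r'_def sa_def by (simp_all add: abs_minus_commute)
  qed
  \<comment> \<open>Two terms per channel, each at most \<Delta> / (2 c) times 4 \<epsilon>^2: hence
    the 8 in the hypothesis on \<epsilon>.\<close>
  have "cmod Er \<le> (\<Sum>i\<in>I. \<Delta> / (2 * c) * (4 * \<epsilon>\<^sup>2) + \<Delta> / (2 * c) * (4 * \<epsilon>\<^sup>2))"
    unfolding Er_def
  proof (rule order_trans[OF norm_sum sum_mono])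
    fix i assume i: "i \<in> I"
    have "cmod (of_real (r i - 1) * P i) \<le> \<Delta> / (2 * c) * (4 * \<epsilon>\<^sup>2)" "cmod (of_real (r' i - 1) * Q i) \<le> \<Delta> / (2 * c) * (4 * \<epsilon>\<^sup>2)"
      unfolding norm_mult norm_of_real
      by (rule mult_mono[OF rb(1)[OF i] PQb(1)[OF i]], use \<Delta> c in simp, simp)
        (rule mult_mono[OF rb(2)[OF i] PQb(2)[OF i]], use \<Delta> c in simp, simp)
    then show "cmod (of_real (r i - 1) * P i + of_real (r' i - 1) * Q i) \<le> \<Delta> / (2 * c) * (4 * \<epsilon>\<^sup>2) + \<Delta> / (2 * c) * (4 * \<epsilon>\<^sup>2)"
      using norm_triangle_ineq[of "of_real (r i - 1) * P i" "of_real (r' i - 1) * Q i"] by linarith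
  qed
  also have "\<dots> = \<Delta> * (real (card I) * (8 * \<epsilon>\<^sup>2) / (2 * c))" by simp
  also have "\<dots> \<le> \<Delta> * (emin * Hs / 4)" using \<epsilon> \<Delta> by (intro mult_left_mono) auto
  finally have Erb: "Im Er \<le> \<Delta> * (emin * Hs / 4)" using abs_Im_le_cmod[of Er] by linarith
  note d = V_diff[OF u(1) us] V_diff[OF u(2) us]
  have \<eta>0: "\<eta> \<ge> 0" using near(1) nH_nonneg order_trans by blast
  have n2: "nH u2 \<le> nH us + \<eta>"
    using fnorm_triangle[OF fun_space_V herm_on_ipH ipH_pos d(2) us] near(2) by simp
  have Es: "Ef \<beta> \<delta> k1 k2 u1 u2 = Ef \<beta> \<delta> k1 k2 us us + Ef \<beta> \<delta> k1 k2 (\<lambda>x. u1 x - us x) u2 + Ef \<beta> \<delta> k1 k2 us (\<lambda>x. u2 x - us x)"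
    using lin_on_diff[OF fun_space_V herm_on_lin[OF Ef_herm[OF p] u(2)] u(1) us] herm_on_diff_right[OF Ef_herm[OF p] fun_space_V us u(2) us]
    by simp
  have E1: "cmod (Ef \<beta> \<delta> k1 k2 (\<lambda>x. u1 x - us x) u2) \<le> KE * (\<eta> * (nH us + \<eta>))"
    by (rule order_trans[OF Ef_bound[OF p d(1) u(2)]]) (use KE_pos near n2 \<eta>0 in \<open>auto intro!: mult_left_mono mult_mono\<close>)
  have E2: "cmod (Ef \<beta> \<delta> k1 k2 us (\<lambda>x. u2 x - us x)) \<le> KE * (nH us * \<eta>)"
    by (rule order_trans[OF Ef_bound[OF p us d(2)]]) (use KE_pos near in \<open>auto intro!: mult_left_mono\<close>)
  have "Re (Ef \<beta> \<delta> k1 k2 u1 u2) = Re (Ef \<beta> \<delta> k1 k2 us us) + Re (Ef \<beta> \<delta> k1 k2 (\<lambda>x. u1 x - us x) u2)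
      + Re (Ef \<beta> \<delta> k1 k2 us (\<lambda>x. u2 x - us x))" unfolding Es by simp
  then have "Re (Ef \<beta> \<delta> k1 k2 u1 u2) \<ge> emin * Hs - emin * Hs / 4"
    using Ef_pos[OF p us] \<eta>[unfolded distrib_left] E1 E2 abs_Re_le_cmod[of "Ef \<beta> \<delta> k1 k2 (\<lambda>x. u1 x - us x) u2"]
      abs_Re_le_cmod[of "Ef \<beta> \<delta> k1 k2 us (\<lambda>x. u2 x - us x)"] unfolding distrib_left by linarith
  then have "\<Delta> * (emin * Hs - emin * Hs / 4) \<le> \<Delta> * Re (Ef \<beta> \<delta> k1 k2 u1 u2)" using \<Delta> by (intro mult_left_mono) auto
  \<comment> \<open>A quarter of \<open>emin\<close> times \<open>Hs\<close> is lost in replacing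
    \<open>u1\<close> and \<open>u2\<close> by \<open>us\<close>, another quarter to
    \<open>Er\<close>; half remains.\<close>
  then have "(Re \<tau>1 - Re \<tau>2) * Hs \<ge> \<Delta> * (emin * Hs - emin * Hs / 4) - \<Delta> * (emin * Hs / 4)" using re Erb by linarith
  also have "\<Delta> * (emin * Hs - emin * Hs / 4) - \<Delta> * (emin * Hs / 4) = \<Delta> * (emin * Hs / 2)" by (simp add: algebra_simps)
  finally have "(Re \<tau>1 - Re \<tau>2) * Hs \<ge> \<Delta> * (emin * Hs / 2)" .
  moreover have "\<Delta> * (emin * Hs / 2) > 0" using \<Delta> emin(1) us_pos by simp
  ultimately have "(Re \<tau>1 - Re \<tau>2) * Hs > 0" by linarith
  then show ?thesis using us_pos by (simp add: zero_less_mult_iff)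
qed

end

section \<open>The bordered system of cell averages, amplitudes and multiplier\<close>

lemma ball_sites: "(\<forall>s\<in>sites n I. Q s) \<longleftrightarrow> (\<forall>i<n. \<forall>j<n. Q (Cell i j)) \<and> (\<forall>i\<in>I. Q (Port i)) \<and> Q Mode"
  by (auto simp: sites_def)

context channel_problem
begin

definition func :: "nat \<Rightarrow> site \<Rightarrow> (pt \<Rightarrow> complex) \<Rightarrow> complex" where
  "func n s u = (case s of Cell i j \<Rightarrow> avg n i j u | Port i \<Rightarrow> trco d0 u (fst i) (snd i) | Mode \<Rightarrow> ip M u us)"

text \<open>Source strengths in the equation for u: \<mu> times the average on a cell, the
  coefficient of \<open>flux\<close> in a channel, and -\<tau> for the normalisation.\<close>

definition Cf :: "real \<Rightarrow> real \<Rightarrow> real \<Rightarrow> site \<Rightarrow> site \<Rightarrow> complex" where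
  "Cf \<mu> \<beta> k s t = (case s of Cell i j \<Rightarrow> (if t = s then of_real \<mu> else 0)
     | Port i \<Rightarrow> (case t of Port j \<Rightarrow> \<i> * of_real (sa \<beta> k (snd i)) * (Mx i j - (if i = j then 1 else 0)) | _ \<Rightarrow> 0)
     | Mode \<Rightarrow> (if t = Mode then - 1 else 0))"

text \<open>Prescribed values of the functionals: a cell unknown is the average itself, the channel
  row is \<open>chan\<close> solved for the trace, and the normalisation row is 0 because its value
  comes from the inhomogeneity.\<close>

definition Df :: "real \<Rightarrow> real \<Rightarrow> site \<Rightarrow> site \<Rightarrow> complex" where
  "Df \<beta> k s t = (case s of Cell i j \<Rightarrow> (if t = s then 1 else 0)
     | Port i \<Rightarrow> (case t of Port j \<Rightarrow> (Mx i j + (if i = j then 1 else 0)) / of_real (sa \<beta> k (snd i)) | _ \<Rightarrow> 0)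
     | Mode \<Rightarrow> 0)"

text \<open>The averages are added to gain coercivity. The cell unknowns put the same terms on the
  right-hand side, so the problem is unchanged.\<close>

definition Bf :: "nat \<Rightarrow> real \<Rightarrow> real \<Rightarrow> real^'n \<Rightarrow> real \<Rightarrow> (pt \<Rightarrow> complex) \<Rightarrow> (pt \<Rightarrow> complex) \<Rightarrow> complex" where
  "Bf n \<mu> \<beta> \<delta> k u v = Af \<beta> \<delta> k u v + of_real \<mu> * (\<Sum>i<n. \<Sum>j<n. avg n i j u * cnj (avg n i j v))"

lemma out_minus: "i \<in> I \<Longrightarrow> (\<Sum>j\<in>I. (Mx i j - (if i = j then 1 else 0)) * a j) = out a i - a i"
  using fin_I by (simp add: left_diff_distrib sum_subtractf matvec_def if_distrib[where f = "\<lambda>z. z * _"] cong: if_cong)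

lemma out_plus: "i \<in> I \<Longrightarrow> (\<Sum>j\<in>I. (Mx i j + (if i = j then 1 else 0)) * a j) = out a i + a i"
  using fin_I by (simp add: distrib_right sum.distrib matvec_def if_distrib[where f = "\<lambda>z. z * _"] cong: if_cong)

lemma delta_site: "s \<in> sites n I \<Longrightarrow> (\<Sum>t\<in>sites n I. (if t = s then z else 0) * y t) = z * (y s :: complex)"
  using finite_sites[OF fin_I, of n] by (simp add: if_distrib[where f = "\<lambda>z. z * _"] cong: if_cong)

lemma Cf_row:
  "i < n \<Longrightarrow> j < n \<Longrightarrow> (\<Sum>t\<in>sites n I. Cf \<mu> \<beta> k (Cell i j) t * y t) = of_real \<mu> * y (Cell i j)"
  "a \<in> I \<Longrightarrow> (\<Sum>t\<in>sites n I. Cf \<mu> \<beta> k (Port a) t * y t) = \<i> * of_real (sa \<beta> k (snd a)) * (out (\<lambda>b. y (Port b)) a - y (Port a))"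
  "(\<Sum>t\<in>sites n I. Cf \<mu> \<beta> k Mode t * y t) = - y Mode"
proof -
  show "(\<Sum>t\<in>sites n I. Cf \<mu> \<beta> k (Cell i j) t * y t) = of_real \<mu> * y (Cell i j)" if "i < n" "j < n"
    unfolding Cf_def site.case by (rule delta_site) (use that in \<open>auto simp: sites_def\<close>)
  show "(\<Sum>t\<in>sites n I. Cf \<mu> \<beta> k (Port a) t * y t) = \<i> * of_real (sa \<beta> k (snd a)) * (out (\<lambda>b. y (Port b)) a - y (Port a))" if "a \<in> I"
    unfolding sum_sites[OF fin_I] out_minus[OF that, of "\<lambda>b. y (Port b)", symmetric] by (simp add: Cf_def sum_distrib_left mult.assoc)
  show "(\<Sum>t\<in>sites n I. Cf \<mu> \<beta> k Mode t * y t) = - y Mode"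
    unfolding Cf_def site.case using delta_site[of Mode n "-1" y] by (simp add: sites_def)
qed

lemma Df_row:
  "i < n \<Longrightarrow> j < n \<Longrightarrow> (\<Sum>t\<in>sites n I. Df \<beta> k (Cell i j) t * y t) = y (Cell i j)"
  "a \<in> I \<Longrightarrow> (\<Sum>t\<in>sites n I. Df \<beta> k (Port a) t * y t) = (out (\<lambda>b. y (Port b)) a + y (Port a)) / of_real (sa \<beta> k (snd a))"
  "(\<Sum>t\<in>sites n I. Df \<beta> k Mode t * y t) = 0"
proof -
  show "(\<Sum>t\<in>sites n I. Df \<beta> k (Cell i j) t * y t) = y (Cell i j)" if "i < n" "j < n"
    unfolding Df_def site.case using delta_site[of "Cell i j" n 1 y] that by (auto simp: sites_def)
  show "(\<Sum>t\<in>sites n I. Df \<beta> k (Port a) t * y t) = (out (\<lambda>b. y (Port b)) a + y (Port a)) / of_real (sa \<beta> k (snd a))" if "a \<in> I"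
    unfolding sum_sites[OF fin_I] out_plus[OF that, of "\<lambda>b. y (Port b)", symmetric] by (simp add: Df_def sum_divide_distrib)
  show "(\<Sum>t\<in>sites n I. Df \<beta> k Mode t * y t) = 0" by (simp add: Df_def)
qed

text \<open>The condition attached to a cell forces its unknown to be the average of u; then the
  \<mu> terms on the two sides cancel, and what is left is exactly \<open>sys\<close>.\<close>

lemma bordered_sites_iff:
  assumes p: "(\<beta>, \<delta>, k) \<in> S"
  shows "bordered (sites n I) (func n) (Bf n \<mu> \<beta> \<delta> k) (Cf \<mu> \<beta> k) (Df \<beta> k) (\<lambda>s. if s = Mode then h else 0) u y \<longleftrightarrow>
    (\<forall>i<n. \<forall>j<n. y (Cell i j) = avg n i j u) \<and> sys \<beta> \<delta> k h u (\<lambda>i. y (Port i)) (y Mode)"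
proof -
  let ?a = "\<lambda>i. y (Port i)"
  let ?cells = "\<forall>i<n. \<forall>j<n. y (Cell i j) = avg n i j u"
  have 1: "(\<forall>r\<in>sites n I. func n r u = (\<Sum>t\<in>sites n I. Df \<beta> k r t * y t) + (if r = Mode then h else 0)) \<longleftrightarrow>
      ?cells \<and> chan \<beta> k ?a u \<and> ip M u us = h"
  proof -
    have "trco d0 u (fst i) (snd i) = (out ?a i + ?a i) / of_real (sa \<beta> k (snd i)) \<longleftrightarrow>
        of_real (sa \<beta> k (snd i)) * trco d0 u (fst i) (snd i) = ?a i + out ?a i" if "i \<in> I" for i
      using sa_facts(3)[OF p that] by (simp add: field_simps)
    then show ?thesis unfolding ball_sites chan_def
      by (simp add: Df_row func_def del: split_paired_All) (metis (no_types, lifting))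
  qed
  have 2: "(\<Sum>s\<in>sites n I. (\<Sum>t\<in>sites n I. Cf \<mu> \<beta> k s t * y t) * cnj (func n s v)) =
     of_real \<mu> * (\<Sum>i<n. \<Sum>j<n. y (Cell i j) * cnj (avg n i j v)) + flux \<beta> k ?a v - y Mode * cnj (ip M v us)" for v
    unfolding sum_sites[OF fin_I, of _ n] flux_def sum_distrib_left
    by (simp add: Cf_row[unfolded sum_sites[OF fin_I]] func_def mult.assoc)
  have 3: "(Bf n \<mu> \<beta> \<delta> k u v = of_real \<mu> * (\<Sum>i<n. \<Sum>j<n. y (Cell i j) * cnj (avg n i j v)) + flux \<beta> k ?a v - y Mode * cnj (ip M v us)) \<longleftrightarrow>
      Af \<beta> \<delta> k u v = flux \<beta> k ?a v - y Mode * cnj (ip M v us)" if ?cells for v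
  proof -
    have "(\<Sum>i<n. \<Sum>j<n. y (Cell i j) * cnj (avg n i j v)) = (\<Sum>i<n. \<Sum>j<n. avg n i j u * cnj (avg n i j v))"
      using that by simp
    then show ?thesis unfolding Bf_def by (auto simp: algebra_simps)
  qed
  show ?thesis unfolding bordered_def sys_def 1 2 using 3 by blast
qed

lemma func_linear: "s \<in> sites n I \<Longrightarrow> lin_on V (func n s)"
proof -
  assume "s \<in> sites n I"
  then consider i j where "s = Cell i j" "i < n" "j < n" | i where "s = Port i" | "s = Mode" by (auto simp: sites_def)
  then show ?thesis
  proof cases
    case 1
    then show ?thesis using avg_linear[of i n j] by (simp add: func_def[abs_def])
  next
    case 2
    then show ?thesis using trco_linear[of "fst i" "snd i"] by (simp add: func_def[abs_def])
  next
    case 3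
    then show ?thesis using ip_linear(1)[OF V_sqint(1)[OF us]] by (simp add: func_def[abs_def])
  qed
qed

lemma avg_bound:
  assumes "i < n" "j < n" "u \<in> V"
  shows "cmod (avg n i j u) \<le> sqrt (sq M (indicator (cell n i j))) * nH u"
proof -
  have "cmod (avg n i j u) \<le> sqrt (sq M u) * sqrt (sq M (indicator (cell n i j)))"
    unfolding avg_def by (rule ip_cauchy_schwarz[OF V_sqint(1)[OF assms(3)] sqint_indicator_cell[OF assms(1,2)]])
  also have "\<dots> \<le> nH u * sqrt (sq M (indicator (cell n i j)))" by (rule mult_right_mono[OF nH_ge(1)]) (simp add: sq_nonneg)
  finally show ?thesis by (simp add: mult.commute)
qed

lemma trco_bound: "u \<in> V \<Longrightarrow> cmod (trco d0 u fl m) \<le> sqrt CT * nH u"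
proof -
  assume u: "u \<in> V"
  have "(cmod (trco d0 u fl m))\<^sup>2 \<le> (1 + \<bar>real_of_int m\<bar>) * (cmod (trco d0 u fl m))\<^sup>2" by (simp add: mult_le_cancel_right1)
  also have "\<dots> \<le> CT * (nH u)\<^sup>2" using trace_bound[OF u, of "{m}" fl] by simp
  also have "\<dots> = (sqrt CT * nH u)\<^sup>2" using CT_pos by (simp add: power_mult_distrib)
  finally show ?thesis by (rule power2_le_imp_le) (use CT_pos in simp)
qed

lemma func_bound: "\<exists>L. \<forall>s\<in>sites n I. \<forall>u\<in>V. cmod (func n s u) \<le> L * nH u"
proof -
  have "\<exists>L. \<forall>u\<in>V. cmod (func n s u) \<le> L * nH u" if "s \<in> sites n I" for s
  proof -
    consider i j where "s = Cell i j" "i < n" "j < n" | i where "s = Port i" | "s = Mode" using \<open>s \<in> sites n I\<close> by (auto simp: sites_def)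
    then show ?thesis
    proof cases
      case 1
      then show ?thesis using avg_bound[of i n j] unfolding func_def by (intro exI[of _ "sqrt (sq M (indicator (cell n i j)))"]) simp
    next
      case 2
      then show ?thesis using trco_bound unfolding func_def by (intro exI[of _ "sqrt CT"]) simp
    next
      case 3
      have "cmod (ip M u us) \<le> nH us * nH u" if "u \<in> V" for u using ip_nH(1)[OF that us] by (simp add: mult.commute)
      then show ?thesis using 3 unfolding func_def by (intro exI[of _ "nH us"]) simp
    qed
  qed
  then obtain L where L: "\<And>s u. s \<in> sites n I \<Longrightarrow> u \<in> V \<Longrightarrow> cmod (func n s u) \<le> L s * nH u" by metis
  have "cmod (func n s u) \<le> (\<Sum>s\<in>sites n I. \<bar>L s\<bar>) * nH u" if s: "s \<in> sites n I" and u: "u \<in> V" for s u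
  proof -
    have "L s \<le> (\<Sum>s\<in>sites n I. \<bar>L s\<bar>)"
      using member_le_sum[OF s _ finite_sites[OF fin_I], of "\<lambda>s. \<bar>L s\<bar>"] by simp
    then have "L s * nH u \<le> (\<Sum>s\<in>sites n I. \<bar>L s\<bar>) * nH u" by (rule mult_right_mono) simp
    then show ?thesis using L[OF s u] by linarith
  qed
  then show ?thesis by blast
qed

lemma sa_cont: "continuous_on S (\<lambda>p. sa (fst p) (snd (snd p)) m)"
  unfolding sa_def by (intro continuous_intros)

lemma CD_cont:
  assumes "s \<in> sites n I" "t \<in> sites n I"
  shows "continuous_on S (\<lambda>p. Cf \<mu> (fst p) (snd (snd p)) s t)" "continuous_on S (\<lambda>p. Df (fst p) (snd (snd p)) s t)"
proof -
  show "continuous_on S (\<lambda>p. Cf \<mu> (fst p) (snd (snd p)) s t)"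
    unfolding Cf_def by (cases s; cases t) (auto intro!: continuous_intros sa_cont)
  have "sa (fst p) (snd (snd p)) (snd i) \<noteq> 0" if "i \<in> I" "p \<in> S" for i p
    using sa_facts(3)[of "fst p" "fst (snd p)" "snd (snd p)" i] that by simp
  then show "continuous_on S (\<lambda>p. Df (fst p) (snd (snd p)) s t)"
    using assms(1) unfolding Df_def by (cases s; cases t) (auto intro!: continuous_intros sa_cont simp: sites_def)
qed

lemma Bf_herm: "\<delta> \<in> W1 \<Longrightarrow> herm_on V (Bf n \<mu> \<beta> \<delta> k)"
proof -
  assume d: "\<delta> \<in> W1"
  have l: "lin_on V (\<lambda>u. \<Sum>i<n. \<Sum>j<n. avg n i j u * z i j)" for z
  proof (rule lin_onI_combine[OF fun_space_V])
    fix u v e assume u: "u \<in> V" and v: "v \<in> V"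
    have "avg n i j (\<lambda>x. u x + e * v x) = avg n i j u + e * avg n i j v" if "i < n" "j < n" for i j
      using lin_onD(1)[OF avg_linear[OF that] u fun_spaceD(3)[OF fun_space_V v]] lin_onD(2)[OF avg_linear[OF that] v] by simp
    then have "(\<Sum>i<n. \<Sum>j<n. avg n i j (\<lambda>x. u x + e * v x) * z i j) = (\<Sum>i<n. \<Sum>j<n. avg n i j u * z i j + e * (avg n i j v * z i j))"
      by (intro sum.cong refl) (simp add: algebra_simps)
    then show "(\<Sum>i<n. \<Sum>j<n. avg n i j (\<lambda>x. u x + e * v x) * z i j) = (\<Sum>i<n. \<Sum>j<n. avg n i j u * z i j) + e * (\<Sum>i<n. \<Sum>j<n. avg n i j v * z i j)"
      by (simp add: sum.distrib sum_distrib_left)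
  qed
  show ?thesis unfolding herm_on_def
  proof (intro conjI ballI)
    fix v assume "v \<in> V"
    then show "lin_on V (\<lambda>u. Bf n \<mu> \<beta> \<delta> k u v)" unfolding Bf_def
      by (intro lin_on_add lin_on_scale l herm_on_lin[OF Af_herm[OF d]])
  next
    fix u v assume "u \<in> V" "v \<in> V"
    then show "Bf n \<mu> \<beta> \<delta> k v u = cnj (Bf n \<mu> \<beta> \<delta> k u v)" unfolding Bf_def
      using herm_on_sym[OF Af_herm[OF d], of u v \<beta> k] by (simp add: mult.commute)
  qed
qed

lemma Bf_self: "Re (Bf n \<mu> \<beta> \<delta> k u u) = Re (Af \<beta> \<delta> k u u) + \<mu> * (\<Sum>i<n. \<Sum>j<n. (cmod (avg n i j u))\<^sup>2)"
proof -
  have "(\<Sum>i<n. \<Sum>j<n. avg n i j u * cnj (avg n i j u)) = of_real (\<Sum>i<n. \<Sum>j<n. (cmod (avg n i j u))\<^sup>2)"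
    unfolding of_real_sum complex_norm_square ..
  then show ?thesis by (simp add: Bf_def flip: of_real_mult)
qed

text \<open>The Garding inequality loses \<open>Lam\<close> times the squared L2 norm. Bounding L =
  \<open>Lam\<close> + 1/4 times that norm by \<open>ehrling\<close> with tolerance 1 / (4 L) leaves
  a quarter of both the gradient energy and the L2 norm, and dictates \<mu> = L C.\<close>

lemma Bf_coercive:
  "\<exists>n>0. \<exists>\<mu>\<ge>0. \<forall>\<beta> \<delta> k. (\<beta>, \<delta>, k) \<in> S \<longrightarrow> (\<forall>u\<in>V. 1/4 * (nH u)\<^sup>2 \<le> Re (Bf n \<mu> \<beta> \<delta> k u u))"
proof -
  define L where "L = Lam + 1/4"
  have L: "L > 0" using Lam_pos by (simp add: L_def)
  obtain n C where n: "n > 0" and C: "C \<ge> 0"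
    and E: "\<And>u. u \<in> V \<Longrightarrow> sq M u \<le> 1 / (4 * L) * (sq M (G1 u) + sq M (G2 u)) + C * (\<Sum>i<n. \<Sum>j<n. (cmod (avg n i j u))\<^sup>2)"
    using ehrling[of "1 / (4 * L)"] L by auto
  have "1/4 * (nH u)\<^sup>2 \<le> Re (Bf n (L * C) \<beta> \<delta> k u u)" if p: "(\<beta>, \<delta>, k) \<in> S" and u: "u \<in> V" for \<beta> \<delta> k u
  proof -
    define A where "A = (\<Sum>i<n. \<Sum>j<n. (cmod (avg n i j u))\<^sup>2)"
    define G where "G = sq M (G1 u) + sq M (G2 u)"
    have "L * sq M u \<le> L * (1 / (4 * L) * G + C * A)" unfolding G_def A_def by (rule mult_left_mono[OF E[OF u]]) (use L in simp)
    also have "\<dots> = G / 4 + L * C * A" using L by (simp add: field_simps)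
    finally have "L * sq M u \<le> G / 4 + L * C * A" .
    moreover have "G / 2 - Lam * sq M u \<le> Re (Af \<beta> \<delta> k u u)" unfolding G_def by (rule Af_garding[OF p u])
    moreover have "L * sq M u = Lam * sq M u + sq M u / 4" by (simp add: L_def algebra_simps)
    ultimately have "1/4 * (sq M u + G) \<le> Re (Af \<beta> \<delta> k u u) + L * C * A" by simp
    then show ?thesis unfolding Bf_self nH_sq A_def[symmetric] by (simp add: G_def add.assoc)
  qed
  moreover have "L * C \<ge> 0" using L C by simp
  ultimately show ?thesis using n by blast
qed

lemma ip_zero_AE_left:
  assumes z: "AE x in M. u x = 0" and u: "sqint M u" and w: "sqint M w" shows "ip M u w = 0"
proof -
  have "cmod (ip M u w) \<le> sqrt (sq M u) * sqrt (sq M w)" by (rule ip_cauchy_schwarz[OF u w])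
  then show ?thesis using sq_eq_0_iff[OF u] z by simp
qed

text \<open>\<open>bordered_perturbation\<close> applied to the sites, where the substance is
  injectivity at the BIC. The frequency is still a free parameter: a solution exists for every
  (\<beta>, \<delta>, k) of S close to the BIC, at the price of a multiplier.\<close>

theorem local_branch:
  assumes simple: "\<forall>u\<in>V. \<forall>a. chan \<beta>s ks a u \<longrightarrow> (\<forall>v\<in>V. Af \<beta>s \<delta>s ks u v = flux \<beta>s ks a v) \<longrightarrow>
      (\<forall>i\<in>I. a i = 0) \<and> (\<exists>z. AE x in M. u x = z * us x)"
  shows "\<exists>r>0. \<exists>U A \<tau>. (\<forall>\<beta> \<delta> k. (\<beta>, \<delta>, k) \<in> S \<inter> ball (\<beta>s, \<delta>s, ks) r \<longrightarrow> U (\<beta>, \<delta>, k) \<in> V \<and>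
        sys \<beta> \<delta> k (of_real Hs) (U (\<beta>, \<delta>, k)) (A (\<beta>, \<delta>, k)) (\<tau> (\<beta>, \<delta>, k)) \<and>
        (\<forall>u\<in>V. \<forall>a t. sys \<beta> \<delta> k (of_real Hs) u a t \<longrightarrow> nH (\<lambda>x. u x - U (\<beta>, \<delta>, k) x) = 0 \<and> (\<forall>i\<in>I. a i = A (\<beta>, \<delta>, k) i) \<and> t = \<tau> (\<beta>, \<delta>, k)))
      \<and> continuous_on (S \<inter> ball (\<beta>s, \<delta>s, ks) r) \<tau> \<and> (\<forall>i\<in>I. continuous_on (S \<inter> ball (\<beta>s, \<delta>s, ks) r) (\<lambda>p. A p i))
      \<and> (\<forall>p\<in>S \<inter> ball (\<beta>s, \<delta>s, ks) r. ((\<lambda>q. nH (\<lambda>x. U q x - U p x)) \<longlongrightarrow> 0) (at p within S \<inter> ball (\<beta>s, \<delta>s, ks) r))"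
proof -
  obtain n \<mu> where n: "n > 0" and \<mu>: "\<mu> \<ge> 0"
    and co: "\<And>\<beta> \<delta> k u. (\<beta>, \<delta>, k) \<in> S \<Longrightarrow> u \<in> V \<Longrightarrow> 1/4 * (nH u)\<^sup>2 \<le> Re (Bf n \<mu> \<beta> \<delta> k u u)"
    using Bf_coercive by blast
  obtain L where L: "\<And>s u. s \<in> sites n I \<Longrightarrow> u \<in> V \<Longrightarrow> cmod (func n s u) \<le> L * nH u" using func_bound by blast
  define B where "B p = Bf n \<mu> (fst p) (fst (snd p)) (snd (snd p))" for p :: "real \<times> (real^'n) \<times> real"
  define C where "C p = Cf \<mu> (fst p) (snd (snd p))" for p :: "real \<times> (real^'n) \<times> real"
  define D where "D p = Df (fst p) (snd (snd p))" for p :: "real \<times> (real^'n) \<times> real"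
  have "\<exists>K. \<forall>u\<in>V. Re (B p u u) \<le> K * (nH u)\<^sup>2" if p: "p \<in> S" for p
  proof -
    obtain \<beta> \<delta> k where pe: "p = (\<beta>, \<delta>, k)" by (cases p) auto
    obtain K where K: "\<And>u v. u \<in> V \<Longrightarrow> v \<in> V \<Longrightarrow> cmod (Af \<beta> \<delta> k u v) \<le> K * (nH u * nH v)"
      using Af_bound[of \<beta> \<delta> k] p pe by blast
    have "Re (B p u u) \<le> (K + \<mu> * (\<Sum>i<n. \<Sum>j<n. L\<^sup>2)) * (nH u)\<^sup>2" if u: "u \<in> V" for u
    proof -
      have "(\<Sum>i<n. \<Sum>j<n. (cmod (avg n i j u))\<^sup>2) \<le> (\<Sum>i<n. \<Sum>j<n. (L * nH u)\<^sup>2)"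
      proof (intro sum_mono power_mono)
        fix i j assume "i \<in> {..<n}" "j \<in> {..<n}"
        then have "Cell i j \<in> sites n I" by (auto simp: sites_def)
        from L[OF this u] show "cmod (avg n i j u) \<le> L * nH u" by (simp add: func_def)
      qed simp
      then have "\<mu> * (\<Sum>i<n. \<Sum>j<n. (cmod (avg n i j u))\<^sup>2) \<le> \<mu> * (\<Sum>i<n. \<Sum>j<n. (L * nH u)\<^sup>2)" using \<mu> by (rule mult_left_mono)
      moreover have "Re (Af \<beta> \<delta> k u u) \<le> K * (nH u * nH u)" using K[OF u u] complex_Re_le_cmod order_trans by blast
      ultimately show ?thesis unfolding pe B_def fst_conv snd_conv Bf_self
        by (simp add: power_mult_distrib algebra_simps power2_eq_square)
    qed
    then show ?thesis by blast
  qed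
  then obtain K where K: "\<And>p u. p \<in> S \<Longrightarrow> u \<in> V \<Longrightarrow> Re (B p u u) \<le> K p * (nH u)\<^sup>2" by metis
  have Bc: "\<exists>d>0. \<forall>q\<in>S. dist q p < d \<longrightarrow> (\<forall>u\<in>V. \<forall>v\<in>V. cmod (B q u v - B p u v) \<le> e * nH u * nH v)"
    if p: "p \<in> S" and e: "e > 0" for p e
  proof -
    obtain \<beta> \<delta> k where pe: "p = (\<beta>, \<delta>, k)" by (cases p) auto
    obtain d where d: "d > 0" "\<And>\<beta>' \<delta>' k' u v. (\<beta>', \<delta>', k') \<in> S \<Longrightarrow> dist (\<beta>', \<delta>', k') (\<beta>, \<delta>, k) < d \<Longrightarrow> u \<in> V \<Longrightarrow> v \<in> V \<Longrightarrow>
        cmod (Af \<beta>' \<delta>' k' u v - Af \<beta> \<delta> k u v) \<le> e * (nH u * nH v)"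
      using Af_cont[OF p[unfolded pe] e] by blast
    have "cmod (B q u v - B p u v) \<le> e * nH u * nH v" if "q \<in> S" "dist q p < d" "u \<in> V" "v \<in> V" for q u v
      using d(2)[of "fst q" "fst (snd q)" "snd (snd q)" u v] that by (simp add: pe B_def Bf_def mult.assoc)
    then show ?thesis using d(1) by blast
  qed
  have injs: "\<forall>s\<in>sites n I. y s = 0"
    if u: "u \<in> V" and b: "bordered (sites n I) (func n) (B (\<beta>s, \<delta>s, ks)) (C (\<beta>s, \<delta>s, ks)) (D (\<beta>s, \<delta>s, ks)) (\<lambda>_. 0) u y" for u y
  proof -
    have b': "(\<forall>i<n. \<forall>j<n. y (Cell i j) = avg n i j u)" and sy: "sys \<beta>s \<delta>s ks 0 u (\<lambda>i. y (Port i)) (y Mode)"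
      using bordered_sites_iff[OF star, of n \<mu> 0 u y] b by (simp_all add: B_def C_def D_def)
    \<comment> \<open>Testing with \<open>us\<close> isolates \<tau>: the form vanishes because it
      is Hermitian and \<open>us\<close> is in its kernel, the flux because \<open>us\<close> has no
      propagating traces.\<close>
    have "Af \<beta>s \<delta>s ks u us = cnj (Af \<beta>s \<delta>s ks us u)" by (rule herm_on_sym[OF Af_herm[OF S_D(1)[OF star]] us u])
    also have "\<dots> = 0" by (simp add: us_null[OF u])
    finally have "flux \<beta>s ks (\<lambda>i. y (Port i)) us - y Mode * cnj (ip M us us) = 0" using sy us by (simp add: sys_def)
    moreover have "flux \<beta>s ks (\<lambda>i. y (Port i)) us = 0" unfolding flux_def by (rule sum.neutral) (use us_trace in auto)
    ultimately have t0: "y Mode = 0" using us_pos by (simp add: ip_self)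
    then have "chan \<beta>s ks (\<lambda>i. y (Port i)) u" "\<forall>v\<in>V. Af \<beta>s \<delta>s ks u v = flux \<beta>s ks (\<lambda>i. y (Port i)) v"
      using sy by (auto simp: sys_def)
    then have "(\<forall>i\<in>I. y (Port i) = 0) \<and> (\<exists>z. AE x in M. u x = z * us x)"
      by (rule simple[THEN bspec, OF u, THEN spec, THEN mp, THEN mp])
    then obtain z where y0: "\<forall>i\<in>I. y (Port i) = 0" and z: "AE x in M. u x = z * us x" by blast
    \<comment> \<open>The homogeneous normalisation removes the remaining freedom along
      \<open>us\<close>.\<close>
    have "ip M u us = ip M (\<lambda>x. z * us x) us"
      by (rule ip_cong_AE[OF z]) (use V_sqint(1)[OF u] V_sqint(1)[OF us] sqint_scale[OF V_sqint(1)[OF us], of z] in \<open>auto intro: sqint_meas\<close>)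
    also have "\<dots> = z * of_real Hs" using lin_onD(2)[OF herm_on_lin[OF herm_on_ip], of us M us z] V_sqint(1)[OF us] by (simp add: ip_self)
    finally have "z = 0" using sy us_pos by (simp add: sys_def)
    then have u0: "AE x in M. u x = 0" using z by simp
    have "avg n i j u = 0" if "i < n" "j < n" for i j
      unfolding avg_def by (rule ip_zero_AE_left[OF u0 V_sqint(1)[OF u] sqint_indicator_cell[OF that]])
    then show ?thesis unfolding ball_sites using b' y0 t0 by simp
  qed
  have "\<exists>r>0. \<exists>U Y. (\<forall>p\<in>S \<inter> ball (\<beta>s, \<delta>s, ks) r. U p \<in> V \<and>
        bordered (sites n I) (func n) (B p) (C p) (D p) (\<lambda>s. if s = Mode then of_real Hs else 0) (U p) (Y p) \<and>
        (\<forall>u\<in>V. \<forall>y. bordered (sites n I) (func n) (B p) (C p) (D p) (\<lambda>s. if s = Mode then of_real Hs else 0) u y \<longrightarrow>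
            nH (\<lambda>x. u x - U p x) = 0 \<and> (\<forall>i\<in>sites n I. y i = Y p i)))
      \<and> (\<forall>i\<in>sites n I. continuous_on (S \<inter> ball (\<beta>s, \<delta>s, ks) r) (\<lambda>p. Y p i))
      \<and> (\<forall>p\<in>S \<inter> ball (\<beta>s, \<delta>s, ks) r. ((\<lambda>q. nH (\<lambda>x. U q x - U p x)) \<longlongrightarrow> 0) (at p within S \<inter> ball (\<beta>s, \<delta>s, ks) r))"
  proof (rule bordered_perturbation[OF finite_sites[OF fin_I] star, of "1/4"])
    fix p assume p: "p \<in> S"
    then have p': "(fst p, fst (snd p), snd (snd p)) \<in> S" by simp
    show "herm_on V (B p)" unfolding B_def by (rule Bf_herm[OF S_D(1)[OF p']])
    show "1/4 * (nH u)\<^sup>2 \<le> Re (B p u u)" if "u \<in> V" for u unfolding B_def by (rule co[OF p' that])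
    show "Re (B p u u) \<le> K p * (nH u)\<^sup>2" if "u \<in> V" for u by (rule K[OF p that])
    show "\<exists>d>0. \<forall>q\<in>S. dist q p < d \<longrightarrow> (\<forall>u\<in>V. \<forall>v\<in>V. cmod (B q u v - B p u v) \<le> e * nH u * nH v)" if "e > 0" for e
      by (rule Bc[OF p that])
  next
    fix s assume s: "s \<in> sites n I"
    show "lin_on V (func n s)" by (rule func_linear[OF s])
    show "cmod (func n s u) \<le> L * nH u" if "u \<in> V" for u by (rule L[OF s that])
    fix t assume t: "t \<in> sites n I"
    show "continuous_on S (\<lambda>p. C p s t)" unfolding C_def by (rule CD_cont(1)[OF s t])
    show "continuous_on S (\<lambda>p. D p s t)" unfolding D_def by (rule CD_cont(2)[OF s t])
  qed (use injs in auto)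
  then obtain r U Y where r: "r > 0"
    and P: "\<And>p. p \<in> S \<inter> ball (\<beta>s, \<delta>s, ks) r \<Longrightarrow> U p \<in> V \<and>
        bordered (sites n I) (func n) (B p) (C p) (D p) (\<lambda>s. if s = Mode then of_real Hs else 0) (U p) (Y p) \<and>
        (\<forall>u\<in>V. \<forall>y. bordered (sites n I) (func n) (B p) (C p) (D p) (\<lambda>s. if s = Mode then of_real Hs else 0) u y \<longrightarrow>
            nH (\<lambda>x. u x - U p x) = 0 \<and> (\<forall>i\<in>sites n I. y i = Y p i))"
    and Yc: "\<And>i. i \<in> sites n I \<Longrightarrow> continuous_on (S \<inter> ball (\<beta>s, \<delta>s, ks) r) (\<lambda>p. Y p i)"
    and Ul: "\<And>p. p \<in> S \<inter> ball (\<beta>s, \<delta>s, ks) r \<Longrightarrow> ((\<lambda>q. nH (\<lambda>x. U q x - U p x)) \<longlongrightarrow> 0) (at p within S \<inter> ball (\<beta>s, \<delta>s, ks) r)"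
    by blast
  have PS: "Port i \<in> sites n I" if "i \<in> I" for i using that by (simp add: sites_def)
  have MS: "Mode \<in> sites n I" by (simp add: sites_def)
  show ?thesis
  proof (intro exI[of _ r] conjI r exI[of _ U] exI[of _ "\<lambda>p i. Y p (Port i)"] exI[of _ "\<lambda>p. Y p Mode"] allI impI ballI)
    fix \<beta> \<delta> k assume p: "(\<beta>, \<delta>, k) \<in> S \<inter> ball (\<beta>s, \<delta>s, ks) r"
    then have pS: "(\<beta>, \<delta>, k) \<in> S" by simp
    note Pp = P[OF p]
    note iff = bordered_sites_iff[OF pS, of n \<mu> "of_real Hs"]
    show "U (\<beta>, \<delta>, k) \<in> V" using Pp by blast
    show "sys \<beta> \<delta> k (of_real Hs) (U (\<beta>, \<delta>, k)) (\<lambda>i. Y (\<beta>, \<delta>, k) (Port i)) (Y (\<beta>, \<delta>, k) Mode)"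
      using Pp iff unfolding B_def C_def D_def fst_conv snd_conv by blast
    fix u a t assume u: "u \<in> V" and s: "sys \<beta> \<delta> k (of_real Hs) u a t"
    \<comment> \<open>A solution of \<open>sys\<close> becomes one of the bordered system once its
      cell unknowns are defined to be its averages.\<close>
    define y where "y s = (case s of Cell i j \<Rightarrow> avg n i j u | Port i \<Rightarrow> a i | Mode \<Rightarrow> t)" for s
    have "bordered (sites n I) (func n) (B (\<beta>, \<delta>, k)) (C (\<beta>, \<delta>, k)) (D (\<beta>, \<delta>, k)) (\<lambda>s. if s = Mode then of_real Hs else 0) u y"
      unfolding B_def C_def D_def fst_conv snd_conv iff using s by (simp add: y_def)
    then have un: "nH (\<lambda>x. u x - U (\<beta>, \<delta>, k) x) = 0" "\<And>s. s \<in> sites n I \<Longrightarrow> y s = Y (\<beta>, \<delta>, k) s" using Pp u by blast+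
    show "nH (\<lambda>x. u x - U (\<beta>, \<delta>, k) x) = 0" by (rule un(1))
    show "t = Y (\<beta>, \<delta>, k) Mode" using un(2)[OF MS] by (simp add: y_def)
    show "a i = Y (\<beta>, \<delta>, k) (Port i)" if "i \<in> I" for i using un(2)[OF PS[OF that]] by (simp add: y_def)
  qed (use Yc[OF MS] Yc[OF PS] Ul in auto)
qed

section \<open>From the multiplier back to the scattering problem\<close>

lemma chan_cong: "(\<And>i. i \<in> I \<Longrightarrow> a i = b i) \<Longrightarrow> chan \<beta> k a u = chan \<beta> k b u"
  using out_cong[of a b] by (simp add: chan_def)

lemma flux_cong: "(\<And>i. i \<in> I \<Longrightarrow> a i = b i) \<Longrightarrow> flux \<beta> k a v = flux \<beta> k b v"
  using out_cong[of a b] unfolding flux_def by (intro sum.cong) auto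

lemma sys_cong: "(\<And>i. i \<in> I \<Longrightarrow> a i = b i) \<Longrightarrow> sys \<beta> \<delta> k h u a t = sys \<beta> \<delta> k h u b t"
  using chan_cong[of a b] flux_cong[of a b] by (simp add: sys_def)

text \<open>The condition \<open>cond\<close> of the final statement, with the radius of the
  interval for k as a parameter.\<close>

definition good :: "real \<Rightarrow> real \<times> (real^'n) \<Rightarrow> real \<Rightarrow> (pt \<Rightarrow> complex) \<Rightarrow> (bool \<times> int \<Rightarrow> complex) \<Rightarrow> bool" where
  "good r6 p k u a \<longleftrightarrow> k \<in> {ks - r6<..<ks + r6} \<and> (fst p, snd p, k) \<in> lambdaM d0 eps W1 Mx
     \<and> solves d0 eps (fst p) (snd p) k a u \<and> governed d0 (fst p) k Mx a u
     \<and> ipO d0 u us = of_real (LINT x:\<Omega>|lborel. (cmod (us x))^2)"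

text \<open>Membership in \<open>lambdaM\<close> follows from the other conditions: the
  normalisation makes u nonzero, so u and a themselves are witnesses.\<close>

lemma good_iff:
  assumes p: "(\<beta>, \<delta>, k) \<in> S" and b: "- 1/2 \<le> \<beta>" "\<beta> < 1/2"
  shows "good r6 (\<beta>, \<delta>) k u a \<longleftrightarrow> k \<in> {ks - r6<..<ks + r6} \<and> u \<in> V \<and> vec_on I a \<and> sys \<beta> \<delta> k (of_real Hs) u a 0"
proof -
  note D = S_D[OF p]
  have ipe: "ipO d0 u us = ip M u us" for u unfolding ipO_def LINT_Omega ip_def ..
  have He: "(LINT x:\<Omega>|lborel. (cmod (us x))^2) = Hs" unfolding LINT_Omega sq_def ..
  have lam: "(\<beta>, \<delta>, k) \<in> Lambda W1"
  proof -
    have "alpha \<beta> k m \<noteq> 0" for m using D(8)[of m] c unfolding alpha_eq_0_iff by auto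
    then show ?thesis using D b by (simp add: Lambda_def)
  qed
  have nz: "nonzeroO d0 u" if u: "u \<in> V" and h: "ip M u us = of_real Hs" for u
  proof -
    have "\<not> (AE x in M. u x = 0)"
      using ip_zero_AE_left[OF _ V_sqint(1)[OF u] V_sqint(1)[OF us]] h us_pos by auto
    then show ?thesis unfolding nonzeroO_def AE_Omega .
  qed
  have s: "(solves d0 eps \<beta> \<delta> k a u \<and> governed d0 \<beta> k Mx a u) \<and> ip M u us = of_real Hs \<longleftrightarrow>
      u \<in> V \<and> vec_on I a \<and> sys \<beta> \<delta> k (of_real Hs) u a 0"
    unfolding solves_governed_iff[OF p] sys_def by auto
  have "(\<beta>, \<delta>, k) \<in> lambdaM d0 eps W1 Mx" if "solves d0 eps \<beta> \<delta> k a u" "governed d0 \<beta> k Mx a u" "ip M u us = of_real Hs"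
    using that nz[of u] lam unfolding lambdaM_def by (auto simp: solves_def)
  then show ?thesis unfolding good_def ipe He fst_conv snd_conv s[symmetric] by blast
qed

text \<open>A product neighbourhood whose interval in k is closed, as \<open>monotone_root\<close>
  needs. Thirds of e suffice because the distance of triples is at most the sum of the component
  distances.\<close>

lemma S_box:
  "\<exists>r>0. \<forall>\<beta> \<delta> k. dist (\<beta>, \<delta>) (\<beta>s, \<delta>s) < r \<longrightarrow> \<bar>k - ks\<bar> \<le> r \<longrightarrow> (\<beta>, \<delta>, k) \<in> S \<inter> ball (\<beta>s, \<delta>s, ks) e"
  if e: "e > 0"
proof -
  have rho: "\<rho> > 0" "\<delta>s \<in> W1" using star by (auto simp: S_def)
  obtain w where w: "w > 0" "ball \<delta>s w \<subseteq> W1" using open_W1 rho(2) by (meson open_contains_ball)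
  define r where "r = min (e / 3) (min (\<rho> / 2) w)"
  have r: "r > 0" using e rho w by (simp add: r_def)
  have rr: "r \<le> e / 3" "r \<le> \<rho> / 2" "r \<le> w" unfolding r_def by (intro min.cobounded1 min.coboundedI2 min.cobounded2)+
  have "(\<beta>, \<delta>, k) \<in> S \<inter> ball (\<beta>s, \<delta>s, ks) e" if d: "dist (\<beta>, \<delta>) (\<beta>s, \<delta>s) < r" and k: "\<bar>k - ks\<bar> \<le> r" for \<beta> \<delta> k
  proof -
    have b: "dist \<beta> \<beta>s < r" "dist \<delta> \<delta>s < r"
      using dist_fst_le[of "(\<beta>, \<delta>)" "(\<beta>s, \<delta>s)"] dist_snd_le[of "(\<beta>, \<delta>)" "(\<beta>s, \<delta>s)"] d by simp_all
    have "dist (\<delta>, k) (\<delta>s, ks) \<le> dist \<delta> \<delta>s + dist k ks"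
      unfolding dist_Pair_Pair by (rule sqrt_sum_squares_le_sum) auto
    moreover have "dist (\<beta>, \<delta>, k) (\<beta>s, \<delta>s, ks) \<le> dist \<beta> \<beta>s + dist (\<delta>, k) (\<delta>s, ks)"
      unfolding dist_Pair_Pair[of \<beta>] by (rule sqrt_sum_squares_le_sum) auto
    ultimately have "dist (\<beta>, \<delta>, k) (\<beta>s, \<delta>s, ks) < e" using b k rr(1) by (simp add: dist_real_def)
    moreover have "\<delta> \<in> W1" using b(2) rr(3) w(2) by (auto simp: dist_commute)
    moreover have "\<bar>\<beta> - \<beta>s\<bar> < \<rho>" using b(1) rr(2) rho by (simp add: dist_real_def)
    moreover have "\<bar>k - ks\<bar> < \<rho>" using k rr(2) rho by linarith
    ultimately show ?thesis by (simp add: S_def dist_commute)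
  qed
  then show ?thesis using r by blast
qed

text \<open>The half-open range of \<beta> is intersected with the ball at this stage, and
  uniqueness and continuity are relative to that set, so the endpoint \<beta>s = -1/2 is no
  exception.\<close>

theorem branch:
  assumes bs: "- 1/2 \<le> \<beta>s" "\<beta>s < 1/2"
    and simple: "\<forall>u\<in>V. \<forall>a. chan \<beta>s ks a u \<longrightarrow> (\<forall>v\<in>V. Af \<beta>s \<delta>s ks u v = flux \<beta>s ks a v) \<longrightarrow>
      (\<forall>i\<in>I. a i = 0) \<and> (\<exists>z. AE x in M. u x = z * us x)"
  shows "\<exists>r5>0. \<exists>r6>0. \<exists>K U A.
     (\<forall>p\<in>{p \<in> ball (\<beta>s, \<delta>s) r5. - 1/2 \<le> fst p \<and> fst p < 1/2}. good r6 p (K p) (U p) (A p)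
        \<and> (\<forall>k u a. good r6 p k u a \<longrightarrow> k = K p \<and> aeeqO d0 u (U p) \<and> a = A p))
      \<and> continuous_on {p \<in> ball (\<beta>s, \<delta>s) r5. - 1/2 \<le> fst p \<and> fst p < 1/2} K
      \<and> (\<forall>i. continuous_on {p \<in> ball (\<beta>s, \<delta>s) r5. - 1/2 \<le> fst p \<and> fst p < 1/2} (\<lambda>p. A p i))
      \<and> (\<forall>p0\<in>{p \<in> ball (\<beta>s, \<delta>s) r5. - 1/2 \<le> fst p \<and> fst p < 1/2}. \<forall>e>0. \<exists>d>0.
           \<forall>p\<in>{p \<in> ball (\<beta>s, \<delta>s) r5. - 1/2 \<le> fst p \<and> fst p < 1/2}. dist p p0 < d \<longrightarrow> H1norm2 d0 (\<lambda>x. U p x - U p0 x) < e)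
      \<and> K (\<beta>s, \<delta>s) = ks \<and> aeeqO d0 (U (\<beta>s, \<delta>s)) us \<and> A (\<beta>s, \<delta>s) = (\<lambda>_. 0)"
proof -
  let ?ps = "(\<beta>s, \<delta>s, ks)"
  obtain r where r_ex: "r > 0 \<and> (\<exists>U A \<tau>. (\<forall>\<beta> \<delta> k. (\<beta>, \<delta>, k) \<in> S \<inter> ball ?ps r \<longrightarrow> U (\<beta>, \<delta>, k) \<in> V \<and>
        sys \<beta> \<delta> k (of_real Hs) (U (\<beta>, \<delta>, k)) (A (\<beta>, \<delta>, k)) (\<tau> (\<beta>, \<delta>, k)) \<and>
        (\<forall>u\<in>V. \<forall>a t. sys \<beta> \<delta> k (of_real Hs) u a t \<longrightarrow> nH (\<lambda>x. u x - U (\<beta>, \<delta>, k) x) = 0 \<and> (\<forall>i\<in>I. a i = A (\<beta>, \<delta>, k) i) \<and> t = \<tau> (\<beta>, \<delta>, k)))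
      \<and> continuous_on (S \<inter> ball ?ps r) \<tau> \<and> (\<forall>i\<in>I. continuous_on (S \<inter> ball ?ps r) (\<lambda>p. A p i))
      \<and> (\<forall>p\<in>S \<inter> ball ?ps r. ((\<lambda>q. nH (\<lambda>x. U q x - U p x)) \<longlongrightarrow> 0) (at p within S \<inter> ball ?ps r)))"
    by (rule exE[OF local_branch[OF simple]])
  have r: "r > 0" using r_ex by (rule conjunct1)
  obtain U A \<tau> where all: "(\<forall>\<beta> \<delta> k. (\<beta>, \<delta>, k) \<in> S \<inter> ball ?ps r \<longrightarrow> U (\<beta>, \<delta>, k) \<in> V \<and>
        sys \<beta> \<delta> k (of_real Hs) (U (\<beta>, \<delta>, k)) (A (\<beta>, \<delta>, k)) (\<tau> (\<beta>, \<delta>, k)) \<and>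
        (\<forall>u\<in>V. \<forall>a t. sys \<beta> \<delta> k (of_real Hs) u a t \<longrightarrow> nH (\<lambda>x. u x - U (\<beta>, \<delta>, k) x) = 0 \<and> (\<forall>i\<in>I. a i = A (\<beta>, \<delta>, k) i) \<and> t = \<tau> (\<beta>, \<delta>, k)))
      \<and> continuous_on (S \<inter> ball ?ps r) \<tau> \<and> (\<forall>i\<in>I. continuous_on (S \<inter> ball ?ps r) (\<lambda>p. A p i))
      \<and> (\<forall>p\<in>S \<inter> ball ?ps r. ((\<lambda>q. nH (\<lambda>x. U q x - U p x)) \<longlongrightarrow> 0) (at p within S \<inter> ball ?ps r))"
    using conjunct2[OF r_ex] by (elim exE) (rule that)
  note uni = conjunct1[OF all] and cts = conjunct2[OF all]
  have br: "U (\<beta>, \<delta>, k) \<in> V \<and> sys \<beta> \<delta> k (of_real Hs) (U (\<beta>, \<delta>, k)) (A (\<beta>, \<delta>, k)) (\<tau> (\<beta>, \<delta>, k))"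
    if "(\<beta>, \<delta>, k) \<in> S \<inter> ball ?ps r" for \<beta> \<delta> k
    using uni[rule_format, OF that] by (elim conjE) (intro conjI)
  have un: "nH (\<lambda>x. u x - U (\<beta>, \<delta>, k) x) = 0 \<and> (\<forall>i\<in>I. a i = A (\<beta>, \<delta>, k) i) \<and> t = \<tau> (\<beta>, \<delta>, k)"
    if p: "(\<beta>, \<delta>, k) \<in> S \<inter> ball ?ps r" and uV: "u \<in> V" and su: "sys \<beta> \<delta> k (of_real Hs) u a t" for \<beta> \<delta> k u a t
  proof -
    have "\<forall>u\<in>V. \<forall>a t. sys \<beta> \<delta> k (of_real Hs) u a t \<longrightarrow>
        nH (\<lambda>x. u x - U (\<beta>, \<delta>, k) x) = 0 \<and> (\<forall>i\<in>I. a i = A (\<beta>, \<delta>, k) i) \<and> t = \<tau> (\<beta>, \<delta>, k)"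
      using uni[THEN spec, THEN spec, THEN spec, THEN mp, OF p] by (elim conjE)
    from this[THEN bspec, OF uV, THEN spec, THEN spec, THEN mp, OF su] show ?thesis .
  qed
  have ct: "continuous_on (S \<inter> ball ?ps r) \<tau>" using cts by (elim conjE)
  have cA: "continuous_on (S \<inter> ball ?ps r) (\<lambda>p. A p i)" if "i \<in> I" for i
    using conjunct1[OF conjunct2[OF cts]] that by (rule bspec)
  have cU: "((\<lambda>q. nH (\<lambda>x. U q x - U p x)) \<longlongrightarrow> 0) (at p within S \<inter> ball ?ps r)" if "p \<in> S \<inter> ball ?ps r" for p
    using conjunct2[OF conjunct2[OF cts]] that by (rule bspec)
  define T where "T = S \<inter> ball ?ps r"
  have psT: "?ps \<in> T" using star r by (simp add: T_def)
  \<comment> \<open>\<open>us\<close> with zero amplitudes and zero multiplier solves the system at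
    the reference point, so uniqueness identifies the branch there.\<close>
  have sys0: "sys \<beta>s \<delta>s ks (of_real Hs) us (\<lambda>_. 0) 0"
    using us_trace us_null by (auto simp: sys_def chan_def flux_def matvec_def ip_self)
  note st = un[OF psT[unfolded T_def] us sys0]
  have U0: "nH (\<lambda>x. us x - U ?ps x) = 0" and A0: "\<And>i. i \<in> I \<Longrightarrow> A ?ps i = 0" and t0: "\<tau> ?ps = 0" using st by auto
  have UV: "U p \<in> V" if "p \<in> T" for p using br[of "fst p" "fst (snd p)" "snd (snd p)"] that by (simp add: T_def)
  have Ud: "\<exists>d>0. \<forall>q\<in>T. dist q p < d \<longrightarrow> nH (\<lambda>x. U q x - U p x) < e" if p: "p \<in> T" and e: "e > 0" for p e
  proof -
    have "\<forall>\<^sub>F q in at p within T. nH (\<lambda>x. U q x - U p x) < e"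
      using order_tendstoD(2)[OF cU[OF p[unfolded T_def]] e] by (simp add: T_def)
    then obtain d where d: "d > 0" "\<And>q. q \<in> T \<Longrightarrow> q \<noteq> p \<Longrightarrow> dist q p < d \<Longrightarrow> nH (\<lambda>x. U q x - U p x) < e"
      unfolding eventually_at by auto
    have "nH (\<lambda>x. U p x - U p x) = 0" using lin_on_zero[OF fun_space_V herm_on_lin[OF herm_on_ipH V_zero]] by (simp add: fnorm_def)
    then show ?thesis using d e by metis
  qed
  \<comment> \<open>The common right-hand side of the two smallness hypotheses of
    \<open>tau_mono\<close>.\<close>
  define x where "x = emin * Hs / 4"
  have x: "x > 0" using emin us_pos by (simp add: x_def)
  \<comment> \<open>The bound 1 makes the quadratic expression in \<eta> at most linear; the
    quotient then keeps it below x.\<close>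
  define \<eta> where "\<eta> = min 1 (x / (KE * (2 * nH us + 1)))"
  have Kn: "KE * (2 * nH us + 1) > 0" using KE_pos nH_nonneg[of us] by (intro mult_pos_pos) linarith+
  have \<eta>: "\<eta> > 0" using x Kn by (simp add: \<eta>_def)
  have \<eta>x: "KE * (\<eta> * (nH us + \<eta>) + nH us * \<eta>) \<le> emin * Hs / 4"
  proof -
    have "\<eta> * (nH us + \<eta>) + nH us * \<eta> = \<eta> * (2 * nH us + \<eta>)" by (simp add: algebra_simps)
    also have "\<dots> \<le> \<eta> * (2 * nH us + 1)" using \<eta> by (intro mult_left_mono) (auto simp: \<eta>_def)
    finally have "KE * (\<eta> * (nH us + \<eta>) + nH us * \<eta>) \<le> KE * (\<eta> * (2 * nH us + 1))" using KE_pos by (intro mult_left_mono) auto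
    also have "\<dots> = \<eta> * (KE * (2 * nH us + 1))" by simp
    also have "\<dots> \<le> x" using Kn by (simp add: pos_le_divide_eq[symmetric] \<eta>_def)
    finally show ?thesis by (simp add: x_def)
  qed
  \<comment> \<open>The hypothesis on \<epsilon> solved for equality, except for the + 1, which
    keeps the denominator positive.\<close>
  define \<epsilon> where "\<epsilon> = sqrt (x * (2 * c) / (8 * real (card I) + 1))"
  have \<epsilon>: "\<epsilon> > 0" using x c by (simp add: \<epsilon>_def)
  have \<epsilon>x: "real (card I) * (8 * \<epsilon>\<^sup>2) / (2 * c) \<le> emin * Hs / 4"
  proof -
    have e2: "\<epsilon>\<^sup>2 = x * (2 * c) / (8 * real (card I) + 1)" using x c by (simp add: \<epsilon>_def)
    define y where "y = 8 * real (card I) + 1"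
    have y: "y > 0" by (simp add: y_def)
    have "real (card I) * (8 * \<epsilon>\<^sup>2) / (2 * c) = x * (8 * real (card I) / y)"
      unfolding e2 y_def[symmetric] using c y by (simp add: field_simps)
    also have "\<dots> \<le> x * 1" by (intro mult_left_mono) (use x y in \<open>auto simp: y_def\<close>)
    finally show ?thesis by (simp add: x_def)
  qed
  obtain d1 where d1: "d1 > 0" "\<And>q. q \<in> T \<Longrightarrow> dist q ?ps < d1 \<Longrightarrow> nH (\<lambda>x. U q x - U ?ps x) < \<eta>" using Ud[OF psT \<eta>] by blast
  have evA: "\<forall>\<^sub>F q in at ?ps within T. \<forall>i\<in>I. cmod (A q i) < \<epsilon> \<and> cmod (out (A q) i) < \<epsilon>"
  proof (rule eventually_ball_finite[OF fin_I], rule ballI, rule eventually_conj)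
    fix i assume i: "i \<in> I"
    have lA: "((\<lambda>q. A q j) \<longlongrightarrow> 0) (at ?ps within T)" if "j \<in> I" for j
      using cA[OF that] psT A0[OF that] unfolding continuous_on_def T_def by metis
    show "\<forall>\<^sub>F q in at ?ps within T. cmod (A q i) < \<epsilon>"
      using order_tendstoD(2)[OF tendsto_norm[OF lA[OF i]], of \<epsilon>] \<epsilon> by simp
    have "((\<lambda>q. \<Sum>j\<in>I. Mx i j * A q j) \<longlongrightarrow> (\<Sum>j\<in>I. Mx i j * 0)) (at ?ps within T)"
      by (intro tendsto_sum tendsto_mult_left lA)
    then have "((\<lambda>q. out (A q) i) \<longlongrightarrow> 0) (at ?ps within T)" using i by (simp add: matvec_def)
    from order_tendstoD(2)[OF tendsto_norm[OF this], of \<epsilon>] show "\<forall>\<^sub>F q in at ?ps within T. cmod (out (A q) i) < \<epsilon>" using \<epsilon> by simp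
  qed
  obtain d2 where d2: "d2 > 0" "\<And>q i. q \<in> T \<Longrightarrow> q \<noteq> ?ps \<Longrightarrow> dist q ?ps < d2 \<Longrightarrow> i \<in> I \<Longrightarrow> cmod (A q i) < \<epsilon> \<and> cmod (out (A q) i) < \<epsilon>"
    using evA unfolding eventually_at by blast
  \<comment> \<open>The filter \<open>at ?ps within T\<close> leaves out the reference point itself,
    where all amplitudes are 0.\<close>
  have A0': "cmod (A ?ps i) \<le> \<epsilon> \<and> cmod (out (A ?ps) i) \<le> \<epsilon>" if "i \<in> I" for i
    using \<epsilon> A0 that by (simp add: matvec_def)
  define e0 where "e0 = min r (min d1 d2)"
  have e0: "e0 > 0" "e0 \<le> r" "e0 \<le> d1" "e0 \<le> d2" using r d1(1) d2(1) by (auto simp: e0_def)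
  obtain r0 where r0: "r0 > 0" "\<And>\<beta> \<delta> k. dist (\<beta>, \<delta>) (\<beta>s, \<delta>s) < r0 \<Longrightarrow> \<bar>k - ks\<bar> \<le> r0 \<Longrightarrow> (\<beta>, \<delta>, k) \<in> S \<inter> ball ?ps e0"
    using S_box[OF e0(1)] by blast
  define P where "P = {p \<in> ball (\<beta>s, \<delta>s) r0. - 1/2 \<le> fst p \<and> fst p < (1/2 :: real)}"
  have box: "(fst p, snd p, k) \<in> S" "(fst p, snd p, k) \<in> T" "dist (fst p, snd p, k) ?ps < e0" if "p \<in> P" "k \<in> {ks - r0..ks + r0}" for p k
    using r0(2)[of "fst p" "snd p" k] that e0(2) by (auto simp: P_def T_def dist_commute abs_le_iff)
  have near: "nH (\<lambda>x. U q x - us x) \<le> \<eta>" if q: "q \<in> T" and d: "dist q ?ps < e0" for q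
  proof -
    have "nH (\<lambda>x. U q x - us x) \<le> nH (\<lambda>x. U q x - U ?ps x) + nH (\<lambda>x. U ?ps x - us x)"
      by (rule fnorm_triangle_diff[OF fun_space_V herm_on_ipH ipH_pos UV[OF q] UV[OF psT] us])
    also have "nH (\<lambda>x. U ?ps x - us x) = 0"
      using fnorm_diff_commute[OF fun_space_V herm_on_ipH ipH_pos UV[OF psT] us] U0 by simp
    finally show ?thesis using d1(2)[OF q] d e0(3) by simp
  qed
  have small: "cmod (A q i) \<le> \<epsilon> \<and> cmod (out (A q) i) \<le> \<epsilon>" if "q \<in> T" "dist q ?ps < e0" "i \<in> I" for q i
    using d2(2)[of q i] A0'[OF that(3)] that e0(4) by (cases "q = ?ps") (auto intro: less_imp_le)
  \<comment> \<open>Only the real part is followed; at a zero of f the whole multiplier vanishes by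
    \<open>tau_real\<close>.\<close>
  define f where "f p k = Re (\<tau> (fst p, snd p, k))" for p :: "real \<times> (real^'n)" and k
  have fmono: "f p k < f p k'" if p: "p \<in> P" and k: "k \<in> {ks - r0..ks + r0}" "k' \<in> {ks - r0..ks + r0}" "k < k'" for p k k'
  proof -
    note b = box[OF p k(1)] and b' = box[OF p k(2)]
    note h = br[OF b(2)[unfolded T_def]] and h' = br[OF b'(2)[unfolded T_def]]
    show ?thesis unfolding f_def
    proof (rule tau_mono[OF b'(1) b(1) k(3)])
      show "U (fst p, snd p, k') \<in> V" "U (fst p, snd p, k) \<in> V"
        "sys (fst p) (snd p) k' (of_real Hs) (U (fst p, snd p, k')) (A (fst p, snd p, k')) (\<tau> (fst p, snd p, k'))"
        "sys (fst p) (snd p) k (of_real Hs) (U (fst p, snd p, k)) (A (fst p, snd p, k)) (\<tau> (fst p, snd p, k))"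
        using h h' by blast+
      show "nH (\<lambda>x. U (fst p, snd p, k') x - us x) \<le> \<eta>" "nH (\<lambda>x. U (fst p, snd p, k) x - us x) \<le> \<eta>"
        using near b b' by blast+
      show "cmod (A (fst p, snd p, k') i) \<le> \<epsilon> \<and> cmod (A (fst p, snd p, k) i) \<le> \<epsilon> \<and>
          cmod (out (A (fst p, snd p, k')) i) \<le> \<epsilon> \<and> cmod (out (A (fst p, snd p, k)) i) \<le> \<epsilon>" if "i \<in> I" for i
        using small[OF b(2,3) that] small[OF b'(2,3) that] by blast
    qed (rule \<eta>x \<epsilon>x)+
  qed
  have fcont: "continuous_on (P \<times> {ks - r0..ks + r0}) (\<lambda>(p, k). f p k)"
  proof -
    have "continuous_on (P \<times> {ks - r0..ks + r0}) (\<lambda>z. \<tau> (fst (fst z), snd (fst z), snd z))"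
      by (rule continuous_on_compose2[OF ct[folded T_def]]) (use box(2) in \<open>auto intro!: continuous_intros\<close>)
    then show ?thesis unfolding f_def split_beta by (intro continuous_intros)
  qed
  have p0P: "(\<beta>s, \<delta>s) \<in> P" using bs r0(1) by (simp add: P_def)
  have f0: "f (\<beta>s, \<delta>s) ks = 0" using t0 by (simp add: f_def)
  from monotone_root[OF r0(1) p0P fcont fmono f0] obtain d K where d: "d > 0"
    and K: "\<And>p. p \<in> P \<inter> ball (\<beta>s, \<delta>s) d \<Longrightarrow> K p \<in> {ks - r0<..<ks + r0} \<and> f p (K p) = 0 \<and>
       (\<forall>k\<in>{ks - r0<..<ks + r0}. f p k = 0 \<longrightarrow> k = K p)"
    and cK: "continuous_on (P \<inter> ball (\<beta>s, \<delta>s) d) K" and K0: "K (\<beta>s, \<delta>s) = ks" by blast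
  define r5 where "r5 = min r0 d"
  have r5_pos: "r5 > 0" using r0(1) d by (simp add: r5_def)
  define P5 where "P5 = {p \<in> ball (\<beta>s, \<delta>s) r5. - 1/2 \<le> fst p \<and> fst p < (1/2 :: real)}"
  have P5: "P5 = P \<inter> ball (\<beta>s, \<delta>s) d" by (auto simp: P5_def P_def r5_def)
  define Uf where "Uf p = U (fst p, snd p, K p)" for p
  \<comment> \<open>Extended by 0 outside the channels, as \<open>vec_on\<close> demands, so that
    uniqueness of a is equality of functions.\<close>
  define Ap where "Ap p i = (if i \<in> I then A (fst p, snd p, K p) i else 0)" for p i
  have Kb: "(fst p, snd p, K p) \<in> S" "(fst p, snd p, K p) \<in> T" "K p \<in> {ks - r0<..<ks + r0}" "f p (K p) = 0"
    "- 1/2 \<le> fst p" "fst p < 1/2" if "p \<in> P5" for p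
    using box[of p "K p"] K[of p] that unfolding P5 by (auto simp: P_def)
  have gi: "good r0 p k u a \<longleftrightarrow> k \<in> {ks - r0<..<ks + r0} \<and> u \<in> V \<and> vec_on I a \<and> sys (fst p) (snd p) k (of_real Hs) u a 0"
    if "p \<in> P5" "k \<in> {ks - r0<..<ks + r0}" for p k u a
    using good_iff[of "fst p" "snd p" k r0 u a] box(1)[of p k] Kb(5,6)[OF that(1)] that unfolding P5 by auto
  have ae: "aeeqO d0 u v" if "u \<in> V" "v \<in> V" "nH (\<lambda>x. u x - v x) = 0" for u v
  proof -
    have "sq M (\<lambda>x. u x - v x) = 0" using nH_ge(1)[of "\<lambda>x. u x - v x"] that(3) sq_nonneg[of M "\<lambda>x. u x - v x"] by simp
    then have "AE x in M. u x - v x = 0" using sq_eq_0_iff[OF sqint_diff[OF V_sqint(1)[OF that(1)] V_sqint(1)[OF that(2)]]] by simp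
    then show ?thesis unfolding aeeqO_def AE_Omega by simp
  qed
  have cg: "continuous_on P5 (\<lambda>p. (fst p, snd p, K p))" using cK unfolding P5 by (intro continuous_intros)
  show ?thesis
  proof (rule exI[of _ r5], rule conjI[OF r5_pos], rule exI[of _ r0], rule conjI[OF r0(1)],
      intro exI[of _ K] exI[of _ Uf] exI[of _ Ap] conjI, unfold P5_def[symmetric])
    show "\<forall>p\<in>P5. good r0 p (K p) (Uf p) (Ap p) \<and> (\<forall>k u a. good r0 p k u a \<longrightarrow> k = K p \<and> aeeqO d0 u (Uf p) \<and> a = Ap p)"
    proof (rule ballI, rule conjI)
      fix p assume p: "p \<in> P5"
      note kb = Kb[OF p]
      have h: "Uf p \<in> V" "sys (fst p) (snd p) (K p) (of_real Hs) (Uf p) (A (fst p, snd p, K p)) (\<tau> (fst p, snd p, K p))"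
        using br[OF kb(2)[unfolded T_def]] by (auto simp: Uf_def)
      have "\<tau> (fst p, snd p, K p) = 0"
        using tau_real[OF kb(1) h] kb(4) by (simp add: f_def complex_eq_iff)
      then have "sys (fst p) (snd p) (K p) (of_real Hs) (Uf p) (Ap p) 0"
        using h(2) sys_cong[of "Ap p" "A (fst p, snd p, K p)"] by (simp add: Ap_def)
      then show "good r0 p (K p) (Uf p) (Ap p)" unfolding gi[OF p kb(3)] using h(1) kb(3) by (simp add: vec_on_def Ap_def)
      show "\<forall>k u a. good r0 p k u a \<longrightarrow> k = K p \<and> aeeqO d0 u (Uf p) \<and> a = Ap p"
      proof (intro allI impI)
        fix k u a assume g: "good r0 p k u a"
        then have k: "k \<in> {ks - r0<..<ks + r0}" by (simp add: good_def)
        then have uV: "u \<in> V" and va: "vec_on I a" and sy: "sys (fst p) (snd p) k (of_real Hs) u a 0" using g gi[OF p k] by blast+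
        \<comment> \<open>A competitor solves the system with multiplier 0 at its own k. Uniqueness
          at that k makes it a zero of f, hence equal to \<open>K p\<close>; only then can u and a
          be compared.\<close>
        have kT: "(fst p, snd p, k) \<in> T" using box(2)[of p k] p k unfolding P5 by auto
        note w = un[OF kT[unfolded T_def] uV sy]
        have "\<tau> (fst p, snd p, k) = 0" using w by metis
        then have "f p k = 0" by (simp add: f_def)
        then have kK: "k = K p" using K[of p] p k unfolding P5 by blast
        have "a = Ap p" using w va unfolding kK by (auto simp: Ap_def vec_on_def fun_eq_iff)
        moreover have "aeeqO d0 u (Uf p)" using ae[OF uV h(1)] w unfolding kK Uf_def by blast
        ultimately show "k = K p \<and> aeeqO d0 u (Uf p) \<and> a = Ap p" using kK by blast
      qed
    qed
    show "continuous_on P5 K" using cK unfolding P5 .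
    show "\<forall>i. continuous_on P5 (\<lambda>p. Ap p i)"
    proof
      fix i show "continuous_on P5 (\<lambda>p. Ap p i)"
      proof (cases "i \<in> I")
        case True
        have "continuous_on P5 (\<lambda>p. A (fst p, snd p, K p) i)"
          by (rule continuous_on_compose2[OF cA[OF True, folded T_def] cg]) (use Kb(2) in auto)
        then show ?thesis using True by (simp add: Ap_def)
      qed (simp add: Ap_def)
    qed
    show "\<forall>p0\<in>P5. \<forall>e>0. \<exists>d>0. \<forall>p\<in>P5. dist p p0 < d \<longrightarrow> H1norm2 d0 (\<lambda>x. Uf p x - Uf p0 x) < e"
    proof (intro ballI allI impI)
      fix p0 and e :: real assume p0: "p0 \<in> P5" and e: "e > 0"
      \<comment> \<open>The square root appears because \<open>H1norm2\<close> is the square of the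
        norm.\<close>
      obtain d' where d': "d' > 0" "\<And>q. q \<in> T \<Longrightarrow> dist q (fst p0, snd p0, K p0) < d' \<Longrightarrow> nH (\<lambda>x. U q x - U (fst p0, snd p0, K p0) x) < sqrt e"
        using Ud[OF Kb(2)[OF p0], of "sqrt e"] e by auto
      obtain d'' where d'': "d'' > 0" "\<And>p. p \<in> P5 \<Longrightarrow> dist p p0 < d'' \<Longrightarrow> dist (fst p, snd p, K p) (fst p0, snd p0, K p0) < d'"
        using cg p0 d'(1) unfolding continuous_on_iff by metis
      have "H1norm2 d0 (\<lambda>x. Uf p x - Uf p0 x) < e" if p: "p \<in> P5" "dist p p0 < d''" for p
      proof -
        have v: "(\<lambda>x. Uf p x - Uf p0 x) \<in> V" unfolding Uf_def by (rule V_diff[OF UV[OF Kb(2)[OF p(1)]] UV[OF Kb(2)[OF p0]]])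
        have "H1norm2 d0 (\<lambda>x. Uf p x - Uf p0 x) = (nH (\<lambda>x. Uf p x - Uf p0 x))\<^sup>2"
          using V_sqint[OF v] unfolding H1norm2_def LINT_Omega nH_sq sq_def cnorm2_def sqint_def G1_def G2_def by simp
        also have "\<dots> < (sqrt e)\<^sup>2"
          using d'(2)[OF Kb(2)[OF p(1)] d''(2)[OF p]] unfolding Uf_def by (intro power_strict_mono) auto
        finally show ?thesis using e by simp
      qed
      then show "\<exists>d>0. \<forall>p\<in>P5. dist p p0 < d \<longrightarrow> H1norm2 d0 (\<lambda>x. Uf p x - Uf p0 x) < e" using d''(1) by blast
    qed
    show "K (\<beta>s, \<delta>s) = ks" by (rule K0)
    show "aeeqO d0 (Uf (\<beta>s, \<delta>s)) us"
      using ae[OF UV[OF psT] us] U0 fnorm_diff_commute[OF fun_space_V herm_on_ipH ipH_pos UV[OF psT] us] by (simp add: Uf_def K0)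
    show "Ap (\<beta>s, \<delta>s) = (\<lambda>_. 0)" using A0 by (auto simp: Ap_def K0 fun_eq_iff)
  qed
qed

end

text \<open>The abstract condition of \<open>branch\<close>, that a homogeneous solution governed by
  M has zero amplitudes and is a multiple of \<open>us\<close>, is what the scattering matrix, the
  determinant and simplicity of the BIC provide.\<close>

theorem mainTheorem5:
  fixes d0 emin emax :: real
    and eps :: "pt \<Rightarrow> real^'n \<Rightarrow> real" and W1 :: "(real^'n) set"
    and \<beta>s ks :: real and \<delta>s :: "real^'n" and us :: "pt \<Rightarrow> complex"
    and S0 M :: "bool \<times> int \<Rightarrow> bool \<times> int \<Rightarrow> complex"
  assumes eps: "eps_ok d0 eps W1 emin emax"
    and pt: "(\<beta>s, \<delta>s, ks) \<in> Lambda W1"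
    and bic: "simpleBIC d0 eps \<beta>s \<delta>s ks us"
    and S0: "is_scattering_matrix d0 eps \<beta>s \<delta>s ks S0"
    and MU: "unitary_on (Idx \<beta>s ks) M"
    and MU1: "det_on (Idx \<beta>s ks) (\<lambda>i j. S0 i j - M i j) \<noteq> 0"
  shows "\<exists>r5>0. \<exists>r6>0. \<exists>K U A.
    (let P = {p \<in> ball (\<beta>s, \<delta>s) r5. - 1/2 \<le> fst p \<and> fst p < 1/2};
         cond = (\<lambda>p k u a. k \<in> {ks - r6<..<ks + r6}
                   \<and> (fst p, snd p, k) \<in> lambdaM d0 eps W1 M
                   \<and> solves d0 eps (fst p) (snd p) k a u
                   \<and> governed d0 (fst p) k M a u
                   \<and> ipO d0 u us = of_real (LINT x:Omega0 d0|lborel. (cmod (us x))^2))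
     in (\<forall>p\<in>P. cond p (K p) (U p) (A p)
               \<and> (\<forall>k u a. cond p k u a \<longrightarrow> k = K p \<and> aeeqO d0 u (U p) \<and> a = A p))
      \<and> continuous_on P K
      \<and> (\<forall>i. continuous_on P (\<lambda>p. A p i))
      \<and> (\<forall>p0\<in>P. \<forall>e>0. \<exists>d>0. \<forall>p\<in>P. dist p p0 < d \<longrightarrow>
             H1norm2 d0 (\<lambda>x. U p x - U p0 x) < e)
      \<and> K (\<beta>s, \<delta>s) = ks \<and> aeeqO d0 (U (\<beta>s, \<delta>s)) us \<and> A (\<beta>s, \<delta>s) = (\<lambda>_. 0))"
proof -
  have L: "- 1/2 \<le> \<beta>s" "\<beta>s < 1/2" "\<delta>s \<in> W1" "ks > \<bar>\<beta>s\<bar>" "\<And>m. alpha \<beta>s ks m \<noteq> 0" using pt by (auto simp: Lambda_def)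
  obtain \<rho> c where \<rho>: "\<rho> > 0" and c: "c > 0" and w: "\<And>\<beta> k. \<bar>\<beta> - \<beta>s\<bar> < \<rho> \<Longrightarrow> \<bar>k - ks\<bar> < \<rho> \<Longrightarrow>
     \<bar>\<beta>\<bar> < k \<and> k < 2 * ks \<and> \<bar>\<beta>\<bar> \<le> \<bar>\<beta>s\<bar> + 1 \<and> Z0 \<beta> k = Z0 \<beta>s ks \<and> (\<forall>m. c \<le> \<bar>k\<^sup>2 - (of_int m + \<beta>)\<^sup>2\<bar>)"
    using spectral_gap[OF L(4,5)] by blast
  interpret grating_window d0 eps W1 emin emax \<beta>s ks \<rho> c
  proof
    show "0 < d0" using eps unfolding eps_ok_def by (elim conjE)
    show "eps_ok d0 eps W1 emin emax" by (rule eps)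
    show "ks > 0" using L(4) by linarith
    show "c > 0" by (rule c)
  qed (rule w)
  have star: "(\<beta>s, \<delta>s, ks) \<in> S" using \<rho> L(3) by (simp add: S_def)
  have bs: "solves d0 eps \<beta>s \<delta>s ks (\<lambda>_. 0) us" "nonzeroO d0 us" "bvec d0 \<beta>s ks (\<lambda>_. 0) us = (\<lambda>_. 0)"
    and simp1: "\<And>w. isBIC d0 eps \<beta>s \<delta>s ks w \<Longrightarrow> \<exists>z. aeeqO d0 w (\<lambda>x. z * us x)"
    using bic by (auto simp: simpleBIC_def isBIC_def)
  have usV: "us \<in> V" using bs(1) by (simp add: solves_def)
  have tr: "trco d0 us fl m = 0" if "(fl, m) \<in> I" for fl m
  proof -
    \<comment> \<open>The factor can be divided out because no order is at cut-off at a point of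
      \<open>Lambda\<close>.\<close>
    have "csqrt (alpha \<beta>s ks m) * trco d0 us fl m = 0" using fun_cong[OF bs(3), of "(fl, m)"] that by (simp add: bvec_def)
    then show ?thesis using L(5)[of m] by simp
  qed
  interpret channel_problem d0 eps W1 emin emax \<beta>s ks \<rho> c M \<delta>s us
  proof
    show "(\<beta>s, \<delta>s, ks) \<in> S" by (rule star)
    show "unitary_on I M" by (rule MU)
    show "us \<in> V" by (rule usV)
    have "sq (restrict_space lborel (Omega0 d0)) us \<noteq> 0"
      using bs(2) sq_eq_0_iff[OF V_sqint(1)[OF usV]] unfolding nonzeroO_def AE_Omega by simp
    then show "sq (restrict_space lborel (Omega0 d0)) us > 0" using sq_nonneg[of "restrict_space lborel (Omega0 d0)" us] by linarith
    show "trco d0 us fl m = 0" if "(fl, m) \<in> I" for fl m by (rule tr[OF that])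
    show "Af \<beta>s \<delta>s ks us v = 0" if v: "v \<in> V" for v
    proof -
      have "aform d0 eps \<beta>s \<delta>s ks us v = 0" using bs(1) v by (simp add: solves_def)
      moreover have "(\<Sum>(fl, m)\<in>I. \<i> * alpha \<beta>s ks m * trco d0 us fl m * cnj (trco d0 v fl m)) = 0"
        by (rule sum.neutral) (use tr in auto)
      ultimately show ?thesis using aform_eq[OF usV v, of \<beta>s \<delta>s ks] by simp
    qed
  qed
  have "(\<forall>i\<in>I. a i = 0) \<and> (\<exists>z. AE x in restrict_space lborel (Omega0 d0). u x = z * us x)"
    if u: "u \<in> V" and ch: "chan \<beta>s ks a u" and eq: "\<forall>v\<in>V. Af \<beta>s \<delta>s ks u v = flux \<beta>s ks a v" for u a
  proof -
    \<comment> \<open>\<open>chan\<close> and \<open>flux\<close> see only the values of a on the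
      channels; \<open>solves\<close> requires the vector to vanish elsewhere.\<close>
    define a' where "a' i = (if i \<in> I then a i else 0)" for i
    have aa: "chan \<beta>s ks a' u = chan \<beta>s ks a u" "\<And>v. flux \<beta>s ks a' v = flux \<beta>s ks a v"
      using chan_cong[of a' a] flux_cong[of a' a] by (simp_all add: a'_def)
    have sg: "solves d0 eps \<beta>s \<delta>s ks a' u" "governed d0 \<beta>s ks M a' u"
      using solves_governed_iff[OF star, of a' u] u ch eq unfolding aa by (auto simp: vec_on_def a'_def)
    \<comment> \<open>The outgoing vector of this one solution is given by S0 as well as by M, so S0
      - M annihilates \<open>a'\<close>.\<close>
    have mm: "matvec I M a' = matvec I S0 a'"
      using S0 sg unfolding is_scattering_matrix_def governed_def by metis
    have "a' i = 0" if i: "i \<in> I" for i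
    proof (rule det_on_nonzero_injective[OF fin_I MU1 _ i])
      fix j assume "j \<in> I"
      then have "(\<Sum>l\<in>I. M j l * a' l) = (\<Sum>l\<in>I. S0 j l * a' l)" using fun_cong[OF mm, of j] by (simp add: matvec_def)
      then show "(\<Sum>l\<in>I. (S0 j l - M j l) * a' l) = 0" by (simp add: left_diff_distrib sum_subtractf)
    qed
    then have a0: "a' = (\<lambda>_. 0)" by (auto simp: a'_def fun_eq_iff)
    have "\<exists>z. AE x in restrict_space lborel (Omega0 d0). u x = z * us x"
    proof (cases "nonzeroO d0 u")
      case True
      have "bvec d0 \<beta>s ks (\<lambda>_. 0) u = (\<lambda>_. 0)"
        using sg(2) unfolding governed_def a0 by (auto simp: matvec_def fun_eq_iff)
      then have "isBIC d0 eps \<beta>s \<delta>s ks u" using sg(1) True unfolding isBIC_def a0 by simp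
      then show ?thesis using simp1 unfolding aeeqO_def AE_Omega by blast
    next
      \<comment> \<open>A function that vanishes almost everywhere is not a BIC, but it is the
        multiple of \<open>us\<close> with factor 0.\<close>
      case False
      then show ?thesis unfolding nonzeroO_def AE_Omega by (intro exI[of _ 0]) simp
    qed
    then show ?thesis using a0 by (auto simp: a'_def fun_eq_iff split: if_splits)
  qed
  then have simple: "\<forall>u\<in>V. \<forall>a. chan \<beta>s ks a u \<longrightarrow> (\<forall>v\<in>V. Af \<beta>s \<delta>s ks u v = flux \<beta>s ks a v) \<longrightarrow>
      (\<forall>i\<in>I. a i = 0) \<and> (\<exists>z. AE x in restrict_space lborel (Omega0 d0). u x = z * us x)"
    by (intro ballI allI impI)
  show ?thesis using branch[OF L(1,2) simple] unfolding Let_def good_def by blast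
qed


end
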